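(* Let $p$ be a prime and let $\mathcal{O}$ be a complete local principal ideal domain with residue field $k$ of characteristic $p$. Suppose that the field of fractions $K$ of $\mathcal{O}$ has characteristic zero. Let $G$ be a finite group, and let $U$, $V$ be $\mathcal{O}$-free $\mathcal{O}G$-modules with irreducible characters and with sources of $\mathcal{O}$-ranks prime to $p$. Suppose that the character of $W=U\otimes_{\mathcal{O}}V$ (with diagonal $G$-action) is irreducible. Assume that $k$ is large enough so that $U$, $V$, $W$ and their sources are absolutely indecomposable, and that $K$ is large enough so that the irreducible characters of $U$, $V$, $W$ over $K$ are absolutely irreducible. Then the sources of $W$ have $\mathcal{O}$-rank prime to $p$, and there exist vertices $Q$, $R$ of $U$, $V$, respectively, such that $Q\cap R$ is a vertex of $W$ and such that $QR$ is a Sylow $p$-subgroup of $G$.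
   Context: Modules are finitely generated left modules. An $\mathcal{O}$-free module is one that is free (of finite rank) as an $\mathcal{O}$-module. The character of an $\mathcal{O}$-free $\mathcal{O}G$-module $U$ is the character of the $KG$-module $K\otimes_{\mathcal{O}}U$; if it is irreducible (over $K$), then $U$ is indecomposable. For an indecomposable $\mathcal{O}G$-module $U$, a vertex of $U$ is a minimal subgroup $Q$ of $G$ such that $U$ is isomorphic to a direct summand of $\mathrm{Ind}_Q^G\mathrm{Res}^G_Q(U)$; it is a $p$-subgroup, unique up to $G$-conjugacy. A source of $U$ (with respect to a vertex $Q$) is an indecomposable direct summand $X$ of $\mathrm{Res}^G_Q(U)$ such that $U$ is isomorphic to a direct summand of $\mathrm{Ind}_Q^G(X)$. Vertex-source pairs $(Q,X)$ of $U$ are unique up to $G$-conjugacy (with $X$ taken up to isomorphism). An indecomposable $\mathcal{O}H$-module $M$, for $H$ a finite group, is absolutely indecomposable if $\mathrm{End}_{\mathcal{O}H}(M)/J(\mathrm{End}_{\mathcal{O}H}(M))\cong k$, where $J$ denotes the Jacobson radical. *)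

theory Defs
  imports
    "HOL-Computational_Algebra.Computational_Algebra"
    "HOL-Library.Poly_Mapping"
    "HOL-Algebra.Algebra"
    "HOL-Algebra.Algebraic_Closure_Type"
begin

section \<open>Complete local principal ideal domains\<close>

primrec ideal_power :: "('a, 'b) ring_scheme \<Rightarrow> 'a set \<Rightarrow> nat \<Rightarrow> 'a set" where
  "ideal_power R I 0 = carrier R"
| "ideal_power R I (Suc n) = I \<cdot>\<^bsub>R\<^esub> ideal_power R I n"

definition max_ideal :: "('a, 'b) ring_scheme \<Rightarrow> 'a set" where
  "max_ideal R = (THE m. maximalideal m R)"

definition residue_field :: "('a, 'b) ring_scheme \<Rightarrow> 'a set ring" where
  "residue_field R = R Quot max_ideal R"

text \<open>Completeness is with respect to the topology given by the powers of the maximal ideal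
  and includes separatedness.\<close>

definition complete_local_pid :: "('a, 'b) ring_scheme \<Rightarrow> bool" where
  "complete_local_pid R \<longleftrightarrow>
     principal_domain R \<and>
     (\<exists>!m. maximalideal m R) \<and>
     (\<Inter>n. ideal_power R (max_ideal R) n) = {\<zero>\<^bsub>R\<^esub>} \<and>
     (\<forall>x :: nat \<Rightarrow> 'a.
        (\<forall>i. x i \<in> carrier R) \<and>
        (\<forall>n. \<exists>N. \<forall>i\<ge>N. \<forall>j\<ge>N. x i \<ominus>\<^bsub>R\<^esub> x j \<in> ideal_power R (max_ideal R) n) \<longrightarrow>
        (\<exists>l\<in>carrier R. \<forall>n. \<exists>N. \<forall>i\<ge>N. x i \<ominus>\<^bsub>R\<^esub> l \<in> ideal_power R (max_ideal R) n))"


section \<open>Modules with a group action\<close>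

text \<open>Scalars are a type \<open>'r\<close> of class \<^class>\<open>comm_ring_1\<close>, regarded as a ring record through
  \<^const>\<open>ring_of_type_algebra\<close> so that the library's modules apply.  A module over the group
  algebra is a module with a linear action of the group.  The fields \<^const>\<open>monoid.mult\<close> and
  \<^const>\<open>one\<close> inherited from the ring record carry no information.

  No restriction functor is needed: the record of a \<open>G\<close>-module, considered over the group
  \<open>G\<lparr>carrier := Q\<rparr>\<close>, is its restriction to \<open>Q\<close>.  Likewise \<open>M\<lparr>carrier := A\<rparr>\<close> is the
  submodule \<open>A\<close> of \<open>M\<close> as a module in its own right.\<close>

record ('r, 'g, 'm) gmod = "('r, 'm) module" +
  act :: "'g \<Rightarrow> 'm \<Rightarrow> 'm"

locale gmodule =
  G: group G + M: Module.module "ring_of_type_algebra :: 'r::comm_ring_1 ring" M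
  for G :: "('g, 'z) monoid_scheme" and M :: "('r::comm_ring_1, 'g, 'm) gmod" +
  assumes act_closed: "\<lbrakk>g \<in> carrier G; x \<in> carrier M\<rbrakk> \<Longrightarrow> act M g x \<in> carrier M"
    and act_add: "\<lbrakk>g \<in> carrier G; x \<in> carrier M; y \<in> carrier M\<rbrakk> \<Longrightarrow>
        act M g (x \<oplus>\<^bsub>M\<^esub> y) = act M g x \<oplus>\<^bsub>M\<^esub> act M g y"
    and act_smult: "\<lbrakk>g \<in> carrier G; x \<in> carrier M\<rbrakk> \<Longrightarrow>
        act M g (a \<odot>\<^bsub>M\<^esub> x) = a \<odot>\<^bsub>M\<^esub> act M g x"
    and act_one: "x \<in> carrier M \<Longrightarrow> act M \<one>\<^bsub>G\<^esub> x = x"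
    and act_mult: "\<lbrakk>g \<in> carrier G; h \<in> carrier G; x \<in> carrier M\<rbrakk> \<Longrightarrow>
        act M (g \<otimes>\<^bsub>G\<^esub> h) x = act M g (act M h x)"

definition gsubmodule ::
    "('g, 'z) monoid_scheme \<Rightarrow> 'm set \<Rightarrow> ('r::comm_ring_1, 'g, 'm) gmod \<Rightarrow> bool" where
  "gsubmodule G A M \<longleftrightarrow>
     submodule A (ring_of_type_algebra :: 'r ring) M \<and>
     (\<forall>g\<in>carrier G. \<forall>x\<in>A. act M g x \<in> A)"

definition gmod_hom ::
    "('g, 'z) monoid_scheme \<Rightarrow> ('r, 'g, 'm) gmod \<Rightarrow> ('r, 'g, 'n) gmod \<Rightarrow> ('m \<Rightarrow> 'n) set" where
  "gmod_hom G M N = {f \<in> carrier M \<rightarrow>\<^sub>E carrier N.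
     (\<forall>x\<in>carrier M. \<forall>y\<in>carrier M. f (x \<oplus>\<^bsub>M\<^esub> y) = f x \<oplus>\<^bsub>N\<^esub> f y) \<and>
     (\<forall>a. \<forall>x\<in>carrier M. f (a \<odot>\<^bsub>M\<^esub> x) = a \<odot>\<^bsub>N\<^esub> f x) \<and>
     (\<forall>g\<in>carrier G. \<forall>x\<in>carrier M. f (act M g x) = act N g (f x))}"

definition gmod_isomorphic ::
    "('g, 'z) monoid_scheme \<Rightarrow> ('r, 'g, 'm) gmod \<Rightarrow> ('r, 'g, 'n) gmod \<Rightarrow> bool" where
  "gmod_isomorphic G M N \<longleftrightarrow> (\<exists>f\<in>gmod_hom G M N. bij_betw f (carrier M) (carrier N))"

definition direct_decomposition ::
    "('g, 'z) monoid_scheme \<Rightarrow> ('r::comm_ring_1, 'g, 'm) gmod \<Rightarrow> 'm set \<Rightarrow> 'm set \<Rightarrow> bool" where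
  "direct_decomposition G M A B \<longleftrightarrow>
     gsubmodule G A M \<and> gsubmodule G B M \<and> A \<inter> B = {\<zero>\<^bsub>M\<^esub>} \<and> A <+>\<^bsub>M\<^esub> B = carrier M"

definition direct_summand ::
    "('g, 'z) monoid_scheme \<Rightarrow> 'm set \<Rightarrow> ('r::comm_ring_1, 'g, 'm) gmod \<Rightarrow> bool" where
  "direct_summand G A M \<longleftrightarrow> (\<exists>B. direct_decomposition G M A B)"

definition iso_to_direct_summand ::
    "('g, 'z) monoid_scheme \<Rightarrow> ('r::comm_ring_1, 'g, 'm) gmod \<Rightarrow> ('r, 'g, 'n) gmod \<Rightarrow> bool" where
  "iso_to_direct_summand G M N \<longleftrightarrow>
     (\<exists>A. direct_summand G A N \<and> gmod_isomorphic G M (N\<lparr>carrier := A\<rparr>))"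

definition indecomposable ::
    "('g, 'z) monoid_scheme \<Rightarrow> ('r::comm_ring_1, 'g, 'm) gmod \<Rightarrow> bool" where
  "indecomposable G M \<longleftrightarrow>
     carrier M \<noteq> {\<zero>\<^bsub>M\<^esub>} \<and>
     (\<forall>A B. direct_decomposition G M A B \<longrightarrow> A = {\<zero>\<^bsub>M\<^esub>} \<or> B = {\<zero>\<^bsub>M\<^esub>})"

definition simple_gmod ::
    "('g, 'z) monoid_scheme \<Rightarrow> ('r::comm_ring_1, 'g, 'm) gmod \<Rightarrow> bool" where
  "simple_gmod G M \<longleftrightarrow>
     carrier M \<noteq> {\<zero>\<^bsub>M\<^esub>} \<and>
     (\<forall>A. gsubmodule G A M \<longrightarrow> A = {\<zero>\<^bsub>M\<^esub>} \<or> A = carrier M)"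


section \<open>Bases, rank and trace\<close>

definition mod_basis :: "('r, 'm, 'x) module_scheme \<Rightarrow> 'm set \<Rightarrow> bool" where
  "mod_basis M B \<longleftrightarrow>
     finite B \<and> B \<subseteq> carrier M \<and>
     (\<forall>x\<in>carrier M. \<exists>!c. c \<in> extensional B \<and> x = (\<Oplus>\<^bsub>M\<^esub>b\<in>B. c b \<odot>\<^bsub>M\<^esub> b))"

definition free_of_finite_rank :: "('r, 'm, 'x) module_scheme \<Rightarrow> bool" where
  "free_of_finite_rank M \<longleftrightarrow> (\<exists>B. mod_basis M B)"

definition mod_rank :: "('r, 'm, 'x) module_scheme \<Rightarrow> nat" where
  "mod_rank M = (THE n. \<exists>B. mod_basis M B \<and> card B = n)"

definition mod_coord :: "('r, 'm, 'x) module_scheme \<Rightarrow> 'm set \<Rightarrow> 'm \<Rightarrow> 'm \<Rightarrow> 'r" where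
  "mod_coord M B x = (THE c. c \<in> extensional B \<and> x = (\<Oplus>\<^bsub>M\<^esub>b\<in>B. c b \<odot>\<^bsub>M\<^esub> b))"

text \<open>The trace does not depend on the basis chosen.\<close>

definition mod_trace :: "('r::comm_ring_1, 'm, 'x) module_scheme \<Rightarrow> ('m \<Rightarrow> 'm) \<Rightarrow> 'r" where
  "mod_trace M f = (let B = (SOME B. mod_basis M B) in \<Sum>b\<in>B. mod_coord M B (f b) b)"


section \<open>Tensor products, extension of scalars and induction\<close>

text \<open>These are all given by generators and relations: the free module on a set \<open>S\<close> on which
  the group acts through \<open>\<alpha>\<close>, modulo the submodule generated by relations stable under the group.
  The basis element of \<open>s \<in> S\<close> is \<open>Poly_Mapping.single s 1\<close>.\<close>

definition free_gmod ::
    "'s set \<Rightarrow> ('g \<Rightarrow> 's \<Rightarrow> 's) \<Rightarrow> ('r::comm_ring_1, 'g, 's \<Rightarrow>\<^sub>0 'r) gmod" where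
  "free_gmod S \<alpha> =
     \<lparr>carrier = {f. Poly_Mapping.keys f \<subseteq> S}, monoid.mult = (\<lambda>_ _. 0), one = 0, ring.zero = 0, add = (+),
      module.smult = (\<lambda>a. Poly_Mapping.map ((*) a)),
      act = (\<lambda>g f. \<Sum>s\<in>Poly_Mapping.keys f.
                      Poly_Mapping.single (\<alpha> g s) (Poly_Mapping.lookup f s))\<rparr>"

definition quotient_gmod ::
    "('r, 'g, 'm) gmod \<Rightarrow> 'm set \<Rightarrow> ('r, 'g, 'm set) gmod" where
  "quotient_gmod M N =
     \<lparr>carrier = a_rcosets\<^bsub>M\<^esub> N, monoid.mult = (\<lambda>_ _. N), one = N, ring.zero = N, add = set_add M,
      module.smult = (\<lambda>a C. \<Union>x\<in>C. N +>\<^bsub>M\<^esub> (a \<odot>\<^bsub>M\<^esub> x)),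
      act = (\<lambda>g C. \<Union>x\<in>C. N +>\<^bsub>M\<^esub> act M g x)\<rparr>"

definition presented_gmod ::
    "'s set \<Rightarrow> ('g \<Rightarrow> 's \<Rightarrow> 's) \<Rightarrow> ('s \<Rightarrow>\<^sub>0 'r::comm_ring_1) set \<Rightarrow>
     ('r, 'g, ('s \<Rightarrow>\<^sub>0 'r) set) gmod" where
  "presented_gmod S \<alpha> E =
     quotient_gmod (free_gmod S \<alpha>)
       ((\<lambda>N. submodule N (ring_of_type_algebra :: 'r ring)
               (free_gmod S \<alpha> :: ('r, 'g, 's \<Rightarrow>\<^sub>0 'r) gmod)) hull E)"

text \<open>The tensor product over the scalars with diagonal action.\<close>

definition gmod_tensor ::
    "('r::comm_ring_1, 'g, 'm) gmod \<Rightarrow> ('r, 'g, 'n) gmod \<Rightarrow>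
     ('r, 'g, (('m \<times> 'n) \<Rightarrow>\<^sub>0 'r) set) gmod" where
  "gmod_tensor M N =
     (let e = (\<lambda>x y. Poly_Mapping.single (x, y) (1 :: 'r)) in
      presented_gmod (carrier M \<times> carrier N) (\<lambda>g (x, y). (act M g x, act N g y))
       ({e (x \<oplus>\<^bsub>M\<^esub> x') y - e x y - e x' y | x x' y.
           x \<in> carrier M \<and> x' \<in> carrier M \<and> y \<in> carrier N} \<union>
        {e x (y \<oplus>\<^bsub>N\<^esub> y') - e x y - e x y' | x y y'.
           x \<in> carrier M \<and> y \<in> carrier N \<and> y' \<in> carrier N} \<union>
        {e (a \<odot>\<^bsub>M\<^esub> x) y - Poly_Mapping.single (x, y) a | a x y.
           x \<in> carrier M \<and> y \<in> carrier N} \<union>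
        {e x (a \<odot>\<^bsub>N\<^esub> y) - Poly_Mapping.single (x, y) a | a x y.
           x \<in> carrier M \<and> y \<in> carrier N}))"

text \<open>\<open>gmod_extend \<phi> M\<close> is \<open>S \<otimes>\<^sub>R M\<close> for a ring homomorphism \<open>\<phi> : R \<rightarrow> S\<close>, presented as an
  \<open>S\<close>-module on the generators \<open>1 \<otimes> x\<close>.\<close>

definition gmod_extend ::
    "('r \<Rightarrow> 's::comm_ring_1) \<Rightarrow> ('r::comm_ring_1, 'g, 'm) gmod \<Rightarrow> ('s, 'g, ('m \<Rightarrow>\<^sub>0 's) set) gmod" where
  "gmod_extend \<phi> M =
     (let e = (\<lambda>x. Poly_Mapping.single x (1 :: 's)) in
      presented_gmod (carrier M) (act M)
       ({e (x \<oplus>\<^bsub>M\<^esub> y) - e x - e y | x y. x \<in> carrier M \<and> y \<in> carrier M} \<union>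
        {e (a \<odot>\<^bsub>M\<^esub> x) - Poly_Mapping.single x (\<phi> a) | a x. x \<in> carrier M}))"

text \<open>\<open>gmod_ind G Q M\<close> is \<open>RG \<otimes>\<^bsub>RQ\<^esub> M\<close>, presented as an \<open>R\<close>-module on the generators \<open>g \<otimes> x\<close>
  with \<open>g \<in> G\<close>, \<open>x \<in> M\<close>; the last relation is the balancing over \<open>Q\<close>.\<close>

definition gmod_ind ::
    "('g, 'z) monoid_scheme \<Rightarrow> 'g set \<Rightarrow> ('r::comm_ring_1, 'g, 'm) gmod \<Rightarrow>
     ('r, 'g, (('g \<times> 'm) \<Rightarrow>\<^sub>0 'r) set) gmod" where
  "gmod_ind G Q M =
     (let e = (\<lambda>g x. Poly_Mapping.single (g, x) (1 :: 'r)) in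
      presented_gmod (carrier G \<times> carrier M) (\<lambda>h (g, x). (h \<otimes>\<^bsub>G\<^esub> g, x))
       ({e g (x \<oplus>\<^bsub>M\<^esub> y) - e g x - e g y | g x y.
           g \<in> carrier G \<and> x \<in> carrier M \<and> y \<in> carrier M} \<union>
        {e g (a \<odot>\<^bsub>M\<^esub> x) - Poly_Mapping.single (g, x) a | a g x.
           g \<in> carrier G \<and> x \<in> carrier M} \<union>
        {e (g \<otimes>\<^bsub>G\<^esub> q) x - e g (act M q x) | g q x.
           g \<in> carrier G \<and> q \<in> Q \<and> x \<in> carrier M}))"


section \<open>Characters\<close>

definition gmod_character :: "('k::field, 'g, 'm) gmod \<Rightarrow> 'g \<Rightarrow> 'k" where
  "gmod_character M g = mod_trace M (act M g)"

text \<open>The character of \<open>K \<otimes> M\<close>, where \<open>K\<close> is the field of fractions of the ring of scalars.\<close>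

definition lattice_character :: "('o::idom, 'g, 'm) gmod \<Rightarrow> 'g \<Rightarrow> 'o fract" where
  "lattice_character M = gmod_character (gmod_extend to_fract M)"

text \<open>A function on the group is an irreducible character if it is afforded by a simple module;
  \<open>nat \<Rightarrow> 'k\<close> contains a copy of every finite-dimensional vector space over \<open>'k\<close>.\<close>

definition irreducible_character :: "('g, 'z) monoid_scheme \<Rightarrow> ('g \<Rightarrow> 'k::field) \<Rightarrow> bool" where
  "irreducible_character G \<chi> \<longleftrightarrow>
     (\<exists>M :: ('k, 'g, nat \<Rightarrow> 'k) gmod.
        gmodule G M \<and> free_of_finite_rank M \<and> simple_gmod G M \<and>
        (\<forall>g\<in>carrier G. \<chi> g = gmod_character M g))"

text \<open>Irreducibility over the algebraic closure of \<open>'k\<close>.  This is the strongest instance of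
  irreducibility over an extension field, and a definition cannot quantify over all of them.\<close>

definition absolutely_irreducible_character ::
    "('g, 'z) monoid_scheme \<Rightarrow> ('g \<Rightarrow> 'k::field) \<Rightarrow> bool" where
  "absolutely_irreducible_character G \<chi> \<longleftrightarrow> irreducible_character G (\<lambda>g. to_ac (\<chi> g))"


section \<open>Endomorphism rings and absolute indecomposability\<close>

definition gmod_End ::
    "('g, 'z) monoid_scheme \<Rightarrow> ('r, 'g, 'm) gmod \<Rightarrow> ('m \<Rightarrow> 'm) ring" where
  "gmod_End G M =
     \<lparr>carrier = gmod_hom G M M, monoid.mult = compose (carrier M), one = (\<lambda>x\<in>carrier M. x),
      ring.zero = (\<lambda>x\<in>carrier M. \<zero>\<^bsub>M\<^esub>), add = (\<lambda>f h. \<lambda>x\<in>carrier M. f x \<oplus>\<^bsub>M\<^esub> h x)\<rparr>"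

definition left_ideal :: "'a set \<Rightarrow> ('a, 'b) ring_scheme \<Rightarrow> bool" where
  "left_ideal I R \<longleftrightarrow> additive_subgroup I R \<and> (\<forall>a\<in>I. \<forall>x\<in>carrier R. x \<otimes>\<^bsub>R\<^esub> a \<in> I)"

definition maximal_left_ideal :: "'a set \<Rightarrow> ('a, 'b) ring_scheme \<Rightarrow> bool" where
  "maximal_left_ideal I R \<longleftrightarrow>
     left_ideal I R \<and> I \<noteq> carrier R \<and>
     (\<forall>J. left_ideal J R \<and> I \<subseteq> J \<longrightarrow> J = I \<or> J = carrier R)"

definition jacobson_radical :: "('a, 'b) ring_scheme \<Rightarrow> 'a set" where
  "jacobson_radical R = carrier R \<inter> \<Inter>{I. maximal_left_ideal I R}"

text \<open>The isomorphism of the residue ring with \<open>k\<close> is one of algebras: it is compatible with the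
  scalars.\<close>

definition absolutely_indecomposable ::
    "('g, 'z) monoid_scheme \<Rightarrow> ('r::comm_ring_1, 'g, 'm) gmod \<Rightarrow> bool" where
  "absolutely_indecomposable G M \<longleftrightarrow>
     indecomposable G M \<and>
     (let R = (ring_of_type_algebra :: 'r ring); E = gmod_End G M; J = jacobson_radical E in
      \<exists>\<phi>\<in>ring_iso (E Quot J) (residue_field R).
        \<forall>a. \<phi> (J +>\<^bsub>E\<^esub> (\<lambda>x\<in>carrier M. a \<odot>\<^bsub>M\<^esub> x)) = max_ideal R +>\<^bsub>R\<^esub> a)"


section \<open>Vertices, sources and Sylow subgroups\<close>

definition relatively_projective ::
    "('g, 'z) monoid_scheme \<Rightarrow> ('r::comm_ring_1, 'g, 'm) gmod \<Rightarrow> 'g set \<Rightarrow> bool" where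
  "relatively_projective G M Q \<longleftrightarrow>
     subgroup Q G \<and> iso_to_direct_summand G M (gmod_ind G Q M)"

definition is_vertex ::
    "('g, 'z) monoid_scheme \<Rightarrow> ('r::comm_ring_1, 'g, 'm) gmod \<Rightarrow> 'g set \<Rightarrow> bool" where
  "is_vertex G M Q \<longleftrightarrow>
     relatively_projective G M Q \<and>
     (\<forall>P. relatively_projective G M P \<and> P \<subseteq> Q \<longrightarrow> P = Q)"

definition is_source ::
    "('g, 'z) monoid_scheme \<Rightarrow> ('r::comm_ring_1, 'g, 'm) gmod \<Rightarrow> 'g set \<Rightarrow> 'm set \<Rightarrow> bool" where
  "is_source G M Q S \<longleftrightarrow>
     is_vertex G M Q \<and>
     direct_summand (G\<lparr>carrier := Q\<rparr>) S M \<and>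
     indecomposable (G\<lparr>carrier := Q\<rparr>) (M\<lparr>carrier := S\<rparr>) \<and>
     iso_to_direct_summand G M (gmod_ind G Q (M\<lparr>carrier := S\<rparr>))"

definition sources_rank_prime_to ::
    "nat \<Rightarrow> ('g, 'z) monoid_scheme \<Rightarrow> ('r::comm_ring_1, 'g, 'm) gmod \<Rightarrow> bool" where
  "sources_rank_prime_to p G M \<longleftrightarrow>
     (\<forall>Q S. is_source G M Q S \<longrightarrow> coprime (mod_rank (M\<lparr>carrier := S\<rparr>)) p)"

definition sources_absolutely_indecomposable ::
    "('g, 'z) monoid_scheme \<Rightarrow> ('r::comm_ring_1, 'g, 'm) gmod \<Rightarrow> bool" where
  "sources_absolutely_indecomposable G M \<longleftrightarrow>
     (\<forall>Q S. is_source G M Q S \<longrightarrow>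
        absolutely_indecomposable (G\<lparr>carrier := Q\<rparr>) (M\<lparr>carrier := S\<rparr>))"

definition is_sylow_subgroup :: "nat \<Rightarrow> 'g set \<Rightarrow> ('g, 'z) monoid_scheme \<Rightarrow> bool" where
  "is_sylow_subgroup p P G \<longleftrightarrow> subgroup P G \<and> card P = p ^ multiplicity p (Coset.order G)"

end

theory Submission imports Defs begin

text \<open>An \<open>\<O>\<close>-linear map \<open>a\<close> commuting with a subgroup \<open>Q\<close> has the transfer
  \<open>t(a) = \<Sum>\<^bsub>g\<in>G\<^esub> g a g\<^sup>-\<^sup>1\<close>, and by Higman's criterion a lattice is relatively \<open>Q\<close>-projective if and only
  if \<open>t(a) = |Q|\<close> for some such \<open>a\<close>.  Absolute irreducibility of the character makes \<open>t(a)/|Q|\<close> a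
  scalar, which is computed by taking traces.  If \<open>Q\<close> is a vertex of \<open>U\<close> with source of rank prime to
  \<open>p\<close>, projection onto the source is an \<open>e\<close> commuting with \<open>Q\<close> whose trace is a unit, and
  \<open>|Q| rk U\<close> and \<open>|G|\<close> differ by a unit.  With \<open>f\<close> and \<open>R\<close> for \<open>V\<close> in the same way, \<open>e \<otimes> f\<close> commutes
  with \<open>Q \<inter> R\<close> and has unit trace.  Comparing traces gives
  \<open>|G| \<lambda> \<sim> |QR|\<close> up to units, where \<open>|Q \<inter> R| \<lambda>\<close> is the transfer of \<open>e \<otimes> f\<close>.  When \<open>Q\<close> and \<open>R\<close> lie in a
  common Sylow subgroup, this forces \<open>QR\<close> to be that Sylow subgroup and \<open>\<lambda>\<close> to be a unit, so that \<open>W\<close>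
  is relatively \<open>Q \<inter> R\<close>-projective.  Finally, the trace of \<open>e \<otimes> f\<close> composed with the conjugates of
  a map witnessing relative \<open>S\<close>-projectivity is summed over double cosets \<open>(Q \<inter> R)hS\<close>: some term
  with \<open>Q \<inter> R \<subseteq> hSh\<^sup>-\<^sup>1\<close> is a unit.  This gives minimality of \<open>Q \<inter> R\<close>, and an endomorphism of unit
  trace on every source of \<open>W\<close>; on an absolutely indecomposable lattice the trace of an
  endomorphism is congruent to a multiple of the rank.\<close>


subsection \<open>Linear maps, coordinates and traces\<close>

text \<open>The trace is the measuring device because a unit trace survives each change of module:
  traces multiply on tensor products, and cyclicity moves the trace of a map that factors through a
  summand onto that summand.

  The transfer sums over all of G instead of G/Q, which makes it one and the same operation for
  every subgroup. Its price is the factor |Q|, which is cancelled in O but never inverted. That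
  t(a)/|Q| still lies in O comes from writing t(a) as |Q| times a sum over G/Q.

  The trace identity for e \<otimes> f bounds |QR| from below only: whichever vertices Q and R are
  taken, the p-part of |G| is at most |QR|. An upper bound requires QR to lie in a p-subgroup, which
  is why both vertices are conjugated into one Sylow subgroup. As QR is at first a mere set, the
  comparison is one of cardinalities, and that QR is a subgroup comes out at the end.

  Absolute irreducibility enters as a count. A simple module over the algebraic closure is compared
  with the lattice through its character alone, and the count shows that the O-rank of the
  endomorphism ring is 1.\<close>

abbreviation rta :: "'r::comm_ring_1 ring" where "rta \<equiv> ring_of_type_algebra"

lemma rta_simps [simp]:
  "carrier rta = UNIV" "x \<otimes>\<^bsub>rta\<^esub> y = x * y" "\<one>\<^bsub>rta\<^esub> = 1" "\<zero>\<^bsub>rta\<^esub> = 0" "x \<oplus>\<^bsub>rta\<^esub> y = x + y"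
  by (simp_all add: ring_of_type_algebra_def)

locale rmod = Module.module "rta :: 'r::comm_ring_1 ring" M
  for M :: "('r::comm_ring_1, 'm, 'x) module_scheme" (structure)
begin

lemma rmod_smult [simp]: "x \<in> carrier M \<Longrightarrow> a \<odot> x \<in> carrier M"
  using smult_closed[of a x] by simp

lemma rmod_ldistr: "x \<in> carrier M \<Longrightarrow> (a + b) \<odot> x = a \<odot> x \<oplus> b \<odot> x"
  using smult_l_distr[of a b x] by simp

lemma rmod_rdistr: "x \<in> carrier M \<Longrightarrow> y \<in> carrier M \<Longrightarrow> a \<odot> (x \<oplus> y) = a \<odot> x \<oplus> a \<odot> y"
  using smult_r_distr[of a x y] by simp

lemma rmod_assoc: "x \<in> carrier M \<Longrightarrow> (a * b) \<odot> x = a \<odot> (b \<odot> x)"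
  using smult_assoc1[of a b x] by simp

lemma rmod_one [simp]: "x \<in> carrier M \<Longrightarrow> 1 \<odot> x = x"
  using smult_one[of x] by simp

lemma rmod_l_null [simp]: "x \<in> carrier M \<Longrightarrow> 0 \<odot> x = \<zero>"
  using smult_l_null[of x] by simp

lemma rmod_r_null [simp]: "a \<odot> \<zero> = \<zero>"
  using smult_r_null[of a] by simp

lemma rmod_uminus: "x \<in> carrier M \<Longrightarrow> \<ominus> x = (- 1) \<odot> x"
proof -
  assume x: "x \<in> carrier M"
  have "(- 1) \<odot> x \<oplus> x = (- 1 + 1) \<odot> x" using x by (simp only: rmod_ldistr rmod_one)
  then have "(- 1) \<odot> x \<oplus> x = \<zero>" using x by simp
  then show ?thesis using x by (intro M.minus_equality) auto
qed

lemma rmod_swap: "x \<in> carrier M \<Longrightarrow> a \<odot> (b \<odot> x) = b \<odot> (a \<odot> x)"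
  by (simp add: mult.commute flip: rmod_assoc)

lemma rmod_lminus: "x \<in> carrier M \<Longrightarrow> (a - b) \<odot> x = a \<odot> x \<ominus> b \<odot> x"
proof -
  assume x: "x \<in> carrier M"
  have "(a - b) \<odot> x = (a + (- 1) * b) \<odot> x" by simp
  also have "\<dots> = a \<odot> x \<oplus> (- 1) \<odot> (b \<odot> x)"
    using x by (simp only: rmod_ldistr rmod_assoc)
  finally show ?thesis using x by (simp add: rmod_uminus M.minus_eq)
qed

lemma rmod_finsum_smult:
  "finite A \<Longrightarrow> f \<in> A \<rightarrow> carrier M \<Longrightarrow> a \<odot> (\<Oplus>i\<in>A. f i) = (\<Oplus>i\<in>A. a \<odot> f i)"
  using finsum_smult_ldistr[of A a f] by simp

lemma rmod_sum_smult:
  "finite A \<Longrightarrow> x \<in> carrier M \<Longrightarrow> (\<Sum>i\<in>A. a i) \<odot> x = (\<Oplus>i\<in>A. a i \<odot> x)"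
  by (induction A rule: finite_induct) (auto simp: rmod_ldistr)

lemma rmod_finsum_const:
  "finite A \<Longrightarrow> x \<in> carrier M \<Longrightarrow> (\<Oplus>i\<in>A. x) = of_nat (card A) \<odot> x"
  by (induction A rule: finite_induct) (auto simp: rmod_ldistr)

lemma rmod_submoduleI:
  assumes "H \<subseteq> carrier M" "\<zero> \<in> H"
    and "\<And>x y. x \<in> H \<Longrightarrow> y \<in> H \<Longrightarrow> x \<oplus> y \<in> H" "\<And>a x. x \<in> H \<Longrightarrow> a \<odot> x \<in> H"
  shows "submodule H rta M"
  using assms rmod_uminus by (intro submoduleI) (auto simp: subset_iff)

end

text \<open>An additive inverse is supplied by \<open>(- 1) \<odot> x\<close>, so that a record is
  recognised as a module by closure and equations alone.\<close>

lemma rmodI: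
  fixes M :: "('r::comm_ring_1, 'm, 'x) module_scheme" (structure)
  assumes "\<And>x y. x \<in> carrier M \<Longrightarrow> y \<in> carrier M \<Longrightarrow> x \<oplus> y \<in> carrier M"
    "\<zero> \<in> carrier M"
    "\<And>x y z. x \<in> carrier M \<Longrightarrow> y \<in> carrier M \<Longrightarrow> z \<in> carrier M \<Longrightarrow> (x \<oplus> y) \<oplus> z = x \<oplus> (y \<oplus> z)"
    "\<And>x y. x \<in> carrier M \<Longrightarrow> y \<in> carrier M \<Longrightarrow> x \<oplus> y = y \<oplus> x"
    "\<And>x. x \<in> carrier M \<Longrightarrow> \<zero> \<oplus> x = x"
    "\<And>a x. x \<in> carrier M \<Longrightarrow> a \<odot> x \<in> carrier M"
    "\<And>a b x. x \<in> carrier M \<Longrightarrow> (a + b) \<odot> x = a \<odot> x \<oplus> b \<odot> x"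
    "\<And>a x y. x \<in> carrier M \<Longrightarrow> y \<in> carrier M \<Longrightarrow> a \<odot> (x \<oplus> y) = a \<odot> x \<oplus> a \<odot> y"
    "\<And>a b x. x \<in> carrier M \<Longrightarrow> (a * b) \<odot> x = a \<odot> (b \<odot> x)"
    "\<And>x. x \<in> carrier M \<Longrightarrow> 1 \<odot> x = x"
    "\<And>x. x \<in> carrier M \<Longrightarrow> 0 \<odot> x = \<zero>"
  shows "rmod M"
proof -
  have inv: "\<exists>y\<in>carrier M. y \<oplus> x = \<zero>" if "x \<in> carrier M" for x
    using assms(6)[OF that, of "-1"] assms(7)[OF that, of "-1" 1] assms(10,11)[OF that] by force
  have "abelian_group M"
    by (rule abelian_groupI) (use assms inv in auto)
  then show ?thesis
    unfolding rmod_def using assms by (intro moduleI ring_from_type_algebra) auto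
qed

text \<open>In contrast to \<open>gmod_hom\<close>, values outside the carrier are unconstrained, so
  that linear maps compose as plain lambda terms. An extensional representative is taken only where
  maps are themselves elements of a module.\<close>

definition lin :: "('r::comm_ring_1, 'm, 'x) module_scheme \<Rightarrow> ('r, 'n, 'y) module_scheme \<Rightarrow> ('m \<Rightarrow> 'n) \<Rightarrow> bool" where
  "lin M N f \<longleftrightarrow> (\<forall>x\<in>carrier M. f x \<in> carrier N) \<and>
     (\<forall>x\<in>carrier M. \<forall>y\<in>carrier M. f (x \<oplus>\<^bsub>M\<^esub> y) = f x \<oplus>\<^bsub>N\<^esub> f y) \<and>
     (\<forall>a. \<forall>x\<in>carrier M. f (a \<odot>\<^bsub>M\<^esub> x) = a \<odot>\<^bsub>N\<^esub> f x)"

lemma lin_closed: "lin M N f \<Longrightarrow> x \<in> carrier M \<Longrightarrow> f x \<in> carrier N"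
  and lin_add: "lin M N f \<Longrightarrow> x \<in> carrier M \<Longrightarrow> y \<in> carrier M \<Longrightarrow> f (x \<oplus>\<^bsub>M\<^esub> y) = f x \<oplus>\<^bsub>N\<^esub> f y"
  and lin_smult: "lin M N f \<Longrightarrow> x \<in> carrier M \<Longrightarrow> f (a \<odot>\<^bsub>M\<^esub> x) = a \<odot>\<^bsub>N\<^esub> f x"
  by (auto simp: lin_def)

lemma lin_zero:
  assumes "rmod M" "rmod N" "lin M N f" shows "f \<zero>\<^bsub>M\<^esub> = \<zero>\<^bsub>N\<^esub>"
proof -
  interpret M: rmod M by fact
  interpret N: rmod N by fact
  show ?thesis
    using lin_smult[OF assms(3) M.M.zero_closed, of 0] lin_closed[OF assms(3) M.M.zero_closed] by simp
qed

lemma lin_cong: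
  assumes "\<And>x. x \<in> carrier M \<Longrightarrow> f x = g x" "rmod M" shows "lin M N f = lin M N g"
proof -
  interpret M: rmod M by fact
  show ?thesis using assms(1) by (simp add: lin_def)
qed

lemma lin_comp: "lin M N f \<Longrightarrow> lin N P g \<Longrightarrow> lin M P (\<lambda>x. g (f x))"
  by (simp add: lin_def)

lemma lin_id: "lin M M (\<lambda>x. x)"
  by (simp add: lin_def)

lemma lin_finsum:
  assumes "rmod M" "rmod N" "lin M N f" "finite A" "g \<in> A \<rightarrow> carrier M"
  shows "f (\<Oplus>\<^bsub>M\<^esub>a\<in>A. g a) = (\<Oplus>\<^bsub>N\<^esub>a\<in>A. f (g a))"
proof -
  interpret M: rmod M by fact
  interpret N: rmod N by fact
  show ?thesis using assms(4,5)
  proof (induction A rule: finite_induct)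
    case empty then show ?case using lin_zero[OF assms(1-3)] by simp
  next
    case (insert x F)
    then show ?case using lin_add[OF assms(3)] lin_closed[OF assms(3)]
      by (auto simp: Pi_def)
  qed
qed

lemma lin_plus:
  assumes "rmod N" "lin M N f" "lin M N g" shows "lin M N (\<lambda>x. f x \<oplus>\<^bsub>N\<^esub> g x)"
proof -
  interpret N: rmod N by fact
  show ?thesis using assms(2,3) by (auto simp: lin_def N.rmod_rdistr N.M.a_ac)
qed

lemma lin_scale:
  assumes "rmod N" "lin M N f" shows "lin M N (\<lambda>x. a \<odot>\<^bsub>N\<^esub> f x)"
proof -
  interpret N: rmod N by fact
  show ?thesis using assms(2)
    by (auto simp: lin_def N.rmod_rdistr intro: N.rmod_swap)
qed

lemma lin_sum:
  assumes "rmod M" "rmod N" "finite A" "\<And>i. i \<in> A \<Longrightarrow> lin M N (f i)"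
  shows "lin M N (\<lambda>x. \<Oplus>\<^bsub>N\<^esub>i\<in>A. f i x)"
proof -
  interpret N: rmod N by fact
  have cl: "\<And>i x. i \<in> A \<Longrightarrow> x \<in> carrier M \<Longrightarrow> f i x \<in> carrier N" using assms(4) lin_closed by metis
  have "(\<Oplus>\<^bsub>N\<^esub>i\<in>A. f i (x \<oplus>\<^bsub>M\<^esub> y)) = (\<Oplus>\<^bsub>N\<^esub>i\<in>A. f i x) \<oplus>\<^bsub>N\<^esub> (\<Oplus>\<^bsub>N\<^esub>i\<in>A. f i y)"
    if "x \<in> carrier M" "y \<in> carrier M" for x y
  proof -
    have "(\<Oplus>\<^bsub>N\<^esub>i\<in>A. f i (x \<oplus>\<^bsub>M\<^esub> y)) = (\<Oplus>\<^bsub>N\<^esub>i\<in>A. f i x \<oplus>\<^bsub>N\<^esub> f i y)"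
      using that cl assms(3,4) by (intro N.M.finsum_cong') (auto simp: lin_add)
    also have "\<dots> = (\<Oplus>\<^bsub>N\<^esub>i\<in>A. f i x) \<oplus>\<^bsub>N\<^esub> (\<Oplus>\<^bsub>N\<^esub>i\<in>A. f i y)"
      using that cl by (intro N.M.finsum_addf) auto
    finally show ?thesis .
  qed
  moreover have "(\<Oplus>\<^bsub>N\<^esub>i\<in>A. f i (a \<odot>\<^bsub>M\<^esub> x)) = a \<odot>\<^bsub>N\<^esub> (\<Oplus>\<^bsub>N\<^esub>i\<in>A. f i x)"
    if "x \<in> carrier M" for a x
    using that cl assms(3,4)
    by (subst N.rmod_finsum_smult) (auto intro!: N.M.finsum_cong' simp: lin_smult)
  ultimately show ?thesis using cl assms(3) by (auto simp: lin_def Pi_def)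
qed

section \<open>Functionals, dual bases, traces and ranks\<close>

text \<open>The scalars as a module over themselves: a functional is a linear map into
  \<open>scal\<close> and shares the lemmas on \<open>lin\<close>.\<close>

definition scal :: "('r::comm_ring_1, 'r) module" where
  "scal = \<lparr>carrier = UNIV, monoid.mult = (*), one = 1, ring.zero = 0, add = (+), module.smult = (*)\<rparr>"

lemma scal_simps [simp]:
  "carrier scal = UNIV" "x \<oplus>\<^bsub>scal\<^esub> y = x + y" "\<zero>\<^bsub>scal\<^esub> = 0" "a \<odot>\<^bsub>scal\<^esub> x = a * x"
  by (simp_all add: scal_def)

lemma rmod_scal: "rmod scal"
  by (rule rmodI) (auto simp: algebra_simps)

lemma finsum_scal: "finsum scal f A = sum f A"
proof -
  interpret rmod scal by (rule rmod_scal)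
  show ?thesis
  proof (cases "finite A")
    case True then show ?thesis by (induction A rule: finite_induct) auto
  qed (simp add: M.finsum_infinite)
qed

lemma fun_add: "lin M scal f \<Longrightarrow> x \<in> carrier M \<Longrightarrow> y \<in> carrier M \<Longrightarrow> f (x \<oplus>\<^bsub>M\<^esub> y) = f x + f y"
  and fun_smult: "lin M scal f \<Longrightarrow> x \<in> carrier M \<Longrightarrow> f (a \<odot>\<^bsub>M\<^esub> x) = a * f x"
  by (auto simp: lin_def)

lemma fun_sum:
  assumes "rmod M" "lin M scal f" "finite A" "g \<in> A \<rightarrow> carrier M"
  shows "f (\<Oplus>\<^bsub>M\<^esub>a\<in>A. g a) = (\<Sum>a\<in>A. f (g a))"
  using lin_finsum[OF assms(1) rmod_scal assms(2-4)] by (simp add: finsum_scal)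

text \<open>A basis indexed by \<open>I\<close> together with its dual basis. Coordinates are
  carried as functionals \<open>c i\<close> instead of the extensional coefficient functions of
  \<open>mod_basis\<close>, and the index set is arbitrary, so that \<open>B \<times> B\<close> and
  \<open>{..<r}\<close> can serve directly.\<close>

definition coords :: "('r::comm_ring_1, 'm, 'x) module_scheme \<Rightarrow> 'i set \<Rightarrow> ('i \<Rightarrow> 'm) \<Rightarrow> ('i \<Rightarrow> 'm \<Rightarrow> 'r) \<Rightarrow> bool" where
  "coords M I b c \<longleftrightarrow> rmod M \<and> finite I \<and> (\<forall>i\<in>I. b i \<in> carrier M) \<and> (\<forall>i\<in>I. lin M scal (c i)) \<and>
     (\<forall>x\<in>carrier M. x = (\<Oplus>\<^bsub>M\<^esub>i\<in>I. c i x \<odot>\<^bsub>M\<^esub> b i)) \<and>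
     (\<forall>i\<in>I. \<forall>j\<in>I. c i (b j) = (if i = j then 1 else 0))"

lemma coordsD:
  assumes "coords M I b c"
  shows "rmod M" "finite I" "\<And>i. i \<in> I \<Longrightarrow> b i \<in> carrier M" "\<And>i. i \<in> I \<Longrightarrow> lin M scal (c i)"
    "\<And>i j. i \<in> I \<Longrightarrow> j \<in> I \<Longrightarrow> c i (b j) = (if i = j then 1 else 0)"
proof -
  note D = assms[unfolded coords_def]
  show "rmod M" "finite I" using D by (rule conjunct1, rule conjunct1[OF conjunct2])
  show "\<And>i. i \<in> I \<Longrightarrow> b i \<in> carrier M" using D[THEN conjunct2, THEN conjunct2, THEN conjunct1] by (rule bspec)
  show "\<And>i. i \<in> I \<Longrightarrow> lin M scal (c i)"
    using D[THEN conjunct2, THEN conjunct2, THEN conjunct2, THEN conjunct1] by (rule bspec)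
  show "\<And>i j. i \<in> I \<Longrightarrow> j \<in> I \<Longrightarrow> c i (b j) = (if i = j then 1 else 0)"
    using D[THEN conjunct2, THEN conjunct2, THEN conjunct2, THEN conjunct2, THEN conjunct2] by (metis (full_types))
qed

lemma coords_repr:
  assumes "coords M I b c" "x \<in> carrier M"
  shows "(\<Oplus>\<^bsub>M\<^esub>i\<in>I. c i x \<odot>\<^bsub>M\<^esub> b i) = x"
  using assms(1)[unfolded coords_def, THEN conjunct2, THEN conjunct2, THEN conjunct2, THEN conjunct2,
      THEN conjunct1, THEN bspec, OF assms(2)] by (rule sym)

lemma coords_expand:
  assumes "coords M I b c" "rmod N" "lin M N h" "x \<in> carrier M"
  shows "h x = (\<Oplus>\<^bsub>N\<^esub>i\<in>I. c i x \<odot>\<^bsub>N\<^esub> h (b i))"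
proof -
  note C = coordsD[OF assms(1)]
  interpret M: rmod M by (rule C)
  interpret N: rmod N by fact
  have "h x = h (\<Oplus>\<^bsub>M\<^esub>i\<in>I. c i x \<odot>\<^bsub>M\<^esub> b i)" using coords_repr[OF assms(1,4)] by simp
  also have "\<dots> = (\<Oplus>\<^bsub>N\<^esub>i\<in>I. h (c i x \<odot>\<^bsub>M\<^esub> b i))"
    using C(2,3) by (intro lin_finsum) (auto simp: assms C(1))
  also have "\<dots> = (\<Oplus>\<^bsub>N\<^esub>i\<in>I. c i x \<odot>\<^bsub>N\<^esub> h (b i))"
    using C(3) assms(3) by (intro N.M.finsum_cong') (auto simp: lin_smult lin_closed)
  finally show ?thesis .
qed

lemma coords_expand_fun:
  assumes "coords M I b c" "lin M scal h" "x \<in> carrier M"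
  shows "h x = (\<Sum>i\<in>I. c i x * h (b i))"
  using coords_expand[OF assms(1) rmod_scal assms(2,3)] by (simp add: finsum_scal)

lemma coords_eqI:
  assumes "coords M I b c" "x \<in> carrier M" "y \<in> carrier M" "\<And>i. i \<in> I \<Longrightarrow> c i x = c i y"
  shows "x = y"
proof -
  interpret M: rmod M using assms(1) by (rule coordsD)
  have "x = (\<Oplus>\<^bsub>M\<^esub>i\<in>I. c i x \<odot>\<^bsub>M\<^esub> b i)" by (rule coords_repr[OF assms(1,2), symmetric])
  also have "\<dots> = (\<Oplus>\<^bsub>M\<^esub>i\<in>I. c i y \<odot>\<^bsub>M\<^esub> b i)"
    using assms(4) coordsD(3)[OF assms(1)] by (intro M.finsum_cong') auto
  also have "\<dots> = y" by (rule coords_repr[OF assms(1,3)])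
  finally show ?thesis .
qed

lemma coords_lin_eqI:
  assumes "coords M I b c" "rmod N" "lin M N f" "lin M N g" "\<And>i. i \<in> I \<Longrightarrow> f (b i) = g (b i)" "x \<in> carrier M"
  shows "f x = g x"
proof -
  interpret N: rmod N by fact
  show ?thesis
    unfolding coords_expand[OF assms(1,2,3,6)] coords_expand[OF assms(1,2,4,6)]
    using assms(5) coordsD(3)[OF assms(1)] lin_closed[OF assms(4)] by (intro N.M.finsum_cong') auto
qed

lemma coords_comb:
  assumes "coords M I b c" "i \<in> I"
  shows "c i (\<Oplus>\<^bsub>M\<^esub>j\<in>I. a j \<odot>\<^bsub>M\<^esub> b j) = a i"
proof -
  note C = coordsD[OF assms(1)]
  interpret M: rmod M by (rule C)
  have "c i (\<Oplus>\<^bsub>M\<^esub>j\<in>I. a j \<odot>\<^bsub>M\<^esub> b j) = (\<Sum>j\<in>I. c i (a j \<odot>\<^bsub>M\<^esub> b j))"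
    using C assms(2) by (intro fun_sum) auto
  also have "\<dots> = (\<Sum>j\<in>I. if i = j then a j else 0)"
    using C assms(2) by (intro sum.cong) (auto simp: fun_smult[OF C(4)])
  finally show ?thesis using assms(2) C(2) by simp
qed

text \<open>Both sides equal the double sum of \<open>e j (f (b i)) * c i (g (d j))\<close>. The two
  bases are unrelated: with the identity as one of the maps this shows that the trace does not
  depend on the basis, and with the identity as both it compares two ranks.\<close>

lemma trace_commute:
  assumes "coords M I b c" "coords N J d e" "lin M N f" "lin N M g"
  shows "(\<Sum>i\<in>I. c i (g (f (b i)))) = (\<Sum>j\<in>J. e j (f (g (d j))))"
proof -
  note M = coordsD[OF assms(1)] and N = coordsD[OF assms(2)]
  have "(\<Sum>i\<in>I. c i (g (f (b i)))) = (\<Sum>i\<in>I. \<Sum>j\<in>J. e j (f (b i)) * c i (g (d j)))"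
    using coords_expand_fun[OF assms(2) lin_comp[OF assms(4) M(4)]] lin_closed[OF assms(3) M(3)]
    by (intro sum.cong) auto
  also have "\<dots> = (\<Sum>j\<in>J. \<Sum>i\<in>I. c i (g (d j)) * e j (f (b i)))"
    by (subst sum.swap) (simp add: mult.commute)
  also have "\<dots> = (\<Sum>j\<in>J. e j (f (g (d j))))"
    using coords_expand_fun[OF assms(1) lin_comp[OF assms(3) N(4)]] lin_closed[OF assms(4) N(3)]
    by (intro sum.cong) auto
  finally show ?thesis .
qed

text \<open>Uniqueness of the coefficients gives everything: the coordinates of a sum, of a multiple
  and of a basis element are recognised from an expansion.\<close>

lemma mod_basis_coords:
  assumes "rmod M" "mod_basis M B"
  shows "coords M B (\<lambda>b. b) (\<lambda>b x. mod_coord M B x b)"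
proof -
  interpret M: rmod M by fact
  have B: "finite B" "B \<subseteq> carrier M"
    "\<And>x. x \<in> carrier M \<Longrightarrow> \<exists>!c. c \<in> extensional B \<and> x = (\<Oplus>\<^bsub>M\<^esub>b\<in>B. c b \<odot>\<^bsub>M\<^esub> b)"
    using assms(2) by (auto simp: mod_basis_def)
  have ex: "(\<Oplus>\<^bsub>M\<^esub>b\<in>B. mod_coord M B x b \<odot>\<^bsub>M\<^esub> b) = x" if "x \<in> carrier M" for x
    using theI'[OF B(3)[OF that], THEN conjunct2] unfolding mod_coord_def by (rule sym)
  have uniq: "mod_coord M B x b = c b" if "x \<in> carrier M" "x = (\<Oplus>\<^bsub>M\<^esub>b\<in>B. c b \<odot>\<^bsub>M\<^esub> b)" "b \<in> B" for x c b
  proof -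
    have "x = (\<Oplus>\<^bsub>M\<^esub>b\<in>B. restrict c B b \<odot>\<^bsub>M\<^esub> b)"
      using B by (subst that(2)) (intro M.finsum_cong', auto)
    then have "mod_coord M B x = restrict c B"
      unfolding mod_coord_def by (intro the1_equality[OF B(3)[OF that(1)]] conjI restrict_extensional)
    then show ?thesis using that(3) by simp
  qed
  have "mod_coord M B (x \<oplus>\<^bsub>M\<^esub> y) b = mod_coord M B x b + mod_coord M B y b"
    if "x \<in> carrier M" "y \<in> carrier M" "b \<in> B" for x y b
  proof (rule uniq)
    have "x \<oplus>\<^bsub>M\<^esub> y = (\<Oplus>\<^bsub>M\<^esub>b\<in>B. mod_coord M B x b \<odot>\<^bsub>M\<^esub> b) \<oplus>\<^bsub>M\<^esub> (\<Oplus>\<^bsub>M\<^esub>b\<in>B. mod_coord M B y b \<odot>\<^bsub>M\<^esub> b)"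
      by (simp only: ex that)
    also have "\<dots> = (\<Oplus>\<^bsub>M\<^esub>b\<in>B. (mod_coord M B x b + mod_coord M B y b) \<odot>\<^bsub>M\<^esub> b)"
      using B by (subst M.finsum_addf[symmetric]) (auto intro!: M.finsum_cong' simp: M.rmod_ldistr)
    finally show "x \<oplus>\<^bsub>M\<^esub> y = \<dots>" .
  qed (use that in auto)
  moreover have "mod_coord M B (a \<odot>\<^bsub>M\<^esub> x) b = a * mod_coord M B x b"
    if "x \<in> carrier M" "b \<in> B" for x a b
  proof (rule uniq)
    have "a \<odot>\<^bsub>M\<^esub> x = a \<odot>\<^bsub>M\<^esub> (\<Oplus>\<^bsub>M\<^esub>b\<in>B. mod_coord M B x b \<odot>\<^bsub>M\<^esub> b)"
      by (simp only: ex that)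
    also have "\<dots> = (\<Oplus>\<^bsub>M\<^esub>b\<in>B. (a * mod_coord M B x b) \<odot>\<^bsub>M\<^esub> b)"
      using B by (subst M.rmod_finsum_smult) (auto intro!: M.finsum_cong' simp: M.rmod_assoc)
    finally show "a \<odot>\<^bsub>M\<^esub> x = \<dots>" .
  qed (use that in auto)
  moreover have "mod_coord M B d b = (if b = d then 1 else 0)" if "b \<in> B" "d \<in> B" for b d
  proof (rule uniq)
    have "(\<Oplus>\<^bsub>M\<^esub>b\<in>B. (if b = d then 1 else 0) \<odot>\<^bsub>M\<^esub> b) = (\<Oplus>\<^bsub>M\<^esub>b\<in>B. if d = b then b else \<zero>\<^bsub>M\<^esub>)"
      using B by (intro M.finsum_cong') auto
    also have "\<dots> = d" using B that by (intro M.finsum_singleton) auto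
    finally show "d = (\<Oplus>\<^bsub>M\<^esub>b\<in>B. (if b = d then 1 else 0) \<odot>\<^bsub>M\<^esub> b)" by simp
  qed (use that B in auto)
  ultimately show ?thesis
    unfolding coords_def using B(1,2) assms(1)
    by (auto simp: lin_def ex)
qed

lemma coords_mod_basis:
  assumes "coords M I b c"
  shows "mod_basis M (b ` I)" "card (b ` I) = card I"
proof -
  note C = coordsD[OF assms(1)]
  interpret M: rmod M by (rule C)
  have inj: "inj_on b I"
    by (rule inj_onI) (metis C(5) zero_neq_one)
  then show "card (b ` I) = card I" by (rule card_image)
  have re: "(\<Oplus>\<^bsub>M\<^esub>y\<in>b ` I. a y \<odot>\<^bsub>M\<^esub> y) = (\<Oplus>\<^bsub>M\<^esub>i\<in>I. a (b i) \<odot>\<^bsub>M\<^esub> b i)" for a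
    using C inj by (intro M.finsum_reindex) auto
  have "\<exists>!a. a \<in> extensional (b ` I) \<and> x = (\<Oplus>\<^bsub>M\<^esub>y\<in>b ` I. a y \<odot>\<^bsub>M\<^esub> y)" if x: "x \<in> carrier M" for x
  proof (rule ex1I, intro conjI)
    let ?a = "\<lambda>y\<in>b ` I. c (the_inv_into I b y) x"
    show "?a \<in> extensional (b ` I)" by auto
    have "(\<Oplus>\<^bsub>M\<^esub>i\<in>I. ?a (b i) \<odot>\<^bsub>M\<^esub> b i) = (\<Oplus>\<^bsub>M\<^esub>i\<in>I. c i x \<odot>\<^bsub>M\<^esub> b i)"
      using C inj by (intro M.finsum_cong') (auto simp: the_inv_into_f_f)
    then show "x = (\<Oplus>\<^bsub>M\<^esub>y\<in>b ` I. ?a y \<odot>\<^bsub>M\<^esub> y)"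
      unfolding re using coords_repr[OF assms x] by simp
    fix a assume a: "a \<in> extensional (b ` I) \<and> x = (\<Oplus>\<^bsub>M\<^esub>y\<in>b ` I. a y \<odot>\<^bsub>M\<^esub> y)"
    have "c i x = a (b i)" if "i \<in> I" for i
      using coords_comb[OF assms that, of "\<lambda>i. a (b i)"] a re[of a] by simp
    then show "a = ?a"
      using a inj by (auto intro!: extensionalityI[of _ "b ` I"] simp: the_inv_into_f_f)
  qed
  then show "mod_basis M (b ` I)"
    using C by (auto simp: mod_basis_def)
qed

lemma free_coords:
  assumes "rmod M" "free_of_finite_rank M"
  obtains B c where "coords M B (\<lambda>b. b) c"
  using assms mod_basis_coords unfolding free_of_finite_rank_def by blast

lemma coords_free: "coords M I b c \<Longrightarrow> free_of_finite_rank M"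
  using coords_mod_basis unfolding free_of_finite_rank_def by blast

text \<open>The basis picked by \<open>SOME\<close> in \<open>mod_trace\<close> is compared with the
  given one through \<open>trace_commute\<close>, one of the two maps being the identity.\<close>

lemma mod_trace_coords:
  assumes "coords M I b c" "lin M M f"
  shows "mod_trace M f = (\<Sum>i\<in>I. c i (f (b i)))"
proof -
  define B where "B = (SOME B. mod_basis M B)"
  have "mod_basis M B"
    unfolding B_def by (rule someI) (rule coords_mod_basis(1)[OF assms(1)])
  then have "coords M B (\<lambda>b. b) (\<lambda>b x. mod_coord M B x b)"
    by (rule mod_basis_coords[OF coordsD(1)[OF assms(1)]])
  from trace_commute[OF this assms(1) lin_id assms(2)]
  show ?thesis unfolding mod_trace_def B_def[symmetric] by simp
qed

lemma mod_trace_commute: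
  assumes "rmod M" "rmod N" "free_of_finite_rank M" "free_of_finite_rank N" "lin M N f" "lin N M g"
  shows "mod_trace M (\<lambda>x. g (f x)) = mod_trace N (\<lambda>y. f (g y))"
proof -
  obtain B c where B: "coords M B (\<lambda>b. b) c" using free_coords assms by metis
  obtain D e where D: "coords N D (\<lambda>b. b) e" using free_coords assms by metis
  show ?thesis
    using trace_commute[OF B D assms(5,6)] lin_comp[OF assms(5,6)] lin_comp[OF assms(6,5)]
    by (simp add: mod_trace_coords[OF B] mod_trace_coords[OF D])
qed

lemma mod_trace_cong:
  assumes "rmod M" "free_of_finite_rank M" "lin M M f" "\<And>x. x \<in> carrier M \<Longrightarrow> f x = g x"
  shows "mod_trace M f = mod_trace M g"
proof -
  obtain B c where B: "coords M B (\<lambda>b. b) c" using free_coords assms by metis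
  have "lin M M g" using lin_cong[OF assms(4,1), where N = M] assms(3) by simp
  then show ?thesis
    using assms(3,4) coordsD(3)[OF B] by (simp add: mod_trace_coords[OF B])
qed

lemma mod_trace_add:
  assumes "rmod M" "free_of_finite_rank M" "lin M M f" "lin M M g"
  shows "mod_trace M (\<lambda>x. f x \<oplus>\<^bsub>M\<^esub> g x) = mod_trace M f + mod_trace M g"
proof -
  obtain B c where B: "coords M B (\<lambda>b. b) c" using free_coords assms by metis
  show ?thesis
    using lin_plus[OF assms(1,3,4)] assms(3,4) coordsD(3,4)[OF B] 
    by (simp add: mod_trace_coords[OF B] fun_add lin_closed sum.distrib)
qed

lemma mod_trace_scale:
  assumes "rmod M" "free_of_finite_rank M" "lin M M f"
  shows "mod_trace M (\<lambda>x. a \<odot>\<^bsub>M\<^esub> f x) = a * mod_trace M f"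
proof -
  obtain B c where B: "coords M B (\<lambda>b. b) c" using free_coords assms by metis
  show ?thesis
    using lin_scale[OF assms(1,3)] assms(3) coordsD(3,4)[OF B] 
    by (simp add: mod_trace_coords[OF B] fun_smult lin_closed sum_distrib_left)
qed

lemma mod_trace_sum:
  assumes "rmod M" "free_of_finite_rank M" "finite A" "\<And>i. i \<in> A \<Longrightarrow> lin M M (f i)"
  shows "mod_trace M (\<lambda>x. \<Oplus>\<^bsub>M\<^esub>i\<in>A. f i x) = (\<Sum>i\<in>A. mod_trace M (f i))"
proof -
  obtain B c where B: "coords M B (\<lambda>b. b) c" using free_coords assms by metis
  have cl: "\<And>i b. i \<in> A \<Longrightarrow> b \<in> B \<Longrightarrow> f i b \<in> carrier M"
    using assms(4) coordsD(3)[OF B] by (metis lin_closed)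
  have "mod_trace M (\<lambda>x. \<Oplus>\<^bsub>M\<^esub>i\<in>A. f i x) = (\<Sum>b\<in>B. \<Sum>i\<in>A. c b (f i b))"
    using lin_sum[OF assms(1,1,3,4)] cl coordsD[OF B] assms(3)
    by (subst mod_trace_coords[OF B]) (auto intro!: sum.cong fun_sum)
  also have "\<dots> = (\<Sum>i\<in>A. \<Sum>b\<in>B. c b (f i b))" by (rule sum.swap)
  also have "\<dots> = (\<Sum>i\<in>A. mod_trace M (f i))"
    using assms(4) by (simp add: mod_trace_coords[OF B])
  finally show ?thesis .
qed

text \<open>Two bases are compared through the trace of the identity, which is the image of the
  cardinality in the scalars; injectivity of \<open>of_nat\<close> recovers the number.\<close>

lemma mod_rank_coords:
  fixes M :: "('r::comm_ring_1, 'm, 'x) module_scheme"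
  assumes "inj (of_nat :: nat \<Rightarrow> 'r)" "coords M I b c"
  shows "mod_rank M = card I"
proof -
  have "card B = card I" if "mod_basis M B" for B
  proof -
    have B: "coords M B (\<lambda>b. b) (\<lambda>b x. mod_coord M B x b)"
      using mod_basis_coords[OF coordsD(1)[OF assms(2)] that] .
    have "(\<Sum>i\<in>B. mod_coord M B i i) = (\<Sum>i\<in>I. c i (b i))"
      using trace_commute[OF B assms(2) lin_id lin_id] .
    moreover have "(\<Sum>i\<in>B. mod_coord M B i i) = (\<Sum>i\<in>B. 1)"
      using coordsD(5)[OF B] by (intro sum.cong) auto
    moreover have "(\<Sum>i\<in>I. c i (b i)) = (\<Sum>i\<in>I. 1)"
      using coordsD(5)[OF assms(2)] by (intro sum.cong) auto
    ultimately have "(of_nat (card B) :: 'r) = of_nat (card I)" by simp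
    then show ?thesis using assms(1) by (simp add: inj_eq)
  qed
  then show ?thesis
    unfolding mod_rank_def using coords_mod_basis[OF assms(2)] by (intro the_equality) auto
qed

lemma mod_trace_id:
  fixes M :: "('r::comm_ring_1, 'm, 'x) module_scheme"
  assumes "inj (of_nat :: nat \<Rightarrow> 'r)" "rmod M" "free_of_finite_rank M"
  shows "mod_trace M (\<lambda>x. x) = of_nat (mod_rank M)"
proof -
  obtain B c where B: "coords M B (\<lambda>b. b) c" using free_coords assms by metis
  show ?thesis
    unfolding mod_trace_coords[OF B lin_id] mod_rank_coords[OF assms(1) B]
    using coordsD(5)[OF B] by simp
qed

section \<open>Submodules, and freeness over a principal ideal domain\<close>

lemma rmod_sub:
  assumes "rmod M" "submodule H rta M" shows "rmod (M\<lparr>carrier := H\<rparr>)"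
proof -
  interpret M: rmod M by fact
  interpret H: submodule H rta M by fact
  have "\<And>x. x \<in> H \<Longrightarrow> x \<in> carrier M" "\<And>x y. x \<in> H \<Longrightarrow> y \<in> H \<Longrightarrow> x \<oplus>\<^bsub>M\<^esub> y \<in> H" "\<zero>\<^bsub>M\<^esub> \<in> H"
    "\<And>a x. x \<in> H \<Longrightarrow> a \<odot>\<^bsub>M\<^esub> x \<in> H"
    using H.subset H.m_closed H.one_closed H.smult_closed by auto
  then show ?thesis
    by (intro rmodI) (simp_all add: M.M.a_ac M.rmod_ldistr M.rmod_rdistr M.rmod_assoc)
qed

lemma submodule_subset: "submodule H R M \<Longrightarrow> H \<subseteq> carrier M"
  by (metis submodule_def subgroup.subset monoid.simps(1) partial_object.select_convs(1))

lemma finsum_sub: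
  assumes "rmod M" "submodule H rta M" "f \<in> A \<rightarrow> H"
  shows "finsum (M\<lparr>carrier := H\<rparr>) f A = finsum M f A"
proof (cases "finite A")
  case True
  interpret M: rmod M by fact
  interpret N: rmod "M\<lparr>carrier := H\<rparr>" using rmod_sub assms by blast
  have sub: "H \<subseteq> carrier M" using submodule_subset[OF assms(2)] .
  from True assms(3) show ?thesis
  proof (induction A rule: finite_induct)
    case (insert x F)
    then have "f \<in> F \<rightarrow> H" "f x \<in> H" "f \<in> F \<rightarrow> carrier M" "f x \<in> carrier M" using sub by auto
    then show ?case using insert by simp
  qed simp
qed (simp add: finsum_def finprod_def)

lemma lin_incl: "H \<subseteq> carrier M \<Longrightarrow> lin (M\<lparr>carrier := H\<rparr>) M (\<lambda>x. x)"
  by (auto simp: lin_def)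

lemma lin_from_sub: "H \<subseteq> carrier M \<Longrightarrow> lin M N f \<Longrightarrow> lin (M\<lparr>carrier := H\<rparr>) N f"
  by (auto simp: lin_def subset_iff)

lemma lin_to_sub: "lin M N f \<Longrightarrow> (\<And>x. x \<in> carrier M \<Longrightarrow> f x \<in> H) \<Longrightarrow> lin M (N\<lparr>carrier := H\<rparr>) f"
  by (auto simp: lin_def)

lemma principal_generator:
  fixes I :: "'r::idom set"
  assumes "principal_domain (rta :: 'r ring)" "0 \<in> I"
    and "\<And>x y. x \<in> I \<Longrightarrow> y \<in> I \<Longrightarrow> x + y \<in> I" "\<And>a x. x \<in> I \<Longrightarrow> a * x \<in> I"
  obtains d where "d \<in> I" "\<And>x. x \<in> I \<Longrightarrow> d dvd x"
proof -
  interpret principal_domain "rta :: 'r ring" by fact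
  have inv: "inv\<^bsub>add_monoid (rta :: 'r ring)\<^esub> x = - x" for x :: 'r
    using minus_equality[of "- x" x] by (simp add: a_inv_def)
  have "ideal I (rta :: 'r ring)"
  proof (rule idealI)
    show "ring (rta :: 'r ring)" by (rule ring_from_type_algebra)
    show "subgroup I (add_monoid (rta :: 'r ring))"
      by (rule subgroup.intro) (use assms(2-) inv assms(4)[of _ "-1"] in auto)
  qed (use assms(4) in \<open>auto simp: mult.commute\<close>)
  then obtain a where a: "I = PIdl\<^bsub>rta\<^esub> a" using exists_gen by blast
  have "a = 1 * a" by simp
  then have "a \<in> I" unfolding a cgenideal_def by (auto simp del: mult_1)
  moreover have "a dvd x" if "x \<in> I" for x using that unfolding a cgenideal_def by auto
  ultimately show ?thesis using that by blast
qed

text \<open>Jointly injective functionals embed \<open>M\<close> in a free module of rank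
  \<open>card I\<close>. The induction removes one functional: its image is an ideal generated by
  some \<open>d = c i a\<close>, and for nonzero \<open>d\<close> the module is the kernel plus the
  free line of \<open>a\<close>. In this form, with the bound on \<open>r\<close>, it serves both
  submodules of free modules and the existence of linear relations.\<close>

theorem free_of_functionals:
  fixes M :: "('r::idom, 'm, 'x) module_scheme" and c :: "'i \<Rightarrow> 'm \<Rightarrow> 'r"
  assumes "principal_domain (rta :: 'r ring)" "finite I" "rmod M"
    and "\<And>i. i \<in> I \<Longrightarrow> lin M scal (c i)"
    and "\<And>x. x \<in> carrier M \<Longrightarrow> (\<And>i. i \<in> I \<Longrightarrow> c i x = 0) \<Longrightarrow> x = \<zero>\<^bsub>M\<^esub>"
  shows "\<exists>(b :: nat \<Rightarrow> 'm) e r. r \<le> card I \<and> coords M {..<r} b e"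
  using assms(2-)
proof (induction I arbitrary: M rule: finite_induct)
  case empty
  then interpret M: rmod M by blast
  have "coords M {..<0::nat} (\<lambda>_. \<zero>\<^bsub>M\<^esub>) (\<lambda>_ _. 0)"
    using empty(2) M.rmod_axioms by (auto simp: coords_def dest: empty(3))
  then show ?case by blast
next
  case (insert i I)
  interpret M: rmod M by fact
  note ci = insert.prems(2)[of i, simplified]
  define H where "H = {x \<in> carrier M. c i x = 0}"
  have H: "submodule H rta M"
    using lin_zero[OF M.rmod_axioms rmod_scal ci]
    by (intro M.rmod_submoduleI) (auto simp: H_def fun_add[OF ci] fun_smult[OF ci])
  let ?N = "M\<lparr>carrier := H\<rparr>"
  interpret N: rmod ?N using rmod_sub H M.rmod_axioms by blast
  have HM: "H \<subseteq> carrier M" by (auto simp: H_def)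
  have "\<exists>b e r. r \<le> card I \<and> coords ?N {..<r} b e"
  proof (rule insert.IH)
    show "rmod ?N" by (rule N.rmod_axioms)
    show "lin ?N scal (c j)" if "j \<in> I" for j
      using lin_from_sub[OF HM] insert.prems(2) that by auto
    show "x = \<zero>\<^bsub>?N\<^esub>" if "x \<in> carrier ?N" "\<And>j. j \<in> I \<Longrightarrow> c j x = 0" for x
      using that insert.prems(3)[of x] by (auto simp: H_def)
  qed
  then obtain b e r where r: "r \<le> card I" and be: "coords ?N {..<r} b e" by blast
  note C = coordsD[OF be]
  obtain d where d: "d \<in> c i ` carrier M" "\<And>x. x \<in> c i ` carrier M \<Longrightarrow> d dvd x"
  proof (rule principal_generator[OF assms(1), of "c i ` carrier M"])
    show "0 \<in> c i ` carrier M"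
      using lin_zero[OF M.rmod_axioms rmod_scal ci] by (intro image_eqI[of _ _ "\<zero>\<^bsub>M\<^esub>"]) auto
    show "x + y \<in> c i ` carrier M" if "x \<in> c i ` carrier M" "y \<in> c i ` carrier M" for x y
      using that by (auto simp: image_iff) (metis M.M.a_closed fun_add[OF ci])
    show "a * x \<in> c i ` carrier M" if "x \<in> c i ` carrier M" for x a
      using that by (auto simp: image_iff) (metis M.rmod_smult fun_smult[OF ci])
  qed blast
  show ?case
  proof (cases "d = 0")
    case True
    then have "H = carrier M" using d(2) by (auto simp: H_def)
    then show ?thesis using be r insert.hyps by (metis card_insert_disjoint le_SucI module.surjective module.update_convs partial_object.update_convs(1) partial_object.surjective)
  next
    case False
    obtain a where a: "a \<in> carrier M" "d = c i a" using d(1) by blast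
    \<comment> \<open>The functional \<open>c i\<close> divided by \<open>d\<close>. It is linear
      because \<open>d\<close> cancels, and it takes \<open>a\<close> to 1.\<close>
    define q where "q x = (SOME t. c i x = d * t)" for x
    have q: "c i x = d * q x" if "x \<in> carrier M" for x
      unfolding q_def by (rule someI_ex) (use d(2) that in \<open>auto simp: dvd_def\<close>)
    have qlin: "lin M scal q"
      unfolding lin_def
    proof (intro conjI ballI allI)
      fix x y assume xy: "x \<in> carrier M" "y \<in> carrier M"
      have "d * q (x \<oplus>\<^bsub>M\<^esub> y) = d * (q x + q y)"
        using xy q[of "x \<oplus>\<^bsub>M\<^esub> y"] q[of x] q[of y] fun_add[OF ci] by (simp add: distrib_left)
      then show "q (x \<oplus>\<^bsub>M\<^esub> y) = q x \<oplus>\<^bsub>scal\<^esub> q y" using False by simp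
    next
      fix t x assume x: "x \<in> carrier M"
      have "d * q (t \<odot>\<^bsub>M\<^esub> x) = t * c i x"
        using x q[of "t \<odot>\<^bsub>M\<^esub> x"] fun_smult[OF ci] by simp
      then have "d * q (t \<odot>\<^bsub>M\<^esub> x) = d * (t * q x)"
        using q[OF x] by (simp add: mult.left_commute)
      then show "q (t \<odot>\<^bsub>M\<^esub> x) = t \<odot>\<^bsub>scal\<^esub> q x" using False by simp
    qed simp
    \<comment> \<open>The projection onto the kernel \<open>H\<close> along
      \<open>a\<close>.\<close>
    define p where "p x = x \<oplus>\<^bsub>M\<^esub> (- 1 * q x) \<odot>\<^bsub>M\<^esub> a" for x
    have "lin M M (\<lambda>x. (- 1 * q x) \<odot>\<^bsub>M\<^esub> a)"
      using a(1) unfolding lin_def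
      by (simp add: fun_add[OF qlin] fun_smult[OF qlin] M.rmod_ldistr mult.left_commute M.rmod_assoc del: mult_minus1 mult_minus_left flip: M.rmod_ldistr minus_add_distrib)
        (simp add: add.commute flip: M.rmod_ldistr M.rmod_assoc)
    then have pM: "lin M M p" unfolding p_def by (intro lin_plus M.rmod_axioms lin_id)
    have pH: "p x \<in> H" if "x \<in> carrier M" for x
      using that a q[OF that] by (auto simp: H_def p_def fun_add[OF ci] fun_smult[OF ci] mult.commute)
    have p: "lin M ?N p" using lin_to_sub[OF pM pH] by simp
    have q0: "q x = 0" if "x \<in> H" for x using q[of x] that False by (auto simp: H_def)
    have qa: "q a = 1" using q[OF a(1)] a(2) False by simp
    have p0: "p x = x" if "x \<in> H" for x
      using that q0[OF that] a(1) HM by (auto simp: p_def)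
    have pa: "p a = \<zero>\<^bsub>M\<^esub>"
      using qa a(1) by (simp add: p_def M.M.r_neg flip: M.rmod_uminus)
    define b' where "b' = b(r := a)"
    define e' where "e' k x = (if k = r then q x else e k (p x))" for k x
    have "coords M {..<Suc r} b' e'"
      unfolding coords_def
    proof (intro conjI ballI)
      fix k assume k: "k \<in> {..<Suc r}"
      show "b' k \<in> carrier M" using k C(3)[of k] HM a by (auto simp: b'_def less_Suc_eq)
      show "lin M scal (e' k)" using k qlin lin_comp[OF p C(4)[of k]]
        by (cases "k = r") (auto simp: e'_def[abs_def] less_Suc_eq)
      fix l assume l: "l \<in> {..<Suc r}"
      have "e k (b l) = (if k = l then 1 else 0)" if "k < r" "l < r" using C(5) that by simp
      moreover have "b l \<in> H" if "l < r" using C(3)[of l] that by simp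
      moreover have "e k \<zero>\<^bsub>M\<^esub> = 0" if "k < r"
        using lin_zero[OF N.rmod_axioms rmod_scal C(4)[of k]] that by simp
      ultimately show "e' k (b' l) = (if k = l then 1 else 0)"
        using k l p0[of "b l"] q0[of "b l"] qa pa by (auto simp: e'_def b'_def less_Suc_eq)
    next
      fix x assume x: "x \<in> carrier M"
      have bH: "b k \<in> H" if "k < r" for k using C(3)[of k] that by simp
      have "(\<Oplus>\<^bsub>M\<^esub>k\<in>{..<r}. e k (p x) \<odot>\<^bsub>M\<^esub> b k) = p x"
        using coords_repr[OF be, of "p x"] pH[OF x] bH N.rmod_smult[simplified]
        by (subst finsum_sub[symmetric, OF M.rmod_axioms H]) auto
      moreover have "(\<Oplus>\<^bsub>M\<^esub>k\<in>{..<r}. e k (p x) \<odot>\<^bsub>M\<^esub> b k) = (\<Oplus>\<^bsub>M\<^esub>k\<in>{..<r}. e' k x \<odot>\<^bsub>M\<^esub> b' k)"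
        using bH HM by (intro M.M.finsum_cong') (auto simp: e'_def b'_def subset_iff)
      ultimately have "(\<Oplus>\<^bsub>M\<^esub>k\<in>{..<Suc r}. e' k x \<odot>\<^bsub>M\<^esub> b' k) = q x \<odot>\<^bsub>M\<^esub> a \<oplus>\<^bsub>M\<^esub> p x"
        using bH HM a unfolding lessThan_Suc
        by (subst M.M.finsum_insert) (auto simp: e'_def b'_def subset_iff)
      also have "\<dots> = x \<oplus>\<^bsub>M\<^esub> (q x \<odot>\<^bsub>M\<^esub> a \<oplus>\<^bsub>M\<^esub> (- 1 * q x) \<odot>\<^bsub>M\<^esub> a)"
        using x a(1) unfolding p_def by (intro M.M.a_lcomm) auto
      also have "\<dots> = x"
        using x a(1) by (simp flip: M.rmod_ldistr)
      finally show "x = (\<Oplus>\<^bsub>M\<^esub>k\<in>{..<Suc r}. e' k x \<odot>\<^bsub>M\<^esub> b' k)" by simp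
    qed (use M.rmod_axioms in auto)
    moreover have "Suc r \<le> card (insert i I)" using r insert.hyps by simp
    ultimately show ?thesis by blast
  qed
qed

lemma free_sub:
  fixes M :: "('r::idom, 'm, 'x) module_scheme"
  assumes "principal_domain (rta :: 'r ring)" "rmod M" "free_of_finite_rank M" "submodule H rta M"
  shows "free_of_finite_rank (M\<lparr>carrier := H\<rparr>)"
proof -
  obtain B c where B: "coords M B (\<lambda>b. b) c" using free_coords assms by metis
  interpret M: rmod M by fact
  have HM: "H \<subseteq> carrier M" using submodule_subset[OF assms(4)] .
  have "\<exists>b e r. r \<le> card B \<and> coords (M\<lparr>carrier := H\<rparr>) {..<r::nat} b e"
  proof (rule free_of_functionals[OF assms(1), where c = c])
    show "finite B" using coordsD[OF B] by blast
    show "rmod (M\<lparr>carrier := H\<rparr>)" using rmod_sub assms by blast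
    show "lin (M\<lparr>carrier := H\<rparr>) scal (c i)" if "i \<in> B" for i
      using lin_from_sub[OF HM coordsD(4)[OF B that]] .
    show "x = \<zero>\<^bsub>M\<lparr>carrier := H\<rparr>\<^esub>" if "x \<in> carrier (M\<lparr>carrier := H\<rparr>)" "\<And>i. i \<in> B \<Longrightarrow> c i x = 0" for x
      using that HM lin_zero[OF assms(2) rmod_scal coordsD(4)[OF B]]
      by (auto intro!: coords_eqI[OF B])
  qed
  then show ?thesis using coords_free by blast
qed

section \<open>Modules with a group action and their quotients\<close>

lemma gmodule_rmod: "gmodule G M \<Longrightarrow> rmod M"
  by (simp add: gmodule_def rmod_def)

lemma act_lin: "gmodule G M \<Longrightarrow> g \<in> carrier G \<Longrightarrow> lin M M (act M g)"
  by (simp add: lin_def gmodule.act_closed gmodule.act_add gmodule.act_smult)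

lemma gmoduleI:
  assumes "group G" "rmod M"
    and "\<And>g. g \<in> carrier G \<Longrightarrow> lin M M (act M g)"
    and "\<And>x. x \<in> carrier M \<Longrightarrow> act M \<one>\<^bsub>G\<^esub> x = x"
    and "\<And>g h x. g \<in> carrier G \<Longrightarrow> h \<in> carrier G \<Longrightarrow> x \<in> carrier M \<Longrightarrow>
      act M (g \<otimes>\<^bsub>G\<^esub> h) x = act M g (act M h x)"
  shows "gmodule G M"
  unfolding gmodule_def gmodule_axioms_def using assms
  by (auto simp: rmod_def lin_def)

text \<open>Differences are written with \<open>(- 1) \<odot>\<close>, a form that linear maps
  preserve with no appeal to inverses.\<close>

lemma rmod_eq_iff:
  assumes "rmod M" "x \<in> carrier M" "y \<in> carrier M"
  shows "x \<oplus>\<^bsub>M\<^esub> (- 1) \<odot>\<^bsub>M\<^esub> y = \<zero>\<^bsub>M\<^esub> \<longleftrightarrow> x = y"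
proof -
  interpret M: rmod M by fact
  have "x = y" if "x \<oplus>\<^bsub>M\<^esub> \<ominus>\<^bsub>M\<^esub> y = \<zero>\<^bsub>M\<^esub>"
    using M.M.minus_equality[OF that] assms by simp
  then show ?thesis using assms by (auto simp: M.M.r_neg simp flip: M.rmod_uminus)
qed

lemma rmod_eq_iff3:
  assumes "rmod M" "x \<in> carrier M" "y \<in> carrier M" "z \<in> carrier M"
  shows "x \<oplus>\<^bsub>M\<^esub> (- 1) \<odot>\<^bsub>M\<^esub> y \<oplus>\<^bsub>M\<^esub> (- 1) \<odot>\<^bsub>M\<^esub> z = \<zero>\<^bsub>M\<^esub> \<longleftrightarrow> x = y \<oplus>\<^bsub>M\<^esub> z"
proof -
  interpret M: rmod M by fact
  have "x \<oplus>\<^bsub>M\<^esub> (- 1) \<odot>\<^bsub>M\<^esub> y \<oplus>\<^bsub>M\<^esub> (- 1) \<odot>\<^bsub>M\<^esub> z = x \<oplus>\<^bsub>M\<^esub> (- 1) \<odot>\<^bsub>M\<^esub> (y \<oplus>\<^bsub>M\<^esub> z)"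
    using assms by (simp add: M.rmod_rdistr M.M.a_assoc)
  then show ?thesis using rmod_eq_iff[OF assms(1,2), of "y \<oplus>\<^bsub>M\<^esub> z"] assms by simp
qed

lemma gmodule_quotient:
  fixes F :: "('r::comm_ring_1, 'g, 'm) gmod"
  assumes F: "gmodule G F" and N: "gsubmodule G N F"
  shows "gmodule G (quotient_gmod F N)"
    and "lin F (quotient_gmod F N) (\<lambda>x. N +>\<^bsub>F\<^esub> x)"
    and "carrier (quotient_gmod F N) = (\<lambda>x. N +>\<^bsub>F\<^esub> x) ` carrier F"
    and "\<And>g x. g \<in> carrier G \<Longrightarrow> x \<in> carrier F \<Longrightarrow>
      act (quotient_gmod F N) g (N +>\<^bsub>F\<^esub> x) = N +>\<^bsub>F\<^esub> act F g x"
    and "\<And>x. x \<in> N \<Longrightarrow> N +>\<^bsub>F\<^esub> x = \<zero>\<^bsub>quotient_gmod F N\<^esub>"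
    and "\<And>x y. x \<in> carrier F \<Longrightarrow> y \<in> carrier F \<Longrightarrow> N +>\<^bsub>F\<^esub> x = N +>\<^bsub>F\<^esub> y \<Longrightarrow> \<exists>n\<in>N. x = n \<oplus>\<^bsub>F\<^esub> y"
proof -
  let ?Q = "quotient_gmod F N"
  interpret F: gmodule G F by fact
  interpret F: rmod F using F by (rule gmodule_rmod)
  have sub: "submodule N rta F" and st: "\<And>g x. g \<in> carrier G \<Longrightarrow> x \<in> N \<Longrightarrow> act F g x \<in> N"
    using N by (auto simp: gsubmodule_def)
  interpret N: submodule N rta F by fact
  have NF: "\<And>x. x \<in> N \<Longrightarrow> x \<in> carrier F" using submodule_subset[OF sub] by blast
  have Nsm: "\<And>a x. x \<in> N \<Longrightarrow> a \<odot>\<^bsub>F\<^esub> x \<in> N" using N.smult_closed by simp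
  have "subgroup N (add_monoid F)" by (rule N.subgroup_axioms)
  then interpret A: abelian_subgroup N F
    using F.M.abelian_group_axioms by (intro abelian_subgroupI3 additive_subgroup.intro) auto
  have mem: "y \<in> N +>\<^bsub>F\<^esub> x \<longleftrightarrow> (\<exists>n\<in>N. y = n \<oplus>\<^bsub>F\<^esub> x)" for x y
    by (auto simp: a_r_coset_def')
  have shift: "N +>\<^bsub>F\<^esub> (n \<oplus>\<^bsub>F\<^esub> x) = N +>\<^bsub>F\<^esub> x" if "n \<in> N" "x \<in> carrier F" for n x
    using that NF A.a_rcos_sum[of n x] A.a_rcos_sum[of "\<zero>\<^bsub>F\<^esub>" x] A.a_rcos_const[of n]
      A.a_rcos_const[of "\<zero>\<^bsub>F\<^esub>"] by simp
  have ex: "\<exists>z. z \<in> N +>\<^bsub>F\<^esub> x" if "x \<in> carrier F" for x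
    using mem A.a_subset by (metis A.zero_closed)
  \<comment> \<open>The union over representatives in \<open>quotient_gmod\<close> collapses to one
    coset because \<open>h\<close> maps \<open>N\<close> into itself. Scalars and group elements are
    the two instances.\<close>
  have fac: "(\<Union>y\<in>N +>\<^bsub>F\<^esub> x. N +>\<^bsub>F\<^esub> h y) = N +>\<^bsub>F\<^esub> h x"
    if "x \<in> carrier F" "lin F F h" "\<And>n. n \<in> N \<Longrightarrow> h n \<in> N" for h x
  proof -
    have "N +>\<^bsub>F\<^esub> h y = N +>\<^bsub>F\<^esub> h x" if "y \<in> N +>\<^bsub>F\<^esub> x" for y
      using that mem shift \<open>x \<in> carrier F\<close> lin_closed[OF \<open>lin F F h\<close>] lin_add[OF \<open>lin F F h\<close>] NF
        \<open>\<And>n. n \<in> N \<Longrightarrow> h n \<in> N\<close> by auto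
    then show ?thesis using ex[OF that(1)] by auto
  qed
  show car: "carrier ?Q = (\<lambda>x. N +>\<^bsub>F\<^esub> x) ` carrier F"
    by (auto simp: quotient_gmod_def A_RCOSETS_def')
  have add: "(N +>\<^bsub>F\<^esub> x) \<oplus>\<^bsub>?Q\<^esub> (N +>\<^bsub>F\<^esub> y) = N +>\<^bsub>F\<^esub> (x \<oplus>\<^bsub>F\<^esub> y)"
    if "x \<in> carrier F" "y \<in> carrier F" for x y
    using A.a_rcos_sum[OF that] by (simp add: quotient_gmod_def)
  have smult: "a \<odot>\<^bsub>?Q\<^esub> (N +>\<^bsub>F\<^esub> x) = N +>\<^bsub>F\<^esub> (a \<odot>\<^bsub>F\<^esub> x)" if "x \<in> carrier F" for a x
    using fac[OF that lin_scale[OF F.rmod_axioms lin_id]] Nsm by (simp add: quotient_gmod_def)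
  show ac: "act ?Q g (N +>\<^bsub>F\<^esub> x) = N +>\<^bsub>F\<^esub> act F g x" if "g \<in> carrier G" "x \<in> carrier F" for g x
    using fac[OF that(2) act_lin[OF F that(1)]] st[OF that(1)] by (simp add: quotient_gmod_def)
  have zero: "\<zero>\<^bsub>?Q\<^esub> = N +>\<^bsub>F\<^esub> \<zero>\<^bsub>F\<^esub>"
    using A.a_rcos_const[of "\<zero>\<^bsub>F\<^esub>"] by (simp add: quotient_gmod_def)
  show "N +>\<^bsub>F\<^esub> x = \<zero>\<^bsub>?Q\<^esub>" if "x \<in> N" for x
    using A.a_rcos_const[OF that] by (simp add: quotient_gmod_def)
  show "\<exists>n\<in>N. x = n \<oplus>\<^bsub>F\<^esub> y" if "x \<in> carrier F" "y \<in> carrier F" "N +>\<^bsub>F\<^esub> x = N +>\<^bsub>F\<^esub> y" for x y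
  proof -
    have "x \<in> N +>\<^bsub>F\<^esub> x" using mem[of x x] that(1) by (metis A.zero_closed F.M.l_zero)
    then show ?thesis using that(3) mem by simp
  qed
  have rm: "rmod ?Q"
    by (rule rmodI; unfold zero car)
      (auto simp: add smult F.M.a_ac F.rmod_ldistr F.rmod_rdistr F.rmod_assoc)
  show ln: "lin F ?Q (\<lambda>x. N +>\<^bsub>F\<^esub> x)"
    by (auto simp: lin_def car add smult)
  show "gmodule G ?Q"
    by (rule gmoduleI[OF F.G.group_axioms rm])
      (auto simp: lin_def car add smult ac F.act_closed F.act_add F.act_smult F.act_one F.act_mult)
qed

lemma gmodule_quotient_lift:
  fixes F :: "('r::comm_ring_1, 'g, 'm) gmod"
  assumes F: "gmodule G F" and N: "gsubmodule G N F" and Y: "rmod Y" and h: "lin F Y h"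
    and h0: "\<And>n. n \<in> N \<Longrightarrow> h n = \<zero>\<^bsub>Y\<^esub>"
  obtains f where "lin (quotient_gmod F N) Y f" "\<And>x. x \<in> carrier F \<Longrightarrow> f (N +>\<^bsub>F\<^esub> x) = h x"
proof -
  let ?Q = "quotient_gmod F N"
  note Q = gmodule_quotient[OF F N]
  interpret F: rmod F using F by (rule gmodule_rmod)
  interpret Y: rmod Y by fact
  have NF: "N \<subseteq> carrier F" using N submodule_subset by (auto simp: gsubmodule_def)
  \<comment> \<open>The value at a chosen representative. Two representatives differ by an element
    of \<open>N\<close>, which \<open>h\<close> kills.\<close>
  define f where "f C = h (SOME x. x \<in> carrier F \<and> C = N +>\<^bsub>F\<^esub> x)" for C
  have f: "f (N +>\<^bsub>F\<^esub> x) = h x" if "x \<in> carrier F" for x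
  proof -
    define y where "y = (SOME y. y \<in> carrier F \<and> N +>\<^bsub>F\<^esub> x = N +>\<^bsub>F\<^esub> y)"
    have y: "y \<in> carrier F \<and> N +>\<^bsub>F\<^esub> x = N +>\<^bsub>F\<^esub> y"
      unfolding y_def by (rule someI[of _ x]) (use that in simp)
    then have "\<exists>n\<in>N. x = n \<oplus>\<^bsub>F\<^esub> y" using Q(6)[OF that, of y] by blast
    then obtain n where "n \<in> N" "x = n \<oplus>\<^bsub>F\<^esub> y" by blast
    then have "h x = h y" using h0 conjunct1[OF y] NF lin_add[OF h, of n y] lin_closed[OF h, of y] by auto
    then show ?thesis unfolding f_def y_def[symmetric] by simp
  qed
  have "lin ?Q Y f"
    using lin_closed[OF h] lin_add[OF h] lin_smult[OF h] lin_add[OF Q(2), symmetric] lin_smult[OF Q(2), symmetric]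
    by (auto simp: lin_def Q(3) f)
  then show ?thesis using f that by blast
qed

subsection \<open>Free modules and presentations\<close>

lemma poly_mapping_span_induct [consumes 1, case_names zero single add]:
  fixes f :: "'s \<Rightarrow>\<^sub>0 'r::comm_ring_1"
  assumes "Poly_Mapping.keys f \<subseteq> S" "P 0"
    and "\<And>s a. s \<in> S \<Longrightarrow> P (Poly_Mapping.single s a)"
    and "\<And>f g. Poly_Mapping.keys f \<subseteq> S \<Longrightarrow> Poly_Mapping.keys g \<subseteq> S \<Longrightarrow> P f \<Longrightarrow> P g \<Longrightarrow> P (f + g)"
  shows "P f"
proof -
  have "P (\<Sum>s\<in>A. Poly_Mapping.single s (Poly_Mapping.lookup f s)) \<and>
      Poly_Mapping.keys (\<Sum>s\<in>A. Poly_Mapping.single s (Poly_Mapping.lookup f s)) \<subseteq> S"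
    if "finite A" "A \<subseteq> S" for A
    using that
  proof (induction A rule: finite_induct)
    case (insert s A)
    then show ?case
      using assms(3,4) Poly_Mapping.keys_add[of "Poly_Mapping.single s (Poly_Mapping.lookup f s)"
          "\<Sum>s\<in>A. Poly_Mapping.single s (Poly_Mapping.lookup f s)"]
      by (auto split: if_splits simp: subset_iff)
  qed (use assms(2) in simp)
  moreover have "f = (\<Sum>s\<in>Poly_Mapping.keys f. Poly_Mapping.single s (Poly_Mapping.lookup f s))"
    by (rule poly_mapping_eqI) (auto simp: lookup_sum lookup_single when_def in_keys_iff)
  ultimately show ?thesis using assms(1) by (metis finite_keys)
qed

lemma free_gmod_simps [simp]:
  "carrier (free_gmod S \<alpha>) = {f. Poly_Mapping.keys f \<subseteq> S}" "\<zero>\<^bsub>free_gmod S \<alpha>\<^esub> = 0"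
  "f \<oplus>\<^bsub>free_gmod S \<alpha>\<^esub> g = f + g" "a \<odot>\<^bsub>free_gmod S \<alpha>\<^esub> f = Poly_Mapping.map ((*) a) f"
  by (simp_all add: free_gmod_def)

lemma lookup_map_mult [simp]: "Poly_Mapping.lookup (Poly_Mapping.map ((*) a) f) k = a * Poly_Mapping.lookup f (k::'k)"
  for a :: "'r::comm_ring_1"
  by (simp add: map.rep_eq when_def)

lemma keys_map_mult: "Poly_Mapping.keys (Poly_Mapping.map ((*) a) f) \<subseteq> Poly_Mapping.keys f"
  for a :: "'r::comm_ring_1"
  by (auto simp: in_keys_iff)

lemma rmod_free: "rmod (free_gmod S \<alpha> :: ('r::comm_ring_1, 'g, 's \<Rightarrow>\<^sub>0 'r) gmod)"
proof -
  have "Poly_Mapping.keys (f + g) \<subseteq> S" if "Poly_Mapping.keys f \<subseteq> S" "Poly_Mapping.keys g \<subseteq> S" for f g :: "'s \<Rightarrow>\<^sub>0 'r"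
    using Poly_Mapping.keys_add[of f g] that by blast
  moreover have "Poly_Mapping.keys (Poly_Mapping.map ((*) a) f) \<subseteq> S" if "Poly_Mapping.keys f \<subseteq> S" for a :: 'r and f
    using keys_map_mult[of a f] that by blast
  ultimately show ?thesis
    by (intro rmodI) (auto intro!: poly_mapping_eqI simp: lookup_add algebra_simps)
qed

text \<open>The linear extension of \<open>h\<close> from basis elements, that is, the universal
  property of the free module.\<close>

definition lext :: "('r::comm_ring_1, 'm, 'x) module_scheme \<Rightarrow> ('s \<Rightarrow> 'm) \<Rightarrow> ('s \<Rightarrow>\<^sub>0 'r) \<Rightarrow> 'm" where
  "lext Y h f = (\<Oplus>\<^bsub>Y\<^esub>s\<in>Poly_Mapping.keys f. Poly_Mapping.lookup f s \<odot>\<^bsub>Y\<^esub> h s)"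

lemma lext_superset:
  assumes "rmod Y" "h \<in> A \<rightarrow> carrier Y" "finite A" "Poly_Mapping.keys f \<subseteq> A"
  shows "lext Y h f = (\<Oplus>\<^bsub>Y\<^esub>s\<in>A. Poly_Mapping.lookup f s \<odot>\<^bsub>Y\<^esub> h s)"
proof -
  interpret Y: rmod Y by fact
  show ?thesis unfolding lext_def using assms
    by (intro Y.M.add.finprod_mono_neutral_cong_left) (auto simp: in_keys_iff Pi_def)
qed

lemma lext_single:
  assumes "rmod Y" "h s \<in> carrier Y" shows "lext Y h (Poly_Mapping.single s a) = a \<odot>\<^bsub>Y\<^esub> h s"
proof -
  interpret Y: rmod Y by fact
  show ?thesis using assms lext_superset[of Y h "{s}" "Poly_Mapping.single s a"] by simp
qed

lemma lext_lin:
  fixes Y :: "('r::comm_ring_1, 'm, 'x) module_scheme"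
  assumes "rmod Y" "h \<in> S \<rightarrow> carrier Y"
  shows "lin (free_gmod S \<alpha> :: ('r, 'g, 's \<Rightarrow>\<^sub>0 'r) gmod) Y (lext Y h)"
proof -
  interpret Y: rmod Y by fact
  have cl: "lext Y h f \<in> carrier Y" if "Poly_Mapping.keys f \<subseteq> S" for f
    unfolding lext_def using that assms(2) by (intro Y.M.finsum_closed) (auto simp: subset_iff Pi_iff)
  have "lext Y h (f + g) = lext Y h f \<oplus>\<^bsub>Y\<^esub> lext Y h g"
    if "Poly_Mapping.keys f \<subseteq> S" "Poly_Mapping.keys g \<subseteq> S" for f g :: "'s \<Rightarrow>\<^sub>0 'r"
  proof -
    let ?A = "Poly_Mapping.keys f \<union> Poly_Mapping.keys g"
    have A: "finite ?A" "h \<in> ?A \<rightarrow> carrier Y" using that assms(2) by auto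
    show ?thesis
      using A Poly_Mapping.keys_add[of f g]
      by (subst (1 2 3) lext_superset[OF assms(1) A(2,1)])
        (auto simp: lookup_add Y.rmod_ldistr Pi_def simp flip: Y.M.finsum_addf intro!: Y.M.finsum_cong')
  qed
  moreover have "lext Y h (Poly_Mapping.map ((*) a) f) = a \<odot>\<^bsub>Y\<^esub> lext Y h f"
    if "Poly_Mapping.keys f \<subseteq> S" for a f
  proof -
    have "h \<in> Poly_Mapping.keys f \<rightarrow> carrier Y" using that assms(2) by auto
    then show ?thesis
      using keys_map_mult[of a f]
      by (subst (1 2) lext_superset[OF assms(1), where A = "Poly_Mapping.keys f"])
        (auto simp: Y.rmod_assoc Y.rmod_finsum_smult Pi_def intro!: Y.M.finsum_cong')
  qed
  ultimately show ?thesis using cl by (simp add: lin_def)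
qed

lemma smult_single [simp]: "Poly_Mapping.map ((*) a) (Poly_Mapping.single t b) = Poly_Mapping.single t (a * b)"
  for a :: "'r::comm_ring_1"
  by (rule poly_mapping_eqI) (simp add: lookup_single when_def)

text \<open>The target is the free module on all of \<open>'s\<close>, so that linearity of the
  action is available before \<alpha> is known to preserve \<open>S\<close>.\<close>

lemma act_free:
  fixes f :: "'s \<Rightarrow>\<^sub>0 'r::comm_ring_1"
  shows "act (free_gmod S \<alpha> :: ('r, 'g, 's \<Rightarrow>\<^sub>0 'r) gmod) g f =
    lext (free_gmod UNIV \<alpha> :: ('r, 'g, 's \<Rightarrow>\<^sub>0 'r) gmod) (\<lambda>s. Poly_Mapping.single (\<alpha> g s) 1) f"
proof -
  let ?U = "free_gmod UNIV \<alpha> :: ('r, 'g, 's \<Rightarrow>\<^sub>0 'r) gmod"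
  interpret rmod ?U by (rule rmod_free)
  have "finsum ?U h A = sum h A" if "finite A" for h and A :: "'s set"
    using that by (induction A rule: finite_induct) auto
  then show ?thesis by (simp add: lext_def free_gmod_def[of S])
qed

text \<open>The relations of all three presentations have one of two shapes: \<open>s = a t\<close>,
  which is \<open>rel2\<close>, and \<open>s = t + u\<close>, which is \<open>rel3\<close>. The
  group takes a relation to one of the same shape by moving its generators.\<close>

definition rel2 :: "'s \<Rightarrow> 's \<Rightarrow> 'r \<Rightarrow> 's \<Rightarrow>\<^sub>0 'r::comm_ring_1" where
  "rel2 s t a = Poly_Mapping.single s 1 - Poly_Mapping.single t a"

definition rel3 :: "'s \<Rightarrow> 's \<Rightarrow> 's \<Rightarrow> 's \<Rightarrow>\<^sub>0 'r::comm_ring_1" where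
  "rel3 s t u = Poly_Mapping.single s 1 - Poly_Mapping.single t 1 - Poly_Mapping.single u 1"

lemma keys_rel2: "k \<in> Poly_Mapping.keys (rel2 s t a) \<Longrightarrow> k = s \<or> k = t"
  using keys_diff[of "Poly_Mapping.single s 1" "Poly_Mapping.single t a"]
  by (auto simp: rel2_def split: if_splits)

lemma keys_rel3: "k \<in> Poly_Mapping.keys (rel3 s t u :: 's \<Rightarrow>\<^sub>0 'r::comm_ring_1) \<Longrightarrow> k = s \<or> k = t \<or> k = u"
  using keys_diff[of "Poly_Mapping.single s (1::'r) - Poly_Mapping.single t 1" "Poly_Mapping.single u 1"]
    keys_diff[of "Poly_Mapping.single s (1::'r)" "Poly_Mapping.single t 1"]
  by (auto simp: rel3_def)

lemma act_free_lin:
  "lin (free_gmod UNIV \<alpha> :: ('r::comm_ring_1, 'g, 's \<Rightarrow>\<^sub>0 'r) gmod) (free_gmod UNIV \<alpha> :: ('r, 'g, 's \<Rightarrow>\<^sub>0 'r) gmod)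
    (act (free_gmod S \<alpha> :: ('r, 'g, 's \<Rightarrow>\<^sub>0 'r) gmod) g)"
  unfolding act_free[abs_def] by (rule lext_lin[OF rmod_free]) simp

lemma act_free_add:
  "act (free_gmod S \<alpha>) g (f + f') = act (free_gmod S \<alpha>) g f + act (free_gmod S \<alpha>) g f'"
  and act_free_smult:
  "act (free_gmod S \<alpha>) g (Poly_Mapping.map ((*) a) f) = Poly_Mapping.map ((*) a) (act (free_gmod S \<alpha>) g f)"
  for f f' :: "'s \<Rightarrow>\<^sub>0 'r::comm_ring_1"
  using lin_add[OF act_free_lin[of \<alpha> S g], of f f'] lin_smult[OF act_free_lin[of \<alpha> S g], of f a] by simp_all

lemma act_free_single:
  "act (free_gmod S \<alpha>) g (Poly_Mapping.single s a) = Poly_Mapping.single (\<alpha> g s) (a :: 'r::comm_ring_1)"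
  by (simp add: act_free lext_single[OF rmod_free])

lemma act_free_zero: "act (free_gmod S \<alpha>) g 0 = 0"
  by (simp add: free_gmod_def)

lemma act_free_diff:
  "act (free_gmod S \<alpha>) g (f - f') = act (free_gmod S \<alpha>) g f - act (free_gmod S \<alpha>) g f'"
  for f f' :: "'s \<Rightarrow>\<^sub>0 'r::comm_ring_1"
  using act_free_add[of S \<alpha> g "f - f'" f'] by (simp add: algebra_simps)

lemma act_rel2: "act (free_gmod S \<alpha>) g (rel2 s t a) = rel2 (\<alpha> g s) (\<alpha> g t) a"
  and act_rel3: "act (free_gmod S \<alpha>) g (rel3 s t u) = rel3 (\<alpha> g s) (\<alpha> g t) (\<alpha> g u)"
  by (simp_all add: rel2_def rel3_def act_free_diff act_free_single)

text \<open>Scalar extension, tensor product and induction are instances. The generators satisfy the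
  relations and are permuted by the group, and maps out of the presented module are governed by
  \<open>gen_lin_eqI\<close> and \<open>gen_lift\<close>; with these at hand the cosets can be
  forgotten.\<close>

locale presentation =
  fixes G :: "('g, 'z) monoid_scheme" and S :: "'s set" and \<alpha> :: "'g \<Rightarrow> 's \<Rightarrow> 's"
    and E :: "('s \<Rightarrow>\<^sub>0 'r::comm_ring_1) set"
  assumes group: "group G"
    and closed: "\<And>g s. g \<in> carrier G \<Longrightarrow> s \<in> S \<Longrightarrow> \<alpha> g s \<in> S"
    and unit: "\<And>s. s \<in> S \<Longrightarrow> \<alpha> \<one>\<^bsub>G\<^esub> s = s"
    and mult: "\<And>g h s. g \<in> carrier G \<Longrightarrow> h \<in> carrier G \<Longrightarrow> s \<in> S \<Longrightarrow> \<alpha> (g \<otimes>\<^bsub>G\<^esub> h) s = \<alpha> g (\<alpha> h s)"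
    and rel_keys: "\<And>e. e \<in> E \<Longrightarrow> Poly_Mapping.keys e \<subseteq> S"
    and rel_stable: "\<And>g e. g \<in> carrier G \<Longrightarrow> e \<in> E \<Longrightarrow> act (free_gmod S \<alpha> :: ('r, 'g, 's \<Rightarrow>\<^sub>0 'r) gmod) g e \<in> E"
begin

abbreviation "FF \<equiv> free_gmod S \<alpha> :: ('r, 'g, 's \<Rightarrow>\<^sub>0 'r) gmod"
abbreviation "PP \<equiv> presented_gmod S \<alpha> E :: ('r, 'g, ('s \<Rightarrow>\<^sub>0 'r) set) gmod"

definition "NN = (\<lambda>N. submodule N (ring_of_type_algebra :: 'r ring) FF) hull E"

definition "gen s = NN +>\<^bsub>FF\<^esub> Poly_Mapping.single s (1::'r)"

lemma gmodule_free: "gmodule G FF"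
proof (rule gmoduleI[OF group rmod_free])
  have keys: "Poly_Mapping.keys (act FF g f) \<subseteq> S" if "Poly_Mapping.keys f \<subseteq> S" "g \<in> carrier G" for g f
    using that(1)
  proof (induction f rule: poly_mapping_span_induct)
    case (add f h)
    then show ?case using Poly_Mapping.keys_add[of "act FF g f" "act FF g h"] by (auto simp: act_free_add)
  qed (auto simp: act_free_zero act_free_single closed that(2) split: if_splits)
  then show "lin FF FF (act FF g)" if "g \<in> carrier G" for g
    using that by (simp add: lin_def act_free_add act_free_smult)
  have "act FF \<one>\<^bsub>G\<^esub> f = f" if "Poly_Mapping.keys f \<subseteq> S" for f
    using that
    by (induction f rule: poly_mapping_span_induct) (auto simp: act_free_zero act_free_single act_free_add unit)
  then show "act FF \<one>\<^bsub>G\<^esub> f = f" if "f \<in> carrier FF" for f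
    using that by simp
  have "act FF (g \<otimes>\<^bsub>G\<^esub> h) f = act FF g (act FF h f)"
    if "g \<in> carrier G" "h \<in> carrier G" "Poly_Mapping.keys f \<subseteq> S" for g h f
    using that(3)
    by (induction f rule: poly_mapping_span_induct)
      (auto simp: act_free_zero act_free_single act_free_add mult that)
  then show "act FF (g \<otimes>\<^bsub>G\<^esub> h) f = act FF g (act FF h f)"
    if "g \<in> carrier G" "h \<in> carrier G" "f \<in> carrier FF" for g h f
    using that by simp
qed

lemma submodule_NN: "submodule NN rta FF"
proof -
  interpret F: rmod FF by (rule rmod_free)
  \<comment> \<open>The elements supported on \<open>S\<close> form a submodule containing
    \<open>E\<close>, so the family intersected by \<open>hull\<close> is nonempty and its
    intersection lies in the carrier.\<close>
  have sub: "submodule {f. Poly_Mapping.keys f \<subseteq> S} rta FF"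
    using F.M.zero_closed F.M.a_closed F.rmod_smult by (intro F.rmod_submoduleI) auto
  define T where "T = {t. submodule t rta FF \<and> E \<subseteq> t}"
  have NN: "NN = \<Inter>T" by (simp add: NN_def hull_def T_def)
  have mem: "{f. Poly_Mapping.keys f \<subseteq> S} \<in> T" using sub rel_keys by (auto simp: T_def)
  have T: "\<zero>\<^bsub>FF\<^esub> \<in> t" "\<And>x y. x \<in> t \<Longrightarrow> y \<in> t \<Longrightarrow> x \<oplus>\<^bsub>FF\<^esub> y \<in> t"
    "\<And>a x. x \<in> t \<Longrightarrow> a \<odot>\<^bsub>FF\<^esub> x \<in> t" if "t \<in> T" for t
  proof -
    have "submodule t rta FF" using that by (simp add: T_def)
    then interpret t: submodule t rta FF .
    show "\<zero>\<^bsub>FF\<^esub> \<in> t" "\<And>x y. x \<in> t \<Longrightarrow> y \<in> t \<Longrightarrow> x \<oplus>\<^bsub>FF\<^esub> y \<in> t" "\<And>a x. x \<in> t \<Longrightarrow> a \<odot>\<^bsub>FF\<^esub> x \<in> t"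
      using t.one_closed t.m_closed t.smult_closed by auto
  qed
  show ?thesis unfolding NN
  proof (rule F.rmod_submoduleI)
    show "\<Inter>T \<subseteq> carrier FF" using mem by auto
    show "\<zero>\<^bsub>FF\<^esub> \<in> \<Inter>T" using T(1) by blast
    show "x \<oplus>\<^bsub>FF\<^esub> y \<in> \<Inter>T" if "x \<in> \<Inter>T" "y \<in> \<Inter>T" for x y using that T(2) by blast
    show "a \<odot>\<^bsub>FF\<^esub> x \<in> \<Inter>T" if "x \<in> \<Inter>T" for a x using that T(3) by blast
  qed
qed

text \<open>The kernel of \<open>h\<close> is a submodule that contains \<open>E\<close>, and
  \<open>NN\<close> is the least one.\<close>

lemma NN_minimal:
  assumes "\<And>e. e \<in> E \<Longrightarrow> h e = \<zero>\<^bsub>Y\<^esub>" "rmod Y" "lin FF Y h" "f \<in> NN"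
  shows "h f = \<zero>\<^bsub>Y\<^esub>"
proof -
  interpret F: rmod FF by (rule rmod_free)
  interpret Y: rmod Y by fact
  have "submodule {f \<in> carrier FF. h f = \<zero>\<^bsub>Y\<^esub>} rta FF"
    using F.M.zero_closed F.M.a_closed F.rmod_smult lin_zero[OF F.rmod_axioms assms(2,3)]
      lin_add[OF assms(3)] lin_smult[OF assms(3)]
    by (intro F.rmod_submoduleI) auto
  moreover have "E \<subseteq> {f \<in> carrier FF. h f = \<zero>\<^bsub>Y\<^esub>}" using assms(1) rel_keys by auto
  ultimately have "NN \<subseteq> {f \<in> carrier FF. h f = \<zero>\<^bsub>Y\<^esub>}"
    unfolding NN_def by (intro hull_minimal)
  then show ?thesis using assms(4) by blast
qed

text \<open>For fixed \<open>g\<close> the elements that \<open>g\<close> maps into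
  \<open>NN\<close> form a submodule containing \<open>E\<close>, hence containing
  \<open>NN\<close>.\<close>

lemma gsubmodule_NN: "gsubmodule G NN FF"
  unfolding gsubmodule_def
proof (intro conjI ballI)
  show "submodule NN rta FF" by (rule submodule_NN)
  fix g f assume g: "g \<in> carrier G" and f: "f \<in> NN"
  interpret F: rmod FF by (rule rmod_free)
  have lact: "lin FF FF (act FF g)" by (rule act_lin[OF gmodule_free g])
  interpret N: submodule NN rta FF by (rule submodule_NN)
  have "submodule {f \<in> carrier FF. act FF g f \<in> NN} rta FF"
    using F.M.zero_closed F.M.a_closed F.rmod_smult lin_zero[OF F.rmod_axioms F.rmod_axioms lact]
      lin_add[OF lact] lin_smult[OF lact] N.m_closed N.one_closed N.smult_closed
    by (intro F.rmod_submoduleI) auto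
  moreover have "E \<subseteq> {f \<in> carrier FF. act FF g f \<in> NN}"
    using rel_keys rel_stable[OF g] unfolding NN_def by (auto intro: hull_inc)
  ultimately have "NN \<subseteq> {f \<in> carrier FF. act FF g f \<in> NN}"
    unfolding NN_def by (intro hull_minimal)
  then show "act FF g f \<in> NN" using f by blast
qed

lemma PP_eq: "PP = quotient_gmod FF NN"
  by (simp add: presented_gmod_def NN_def)

lemmas quotient = gmodule_quotient[OF gmodule_free gsubmodule_NN, folded PP_eq]

lemma gmodule_PP: "gmodule G PP"
  by (rule quotient(1))

lemma gen_closed: "s \<in> S \<Longrightarrow> gen s \<in> carrier PP"
  using lin_closed[OF quotient(2)] by (simp add: gen_def)

lemma act_gen: "g \<in> carrier G \<Longrightarrow> s \<in> S \<Longrightarrow> act PP g (gen s) = gen (\<alpha> g s)"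
  by (simp add: gen_def quotient(4) act_free_single)

lemma cls_single: "s \<in> S \<Longrightarrow> NN +>\<^bsub>FF\<^esub> Poly_Mapping.single s a = a \<odot>\<^bsub>PP\<^esub> gen s"
  using lin_smult[OF quotient(2), of "Poly_Mapping.single s 1" a] by (simp add: gen_def)

lemma cls_diff:
  assumes "Poly_Mapping.keys f \<subseteq> S" "Poly_Mapping.keys h \<subseteq> S"
  shows "NN +>\<^bsub>FF\<^esub> (f - h) = (NN +>\<^bsub>FF\<^esub> f) \<oplus>\<^bsub>PP\<^esub> (- 1) \<odot>\<^bsub>PP\<^esub> (NN +>\<^bsub>FF\<^esub> h)"
proof -
  have eq: "f - h = f + Poly_Mapping.map ((*) (-1)) h"
    by (rule poly_mapping_eqI) (simp add: lookup_add lookup_minus)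
  have "Poly_Mapping.keys (Poly_Mapping.map ((*) (-1)) h) \<subseteq> S"
    using keys_map_mult[of "-1" h] assms by blast
  then show ?thesis
    unfolding eq using assms lin_add[OF quotient(2), of f "Poly_Mapping.map ((*) (-1)) h"] lin_smult[OF quotient(2), of h "-1"]
    by simp
qed

lemma cls_rel: "e \<in> E \<Longrightarrow> NN +>\<^bsub>FF\<^esub> e = \<zero>\<^bsub>PP\<^esub>"
  using quotient(5)[of e] hull_subset[of E] by (auto simp: NN_def)

lemma keys_diff_subset:
  "Poly_Mapping.keys f \<subseteq> S \<Longrightarrow> Poly_Mapping.keys (h :: 's \<Rightarrow>\<^sub>0 'r) \<subseteq> S \<Longrightarrow> Poly_Mapping.keys (f - h) \<subseteq> S"
  using keys_diff[of f h] by blast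

lemma gen_rel2:
  assumes "rel2 s t a \<in> E" "s \<in> S" "t \<in> S"
  shows "gen s = a \<odot>\<^bsub>PP\<^esub> gen t"
proof -
  interpret P: rmod PP using gmodule_PP by (rule gmodule_rmod)
  have "(NN +>\<^bsub>FF\<^esub> Poly_Mapping.single s 1) \<oplus>\<^bsub>PP\<^esub> (- 1) \<odot>\<^bsub>PP\<^esub> (NN +>\<^bsub>FF\<^esub> Poly_Mapping.single t a) = \<zero>\<^bsub>PP\<^esub>"
    using cls_rel[OF assms(1)] assms(2,3) unfolding rel2_def by (subst (asm) cls_diff) auto
  then show ?thesis
    using rmod_eq_iff[OF P.rmod_axioms] gen_closed assms by (simp add: cls_single)
qed

lemma gen_rel3:
  assumes "rel3 s t u \<in> E" "s \<in> S" "t \<in> S" "u \<in> S"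
  shows "gen s = gen t \<oplus>\<^bsub>PP\<^esub> gen u"
proof -
  interpret P: rmod PP using gmodule_PP by (rule gmodule_rmod)
  have "(NN +>\<^bsub>FF\<^esub> Poly_Mapping.single s 1) \<oplus>\<^bsub>PP\<^esub> (- 1) \<odot>\<^bsub>PP\<^esub> (NN +>\<^bsub>FF\<^esub> Poly_Mapping.single t 1)
      \<oplus>\<^bsub>PP\<^esub> (- 1) \<odot>\<^bsub>PP\<^esub> (NN +>\<^bsub>FF\<^esub> Poly_Mapping.single u 1) = \<zero>\<^bsub>PP\<^esub>"
    using cls_rel[OF assms(1)] assms(2-) keys_diff_subset
    by (simp add: cls_diff rel3_def)
  then show ?thesis
    using rmod_eq_iff3[OF P.rmod_axioms] gen_closed assms by (simp add: cls_single)
qed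

text \<open>The uniqueness half of the universal property, by induction over the expansion of a
  representative in basis elements.\<close>

lemma gen_lin_eqI:
  assumes "rmod Y" "lin PP Y f" "lin PP Y h" "\<And>s. s \<in> S \<Longrightarrow> f (gen s) = h (gen s)" "x \<in> carrier PP"
  shows "f x = h x"
proof -
  interpret P: rmod PP using gmodule_PP by (rule gmodule_rmod)
  obtain u where u: "Poly_Mapping.keys u \<subseteq> S" "x = NN +>\<^bsub>FF\<^esub> u" using assms(5) quotient(3) by auto
  have cl: "NN +>\<^bsub>FF\<^esub> v \<in> carrier PP" if "Poly_Mapping.keys v \<subseteq> S" for v
    using that quotient(3) by auto
  from u(1) have "f (NN +>\<^bsub>FF\<^esub> u) = h (NN +>\<^bsub>FF\<^esub> u)"
  proof (induction u rule: poly_mapping_span_induct)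
    case zero
    have "NN +>\<^bsub>FF\<^esub> 0 = \<zero>\<^bsub>PP\<^esub>" using lin_zero[OF rmod_free P.rmod_axioms quotient(2)] by simp
    then show ?case using lin_zero[OF P.rmod_axioms assms(1)] assms(2,3) by metis
  next
    case (single s a)
    then show ?case
      using assms(4) gen_closed by (simp add: cls_single lin_smult[OF assms(2)] lin_smult[OF assms(3)])
  next
    case (add v w)
    then show ?case
      using lin_add[OF quotient(2), of v w] cl
      by (simp add: lin_add[OF assms(2)] lin_add[OF assms(3)])
  qed
  then show ?thesis using u by simp
qed

lemma lext_diff:
  fixes Y :: "('r, 'm, 'x) module_scheme"
  assumes "rmod Y" "h \<in> S \<rightarrow> carrier Y" "Poly_Mapping.keys u \<subseteq> S" "Poly_Mapping.keys v \<subseteq> S"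
  shows "lext Y h (u - v) = lext Y h u \<oplus>\<^bsub>Y\<^esub> (- 1) \<odot>\<^bsub>Y\<^esub> lext Y h v"
proof -
  have lin: "lin FF Y (lext Y h)" using lext_lin[OF assms(1,2)] .
  have eq: "u - v = u + Poly_Mapping.map ((*) (-1)) v"
    by (rule poly_mapping_eqI) (simp add: lookup_add lookup_minus)
  have "Poly_Mapping.keys (Poly_Mapping.map ((*) (-1)) v) \<subseteq> S"
    using keys_map_mult[of "-1" v] assms by blast
  then show ?thesis
    unfolding eq using assms lin_add[OF lin, of u "Poly_Mapping.map ((*) (-1)) v"] lin_smult[OF lin, of v "-1"] by simp
qed

lemma lext_rel2:
  fixes Y :: "('r, 'm, 'x) module_scheme"
  assumes "rmod Y" "h \<in> S \<rightarrow> carrier Y" "s \<in> S" "t \<in> S" "h s = a \<odot>\<^bsub>Y\<^esub> h t"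
  shows "lext Y h (rel2 s t a) = \<zero>\<^bsub>Y\<^esub>"
proof -
  interpret Y: rmod Y by fact
  show ?thesis using assms rmod_eq_iff[OF assms(1), of "h s" "h s"]
    by (auto simp: rel2_def lext_diff lext_single Pi_def)
qed

lemma lext_rel3:
  fixes Y :: "('r, 'm, 'x) module_scheme"
  assumes "rmod Y" "h \<in> S \<rightarrow> carrier Y" "s \<in> S" "t \<in> S" "u \<in> S" "h s = h t \<oplus>\<^bsub>Y\<^esub> h u"
  shows "lext Y h (rel3 s t u) = \<zero>\<^bsub>Y\<^esub>"
proof -
  interpret Y: rmod Y by fact
  have cl: "h s \<in> carrier Y" "h t \<in> carrier Y" "h u \<in> carrier Y" using assms by auto
  then have "h s \<oplus>\<^bsub>Y\<^esub> (- 1) \<odot>\<^bsub>Y\<^esub> h t \<oplus>\<^bsub>Y\<^esub> (- 1) \<odot>\<^bsub>Y\<^esub> h u = \<zero>\<^bsub>Y\<^esub>"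
    using assms(6) rmod_eq_iff3[OF assms(1)] by blast
  then show ?thesis using cl assms(1-5) keys_diff_subset
    by (simp add: rel3_def lext_diff lext_single)
qed

text \<open>The existence half of the universal property: the linear extension of \<open>h\<close>
  kills \<open>E\<close>, hence \<open>NN\<close>, and descends to the quotient.\<close>

lemma gen_lift:
  assumes "rmod Y" "h \<in> S \<rightarrow> carrier Y" "\<And>e. e \<in> E \<Longrightarrow> lext Y h e = \<zero>\<^bsub>Y\<^esub>"
  obtains f where "lin PP Y f" "\<And>s. s \<in> S \<Longrightarrow> f (gen s) = h s"
proof -
  have lin: "lin FF Y (lext Y h)" using lext_lin[OF assms(1,2)] .
  interpret Y: rmod Y by fact
  obtain f where f: "lin PP Y f" "\<And>x. x \<in> carrier FF \<Longrightarrow> f (NN +>\<^bsub>FF\<^esub> x) = lext Y h x"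
    using gmodule_quotient_lift[OF gmodule_free gsubmodule_NN assms(1) lin] NN_minimal[OF assms(3) assms(1) lin]
    unfolding PP_eq by metis
  have "f (gen s) = h s" if "s \<in> S" for s
    using that f(2)[of "Poly_Mapping.single s 1"] assms(1,2) by (auto simp: gen_def lext_single Pi_def)
  with f show ?thesis using that by blast
qed

end

subsection \<open>Extension of scalars and tensor products\<close>

definition extend_rel :: "('r \<Rightarrow> 's::comm_ring_1) \<Rightarrow> ('r::comm_ring_1, 'g, 'm) gmod \<Rightarrow> ('m \<Rightarrow>\<^sub>0 's) set" where
  "extend_rel \<phi> M = {rel3 (x \<oplus>\<^bsub>M\<^esub> y) x y | x y. x \<in> carrier M \<and> y \<in> carrier M} \<union>
     {rel2 (a \<odot>\<^bsub>M\<^esub> x) x (\<phi> a) | a x. x \<in> carrier M}"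

lemma gmod_extend_eq: "gmod_extend \<phi> M = presented_gmod (carrier M) (act M) (extend_rel \<phi> M)"
  by (simp add: gmod_extend_def extend_rel_def Let_def rel2_def rel3_def)

lemma extend_relI:
  "x \<in> carrier M \<Longrightarrow> y \<in> carrier M \<Longrightarrow> rel3 (x \<oplus>\<^bsub>M\<^esub> y) x y \<in> extend_rel \<phi> M"
  "x \<in> carrier M \<Longrightarrow> rel2 (a \<odot>\<^bsub>M\<^esub> x) x (\<phi> a) \<in> extend_rel \<phi> M"
  by (auto simp: extend_rel_def)

lemma extend_relE:
  assumes "e \<in> extend_rel \<phi> M"
  obtains x y where "e = rel3 (x \<oplus>\<^bsub>M\<^esub> y) x y" "x \<in> carrier M" "y \<in> carrier M"
  | a x where "e = rel2 (a \<odot>\<^bsub>M\<^esub> x) x (\<phi> a)" "x \<in> carrier M"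
  using assms by (auto simp: extend_rel_def)

lemma presentation_extend:
  assumes "gmodule G M"
  shows "presentation G (carrier M) (act M) (extend_rel \<phi> M)"
proof -
  interpret M: gmodule G M by fact
  interpret M: rmod M using assms by (rule gmodule_rmod)
  show ?thesis
  proof
    show "Poly_Mapping.keys e \<subseteq> carrier M" if "e \<in> extend_rel \<phi> M" for e
      using that by (cases rule: extend_relE) (auto dest!: keys_rel2 keys_rel3)
    show "act (free_gmod (carrier M) (act M)) g e \<in> extend_rel \<phi> M"
      if "g \<in> carrier G" "e \<in> extend_rel \<phi> M" for g e
      using that(2)
      by (cases rule: extend_relE)
        (use that(1) in \<open>auto simp: act_rel2 act_rel3 M.act_add M.act_smult M.act_closed intro!: extend_relI\<close>)
  qed (use M.act_closed M.act_one M.act_mult in auto)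
qed

text \<open>The generators \<open>1 \<otimes> b\<close> over an O-basis form a basis of the extended
  module, since the coordinate functionals extend to it, and so the matrices of \<open>g\<close>
  agree. This replaces characters over the fraction field by traces over O.\<close>

lemma lattice_character_eq:
  fixes M :: "('o::idom, 'g, 'm) gmod"
  assumes M: "gmodule G M" and free: "free_of_finite_rank M" and g: "g \<in> carrier G"
  shows "lattice_character M g = to_fract (mod_trace M (act M g))"
proof -
  interpret M: gmodule G M by fact
  interpret M: rmod M using M by (rule gmodule_rmod)
  obtain B c where B: "coords M B (\<lambda>b. b) c" using free_coords[OF M.rmod_axioms free] by blast
  note C = coordsD[OF B]
  interpret pr: presentation G "carrier M" "act M" "extend_rel to_fract M" by (rule presentation_extend[OF M])
  interpret P: rmod pr.PP using pr.gmodule_PP by (rule gmodule_rmod)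
  have gen_add: "pr.gen (x \<oplus>\<^bsub>M\<^esub> y) = pr.gen x \<oplus>\<^bsub>pr.PP\<^esub> pr.gen y" if "x \<in> carrier M" "y \<in> carrier M" for x y
    using that by (intro pr.gen_rel3) (auto intro: extend_relI)
  have gen_smult: "pr.gen (a \<odot>\<^bsub>M\<^esub> x) = to_fract a \<odot>\<^bsub>pr.PP\<^esub> pr.gen x" if "x \<in> carrier M" for x a
    using that by (intro pr.gen_rel2) (auto intro: extend_relI)
  have gen_zero: "pr.gen \<zero>\<^bsub>M\<^esub> = \<zero>\<^bsub>pr.PP\<^esub>"
    using gen_smult[of "\<zero>\<^bsub>M\<^esub>" 0] pr.gen_closed[of "\<zero>\<^bsub>M\<^esub>"] by simp
  have gen_sum: "pr.gen (\<Oplus>\<^bsub>M\<^esub>i\<in>A. a i \<odot>\<^bsub>M\<^esub> i) = (\<Oplus>\<^bsub>pr.PP\<^esub>i\<in>A. to_fract (a i) \<odot>\<^bsub>pr.PP\<^esub> pr.gen i)"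
    if "finite A" "A \<subseteq> carrier M" for A a
    using that
  proof (induction A rule: finite_induct)
    case (insert x A)
    then have "A \<subseteq> carrier M" "x \<in> carrier M" "finite A" "x \<notin> A" by auto
    moreover have "(\<lambda>i. a i \<odot>\<^bsub>M\<^esub> i) \<in> A \<rightarrow> carrier M"
      "(\<lambda>i. to_fract (a i) \<odot>\<^bsub>pr.PP\<^esub> pr.gen i) \<in> A \<rightarrow> carrier pr.PP"
      using \<open>A \<subseteq> carrier M\<close> pr.gen_closed by (auto simp: subset_iff)
    ultimately show ?case
      using insert.IH pr.gen_closed by (simp add: gen_add gen_smult)
  qed (simp add: gen_zero)
  \<comment> \<open>A coordinate functional followed by \<open>to_fract\<close> respects the
    relations and therefore extends; these extensions prove that the generators are
    independent.\<close>
  have "\<exists>f. lin pr.PP scal f \<and> (\<forall>x\<in>carrier M. f (pr.gen x) = to_fract (c i x))" if i: "i \<in> B" for i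
  proof -
    obtain f where "lin pr.PP scal f" "\<And>x. x \<in> carrier M \<Longrightarrow> f (pr.gen x) = to_fract (c i x)"
    proof (rule pr.gen_lift[OF rmod_scal, of "\<lambda>x. to_fract (c i x)"])
      show "lext scal (\<lambda>x. to_fract (c i x)) e = \<zero>\<^bsub>scal\<^esub>" if "e \<in> extend_rel to_fract M" for e
        using that fun_add[OF C(4)[OF i]] fun_smult[OF C(4)[OF i]]
        by (cases rule: extend_relE) (auto simp del: scal_simps(3) intro!: pr.lext_rel2[OF rmod_scal] pr.lext_rel3[OF rmod_scal])
    qed auto
    then show ?thesis by blast
  qed
  then obtain c' where c': "\<And>i. i \<in> B \<Longrightarrow> lin pr.PP scal (c' i)"
    "\<And>i x. i \<in> B \<Longrightarrow> x \<in> carrier M \<Longrightarrow> c' i (pr.gen x) = to_fract (c i x)" by metis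
  have "coords pr.PP B pr.gen c'"
    unfolding coords_def
  proof (intro conjI ballI)
    show "rmod pr.PP" by (rule P.rmod_axioms)
    show "finite B" by (rule C)
    show "pr.gen i \<in> carrier pr.PP" if "i \<in> B" for i using C(3)[OF that] by (rule pr.gen_closed)
    show "c' i (pr.gen j) = (if i = j then 1 else 0)" if "i \<in> B" "j \<in> B" for i j
      using c'(2) C(3,5) that by simp
    show "x = (\<Oplus>\<^bsub>pr.PP\<^esub>i\<in>B. c' i x \<odot>\<^bsub>pr.PP\<^esub> pr.gen i)" if "x \<in> carrier pr.PP" for x
    \<comment> \<open>Both sides are linear, so the expansion need only be checked on
      generators.\<close>
    proof (rule pr.gen_lin_eqI[OF P.rmod_axioms lin_id _ _ that])
      show "lin pr.PP pr.PP (\<lambda>x. \<Oplus>\<^bsub>pr.PP\<^esub>i\<in>B. c' i x \<odot>\<^bsub>pr.PP\<^esub> pr.gen i)"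
      proof (rule lin_sum[OF P.rmod_axioms P.rmod_axioms C(2)])
        fix i assume i: "i \<in> B"
        then have "pr.gen i \<in> carrier pr.PP" using C(3) pr.gen_closed by blast
        then show "lin pr.PP pr.PP (\<lambda>x. c' i x \<odot>\<^bsub>pr.PP\<^esub> pr.gen i)"
          using c'(1)[OF i] by (simp add: lin_def P.rmod_ldistr P.rmod_assoc)
      qed
      fix s assume s: "s \<in> carrier M"
      have "pr.gen s = pr.gen (\<Oplus>\<^bsub>M\<^esub>i\<in>B. c i s \<odot>\<^bsub>M\<^esub> i)" using coords_repr[OF B s] by simp
      also have "\<dots> = (\<Oplus>\<^bsub>pr.PP\<^esub>i\<in>B. to_fract (c i s) \<odot>\<^bsub>pr.PP\<^esub> pr.gen i)"
        using C(2,3) by (intro gen_sum) auto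
      also have "\<dots> = (\<Oplus>\<^bsub>pr.PP\<^esub>i\<in>B. c' i (pr.gen s) \<odot>\<^bsub>pr.PP\<^esub> pr.gen i)"
        using c'(2) s C(3) pr.gen_closed by (intro P.M.finsum_cong') auto
      finally show "pr.gen s = (\<Oplus>\<^bsub>pr.PP\<^esub>i\<in>B. c' i (pr.gen s) \<odot>\<^bsub>pr.PP\<^esub> pr.gen i)" .
    qed
  qed (use c' in auto)
  from mod_trace_coords[OF this act_lin[OF pr.gmodule_PP g]]
  have "mod_trace pr.PP (act pr.PP g) = (\<Sum>i\<in>B. to_fract (c i (act M g i)))"
    using C(3) c'(2) g M.act_closed by (simp add: pr.act_gen)
  then show ?thesis
    unfolding lattice_character_def gmod_character_def gmod_extend_eq
    by (simp add: mod_trace_coords[OF B act_lin[OF M g]] to_fract_sum)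
qed

section \<open>Tensor products\<close>

definition tensor_rel :: "('r::comm_ring_1, 'g, 'm) gmod \<Rightarrow> ('r, 'g, 'n) gmod \<Rightarrow> (('m \<times> 'n) \<Rightarrow>\<^sub>0 'r) set" where
  "tensor_rel M N =
     {rel3 (x \<oplus>\<^bsub>M\<^esub> x', y) (x, y) (x', y) | x x' y. x \<in> carrier M \<and> x' \<in> carrier M \<and> y \<in> carrier N} \<union>
     {rel3 (x, y \<oplus>\<^bsub>N\<^esub> y') (x, y) (x, y') | x y y'. x \<in> carrier M \<and> y \<in> carrier N \<and> y' \<in> carrier N} \<union>
     {rel2 (a \<odot>\<^bsub>M\<^esub> x, y) (x, y) a | a x y. x \<in> carrier M \<and> y \<in> carrier N} \<union>
     {rel2 (x, a \<odot>\<^bsub>N\<^esub> y) (x, y) a | a x y. x \<in> carrier M \<and> y \<in> carrier N}"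

lemma gmod_tensor_eq:
  "gmod_tensor M N = presented_gmod (carrier M \<times> carrier N) (\<lambda>g (x, y). (act M g x, act N g y)) (tensor_rel M N)"
  by (simp add: gmod_tensor_def tensor_rel_def Let_def rel2_def rel3_def)

lemma tensor_relI:
  "x \<in> carrier M \<Longrightarrow> x' \<in> carrier M \<Longrightarrow> y \<in> carrier N \<Longrightarrow> rel3 (x \<oplus>\<^bsub>M\<^esub> x', y) (x, y) (x', y) \<in> tensor_rel M N"
  "x \<in> carrier M \<Longrightarrow> y \<in> carrier N \<Longrightarrow> y' \<in> carrier N \<Longrightarrow> rel3 (x, y \<oplus>\<^bsub>N\<^esub> y') (x, y) (x, y') \<in> tensor_rel M N"
  "x \<in> carrier M \<Longrightarrow> y \<in> carrier N \<Longrightarrow> rel2 (a \<odot>\<^bsub>M\<^esub> x, y) (x, y) a \<in> tensor_rel M N"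
  "x \<in> carrier M \<Longrightarrow> y \<in> carrier N \<Longrightarrow> rel2 (x, a \<odot>\<^bsub>N\<^esub> y) (x, y) a \<in> tensor_rel M N"
  unfolding tensor_rel_def by blast+

lemma tensor_relE:
  assumes "e \<in> tensor_rel M N"
  obtains x x' y where "e = rel3 (x \<oplus>\<^bsub>M\<^esub> x', y) (x, y) (x', y)" "x \<in> carrier M" "x' \<in> carrier M" "y \<in> carrier N"
  | x y y' where "e = rel3 (x, y \<oplus>\<^bsub>N\<^esub> y') (x, y) (x, y')" "x \<in> carrier M" "y \<in> carrier N" "y' \<in> carrier N"
  | a x y where "e = rel2 (a \<odot>\<^bsub>M\<^esub> x, y) (x, y) a" "x \<in> carrier M" "y \<in> carrier N"
  | a x y where "e = rel2 (x, a \<odot>\<^bsub>N\<^esub> y) (x, y) a" "x \<in> carrier M" "y \<in> carrier N"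
  using assms unfolding tensor_rel_def by blast

lemma presentation_tensor:
  assumes "gmodule G M" "gmodule G N"
  shows "presentation G (carrier M \<times> carrier N) (\<lambda>g (x, y). (act M g x, act N g y)) (tensor_rel M N)"
    (is "presentation G ?S ?\<alpha> ?E")
proof -
  interpret M: gmodule G M by fact
  interpret M: rmod M using assms(1) by (rule gmodule_rmod)
  interpret N: gmodule G N by fact
  interpret N: rmod N using assms(2) by (rule gmodule_rmod)
  show ?thesis
  proof
    show "Poly_Mapping.keys e \<subseteq> ?S" if "e \<in> tensor_rel M N" for e
      using that by (cases rule: tensor_relE) (auto dest!: keys_rel2 keys_rel3)
    show "act (free_gmod ?S ?\<alpha>) g e \<in> tensor_rel M N"
      if "g \<in> carrier G" "e \<in> tensor_rel M N" for g e
      using that(2)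
      by (cases rule: tensor_relE)
        (use that(1) in \<open>auto simp: act_rel2 act_rel3 M.act_add M.act_smult M.act_closed N.act_add N.act_smult N.act_closed
          intro!: tensor_relI\<close>)
  qed (use M.act_closed M.act_one M.act_mult N.act_closed N.act_one N.act_mult in auto)
qed

text \<open>The interface to the tensor product. The third fact is multiplicativity of the rank. The
  fourth provides \<open>f \<otimes> f'\<close>, with equivariance stated for each \<open>g\<close>
  separately, so that a map commuting with \<open>Q\<close> and one commuting with \<open>R\<close>
  give a map commuting with \<open>Q \<inter> R\<close>.\<close>

theorem tensor_facts:
  fixes M :: "('r::comm_ring_1, 'g, 'm) gmod" and N :: "('r, 'g, 'n) gmod"
  assumes M: "gmodule G M" "free_of_finite_rank M" and N: "gmodule G N" "free_of_finite_rank N"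
  shows "gmodule G (gmod_tensor M N)" "free_of_finite_rank (gmod_tensor M N)"
    and "mod_trace (gmod_tensor M N) (\<lambda>x. x) = mod_trace M (\<lambda>x. x) * mod_trace N (\<lambda>x. x)"
    and "lin M M f \<Longrightarrow> lin N N f' \<Longrightarrow> \<exists>F. lin (gmod_tensor M N) (gmod_tensor M N) F \<and>
      mod_trace (gmod_tensor M N) F = mod_trace M f * mod_trace N f' \<and>
      (\<forall>g\<in>carrier G. (\<forall>x\<in>carrier M. f (act M g x) = act M g (f x)) \<longrightarrow>
         (\<forall>x\<in>carrier N. f' (act N g x) = act N g (f' x)) \<longrightarrow>
         (\<forall>x\<in>carrier (gmod_tensor M N). F (act (gmod_tensor M N) g x) = act (gmod_tensor M N) g (F x)))"
proof -
  interpret M: gmodule G M by fact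
  interpret M: rmod M using M(1) by (rule gmodule_rmod)
  interpret N: gmodule G N by fact
  interpret N: rmod N using N(1) by (rule gmodule_rmod)
  interpret pr: presentation G "carrier M \<times> carrier N" "\<lambda>g (x, y). (act M g x, act N g y)" "tensor_rel M N"
    by (rule presentation_tensor[OF M(1) N(1)])
  note eq = gmod_tensor_eq[of M N]
  let ?P = "gmod_tensor M N"
  interpret P: rmod ?P unfolding eq using pr.gmodule_PP by (rule gmodule_rmod)
  show gm: "gmodule G ?P" unfolding eq by (rule pr.gmodule_PP)
  define t where "t x y = pr.gen (x, y)" for x y
  have tc: "t x y \<in> carrier ?P" if "x \<in> carrier M" "y \<in> carrier N" for x y
    unfolding t_def eq using that by (intro pr.gen_closed) auto
  have t1: "lin M ?P (\<lambda>x. t x y)" if "y \<in> carrier N" for y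
    using that tc unfolding lin_def t_def eq
    by (intro conjI ballI allI pr.gen_rel3 pr.gen_rel2 tensor_relI) simp_all
  have t2: "lin N ?P (t x)" if "x \<in> carrier M" for x
    using that tc unfolding lin_def t_def eq
    by (intro conjI ballI allI pr.gen_rel3 pr.gen_rel2 tensor_relI) simp_all
  have act_t: "act ?P g (t x y) = t (act M g x) (act N g y)" if "g \<in> carrier G" "x \<in> carrier M" "y \<in> carrier N" for g x y
    unfolding t_def eq using that by (subst pr.act_gen) auto
  have eqI: "f x = h x" if "rmod Y" "lin ?P Y f" "lin ?P Y h" "x \<in> carrier ?P"
    "\<And>x y. x \<in> carrier M \<Longrightarrow> y \<in> carrier N \<Longrightarrow> f (t x y) = h (t x y)"
    for Y :: "('r, 'y, 'z) module_scheme" and f h x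
    using pr.gen_lin_eqI[OF that(1), of f h x] that(2-) unfolding t_def eq by auto
  have lift: "\<exists>f. lin ?P Y f \<and> (\<forall>x\<in>carrier M. \<forall>y\<in>carrier N. f (t x y) = h x y)"
    if Y: "rmod Y" and h1: "\<And>y. y \<in> carrier N \<Longrightarrow> lin M Y (\<lambda>x. h x y)"
      and h2: "\<And>x. x \<in> carrier M \<Longrightarrow> lin N Y (h x)"
    for Y :: "('r, 'y, 'z) module_scheme" and h
  proof -
    have S: "case_prod h \<in> carrier M \<times> carrier N \<rightarrow> carrier Y" using lin_closed[OF h2] by auto
    obtain f where "lin pr.PP Y f" "\<And>s. s \<in> carrier M \<times> carrier N \<Longrightarrow> f (pr.gen s) = case_prod h s"
    proof (rule pr.gen_lift[OF Y S])
      show "lext Y (case_prod h) e = \<zero>\<^bsub>Y\<^esub>" if "e \<in> tensor_rel M N" for e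
        using that
        by (cases rule: tensor_relE)
          (use S lin_add[OF h1] lin_add[OF h2] lin_smult[OF h1] lin_smult[OF h2] in
            \<open>auto intro!: pr.lext_rel2[OF Y] pr.lext_rel3[OF Y]\<close>)
    qed auto
    then show ?thesis unfolding t_def eq by (intro exI[of _ f]) auto
  qed
  obtain B c where B: "coords M B (\<lambda>b. b) c" using free_coords M M.rmod_axioms by blast
  obtain D e where D: "coords N D (\<lambda>b. b) e" using free_coords N N.rmod_axioms by blast
  note BC = coordsD[OF B] and DC = coordsD[OF D]
  \<comment> \<open>Products of coordinate functionals are bilinear and lift to the tensor product;
    they form the dual basis of the elements \<open>t b d\<close>.\<close>
  have "\<exists>f. lin ?P scal f \<and> (\<forall>x\<in>carrier M. \<forall>y\<in>carrier N. f (t x y) = c (fst i) x * e (snd i) y)"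
    if "i \<in> B \<times> D" for i
    using that BC(4) DC(4) by (intro lift[OF rmod_scal]) (auto simp: lin_def algebra_simps)
  then obtain k where k: "\<And>i. i \<in> B \<times> D \<Longrightarrow> lin ?P scal (k i)"
    "\<And>i x y. i \<in> B \<times> D \<Longrightarrow> x \<in> carrier M \<Longrightarrow> y \<in> carrier N \<Longrightarrow> k i (t x y) = c (fst i) x * e (snd i) y"
    by metis
  have co: "coords ?P (B \<times> D) (\<lambda>(b, d). t b d) k"
    unfolding coords_def
  proof (intro conjI ballI)
    show "rmod ?P" by (rule P.rmod_axioms)
    show fin: "finite (B \<times> D)" using BC DC by blast
    show tcl: "(case i of (b, d) \<Rightarrow> t b d) \<in> carrier ?P" if "i \<in> B \<times> D" for i using that BC(3) DC(3) tc by auto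
    show "k i (case j of (b, d) \<Rightarrow> t b d) = (if i = j then 1 else 0)" if "i \<in> B \<times> D" "j \<in> B \<times> D" for i j
      using that k(2)[OF that(1)] BC(3,5) DC(3,5) by (auto simp: split: if_splits)
    show "x = (\<Oplus>\<^bsub>?P\<^esub>i\<in>B \<times> D. k i x \<odot>\<^bsub>?P\<^esub> (case i of (b, d) \<Rightarrow> t b d))" if "x \<in> carrier ?P" for x
    proof (rule eqI[OF P.rmod_axioms lin_id _ that])
      have sl: "lin ?P ?P (\<lambda>x. k i x \<odot>\<^bsub>?P\<^esub> (case i of (b, d) \<Rightarrow> t b d))" if i: "i \<in> B \<times> D" for i
        using k(1)[OF i] tcl[OF i] by (auto simp: lin_def P.rmod_ldistr P.rmod_assoc)
      show sl2: "lin ?P ?P (\<lambda>x. \<Oplus>\<^bsub>?P\<^esub>i\<in>B \<times> D. k i x \<odot>\<^bsub>?P\<^esub> (case i of (b, d) \<Rightarrow> t b d))"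
        by (rule lin_sum[OF P.rmod_axioms P.rmod_axioms fin sl])
      fix x y assume xy: "x \<in> carrier M" "y \<in> carrier N"
      show "t x y = (\<Oplus>\<^bsub>?P\<^esub>i\<in>B \<times> D. k i (t x y) \<odot>\<^bsub>?P\<^esub> (case i of (b, d) \<Rightarrow> t b d))"
      \<comment> \<open>Bilinearity reduces the expansion of \<open>t x y\<close> to basis elements,
        in the first argument here and in the second one below.\<close>
      proof (rule coords_lin_eqI[OF B P.rmod_axioms t1[OF xy(2)] lin_comp[OF t1[OF xy(2)] sl2] _ xy(1)])
        fix b assume b: "b \<in> B"
        note bM = BC(3)[OF b]
        show "t b y = (\<Oplus>\<^bsub>?P\<^esub>i\<in>B \<times> D. k i (t b y) \<odot>\<^bsub>?P\<^esub> (case i of (b, d) \<Rightarrow> t b d))"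
        proof (rule coords_lin_eqI[OF D P.rmod_axioms t2[OF bM] lin_comp[OF t2[OF bM] sl2] _ xy(2)])
          fix d assume d: "d \<in> D"
          note dN = DC(3)[OF d]
          have "(\<Oplus>\<^bsub>?P\<^esub>i\<in>B \<times> D. k i (t b d) \<odot>\<^bsub>?P\<^esub> (case i of (b, d) \<Rightarrow> t b d)) =
              (\<Oplus>\<^bsub>?P\<^esub>i\<in>B \<times> D. if (b, d) = i then (case i of (b, d) \<Rightarrow> t b d) else \<zero>\<^bsub>?P\<^esub>)"
          proof (intro P.M.finsum_cong' refl)
            fix i assume i: "i \<in> B \<times> D"
            then obtain b' d' where i': "i = (b', d')" "b' \<in> B" "d' \<in> D" by blast
            then show "k i (t b d) \<odot>\<^bsub>?P\<^esub> (case i of (b, d) \<Rightarrow> t b d) =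
                (if (b, d) = i then (case i of (b, d) \<Rightarrow> t b d) else \<zero>\<^bsub>?P\<^esub>)"
              using k(2)[OF i bM dN] BC(5)[OF i'(2) b] DC(5)[OF i'(3) d] tcl[OF i]
              by (cases "b' = b"; cases "d' = d") auto
          qed (use tcl in auto)
          also have "\<dots> = t b d"
            using b d fin tcl by (subst P.M.finsum_singleton) auto
          finally show "t b d = (\<Oplus>\<^bsub>?P\<^esub>i\<in>B \<times> D. k i (t b d) \<odot>\<^bsub>?P\<^esub> (case i of (b, d) \<Rightarrow> t b d))" by simp
        qed
      qed
    qed
  qed (use k in auto)
  show "free_of_finite_rank ?P" using co by (rule coords_free)
  have tr: "mod_trace ?P F = mod_trace M f * mod_trace N f'"
    if F: "lin ?P ?P F" "lin M M f" "lin N N f'"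
      "\<And>x y. x \<in> carrier M \<Longrightarrow> y \<in> carrier N \<Longrightarrow> F (t x y) = t (f x) (f' y)" for F f f'
  proof -
    have "mod_trace ?P F = (\<Sum>i\<in>B \<times> D. c (fst i) (f (fst i)) * e (snd i) (f' (snd i)))"
      unfolding mod_trace_coords[OF co F(1)]
      using F(4) k(2) BC(3) DC(3) lin_closed[OF F(2)] lin_closed[OF F(3)]
      by (intro sum.cong) auto
    then show ?thesis
      unfolding mod_trace_coords[OF B F(2)] mod_trace_coords[OF D F(3)]
      by (simp add: sum_product sum.cartesian_product case_prod_unfold)
  qed
  show "mod_trace ?P (\<lambda>x. x) = mod_trace M (\<lambda>x. x) * mod_trace N (\<lambda>x. x)"
    by (rule tr) (auto simp: lin_id)
  assume f: "lin M M f" "lin N N f'"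
  have "\<exists>F. lin ?P ?P F \<and> (\<forall>x\<in>carrier M. \<forall>y\<in>carrier N. F (t x y) = t (f x) (f' y))"
    using f lin_comp[OF f(1) t1] lin_comp[OF f(2) t2] lin_closed[OF f(1)] lin_closed[OF f(2)]
    by (intro lift[OF P.rmod_axioms]) auto
  then obtain F where F: "lin ?P ?P F"
    "\<And>x y. x \<in> carrier M \<Longrightarrow> y \<in> carrier N \<Longrightarrow> F (t x y) = t (f x) (f' y)" by blast
  have "F (act ?P g z) = act ?P g (F z)"
    if g: "g \<in> carrier G" and "\<forall>x\<in>carrier M. f (act M g x) = act M g (f x)"
      "\<forall>x\<in>carrier N. f' (act N g x) = act N g (f' x)" and z: "z \<in> carrier ?P" for g z
    using that F(2) lin_closed[OF f(1)] lin_closed[OF f(2)] M.act_closed N.act_closed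
    by (intro eqI[OF P.rmod_axioms lin_comp[OF act_lin[OF gm g] F(1)] lin_comp[OF F(1) act_lin[OF gm g]] z])
      (auto simp: act_t)
  then show "\<exists>F. lin ?P ?P F \<and> mod_trace ?P F = mod_trace M f * mod_trace N f' \<and>
      (\<forall>g\<in>carrier G. (\<forall>x\<in>carrier M. f (act M g x) = act M g (f x)) \<longrightarrow>
         (\<forall>x\<in>carrier N. f' (act N g x) = act N g (f' x)) \<longrightarrow>
         (\<forall>x\<in>carrier ?P. F (act ?P g x) = act ?P g (F x)))"
    using F(1) tr[OF F(1) f F(2)] by blast
qed

subsection \<open>Induction and Higman's criterion\<close>

text \<open>Kept apart from \<open>lin\<close>, and relative to a mere set \<open>Q\<close> of group
  elements, so that one map can be viewed over varying subgroups with the records unchanged.\<close>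

definition equi :: "'g set \<Rightarrow> ('r, 'g, 'm) gmod \<Rightarrow> ('r, 'g, 'n) gmod \<Rightarrow> ('m \<Rightarrow> 'n) \<Rightarrow> bool" where
  "equi Q M N f \<longleftrightarrow> (\<forall>g\<in>Q. \<forall>x\<in>carrier M. f (act M g x) = act N g (f x))"

lemma equiD: "equi Q M N f \<Longrightarrow> g \<in> Q \<Longrightarrow> x \<in> carrier M \<Longrightarrow> f (act M g x) = act N g (f x)"
  by (simp add: equi_def)

lemma equi_mono: "equi Q M N f \<Longrightarrow> P \<subseteq> Q \<Longrightarrow> equi P M N f"
  by (auto simp: equi_def)

lemma equi_comp: "lin M N f \<Longrightarrow> equi Q M N f \<Longrightarrow> equi Q N L h \<Longrightarrow> equi Q M L (\<lambda>x. h (f x))"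
  by (simp add: equi_def lin_closed)

lemma gmodule_restrict:
  assumes "gmodule G M" "subgroup Q G" shows "gmodule (G\<lparr>carrier := Q\<rparr>) M"
proof -
  interpret gmodule G M by fact
  have Q: "\<And>q. q \<in> Q \<Longrightarrow> q \<in> carrier G" using subgroup.subset[OF assms(2)] by blast
  show ?thesis
    by (rule gmoduleI[OF G.subgroup_imp_group[OF assms(2)] gmodule_rmod[OF assms(1)]])
      (use Q act_lin[OF assms(1)] act_one act_mult in auto)
qed

lemma gmodule_sub:
  assumes "gmodule G M" "gsubmodule G A M" shows "gmodule G (M\<lparr>carrier := A\<rparr>)"
proof -
  interpret gmodule G M by fact
  have A: "A \<subseteq> carrier M" "submodule A rta M" "\<And>g x. g \<in> carrier G \<Longrightarrow> x \<in> A \<Longrightarrow> act M g x \<in> A"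
    using assms(2) submodule_subset by (auto simp: gsubmodule_def)
  show ?thesis
  proof (rule gmoduleI[OF G.group_axioms rmod_sub[OF gmodule_rmod[OF assms(1)] A(2)]])
    show "lin (M\<lparr>carrier := A\<rparr>) (M\<lparr>carrier := A\<rparr>) (act (M\<lparr>carrier := A\<rparr>) g)" if "g \<in> carrier G" for g
      using act_lin[OF assms(1) that] A that by (auto simp: lin_def subset_iff)
  qed (use A act_one act_mult in auto)
qed

text \<open>Both components are determined by their sum since \<open>A \<inter> B\<close> is zero;
  linearity and equivariance of the projections are read off from this uniqueness.\<close>

lemma decomposition_projections:
  assumes M: "gmodule G M" and d: "direct_decomposition G M A B"
  obtains e e' where "lin M M e" "lin M M e'" "equi (carrier G) M M e" "equi (carrier G) M M e'"
    "\<And>x. x \<in> carrier M \<Longrightarrow> e x \<in> A" "\<And>x. x \<in> carrier M \<Longrightarrow> e' x \<in> B"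
    "\<And>x. x \<in> carrier M \<Longrightarrow> e x \<oplus>\<^bsub>M\<^esub> e' x = x" "\<And>x. x \<in> A \<Longrightarrow> e x = x" "\<And>x. x \<in> B \<Longrightarrow> e' x = x"
proof -
  interpret gmodule G M by fact
  interpret M: rmod M using M by (rule gmodule_rmod)
  have A: "submodule A rta M" and As: "\<And>g x. g \<in> carrier G \<Longrightarrow> x \<in> A \<Longrightarrow> act M g x \<in> A"
    and B: "submodule B rta M" and Bs: "\<And>g x. g \<in> carrier G \<Longrightarrow> x \<in> B \<Longrightarrow> act M g x \<in> B"
    and int: "A \<inter> B = {\<zero>\<^bsub>M\<^esub>}" and sum: "A <+>\<^bsub>M\<^esub> B = carrier M"
    using d by (auto simp: direct_decomposition_def gsubmodule_def)
  interpret A: rmod "M\<lparr>carrier := A\<rparr>" using rmod_sub[OF M.rmod_axioms A] .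
  interpret B: rmod "M\<lparr>carrier := B\<rparr>" using rmod_sub[OF M.rmod_axioms B] .
  note AM = submodule_subset[OF A] and BM = submodule_subset[OF B]
  have ex: "\<exists>a b. a \<in> A \<and> b \<in> B \<and> x = a \<oplus>\<^bsub>M\<^esub> b" if "x \<in> carrier M" for x
    using that sum[symmetric] by (auto simp: set_add_def')
  then obtain e e' where e: "\<And>x. x \<in> carrier M \<Longrightarrow> e x \<in> A" "\<And>x. x \<in> carrier M \<Longrightarrow> e' x \<in> B"
    "\<And>x. x \<in> carrier M \<Longrightarrow> x = e x \<oplus>\<^bsub>M\<^esub> e' x" by metis
  have uniq: "a = e x \<and> b = e' x" if "a \<in> A" "b \<in> B" "x = a \<oplus>\<^bsub>M\<^esub> b" for a b x
  proof -
    have ab: "a \<in> carrier M" "b \<in> carrier M" using that AM BM by auto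
    then have x: "x \<in> carrier M" using that by simp
    have ee: "e x \<in> carrier M" "e' x \<in> carrier M" using e x AM BM by auto
    have "a \<ominus>\<^bsub>M\<^esub> e x = e' x \<ominus>\<^bsub>M\<^esub> b"
    proof -
      have "a \<oplus>\<^bsub>M\<^esub> b = e x \<oplus>\<^bsub>M\<^esub> e' x" using e(3)[OF x] that(3) by simp
      then have "(a \<oplus>\<^bsub>M\<^esub> b) \<oplus>\<^bsub>M\<^esub> (\<ominus>\<^bsub>M\<^esub> e x \<oplus>\<^bsub>M\<^esub> \<ominus>\<^bsub>M\<^esub> b) = (e x \<oplus>\<^bsub>M\<^esub> e' x) \<oplus>\<^bsub>M\<^esub> (\<ominus>\<^bsub>M\<^esub> e x \<oplus>\<^bsub>M\<^esub> \<ominus>\<^bsub>M\<^esub> b)" by simp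
      moreover have "(a \<oplus>\<^bsub>M\<^esub> b) \<oplus>\<^bsub>M\<^esub> (\<ominus>\<^bsub>M\<^esub> e x \<oplus>\<^bsub>M\<^esub> \<ominus>\<^bsub>M\<^esub> b) = (a \<oplus>\<^bsub>M\<^esub> \<ominus>\<^bsub>M\<^esub> e x) \<oplus>\<^bsub>M\<^esub> (b \<oplus>\<^bsub>M\<^esub> \<ominus>\<^bsub>M\<^esub> b)"
        using ab ee by (simp add: M.M.a_ac del: M.M.r_neg)
      moreover have "(e x \<oplus>\<^bsub>M\<^esub> e' x) \<oplus>\<^bsub>M\<^esub> (\<ominus>\<^bsub>M\<^esub> e x \<oplus>\<^bsub>M\<^esub> \<ominus>\<^bsub>M\<^esub> b) = (e' x \<oplus>\<^bsub>M\<^esub> \<ominus>\<^bsub>M\<^esub> b) \<oplus>\<^bsub>M\<^esub> (e x \<oplus>\<^bsub>M\<^esub> \<ominus>\<^bsub>M\<^esub> e x)"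
        using ab ee by (simp add: M.M.a_ac del: M.M.r_neg)
      ultimately show ?thesis using ab ee by (simp add: M.M.r_neg M.M.minus_eq)
    qed
    moreover have "a \<ominus>\<^bsub>M\<^esub> e x \<in> A"
      using that(1) e(1)[OF x] A.M.a_closed[of a "(- 1) \<odot>\<^bsub>M\<^esub> e x"] A.rmod_smult[of "e x" "- 1"] ee
      by (simp add: M.M.minus_eq M.rmod_uminus)
    moreover have "e' x \<ominus>\<^bsub>M\<^esub> b \<in> B"
      using that(2) e(2)[OF x] B.M.a_closed[of "e' x" "(- 1) \<odot>\<^bsub>M\<^esub> b"] B.rmod_smult[of b "- 1"] ab
      by (simp add: M.M.minus_eq M.rmod_uminus)
    ultimately have "a \<ominus>\<^bsub>M\<^esub> e x = \<zero>\<^bsub>M\<^esub>" "e' x \<ominus>\<^bsub>M\<^esub> b = \<zero>\<^bsub>M\<^esub>" using int by auto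
    then show ?thesis
      using rmod_eq_iff[OF M.rmod_axioms ab(1) ee(1)] rmod_eq_iff[OF M.rmod_axioms ee(2) ab(2)] ab ee
      by (simp add: M.M.minus_eq M.rmod_uminus)
  qed
  have eM: "e x \<in> carrier M" "e' x \<in> carrier M" if "x \<in> carrier M" for x
    using e that AM BM by auto
  have add: "e (x \<oplus>\<^bsub>M\<^esub> y) = e x \<oplus>\<^bsub>M\<^esub> e y \<and> e' (x \<oplus>\<^bsub>M\<^esub> y) = e' x \<oplus>\<^bsub>M\<^esub> e' y"
    if "x \<in> carrier M" "y \<in> carrier M" for x y
  proof -
    have "e x \<oplus>\<^bsub>M\<^esub> e y \<in> A" "e' x \<oplus>\<^bsub>M\<^esub> e' y \<in> B"
      using A.M.a_closed[of "e x" "e y"] B.M.a_closed[of "e' x" "e' y"] e that by auto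
    moreover have "x \<oplus>\<^bsub>M\<^esub> y = (e x \<oplus>\<^bsub>M\<^esub> e y) \<oplus>\<^bsub>M\<^esub> (e' x \<oplus>\<^bsub>M\<^esub> e' y)"
    proof -
      have "x \<oplus>\<^bsub>M\<^esub> y = (e x \<oplus>\<^bsub>M\<^esub> e' x) \<oplus>\<^bsub>M\<^esub> (e y \<oplus>\<^bsub>M\<^esub> e' y)" using e(3) that by metis
      then show ?thesis using eM that by (simp add: M.M.a_ac)
    qed
    ultimately show ?thesis using uniq by metis
  qed
  have smult: "e (a \<odot>\<^bsub>M\<^esub> x) = a \<odot>\<^bsub>M\<^esub> e x \<and> e' (a \<odot>\<^bsub>M\<^esub> x) = a \<odot>\<^bsub>M\<^esub> e' x"
    if "x \<in> carrier M" for x a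
  proof -
    have "a \<odot>\<^bsub>M\<^esub> e x \<in> A" "a \<odot>\<^bsub>M\<^esub> e' x \<in> B"
      using A.rmod_smult[of "e x" a] B.rmod_smult[of "e' x" a] e that by auto
    moreover have "a \<odot>\<^bsub>M\<^esub> x = a \<odot>\<^bsub>M\<^esub> e x \<oplus>\<^bsub>M\<^esub> a \<odot>\<^bsub>M\<^esub> e' x"
      using eM[OF that] e(3)[OF that] by (metis M.rmod_rdistr)
    ultimately show ?thesis using uniq by metis
  qed
  have eq: "e (act M g x) = act M g (e x) \<and> e' (act M g x) = act M g (e' x)"
    if "g \<in> carrier G" "x \<in> carrier M" for g x
  proof -
    have "act M g (e x) \<in> A" "act M g (e' x) \<in> B" using As Bs e that by auto
    moreover have "act M g x = act M g (e x) \<oplus>\<^bsub>M\<^esub> act M g (e' x)"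
      using eM[OF that(2)] e(3)[OF that(2)] that(1) by (metis act_add)
    ultimately show ?thesis using uniq by metis
  qed
  show ?thesis
  proof (rule that[of e e'])
    show "lin M M e" "lin M M e'" using eM add smult by (auto simp: lin_def)
    show "equi (carrier G) M M e" "equi (carrier G) M M e'" using eq by (auto simp: equi_def)
    show "e x = x" if "x \<in> A" for x
      using uniq[of x "\<zero>\<^bsub>M\<^esub>" x] that AM B.M.zero_closed by auto
    show "e' x = x" if "x \<in> B" for x
      using uniq[of "\<zero>\<^bsub>M\<^esub>" x x] that BM A.M.zero_closed by auto
  qed (use e in auto)
qed

text \<open>Turns a summand up to isomorphism into a split pair of equivariant maps;
  \<open>iso_summandI\<close> is the converse. Relative projectivity is handled through such
  pairs.\<close>

lemma iso_summand_split:
  assumes N: "gmodule G N" and P: "gmodule G P" and s: "iso_to_direct_summand G N P"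
  obtains i \<pi> where "lin N P i" "lin P N \<pi>" "equi (carrier G) N P i" "equi (carrier G) P N \<pi>"
    "\<And>x. x \<in> carrier N \<Longrightarrow> \<pi> (i x) = x"
proof -
  interpret N: gmodule G N by fact
  interpret N: rmod N using N by (rule gmodule_rmod)
  from s obtain A B f where d: "direct_decomposition G P A B"
    and f: "f \<in> gmod_hom G N (P\<lparr>carrier := A\<rparr>)" "bij_betw f (carrier N) A"
    by (auto simp: iso_to_direct_summand_def direct_summand_def gmod_isomorphic_def)
  obtain e e' where e: "lin P P e" "lin P P e'" "equi (carrier G) P P e" "equi (carrier G) P P e'"
    "\<And>x. x \<in> carrier P \<Longrightarrow> e x \<in> A" "\<And>x. x \<in> A \<Longrightarrow> e x = x"
    using decomposition_projections[OF P d] by metis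
  have AP: "A \<subseteq> carrier P" using d submodule_subset by (auto simp: direct_decomposition_def gsubmodule_def)
  have fA: "f x \<in> A" if "x \<in> carrier N" for x using f(2) that by (auto simp: bij_betw_def)
  define k where "k = the_inv_into (carrier N) f"
  have inj: "inj_on f (carrier N)" using f(2) by (simp add: bij_betw_def)
  have k: "k y \<in> carrier N" "f (k y) = y" if "y \<in> A" for y
    using that f(2) the_inv_into_into[OF inj, of y "carrier N"] f_the_inv_into_f[OF inj]
    by (auto simp: k_def bij_betw_def)
  have kf: "k (f x) = x" if "x \<in> carrier N" for x
    using that the_inv_into_f_f[OF inj] by (simp add: k_def)
  have fl: "f (x \<oplus>\<^bsub>N\<^esub> y) = f x \<oplus>\<^bsub>P\<^esub> f y" "f (a \<odot>\<^bsub>N\<^esub> x) = a \<odot>\<^bsub>P\<^esub> f x" "g \<in> carrier G \<Longrightarrow> f (act N g x) = act P g (f x)"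
    if "x \<in> carrier N" "y \<in> carrier N" for x y a g
    using f(1) that by (auto simp: gmod_hom_def)
  show ?thesis
  proof (rule that[of f "\<lambda>z. k (e z)"])
    show "lin N P f" using fl fA AP by (auto simp: lin_def)
    show "equi (carrier G) N P f" using fl by (auto simp: equi_def)
    show "k (e (f x)) = x" if "x \<in> carrier N" for x using that fA e kf by simp
    have A: "k (u \<oplus>\<^bsub>P\<^esub> v) = k u \<oplus>\<^bsub>N\<^esub> k v" if "u \<in> A" "v \<in> A" for u v
      using that k fl(1)[of "k u" "k v"] kf[of "k u \<oplus>\<^bsub>N\<^esub> k v"] by simp
    have S: "k (a \<odot>\<^bsub>P\<^esub> u) = a \<odot>\<^bsub>N\<^esub> k u" if "u \<in> A" for u a
      using that k fl(2)[of "k u" "k u" a] kf[of "a \<odot>\<^bsub>N\<^esub> k u"] by simp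
    have C: "k (act P g u) = act N g (k u)" if "u \<in> A" "g \<in> carrier G" for u g
      using that k fl(3)[of "k u" "k u" g] kf[of "act N g (k u)"] N.act_closed by simp
    show "lin P N (\<lambda>z. k (e z))"
      using A S k e(5) lin_add[OF e(1)] lin_smult[OF e(1)] by (simp add: lin_def)
    show "equi (carrier G) P N (\<lambda>z. k (e z))"
      using C e(5) e(3) by (simp add: equi_def)
  qed
qed

text \<open>Every \<open>z\<close> is \<open>i (\<pi> z)\<close> plus a remainder, which \<pi> kills
  because \<open>\<pi> i\<close> is the identity.\<close>

lemma split_decomposition:
  assumes N: "gmodule G N" and P: "gmodule G P"
    and i: "lin N P i" "equi (carrier G) N P i" and p: "lin P N \<pi>" "equi (carrier G) P N \<pi>"
    and inv: "\<And>x. x \<in> carrier N \<Longrightarrow> \<pi> (i x) = x"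
  shows "direct_decomposition G P (i ` carrier N) {z \<in> carrier P. \<pi> z = \<zero>\<^bsub>N\<^esub>}"
proof -
  interpret N: gmodule G N by fact
  interpret N: rmod N using N by (rule gmodule_rmod)
  interpret P: gmodule G P by fact
  interpret P: rmod P using P by (rule gmodule_rmod)
  define A where "A = i ` carrier N"
  define B where "B = {z \<in> carrier P. \<pi> z = \<zero>\<^bsub>N\<^esub>}"
  have i0: "i \<zero>\<^bsub>N\<^esub> = \<zero>\<^bsub>P\<^esub>" and p0: "\<pi> \<zero>\<^bsub>P\<^esub> = \<zero>\<^bsub>N\<^esub>"
    using lin_zero[OF N.rmod_axioms P.rmod_axioms i(1)] lin_zero[OF P.rmod_axioms N.rmod_axioms p(1)] by auto
  have N0: "act N g \<zero>\<^bsub>N\<^esub> = \<zero>\<^bsub>N\<^esub>" if "g \<in> carrier G" for g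
    using lin_zero[OF N.rmod_axioms N.rmod_axioms act_lin[OF N that]] .
  have "submodule A rta P"
  proof (rule P.rmod_submoduleI)
    show "A \<subseteq> carrier P" using lin_closed[OF i(1)] by (auto simp: A_def)
    show "\<zero>\<^bsub>P\<^esub> \<in> A" using i0 unfolding A_def by (metis N.M.zero_closed imageI)
    show "x \<oplus>\<^bsub>P\<^esub> y \<in> A" if "x \<in> A" "y \<in> A" for x y
      using that lin_add[OF i(1), symmetric] by (auto simp: A_def)
    show "a \<odot>\<^bsub>P\<^esub> x \<in> A" if "x \<in> A" for x a
      using that lin_smult[OF i(1), symmetric] by (auto simp: A_def)
  qed
  moreover have "submodule B rta P"
    by (rule P.rmod_submoduleI) (auto simp: B_def p0 lin_add[OF p(1)] lin_smult[OF p(1)])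
  moreover have "act P g x \<in> A" if "g \<in> carrier G" "x \<in> A" for g x
    using that equiD[OF i(2), symmetric] N.act_closed by (auto simp: A_def)
  moreover have "act P g x \<in> B" if "g \<in> carrier G" "x \<in> B" for g x
    using that equiD[OF p(2)] P.act_closed N0 by (auto simp: B_def)
  moreover have "A \<inter> B = {\<zero>\<^bsub>P\<^esub>}"
  proof -
    have "z = \<zero>\<^bsub>P\<^esub>" if "z \<in> A" "z \<in> B" for z
      using that inv i0 by (auto simp: A_def B_def)
    moreover have "\<zero>\<^bsub>P\<^esub> \<in> A" using i0 unfolding A_def by (metis N.M.zero_closed imageI)
    moreover have "\<zero>\<^bsub>P\<^esub> \<in> B" using p0 by (simp add: B_def)
    ultimately show ?thesis by blast
  qed
  moreover have "A <+>\<^bsub>P\<^esub> B = carrier P"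
  proof (intro equalityI subsetI)
    fix z assume "z \<in> A <+>\<^bsub>P\<^esub> B"
    then show "z \<in> carrier P" using lin_closed[OF i(1)] by (auto simp: set_add_def' A_def B_def)
  next
    fix z assume z: "z \<in> carrier P"
    define w where "w = z \<oplus>\<^bsub>P\<^esub> (- 1) \<odot>\<^bsub>P\<^esub> i (\<pi> z)"
    have c: "\<pi> z \<in> carrier N" "i (\<pi> z) \<in> carrier P" using lin_closed[OF p(1)] lin_closed[OF i(1)] z by auto
    have "\<pi> w = \<pi> z \<oplus>\<^bsub>N\<^esub> (- 1) \<odot>\<^bsub>N\<^esub> \<pi> z"
      using z c inv by (simp add: w_def lin_add[OF p(1)] lin_smult[OF p(1)])
    then have "w \<in> B" using z c rmod_eq_iff[OF N.rmod_axioms c(1) c(1)] by (simp add: B_def w_def)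
    moreover have "z = i (\<pi> z) \<oplus>\<^bsub>P\<^esub> w"
    proof -
      have "i (\<pi> z) \<oplus>\<^bsub>P\<^esub> w = z \<oplus>\<^bsub>P\<^esub> (i (\<pi> z) \<oplus>\<^bsub>P\<^esub> (- 1) \<odot>\<^bsub>P\<^esub> i (\<pi> z))"
        using z c by (simp add: w_def P.M.a_ac)
      then show ?thesis using z c rmod_eq_iff[OF P.rmod_axioms c(2) c(2)] by simp
    qed
    moreover have "i (\<pi> z) \<in> A" using c by (simp add: A_def)
    ultimately show "z \<in> A <+>\<^bsub>P\<^esub> B" by (auto simp: set_add_def')
  qed
  ultimately show ?thesis
    unfolding direct_decomposition_def gsubmodule_def A_def B_def by blast
qed

lemma iso_summandI:
  assumes N: "gmodule G N" and P: "gmodule G P"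
    and i: "lin N P i" "equi (carrier G) N P i" and p: "lin P N \<pi>" "equi (carrier G) P N \<pi>"
    and inv: "\<And>x. x \<in> carrier N \<Longrightarrow> \<pi> (i x) = x"
  shows "iso_to_direct_summand G N P"
proof -
  interpret N: gmodule G N by fact
  interpret N: rmod N using N by (rule gmodule_rmod)
  define A where "A = i ` carrier N"
  have ds: "direct_summand G A P"
    using split_decomposition[OF assms] unfolding direct_summand_def A_def by blast
  have "restrict i (carrier N) \<in> gmod_hom G N (P\<lparr>carrier := A\<rparr>)"
    using lin_add[OF i(1)] lin_smult[OF i(1)] equiD[OF i(2)] N.act_closed by (auto simp: gmod_hom_def A_def)
  moreover have "bij_betw (restrict i (carrier N)) (carrier N) A"
    unfolding bij_betw_def A_def using inv by (auto intro!: inj_onI) metis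
  ultimately show ?thesis
    using ds unfolding iso_to_direct_summand_def gmod_isomorphic_def
    by (intro exI[of _ A] conjI bexI[of _ "restrict i (carrier N)"]) simp_all
qed

section \<open>Induced modules and sums over cosets\<close>

definition ind_rel :: "('g, 'z) monoid_scheme \<Rightarrow> 'g set \<Rightarrow> ('r::comm_ring_1, 'g, 'm) gmod \<Rightarrow> (('g \<times> 'm) \<Rightarrow>\<^sub>0 'r) set" where
  "ind_rel G Q M =
     {rel3 (g, x \<oplus>\<^bsub>M\<^esub> y) (g, x) (g, y) | g x y. g \<in> carrier G \<and> x \<in> carrier M \<and> y \<in> carrier M} \<union>
     {rel2 (g, a \<odot>\<^bsub>M\<^esub> x) (g, x) a | a g x. g \<in> carrier G \<and> x \<in> carrier M} \<union>
     {rel2 (g \<otimes>\<^bsub>G\<^esub> q, x) (g, act M q x) 1 | g q x. g \<in> carrier G \<and> q \<in> Q \<and> x \<in> carrier M}"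

lemma gmod_ind_eq:
  "gmod_ind G Q M = presented_gmod (carrier G \<times> carrier M) (\<lambda>h (g, x). (h \<otimes>\<^bsub>G\<^esub> g, x)) (ind_rel G Q M)"
  by (simp add: gmod_ind_def ind_rel_def Let_def rel2_def rel3_def)

lemma ind_relI:
  "g \<in> carrier G \<Longrightarrow> x \<in> carrier M \<Longrightarrow> y \<in> carrier M \<Longrightarrow> rel3 (g, x \<oplus>\<^bsub>M\<^esub> y) (g, x) (g, y) \<in> ind_rel G Q M"
  "g \<in> carrier G \<Longrightarrow> x \<in> carrier M \<Longrightarrow> rel2 (g, a \<odot>\<^bsub>M\<^esub> x) (g, x) a \<in> ind_rel G Q M"
  "g \<in> carrier G \<Longrightarrow> q \<in> Q \<Longrightarrow> x \<in> carrier M \<Longrightarrow> rel2 (g \<otimes>\<^bsub>G\<^esub> q, x) (g, act M q x) 1 \<in> ind_rel G Q M"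
  unfolding ind_rel_def by blast+

lemma ind_relE:
  assumes "e \<in> ind_rel G Q M"
  obtains g x y where "e = rel3 (g, x \<oplus>\<^bsub>M\<^esub> y) (g, x) (g, y)" "g \<in> carrier G" "x \<in> carrier M" "y \<in> carrier M"
  | a g x where "e = rel2 (g, a \<odot>\<^bsub>M\<^esub> x) (g, x) a" "g \<in> carrier G" "x \<in> carrier M"
  | g q x where "e = rel2 (g \<otimes>\<^bsub>G\<^esub> q, x) (g, act M q x) 1" "g \<in> carrier G" "q \<in> Q" "x \<in> carrier M"
  using assms unfolding ind_rel_def by blast

lemma presentation_ind:
  assumes "group G" "subgroup Q G" "gmodule (G\<lparr>carrier := Q\<rparr>) M"
  shows "presentation G (carrier G \<times> carrier M) (\<lambda>h (g, x). (h \<otimes>\<^bsub>G\<^esub> g, x)) (ind_rel G Q M)"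
    (is "presentation G ?S ?\<alpha> ?E")
proof -
  interpret G: group G by fact
  interpret M: gmodule "G\<lparr>carrier := Q\<rparr>" M by fact
  interpret M: rmod M using assms(3) by (rule gmodule_rmod)
  have Q: "\<And>q. q \<in> Q \<Longrightarrow> q \<in> carrier G" using subgroup.subset[OF assms(2)] by blast
  have ac: "act M q x \<in> carrier M" if "q \<in> Q" "x \<in> carrier M" for q x using M.act_closed that by simp
  show ?thesis
  proof
    show "Poly_Mapping.keys e \<subseteq> ?S" if "e \<in> ind_rel G Q M" for e
      using that by (cases rule: ind_relE) (auto dest!: keys_rel2 keys_rel3 simp: Q ac)
    show "act (free_gmod ?S ?\<alpha>) g e \<in> ind_rel G Q M"
      if "g \<in> carrier G" "e \<in> ind_rel G Q M" for g e
      using that(2)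
      by (cases rule: ind_relE)
        (use that(1) Q in \<open>auto simp: act_rel2 act_rel3 G.m_assoc[symmetric] intro!: ind_relI\<close>)
  qed (auto simp: G.m_assoc)
qed

lemma (in rmod) finsum_image_gen:
  assumes "finite A" "f \<in> A \<rightarrow> carrier M"
  shows "finsum M f A = (\<Oplus>c\<in>k ` A. \<Oplus>a\<in>{a \<in> A. k a = c}. f a)"
proof -
  have "(\<Oplus>a\<in>{a \<in> A. k a \<in> C}. f a) = (\<Oplus>c\<in>C. \<Oplus>a\<in>{a \<in> A. k a = c}. f a)" if "finite C" for C
    using that
  proof (induction C rule: finite_induct)
    case (insert c C)
    have "{a \<in> A. k a \<in> insert c C} = {a \<in> A. k a = c} \<union> {a \<in> A. k a \<in> C}" by auto
    then have "(\<Oplus>a\<in>{a \<in> A. k a \<in> insert c C}. f a) =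
        (\<Oplus>a\<in>{a \<in> A. k a = c}. f a) \<oplus> (\<Oplus>a\<in>{a \<in> A. k a \<in> C}. f a)"
      using assms insert.hyps by (simp, intro M.finsum_Un_disjoint) auto
    also have "\<dots> = (\<Oplus>c\<in>insert c C. \<Oplus>a\<in>{a \<in> A. k a = c}. f a)"
      using insert assms by (subst M.finsum_insert) (auto intro!: M.finsum_closed)
    finally show ?case .
  qed simp
  from this[of "k ` A"] have "(\<Oplus>a\<in>{a \<in> A. k a \<in> k ` A}. f a) = (\<Oplus>c\<in>k ` A. \<Oplus>a\<in>{a \<in> A. k a = c}. f a)"
    using assms(1) by simp
  moreover have "{a \<in> A. k a \<in> k ` A} = A" by auto
  ultimately show ?thesis by simp
qed

text \<open>For \<open>d\<close> constant on left cosets of \<open>Q\<close> this is the sum over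
  \<open>G/Q\<close>, whatever the representatives. With \<open>d g = g (a (g^-1 x))\<close> it is
  the relative trace, which supplies the quotient of the transfer by |Q| with no division in the
  ring.\<close>

definition coset_sum :: "('g, 'z) monoid_scheme \<Rightarrow> 'g set \<Rightarrow> ('r::comm_ring_1, 'm, 'x) module_scheme \<Rightarrow> ('g \<Rightarrow> 'm) \<Rightarrow> 'm" where
  "coset_sum G Q M d = (\<Oplus>\<^bsub>M\<^esub>C\<in>(\<lambda>g. g <#\<^bsub>G\<^esub> Q) ` carrier G. d (SOME g. g \<in> C))"

locale coset_invariant = G: group G + M: rmod M
  for G :: "('g, 'z) monoid_scheme" and M :: "('r::comm_ring_1, 'm, 'x) module_scheme" +
  fixes Q :: "'g set" and d :: "'g \<Rightarrow> 'm"
  assumes fin: "finite (carrier G)" and Q: "subgroup Q G"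
    and closed: "\<And>g. g \<in> carrier G \<Longrightarrow> d g \<in> carrier M"
    and inv: "\<And>g q. g \<in> carrier G \<Longrightarrow> q \<in> Q \<Longrightarrow> d (g \<otimes>\<^bsub>G\<^esub> q) = d g"
begin

lemma QG: "q \<in> Q \<Longrightarrow> q \<in> carrier G"
  using subgroup.subset[OF Q] by blast

lemma some_coset:
  assumes "g \<in> carrier G"
  shows "(SOME h. h \<in> g <#\<^bsub>G\<^esub> Q) \<in> g <#\<^bsub>G\<^esub> Q"
  using G.lcos_self[OF assms Q] by (rule someI)

lemma some_coset_closed: "g \<in> carrier G \<Longrightarrow> (SOME h. h \<in> g <#\<^bsub>G\<^esub> Q) \<in> carrier G"
  using some_coset G.l_coset_carrier[OF _ _ Q] by blast

lemma d_coset: "g \<in> carrier G \<Longrightarrow> h \<in> g <#\<^bsub>G\<^esub> Q \<Longrightarrow> d h = d g"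
  using inv by (auto simp: l_coset_def)

lemma d_some: "g \<in> carrier G \<Longrightarrow> d (SOME h. h \<in> g <#\<^bsub>G\<^esub> Q) = d g"
  using d_coset some_coset by blast

lemma l_coset_eq_iff:
  assumes "g \<in> carrier G" "h \<in> carrier G"
  shows "g <#\<^bsub>G\<^esub> Q = h <#\<^bsub>G\<^esub> Q \<longleftrightarrow> g \<in> h <#\<^bsub>G\<^esub> Q"
  using G.lcos_self[OF assms(1) Q] G.l_repr_independence[OF _ assms(2) Q, of g] by metis

lemma coset_card: "g \<in> carrier G \<Longrightarrow> card (g <#\<^bsub>G\<^esub> Q) = card Q"
proof -
  assume g: "g \<in> carrier G"
  have "g <#\<^bsub>G\<^esub> Q = (\<lambda>q. g \<otimes>\<^bsub>G\<^esub> q) ` Q" by (auto simp: l_coset_def)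
  moreover have "inj_on (\<lambda>q. g \<otimes>\<^bsub>G\<^esub> q) Q" using g QG by (intro inj_onI) simp
  ultimately show ?thesis by (simp add: card_image)
qed

lemma sum_eq_coset_sum: "finsum M d (carrier G) = of_nat (card Q) \<odot>\<^bsub>M\<^esub> coset_sum G Q M d"
proof -
  let ?k = "\<lambda>g. g <#\<^bsub>G\<^esub> Q"
  have "finsum M d (carrier G) = (\<Oplus>\<^bsub>M\<^esub>C\<in>?k ` carrier G. \<Oplus>\<^bsub>M\<^esub>g\<in>{g \<in> carrier G. ?k g = C}. d g)"
    using fin closed by (intro M.finsum_image_gen) auto
  also have "\<dots> = (\<Oplus>\<^bsub>M\<^esub>C\<in>?k ` carrier G. of_nat (card Q) \<odot>\<^bsub>M\<^esub> d (SOME g. g \<in> C))"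
  proof (intro M.M.finsum_cong' refl)
    fix C assume "C \<in> ?k ` carrier G"
    then obtain g where g: "g \<in> carrier G" "C = ?k g" by blast
    have fib: "{h \<in> carrier G. ?k h = C} = C"
      using g l_coset_eq_iff G.l_coset_carrier[OF _ g(1) Q] by blast
    have "(\<Oplus>\<^bsub>M\<^esub>h\<in>C. d h) = (\<Oplus>\<^bsub>M\<^esub>h\<in>C. d g)"
      using g d_coset closed by (intro M.M.finsum_cong') auto
    also have "\<dots> = of_nat (card C) \<odot>\<^bsub>M\<^esub> d g"
      using finite_subset[OF _ fin, of C] fib g closed by (intro M.rmod_finsum_const) blast+
    finally show "(\<Oplus>\<^bsub>M\<^esub>h\<in>{h \<in> carrier G. ?k h = C}. d h) = of_nat (card Q) \<odot>\<^bsub>M\<^esub> d (SOME h. h \<in> C)"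
      unfolding fib using g coset_card d_some by simp
  qed (use closed d_some in auto)
  also have "\<dots> = of_nat (card Q) \<odot>\<^bsub>M\<^esub> coset_sum G Q M d"
    unfolding coset_sum_def using fin closed d_some by (intro M.rmod_finsum_smult[symmetric]) auto
  finally show ?thesis .
qed

text \<open>Left multiplication by \<open>h\<close> permutes the left cosets of \<open>Q\<close>.
  This is what makes the relative trace \<open>G\<close>-equivariant.\<close>

lemma coset_sum_shift:
  assumes h: "h \<in> carrier G"
  shows "coset_sum G Q M (\<lambda>g. d (h \<otimes>\<^bsub>G\<^esub> g)) = coset_sum G Q M d"
proof -
  let ?L = "(\<lambda>g. g <#\<^bsub>G\<^esub> Q) ` carrier G"
  let ?s = "\<lambda>C. h <#\<^bsub>G\<^esub> C"
  have QG': "Q \<subseteq> carrier G" using QG by blast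
  have s: "?s (g <#\<^bsub>G\<^esub> Q) = (h \<otimes>\<^bsub>G\<^esub> g) <#\<^bsub>G\<^esub> Q" if "g \<in> carrier G" for g
    using G.lcos_m_assoc[OF QG' h that] .
  have im: "?s ` ?L = ?L"
  proof (intro equalityI subsetI)
    fix C assume "C \<in> ?s ` ?L"
    then show "C \<in> ?L" using s h by auto
  next
    fix C assume "C \<in> ?L"
    then obtain g where g: "g \<in> carrier G" "C = g <#\<^bsub>G\<^esub> Q" by blast
    then have "C = ?s ((inv\<^bsub>G\<^esub> h \<otimes>\<^bsub>G\<^esub> g) <#\<^bsub>G\<^esub> Q)"
      using h s[of "inv\<^bsub>G\<^esub> h \<otimes>\<^bsub>G\<^esub> g"] by (simp add: G.m_assoc[symmetric])
    then show "C \<in> ?s ` ?L" using g h by blast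
  qed
  have inj: "inj_on ?s ?L"
  proof (rule inj_onI)
    fix C D assume "C \<in> ?L" "D \<in> ?L" and eq: "?s C = ?s D"
    then obtain a b where "a \<in> carrier G" "b \<in> carrier G" "C = a <#\<^bsub>G\<^esub> Q" "D = b <#\<^bsub>G\<^esub> Q" by blast
    then have "C \<subseteq> carrier G" "D \<subseteq> carrier G" using G.l_coset_subset_G[OF QG'] by auto
    moreover from this have "inv\<^bsub>G\<^esub> h <#\<^bsub>G\<^esub> ?s C = C" "inv\<^bsub>G\<^esub> h <#\<^bsub>G\<^esub> ?s D = D"
      using G.lcos_m_assoc[OF _ G.inv_closed[OF h] h] h G.lcos_mult_one by auto
    ultimately show "C = D" using eq by metis
  qed
  have "coset_sum G Q M d = (\<Oplus>\<^bsub>M\<^esub>C\<in>?s ` ?L. d (SOME g. g \<in> C))"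
    unfolding im coset_sum_def ..
  also have "\<dots> = (\<Oplus>\<^bsub>M\<^esub>C\<in>?L. d (SOME g. g \<in> ?s C))"
    using inj im closed d_some by (intro M.M.finsum_reindex) auto
  also have "\<dots> = (\<Oplus>\<^bsub>M\<^esub>C\<in>?L. d (h \<otimes>\<^bsub>G\<^esub> (SOME g. g \<in> C)))"
  proof (intro M.M.finsum_cong' refl)
    fix C assume "C \<in> ?L"
    then obtain g where g: "g \<in> carrier G" "C = g <#\<^bsub>G\<^esub> Q" by blast
    obtain q where "q \<in> Q" "(SOME g. g \<in> C) = g \<otimes>\<^bsub>G\<^esub> q"
      using some_coset[OF g(1)] g(2) by (auto simp: l_coset_def)
    then have "d (h \<otimes>\<^bsub>G\<^esub> (SOME g. g \<in> C)) = d (h \<otimes>\<^bsub>G\<^esub> g)"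
      using inv[of "h \<otimes>\<^bsub>G\<^esub> g" q] h g QG by (simp add: G.m_assoc)
    then show "d (SOME g. g \<in> ?s C) = d (h \<otimes>\<^bsub>G\<^esub> (SOME g. g \<in> C))"
      using d_some[of "h \<otimes>\<^bsub>G\<^esub> g"] g h s by simp
  qed (use closed h some_coset_closed in auto)
  finally show ?thesis by (simp add: coset_sum_def)
qed

end

lemma finsum_indicator:
  fixes M :: "('r::comm_ring_1, 'm, 'x) module_scheme"
  assumes "rmod M" "finite A" "x \<in> carrier M"
  shows "(\<Oplus>\<^bsub>M\<^esub>a\<in>A. if P a then x else \<zero>\<^bsub>M\<^esub>) = of_nat (card {a \<in> A. P a}) \<odot>\<^bsub>M\<^esub> x"
proof -
  interpret M: rmod M by fact
  have "(\<Oplus>\<^bsub>M\<^esub>a\<in>A. if P a then x else \<zero>\<^bsub>M\<^esub>) = (\<Oplus>\<^bsub>M\<^esub>a\<in>A. (if P a then 1 else 0) \<odot>\<^bsub>M\<^esub> x)"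
    using assms by (intro M.M.finsum_cong') auto
  also have "\<dots> = (\<Sum>a\<in>A. if P a then 1 else 0) \<odot>\<^bsub>M\<^esub> x"
    using assms by (intro M.rmod_sum_smult[symmetric])
  also have "(\<Sum>a\<in>A. if P a then 1 else (0::'r)) = of_nat (card {a \<in> A. P a})"
    using assms(2) by (simp add: sum.If_cases Int_def conj_commute)
  finally show ?thesis .
qed

text \<open>Here \<eta> takes \<open>x\<close> to \<open>1 \<otimes> x\<close>, and \<epsilon> is
  the projection back: it takes \<open>g \<otimes> x\<close> to \<open>g x\<close> for
  \<open>g\<close> in \<open>Q\<close> and to 0 otherwise. The sum formula says that
  \<open>\<eta> \<epsilon>\<close> witnesses relative \<open>Q\<close>-projectivity of the induced
  module; the last property is Frobenius reciprocity.\<close>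

theorem ind_maps:
  fixes M :: "('r::comm_ring_1, 'g, 'm) gmod"
  assumes G: "group G" and fin: "finite (carrier G)" and Q: "subgroup Q G" and M: "gmodule (G\<lparr>carrier := Q\<rparr>) M"
  obtains \<eta> \<epsilon> where "gmodule G (gmod_ind G Q M)"
    "lin M (gmod_ind G Q M) \<eta>" "equi Q M (gmod_ind G Q M) \<eta>"
    "lin (gmod_ind G Q M) M \<epsilon>" "equi Q (gmod_ind G Q M) M \<epsilon>"
    "\<And>z. z \<in> carrier (gmod_ind G Q M) \<Longrightarrow>
      (\<Oplus>\<^bsub>gmod_ind G Q M\<^esub>h\<in>carrier G. act (gmod_ind G Q M) h (\<eta> (\<epsilon> (act (gmod_ind G Q M) (inv\<^bsub>G\<^esub> h) z))))
      = of_nat (card Q) \<odot>\<^bsub>gmod_ind G Q M\<^esub> z"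
    "\<And>N r. gmodule G (N :: ('r, 'g, 'n) gmod) \<Longrightarrow> lin M N r \<Longrightarrow> equi Q M N r \<Longrightarrow>
      \<exists>f. lin (gmod_ind G Q M) N f \<and> equi (carrier G) (gmod_ind G Q M) N f \<and> (\<forall>x\<in>carrier M. f (\<eta> x) = r x)"
proof -
  interpret G: group G by fact
  interpret M: gmodule "G\<lparr>carrier := Q\<rparr>" M by fact
  interpret M: rmod M using M by (rule gmodule_rmod)
  have QG: "\<And>q. q \<in> Q \<Longrightarrow> q \<in> carrier G" using subgroup.subset[OF Q] by blast
  have ac: "act M q x \<in> carrier M" if "q \<in> Q" "x \<in> carrier M" for q x using M.act_closed that by simp
  have al: "lin M M (act M q)" if "q \<in> Q" for q using act_lin[OF M] that by simp
  interpret pr: presentation G "carrier G \<times> carrier M" "\<lambda>h (g, x). (h \<otimes>\<^bsub>G\<^esub> g, x)" "ind_rel G Q M"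
    by (rule presentation_ind[OF G Q M])
  note eq = gmod_ind_eq[of G Q M]
  let ?P = "gmod_ind G Q M"
  have gm: "gmodule G ?P" unfolding eq by (rule pr.gmodule_PP)
  interpret P: gmodule G ?P by (rule gm)
  interpret P: rmod ?P using gm by (rule gmodule_rmod)
  define t where "t g x = pr.gen (g, x)" for g x
  have tc: "t g x \<in> carrier ?P" if "g \<in> carrier G" "x \<in> carrier M" for g x
    unfolding t_def eq using that by (intro pr.gen_closed) auto
  have t_lin: "lin M ?P (t g)" if "g \<in> carrier G" for g
    using that tc unfolding lin_def t_def eq
    by (intro conjI ballI allI pr.gen_rel3 pr.gen_rel2 ind_relI) simp_all
  have t_bal: "t (g \<otimes>\<^bsub>G\<^esub> q) x = t g (act M q x)" if "g \<in> carrier G" "q \<in> Q" "x \<in> carrier M" for g q x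
  proof -
    have "pr.gen (g \<otimes>\<^bsub>G\<^esub> q, x) = 1 \<odot>\<^bsub>pr.PP\<^esub> pr.gen (g, act M q x)"
      using that QG ac by (intro pr.gen_rel2 ind_relI) auto
    then show ?thesis using P.rmod_one[OF tc[of g "act M q x"]] that ac unfolding t_def eq by simp
  qed
  have act_t: "act ?P h (t g x) = t (h \<otimes>\<^bsub>G\<^esub> g) x" if "h \<in> carrier G" "g \<in> carrier G" "x \<in> carrier M" for g h x
    unfolding t_def eq using that by (subst pr.act_gen) auto
  have eqI: "f x = h x" if "rmod Y" "lin ?P Y f" "lin ?P Y h" "x \<in> carrier ?P"
    "\<And>g x. g \<in> carrier G \<Longrightarrow> x \<in> carrier M \<Longrightarrow> f (t g x) = h (t g x)"
    for Y :: "('r, 'y, 'w) module_scheme" and f h x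
    using pr.gen_lin_eqI[OF that(1), of f h x] that(2-) unfolding t_def eq by auto
  have lift: "\<exists>f. lin ?P Y f \<and> (\<forall>g\<in>carrier G. \<forall>x\<in>carrier M. f (t g x) = h g x)"
    if Y: "rmod Y" and h1: "\<And>g. g \<in> carrier G \<Longrightarrow> lin M Y (h g)"
      and h2: "\<And>g q x. g \<in> carrier G \<Longrightarrow> q \<in> Q \<Longrightarrow> x \<in> carrier M \<Longrightarrow> h (g \<otimes>\<^bsub>G\<^esub> q) x = h g (act M q x)"
    for Y :: "('r, 'y, 'w) module_scheme" and h
  proof -
    interpret Y: rmod Y by fact
    have S: "case_prod h \<in> carrier G \<times> carrier M \<rightarrow> carrier Y" using lin_closed[OF h1] by auto
    obtain f where "lin pr.PP Y f" "\<And>s. s \<in> carrier G \<times> carrier M \<Longrightarrow> f (pr.gen s) = case_prod h s"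
    proof (rule pr.gen_lift[OF Y S])
      show "lext Y (case_prod h) e = \<zero>\<^bsub>Y\<^esub>" if "e \<in> ind_rel G Q M" for e
        using that
        by (cases rule: ind_relE)
          (use S lin_add[OF h1] lin_smult[OF h1] h2 lin_closed[OF h1] QG ac in
            \<open>auto intro!: pr.lext_rel2[OF Y] pr.lext_rel3[OF Y]\<close>)
    qed auto
    then show ?thesis unfolding t_def eq by (intro exI[of _ f]) auto
  qed
  define \<eta> where "\<eta> = t \<one>\<^bsub>G\<^esub>"
  have eta_lin: "lin M ?P \<eta>" unfolding \<eta>_def by (rule t_lin) simp
  have eta_act: "act ?P h (\<eta> x) = t h x" if "h \<in> carrier G" "x \<in> carrier M" for h x
    using act_t[of h "\<one>\<^bsub>G\<^esub>" x] that by (simp add: \<eta>_def)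
  have eta_equi: "equi Q M ?P \<eta>"
    using t_bal[of "\<one>\<^bsub>G\<^esub>"] eta_act QG by (simp add: equi_def) (simp add: \<eta>_def)
  have "\<exists>f. lin ?P M f \<and> (\<forall>g\<in>carrier G. \<forall>x\<in>carrier M. f (t g x) = (if g \<in> Q then act M g x else \<zero>\<^bsub>M\<^esub>))"
  proof (rule lift[OF M.rmod_axioms])
    show "lin M M (\<lambda>x. if g \<in> Q then act M g x else \<zero>\<^bsub>M\<^esub>)" for g
      using al[of g] by (auto simp: lin_def)
    fix g q x assume g: "g \<in> carrier G" "q \<in> Q" "x \<in> carrier M"
    have "g \<otimes>\<^bsub>G\<^esub> q \<in> Q \<longleftrightarrow> g \<in> Q"
    proof
      assume "g \<otimes>\<^bsub>G\<^esub> q \<in> Q"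
      then have "g \<otimes>\<^bsub>G\<^esub> q \<otimes>\<^bsub>G\<^esub> inv\<^bsub>G\<^esub> q \<in> Q"
        using g subgroup.m_closed[OF Q] subgroup.m_inv_closed[OF Q] by blast
      then show "g \<in> Q" using g QG by (simp add: G.m_assoc)
    qed (use g subgroup.m_closed[OF Q] in blast)
    then show "(if g \<otimes>\<^bsub>G\<^esub> q \<in> Q then act M (g \<otimes>\<^bsub>G\<^esub> q) x else \<zero>\<^bsub>M\<^esub>) =
        (if g \<in> Q then act M g (act M q x) else \<zero>\<^bsub>M\<^esub>)"
      using M.act_mult[of g q x] g by simp
  qed
  then obtain \<epsilon> where eps_lin: "lin ?P M \<epsilon>"
    and eps: "\<And>g x. g \<in> carrier G \<Longrightarrow> x \<in> carrier M \<Longrightarrow> \<epsilon> (t g x) = (if g \<in> Q then act M g x else \<zero>\<^bsub>M\<^esub>)" by blast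
  have eps_equi: "equi Q ?P M \<epsilon>"
    unfolding equi_def
  proof (intro ballI)
    fix q z assume q: "q \<in> Q" and z: "z \<in> carrier ?P"
    show "\<epsilon> (act ?P q z) = act M q (\<epsilon> z)"
    proof (rule eqI[OF M.rmod_axioms lin_comp[OF act_lin[OF gm QG[OF q]] eps_lin] lin_comp[OF eps_lin al[OF q]] z])
      fix g x assume g: "g \<in> carrier G" "x \<in> carrier M"
      have "q \<otimes>\<^bsub>G\<^esub> g \<in> Q \<longleftrightarrow> g \<in> Q"
      proof
        assume "q \<otimes>\<^bsub>G\<^esub> g \<in> Q"
        then have "inv\<^bsub>G\<^esub> q \<otimes>\<^bsub>G\<^esub> (q \<otimes>\<^bsub>G\<^esub> g) \<in> Q"
          using q subgroup.m_closed[OF Q] subgroup.m_inv_closed[OF Q] by blast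
        then show "g \<in> Q" using q g QG by (simp add: G.m_assoc[symmetric])
      qed (use q subgroup.m_closed[OF Q] in blast)
      then show "\<epsilon> (act ?P q (t g x)) = act M q (\<epsilon> (t g x))"
        using q g QG M.act_mult[of q g x] lin_zero[OF M.rmod_axioms M.rmod_axioms al[OF q]]
        by (simp add: act_t eps)
    qed
  qed
  have transfer_map: "(\<Oplus>\<^bsub>?P\<^esub>h\<in>carrier G. act ?P h (\<eta> (\<epsilon> (act ?P (inv\<^bsub>G\<^esub> h) z)))) = of_nat (card Q) \<odot>\<^bsub>?P\<^esub> z"
    if z: "z \<in> carrier ?P" for z
  proof (rule eqI[OF P.rmod_axioms _ _ z])
    show "lin ?P ?P (\<lambda>z. \<Oplus>\<^bsub>?P\<^esub>h\<in>carrier G. act ?P h (\<eta> (\<epsilon> (act ?P (inv\<^bsub>G\<^esub> h) z))))"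
    proof (rule lin_sum[OF P.rmod_axioms P.rmod_axioms fin])
      fix h assume h: "h \<in> carrier G"
      show "lin ?P ?P (\<lambda>z. act ?P h (\<eta> (\<epsilon> (act ?P (inv\<^bsub>G\<^esub> h) z))))"
        by (rule lin_comp[OF lin_comp[OF lin_comp[OF act_lin[OF gm G.inv_closed[OF h]] eps_lin] eta_lin] act_lin[OF gm h]])
    qed
    show "lin ?P ?P ((\<odot>\<^bsub>?P\<^esub>) (of_nat (card Q)))" by (rule lin_scale[OF P.rmod_axioms lin_id])
    fix g x assume g: "g \<in> carrier G" "x \<in> carrier M"
    have "(\<Oplus>\<^bsub>?P\<^esub>h\<in>carrier G. act ?P h (\<eta> (\<epsilon> (act ?P (inv\<^bsub>G\<^esub> h) (t g x))))) =
        (\<Oplus>\<^bsub>?P\<^esub>h\<in>carrier G. if inv\<^bsub>G\<^esub> h \<otimes>\<^bsub>G\<^esub> g \<in> Q then t g x else \<zero>\<^bsub>?P\<^esub>)"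
    \<comment> \<open>The summand is \<open>t g x\<close> for \<open>h\<close> in the coset
      \<open>gQ\<close> and vanishes otherwise, so |Q| copies of \<open>t g x\<close>
      remain.\<close>
    proof (intro P.M.finsum_cong' refl)
      fix h assume h: "h \<in> carrier G"
      show "act ?P h (\<eta> (\<epsilon> (act ?P (inv\<^bsub>G\<^esub> h) (t g x)))) = (if inv\<^bsub>G\<^esub> h \<otimes>\<^bsub>G\<^esub> g \<in> Q then t g x else \<zero>\<^bsub>?P\<^esub>)"
      proof (cases "inv\<^bsub>G\<^esub> h \<otimes>\<^bsub>G\<^esub> g \<in> Q")
        case True
        then have "act ?P h (\<eta> (\<epsilon> (act ?P (inv\<^bsub>G\<^esub> h) (t g x)))) = t h (act M (inv\<^bsub>G\<^esub> h \<otimes>\<^bsub>G\<^esub> g) x)"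
          using g h ac by (simp add: act_t eps eta_act)
        also have "\<dots> = t (h \<otimes>\<^bsub>G\<^esub> (inv\<^bsub>G\<^esub> h \<otimes>\<^bsub>G\<^esub> g)) x" using True g h by (simp add: t_bal)
        also have "h \<otimes>\<^bsub>G\<^esub> (inv\<^bsub>G\<^esub> h \<otimes>\<^bsub>G\<^esub> g) = g" using g h by (simp add: G.m_assoc[symmetric])
        finally show ?thesis using True by simp
      next
        case False
        then show ?thesis
          using g h lin_zero[OF M.rmod_axioms P.rmod_axioms eta_lin]
            lin_zero[OF P.rmod_axioms P.rmod_axioms act_lin[OF gm h]]
          by (simp add: act_t eps)
      qed
    qed (use g tc in auto)
    also have "\<dots> = of_nat (card {h \<in> carrier G. inv\<^bsub>G\<^esub> h \<otimes>\<^bsub>G\<^esub> g \<in> Q}) \<odot>\<^bsub>?P\<^esub> t g x"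
      by (rule finsum_indicator[OF P.rmod_axioms fin tc[OF g]])
    also have "card {h \<in> carrier G. inv\<^bsub>G\<^esub> h \<otimes>\<^bsub>G\<^esub> g \<in> Q} = card Q"
    proof (rule bij_betw_same_card[symmetric])
      show "bij_betw (\<lambda>q. g \<otimes>\<^bsub>G\<^esub> inv\<^bsub>G\<^esub> q) Q {h \<in> carrier G. inv\<^bsub>G\<^esub> h \<otimes>\<^bsub>G\<^esub> g \<in> Q}"
      proof (rule bij_betw_byWitness[where f' = "\<lambda>h. inv\<^bsub>G\<^esub> h \<otimes>\<^bsub>G\<^esub> g"])
        show "\<forall>q\<in>Q. inv\<^bsub>G\<^esub> (g \<otimes>\<^bsub>G\<^esub> inv\<^bsub>G\<^esub> q) \<otimes>\<^bsub>G\<^esub> g = q"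
          using g QG by (simp add: G.inv_mult_group G.m_assoc)
        show "\<forall>h\<in>{h \<in> carrier G. inv\<^bsub>G\<^esub> h \<otimes>\<^bsub>G\<^esub> g \<in> Q}. g \<otimes>\<^bsub>G\<^esub> inv\<^bsub>G\<^esub> (inv\<^bsub>G\<^esub> h \<otimes>\<^bsub>G\<^esub> g) = h"
          using g by (simp add: G.inv_mult_group G.m_assoc[symmetric])
      qed (use g QG in \<open>auto simp: G.inv_mult_group G.m_assoc\<close>)
    qed
    finally show "(\<Oplus>\<^bsub>?P\<^esub>h\<in>carrier G. act ?P h (\<eta> (\<epsilon> (act ?P (inv\<^bsub>G\<^esub> h) (t g x))))) =
        of_nat (card Q) \<odot>\<^bsub>?P\<^esub> t g x" .
  qed
  have "\<exists>f. lin ?P N f \<and> equi (carrier G) ?P N f \<and> (\<forall>x\<in>carrier M. f (\<eta> x) = r x)"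
    if N: "gmodule G N" and r: "lin M N r" "equi Q M N r" for N :: "('r, 'g, 'n) gmod" and r
  proof -
    interpret N: gmodule G N by fact
    interpret N: rmod N using N by (rule gmodule_rmod)
    have "\<exists>f. lin ?P N f \<and> (\<forall>g\<in>carrier G. \<forall>x\<in>carrier M. f (t g x) = act N g (r x))"
      using lin_comp[OF r(1) act_lin[OF N]] QG equiD[OF r(2)] lin_closed[OF r(1)]
      by (intro lift[OF N.rmod_axioms]) (auto simp: N.act_mult)
    then obtain f where f: "lin ?P N f" "\<And>g x. g \<in> carrier G \<Longrightarrow> x \<in> carrier M \<Longrightarrow> f (t g x) = act N g (r x)" by blast
    have "f (act ?P h z) = act N h (f z)" if h: "h \<in> carrier G" and z: "z \<in> carrier ?P" for h z
      using h f(2) lin_closed[OF r(1)]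
      by (intro eqI[OF N.rmod_axioms lin_comp[OF act_lin[OF gm h] f(1)] lin_comp[OF f(1) act_lin[OF N h]] z])
        (auto simp: act_t N.act_mult)
    moreover have "f (\<eta> x) = r x" if "x \<in> carrier M" for x
      using f(2)[of "\<one>\<^bsub>G\<^esub>" x] that lin_closed[OF r(1)] by (simp add: \<eta>_def N.act_one)
    ultimately show ?thesis using f(1) by (auto simp: equi_def)
  qed
  then show ?thesis using that[OF gm eta_lin eta_equi eps_lin eps_equi transfer_map] by blast
qed

section \<open>The transfer and the criterion of Higman\<close>

definition transfer_map :: "('g, 'z) monoid_scheme \<Rightarrow> ('r, 'g, 'm) gmod \<Rightarrow> ('m \<Rightarrow> 'm) \<Rightarrow> 'm \<Rightarrow> 'm" where
  "transfer_map G M a x = (\<Oplus>\<^bsub>M\<^esub>g\<in>carrier G. act M g (a (act M (inv\<^bsub>G\<^esub> g) x)))"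

lemma act_inv:
  assumes "gmodule G M" "g \<in> carrier G" "x \<in> carrier M"
  shows "act M g (act M (inv\<^bsub>G\<^esub> g) x) = x" "act M (inv\<^bsub>G\<^esub> g) (act M g x) = x"
proof -
  interpret gmodule G M by fact
  show "act M g (act M (inv\<^bsub>G\<^esub> g) x) = x" "act M (inv\<^bsub>G\<^esub> g) (act M g x) = x"
    using act_mult[of g "inv\<^bsub>G\<^esub> g" x] act_mult[of "inv\<^bsub>G\<^esub> g" g x] assms act_one by simp_all
qed

lemma conj_lin:
  assumes "gmodule G M" "g \<in> carrier G" "lin M M a"
  shows "lin M M (\<lambda>x. act M g (a (act M (inv\<^bsub>G\<^esub> g) x)))"
proof -
  interpret gmodule G M by fact
  show ?thesis
    using lin_comp[OF lin_comp[OF act_lin[OF assms(1) G.inv_closed[OF assms(2)]] assms(3)] act_lin[OF assms(1,2)]] .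
qed

lemma transfer_lin:
  assumes "gmodule G M" "finite (carrier G)" "lin M M a"
  shows "lin M M (transfer_map G M a)"
  unfolding transfer_map_def using gmodule_rmod[OF assms(1)] assms(2) conj_lin[OF assms(1) _ assms(3)]
  by (intro lin_sum)

lemma transfer_equi:
  assumes M: "gmodule G M" and fin: "finite (carrier G)" and a: "lin M M a"
  shows "equi (carrier G) M M (transfer_map G M a)"
  unfolding equi_def
proof (intro ballI)
  fix h x assume h: "h \<in> carrier G" and x: "x \<in> carrier M"
  interpret gmodule G M by fact
  interpret M: rmod M using M by (rule gmodule_rmod)
  have cl: "act M g (a (act M (inv\<^bsub>G\<^esub> g) x)) \<in> carrier M" if "g \<in> carrier G" "x \<in> carrier M" for g x
    using lin_closed[OF conj_lin[OF M that(1) a] that(2)] .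
  have bij: "inj_on (\<lambda>g. h \<otimes>\<^bsub>G\<^esub> g) (carrier G)" "(\<lambda>g. h \<otimes>\<^bsub>G\<^esub> g) ` carrier G = carrier G"
    using G.inj_on_cmult[OF h] G.surj_const_mult[OF h] by auto
  have "transfer_map G M a (act M h x) = (\<Oplus>\<^bsub>M\<^esub>g\<in>(\<lambda>g. h \<otimes>\<^bsub>G\<^esub> g) ` carrier G. act M g (a (act M (inv\<^bsub>G\<^esub> g) (act M h x))))"
    by (simp only: transfer_map_def bij(2))
  also have "\<dots> = (\<Oplus>\<^bsub>M\<^esub>g\<in>carrier G. act M (h \<otimes>\<^bsub>G\<^esub> g) (a (act M (inv\<^bsub>G\<^esub> (h \<otimes>\<^bsub>G\<^esub> g)) (act M h x))))"
    using bij h x cl[OF _ act_closed[OF h x]] by (intro M.M.finsum_reindex) auto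
  also have "\<dots> = (\<Oplus>\<^bsub>M\<^esub>g\<in>carrier G. act M h (act M g (a (act M (inv\<^bsub>G\<^esub> g) x))))"
  proof (intro M.M.finsum_cong' refl)
    fix g assume g: "g \<in> carrier G"
    have "inv\<^bsub>G\<^esub> (h \<otimes>\<^bsub>G\<^esub> g) \<otimes>\<^bsub>G\<^esub> h = inv\<^bsub>G\<^esub> g" using g h by (simp add: G.inv_mult_group G.m_assoc)
    then have "act M (inv\<^bsub>G\<^esub> (h \<otimes>\<^bsub>G\<^esub> g)) (act M h x) = act M (inv\<^bsub>G\<^esub> g) x"
      using act_mult[of "inv\<^bsub>G\<^esub> (h \<otimes>\<^bsub>G\<^esub> g)" h x] g h x by simp
    then show "act M (h \<otimes>\<^bsub>G\<^esub> g) (a (act M (inv\<^bsub>G\<^esub> (h \<otimes>\<^bsub>G\<^esub> g)) (act M h x))) = act M h (act M g (a (act M (inv\<^bsub>G\<^esub> g) x)))"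
      using g h x lin_closed[OF a] act_closed by (simp add: act_mult)
  qed (use h x cl act_closed in auto)
  also have "\<dots> = act M h (transfer_map G M a x)"
    unfolding transfer_map_def using fin cl x
    by (intro lin_finsum[OF M.rmod_axioms M.rmod_axioms act_lin[OF M h], symmetric]) auto
  finally show "transfer_map G M a (act M h x) = act M h (transfer_map G M a x)" .
qed

lemma mod_trace_conj:
  assumes "gmodule G M" "free_of_finite_rank M" "g \<in> carrier G" "lin M M a"
  shows "mod_trace M (\<lambda>x. act M g (a (act M (inv\<^bsub>G\<^esub> g) x))) = mod_trace M a"
proof -
  interpret gmodule G M by fact
  note rm = gmodule_rmod[OF assms(1)]
  have l: "lin M M (act M (inv\<^bsub>G\<^esub> g))" "lin M M (act M g)" using act_lin[OF assms(1)] assms(3) by auto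
  have "mod_trace M (\<lambda>x. act M g (a (act M (inv\<^bsub>G\<^esub> g) x))) = mod_trace M (\<lambda>x. act M (inv\<^bsub>G\<^esub> g) (act M g (a x)))"
    using mod_trace_commute[OF rm rm assms(2,2) l(1) lin_comp[OF assms(4) l(2)]] .
  also have "\<dots> = mod_trace M a"
    using act_inv[OF assms(1,3)] lin_closed[OF assms(4)]
    by (intro mod_trace_cong[OF rm assms(2) lin_comp[OF lin_comp[OF assms(4) l(2)] l(1)]]) auto
  finally show ?thesis .
qed

lemma mod_trace_transfer:
  assumes "gmodule G M" "finite (carrier G)" "free_of_finite_rank M" "lin M M a"
  shows "mod_trace M (transfer_map G M a) = of_nat (card (carrier G)) * mod_trace M a"
  unfolding transfer_map_def[abs_def]
  using mod_trace_sum[OF gmodule_rmod[OF assms(1)] assms(3,2) conj_lin[OF assms(1) _ assms(4)]]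
    mod_trace_conj[OF assms(1,3) _ assms(4)] by simp

text \<open>Torsion-freeness over a domain, read off coordinates. It takes the place of division by
  |Q|.\<close>

lemma free_cancel:
  fixes M :: "('r::idom, 'm, 'x) module_scheme"
  assumes "rmod M" "free_of_finite_rank M" "a \<noteq> 0" "x \<in> carrier M" "y \<in> carrier M" "a \<odot>\<^bsub>M\<^esub> x = a \<odot>\<^bsub>M\<^esub> y"
  shows "x = y"
proof -
  obtain B c where B: "coords M B (\<lambda>b. b) c" using free_coords assms by blast
  have "c i x = c i y" if "i \<in> B" for i
  proof -
    have "a * c i x = a * c i y"
      using assms fun_smult[OF coordsD(4)[OF B that], of _ a] by metis
    then show ?thesis using assms(3) by simp
  qed
  then show ?thesis using coords_eqI[OF B] assms by blast
qed

text \<open>As \<open>a\<close> commutes with \<open>Q\<close>, replacing \<open>g\<close> by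
  \<open>g q\<close> leaves the conjugate of \<open>a\<close> by \<open>g\<close> unchanged.\<close>

lemma coset_invariant_conj:
  assumes N: "gmodule G N" and P: "gmodule G P" and fin: "finite (carrier G)" and Q: "subgroup Q G"
    and a: "lin N P a" "equi Q N P a" and x: "x \<in> carrier N"
  shows "coset_invariant G P Q (\<lambda>g. act P g (a (act N (inv\<^bsub>G\<^esub> g) x)))"
proof -
  interpret N: gmodule G N by fact
  interpret P: gmodule G P by fact
  interpret P: rmod P using P by (rule gmodule_rmod)
  have QG: "\<And>q. q \<in> Q \<Longrightarrow> q \<in> carrier G" using subgroup.subset[OF Q] by blast
  show ?thesis
  proof
    fix g assume g: "g \<in> carrier G"
    then show "act P g (a (act N (inv\<^bsub>G\<^esub> g) x)) \<in> carrier P"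
      using x N.act_closed P.act_closed lin_closed[OF a(1)] by simp
    fix q assume q: "q \<in> Q"
    let ?y = "act N (inv\<^bsub>G\<^esub> g) x"
    have y: "?y \<in> carrier N" using x g N.act_closed by simp
    have iq: "act N (inv\<^bsub>G\<^esub> q) ?y \<in> carrier N" using y q QG N.act_closed by simp
    have "act P (g \<otimes>\<^bsub>G\<^esub> q) (a (act N (inv\<^bsub>G\<^esub> (g \<otimes>\<^bsub>G\<^esub> q)) x)) = act P g (act P q (a (act N (inv\<^bsub>G\<^esub> q) ?y)))"
      using g q QG x iq lin_closed[OF a(1)] N.G.inv_mult_group[of g q] N.act_mult[of "inv\<^bsub>G\<^esub> q" "inv\<^bsub>G\<^esub> g" x]
        P.act_mult[of g q "a (act N (inv\<^bsub>G\<^esub> q) ?y)"]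
      by simp
    also have "act P q (a (act N (inv\<^bsub>G\<^esub> q) ?y)) = a (act N q (act N (inv\<^bsub>G\<^esub> q) ?y))"
      using equiD[OF a(2) q iq] by simp
    also have "act N q (act N (inv\<^bsub>G\<^esub> q) ?y) = ?y" using act_inv(1)[OF N QG[OF q] y] .
    finally show "act P (g \<otimes>\<^bsub>G\<^esub> q) (a (act N (inv\<^bsub>G\<^esub> (g \<otimes>\<^bsub>G\<^esub> q)) x)) = act P g (a ?y)" .
  qed (use fin QG subgroup.m_closed[OF Q] subgroup.one_closed[OF Q] subgroup.m_inv_closed[OF Q] in auto)
qed

lemma coset_sum_conj:
  assumes N: "gmodule G N" and P: "gmodule G P" and fin: "finite (carrier G)" and Q: "subgroup Q G"
    and a: "lin N P a" "equi Q N P a"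
  defines "s \<equiv> \<lambda>x. coset_sum G Q P (\<lambda>g. act P g (a (act N (inv\<^bsub>G\<^esub> g) x)))"
  shows "lin N P s" "equi (carrier G) N P s"
proof -
  interpret N: gmodule G N by fact
  interpret P: gmodule G P by fact
  interpret N: rmod N using N by (rule gmodule_rmod)
  interpret P: rmod P using P by (rule gmodule_rmod)
  note ci = coset_invariant_conj[OF N P fin Q a]
  have l: "lin N P (\<lambda>x. act P g (a (act N (inv\<^bsub>G\<^esub> g) x)))" if "g \<in> carrier G" for g
    using lin_comp[OF lin_comp[OF act_lin[OF N N.G.inv_closed[OF that]] a(1)] act_lin[OF P that]] .
  show "lin N P s"
    unfolding s_def coset_sum_def
  proof (rule lin_sum[OF N.rmod_axioms P.rmod_axioms finite_imageI[OF fin]])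
    fix C assume "C \<in> (\<lambda>g. g <#\<^bsub>G\<^esub> Q) ` carrier G"
    then have "(SOME g. g \<in> C) \<in> carrier G"
      using coset_invariant.some_coset_closed[OF ci[OF N.M.zero_closed]] by auto
    then show "lin N P (\<lambda>x. act P (SOME g. g \<in> C) (a (act N (inv\<^bsub>G\<^esub> (SOME g. g \<in> C)) x)))" by (rule l)
  qed
  show "equi (carrier G) N P s"
    unfolding equi_def
  proof (intro ballI)
    fix h x assume h: "h \<in> carrier G" and x: "x \<in> carrier N"
    have hx: "act N h x \<in> carrier N" using h x by (rule N.act_closed)
    interpret c: coset_invariant G P Q "\<lambda>g. act P g (a (act N (inv\<^bsub>G\<^esub> g) (act N h x)))" by (rule ci[OF hx])
    interpret d: coset_invariant G P Q "\<lambda>g. act P g (a (act N (inv\<^bsub>G\<^esub> g) x))" by (rule ci[OF x])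
    \<comment> \<open>The sum for \<open>act N h x\<close> is shifted by \<open>h\<close>, after
      which \<open>h\<close> can be pulled out of every summand.\<close>
    have "s (act N h x) = coset_sum G Q P (\<lambda>g. act P (h \<otimes>\<^bsub>G\<^esub> g) (a (act N (inv\<^bsub>G\<^esub> (h \<otimes>\<^bsub>G\<^esub> g)) (act N h x))))"
      unfolding s_def by (rule c.coset_sum_shift[OF h, symmetric])
    also have "\<dots> = (\<Oplus>\<^bsub>P\<^esub>C\<in>(\<lambda>g. g <#\<^bsub>G\<^esub> Q) ` carrier G. act P h (act P (SOME g. g \<in> C) (a (act N (inv\<^bsub>G\<^esub> (SOME g. g \<in> C)) x))))"
      unfolding coset_sum_def
    proof (intro P.M.finsum_cong' refl)
      fix C assume "C \<in> (\<lambda>g. g <#\<^bsub>G\<^esub> Q) ` carrier G"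
      then have g: "(SOME g. g \<in> C) \<in> carrier G" using d.some_coset_closed by auto
      let ?g = "SOME g. g \<in> C"
      have "inv\<^bsub>G\<^esub> (h \<otimes>\<^bsub>G\<^esub> ?g) \<otimes>\<^bsub>G\<^esub> h = inv\<^bsub>G\<^esub> ?g" using g h by (simp add: N.G.inv_mult_group N.G.m_assoc)
      then have "act N (inv\<^bsub>G\<^esub> (h \<otimes>\<^bsub>G\<^esub> ?g)) (act N h x) = act N (inv\<^bsub>G\<^esub> ?g) x"
        using N.act_mult[of "inv\<^bsub>G\<^esub> (h \<otimes>\<^bsub>G\<^esub> ?g)" h x] g h x by simp
      then show "act P (h \<otimes>\<^bsub>G\<^esub> ?g) (a (act N (inv\<^bsub>G\<^esub> (h \<otimes>\<^bsub>G\<^esub> ?g)) (act N h x))) = act P h (act P ?g (a (act N (inv\<^bsub>G\<^esub> ?g) x)))"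
        using g h x lin_closed[OF a(1)] N.act_closed by (simp add: P.act_mult)
    qed (use h x d.closed d.some_coset_closed P.act_closed in auto)
    also have "\<dots> = act P h (s x)"
      unfolding s_def coset_sum_def using fin d.closed d.some_coset_closed
      by (intro lin_finsum[OF P.rmod_axioms P.rmod_axioms act_lin[OF P h], symmetric]) auto
    finally show "s (act N h x) = act P h (s x)" .
  qed
qed

text \<open>Divisibility by |Q| inside the equivariant endomorphisms. When these are scalars, the
  scalar of the transfer is |Q| times an element of the ring.\<close>

lemma transfer_eq_index_smult:
  assumes "gmodule G M" "finite (carrier G)" "subgroup Q G" "lin M M a" "equi Q M M a"
  obtains s where "lin M M s" "equi (carrier G) M M s"
    "\<And>x. x \<in> carrier M \<Longrightarrow> transfer_map G M a x = of_nat (card Q) \<odot>\<^bsub>M\<^esub> s x"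
  using that[OF coset_sum_conj[OF assms(1,1,2-5)]]
    coset_invariant.sum_eq_coset_sum[OF coset_invariant_conj[OF assms(1,1,2-5)]] by (simp add: transfer_map_def)

text \<open>The witness \<open>\<eta> \<epsilon>\<close> on the induced module is compressed along
  the split pair. Keeping \<alpha> and \<beta> apart records that the witness factors through
  \<open>M\<close>, which matters when \<open>M\<close> is a source.\<close>

theorem higman_necessary:
  assumes N: "gmodule G N" and fin: "finite (carrier G)" and Q: "subgroup Q G"
    and M: "gmodule (G\<lparr>carrier := Q\<rparr>) M" and s: "iso_to_direct_summand G N (gmod_ind G Q M)"
  obtains \<alpha> \<beta> where "lin N M \<alpha>" "equi Q N M \<alpha>" "lin M N \<beta>" "equi Q M N \<beta>"
    "\<And>x. x \<in> carrier N \<Longrightarrow> transfer_map G N (\<lambda>x. \<beta> (\<alpha> x)) x = of_nat (card Q) \<odot>\<^bsub>N\<^esub> x"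
proof -
  interpret N: gmodule G N by fact
  interpret N: rmod N using N by (rule gmodule_rmod)
  let ?P = "gmod_ind G Q M"
  obtain \<eta> \<epsilon> where P: "gmodule G ?P" and eta: "lin M ?P \<eta>" "equi Q M ?P \<eta>" and eps: "lin ?P M \<epsilon>" "equi Q ?P M \<epsilon>"
    and t: "\<And>z. z \<in> carrier ?P \<Longrightarrow> (\<Oplus>\<^bsub>?P\<^esub>h\<in>carrier G. act ?P h (\<eta> (\<epsilon> (act ?P (inv\<^bsub>G\<^esub> h) z)))) = of_nat (card Q) \<odot>\<^bsub>?P\<^esub> z"
    by (rule ind_maps[OF N.G.group_axioms fin Q M]) (rule that)
  interpret P: gmodule G ?P by (rule P)
  interpret P: rmod ?P using P by (rule gmodule_rmod)
  obtain i \<pi> where i: "lin N ?P i" "equi (carrier G) N ?P i" and p: "lin ?P N \<pi>" "equi (carrier G) ?P N \<pi>"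
    and pi: "\<And>x. x \<in> carrier N \<Longrightarrow> \<pi> (i x) = x"
    using iso_summand_split[OF N P s] by metis
  have QG: "Q \<subseteq> carrier G" using subgroup.subset[OF Q] .
  show ?thesis
  proof (rule that[of "\<lambda>x. \<epsilon> (i x)" "\<lambda>x. \<pi> (\<eta> x)"])
    show "lin N M (\<lambda>x. \<epsilon> (i x))" using lin_comp[OF i(1) eps(1)] .
    show "equi Q N M (\<lambda>x. \<epsilon> (i x))" using equi_comp[OF i(1) equi_mono[OF i(2) QG] eps(2)] .
    show "lin M N (\<lambda>x. \<pi> (\<eta> x))" using lin_comp[OF eta(1) p(1)] .
    show "equi Q M N (\<lambda>x. \<pi> (\<eta> x))" using equi_comp[OF eta equi_mono[OF p(2) QG]] .
    fix x assume x: "x \<in> carrier N"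
    have cl: "act ?P h (\<eta> (\<epsilon> (act ?P (inv\<^bsub>G\<^esub> h) (i x)))) \<in> carrier ?P" if "h \<in> carrier G" for h
      using that x lin_closed[OF i(1)] lin_closed[OF eta(1)] lin_closed[OF eps(1)] P.act_closed by simp
    have "transfer_map G N (\<lambda>x. \<pi> (\<eta> (\<epsilon> (i x)))) x = (\<Oplus>\<^bsub>N\<^esub>h\<in>carrier G. \<pi> (act ?P h (\<eta> (\<epsilon> (act ?P (inv\<^bsub>G\<^esub> h) (i x))))))"
      unfolding transfer_map_def
    proof (intro N.M.finsum_cong' refl)
      fix h assume h: "h \<in> carrier G"
      have "i (act N (inv\<^bsub>G\<^esub> h) x) = act ?P (inv\<^bsub>G\<^esub> h) (i x)" using equiD[OF i(2)] h x by simp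
      moreover have "\<eta> (\<epsilon> (act ?P (inv\<^bsub>G\<^esub> h) (i x))) \<in> carrier ?P"
        using h x lin_closed[OF i(1)] lin_closed[OF eta(1)] lin_closed[OF eps(1)] P.act_closed by simp
      ultimately show "act N h (\<pi> (\<eta> (\<epsilon> (i (act N (inv\<^bsub>G\<^esub> h) x))))) = \<pi> (act ?P h (\<eta> (\<epsilon> (act ?P (inv\<^bsub>G\<^esub> h) (i x)))))"
        using equiD[OF p(2) h] by simp
    qed (use cl lin_closed[OF p(1)] in auto)
    also have "\<dots> = \<pi> (\<Oplus>\<^bsub>?P\<^esub>h\<in>carrier G. act ?P h (\<eta> (\<epsilon> (act ?P (inv\<^bsub>G\<^esub> h) (i x)))))"
      using cl by (intro lin_finsum[OF P.rmod_axioms N.rmod_axioms p(1) fin, symmetric]) auto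
    also have "\<dots> = of_nat (card Q) \<odot>\<^bsub>N\<^esub> x"
      using t[of "i x"] lin_closed[OF i(1) x] pi[OF x] by (simp add: lin_smult[OF p(1)])
    finally show "transfer_map G N (\<lambda>x. \<pi> (\<eta> (\<epsilon> (i x)))) x = of_nat (card Q) \<odot>\<^bsub>N\<^esub> x" .
  qed
qed

text \<open>Frobenius reciprocity turns \<beta> into a map \<open>f\<close> from the induced module
  to \<open>N\<close>, and the sum over \<open>G/Q\<close> of the conjugates of
  \<open>\<eta> \<alpha>\<close> is a section \<open>s\<close> of it. That \<open>f s\<close> is the
  identity is verified after multiplication by |Q|, which turns \<open>f s\<close> into the
  transfer.\<close>

theorem higman_sufficient:
  fixes N :: "('r::idom, 'g, 'n) gmod" and M :: "('r, 'g, 'm) gmod"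
  assumes N: "gmodule G N" and fin: "finite (carrier G)" and Q: "subgroup Q G" and free: "free_of_finite_rank N"
    and nz: "(of_nat (card Q) :: 'r) \<noteq> 0" and M: "gmodule (G\<lparr>carrier := Q\<rparr>) M"
    and \<alpha>: "lin N M \<alpha>" "equi Q N M \<alpha>" and \<beta>: "lin M N \<beta>" "equi Q M N \<beta>"
    and t: "\<And>x. x \<in> carrier N \<Longrightarrow> transfer_map G N (\<lambda>x. \<beta> (\<alpha> x)) x = of_nat (card Q) \<odot>\<^bsub>N\<^esub> x"
  shows "iso_to_direct_summand G N (gmod_ind G Q M)"
proof -
  interpret N: gmodule G N by fact
  interpret N: rmod N using N by (rule gmodule_rmod)
  let ?P = "gmod_ind G Q M"
  obtain \<eta> \<epsilon> where P: "gmodule G ?P" and eta: "lin M ?P \<eta>" "equi Q M ?P \<eta>"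
    and lift: "\<And>N r. gmodule G (N :: ('r, 'g, 'n) gmod) \<Longrightarrow> lin M N r \<Longrightarrow> equi Q M N r \<Longrightarrow>
      \<exists>f. lin ?P N f \<and> equi (carrier G) ?P N f \<and> (\<forall>x\<in>carrier M. f (\<eta> x) = r x)"
    by (rule ind_maps[OF N.G.group_axioms fin Q M]) (rule that)
  interpret P: gmodule G ?P by (rule P)
  interpret P: rmod ?P using P by (rule gmodule_rmod)
  obtain f where f: "lin ?P N f" "equi (carrier G) ?P N f" "\<And>x. x \<in> carrier M \<Longrightarrow> f (\<eta> x) = \<beta> x"
    using lift[OF N \<beta>] by blast
  define s where "s x = coset_sum G Q ?P (\<lambda>g. act ?P g (\<eta> (\<alpha> (act N (inv\<^bsub>G\<^esub> g) x))))" for x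
  have ea: "lin N ?P (\<lambda>x. \<eta> (\<alpha> x))" "equi Q N ?P (\<lambda>x. \<eta> (\<alpha> x))"
    using lin_comp[OF \<alpha>(1) eta(1)] equi_comp[OF \<alpha> eta(2)] by auto
  note s = coset_sum_conj[OF N P fin Q ea, folded s_def]
  have "f (s x) = x" if x: "x \<in> carrier N" for x
  proof (rule free_cancel[OF N.rmod_axioms free nz])
    interpret c: coset_invariant G ?P Q "\<lambda>g. act ?P g (\<eta> (\<alpha> (act N (inv\<^bsub>G\<^esub> g) x)))"
      by (rule coset_invariant_conj[OF N P fin Q ea x])
    show "f (s x) \<in> carrier N" "x \<in> carrier N" using x lin_closed[OF f(1)] lin_closed[OF s(1)] by auto
    have "of_nat (card Q) \<odot>\<^bsub>N\<^esub> f (s x) = f (of_nat (card Q) \<odot>\<^bsub>?P\<^esub> s x)"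
      using lin_smult[OF f(1)] lin_closed[OF s(1) x] by simp
    also have "\<dots> = f (\<Oplus>\<^bsub>?P\<^esub>g\<in>carrier G. act ?P g (\<eta> (\<alpha> (act N (inv\<^bsub>G\<^esub> g) x))))"
      by (simp add: s_def c.sum_eq_coset_sum)
    also have "\<dots> = (\<Oplus>\<^bsub>N\<^esub>g\<in>carrier G. f (act ?P g (\<eta> (\<alpha> (act N (inv\<^bsub>G\<^esub> g) x)))))"
      using c.closed by (intro lin_finsum[OF P.rmod_axioms N.rmod_axioms f(1) fin]) auto
    also have "\<dots> = transfer_map G N (\<lambda>x. \<beta> (\<alpha> x)) x"
      unfolding transfer_map_def
    proof (intro N.M.finsum_cong' refl)
      fix g assume g: "g \<in> carrier G"
      have "\<alpha> (act N (inv\<^bsub>G\<^esub> g) x) \<in> carrier M" using g x N.act_closed lin_closed[OF \<alpha>(1)] by simp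
      then show "f (act ?P g (\<eta> (\<alpha> (act N (inv\<^bsub>G\<^esub> g) x)))) = act N g (\<beta> (\<alpha> (act N (inv\<^bsub>G\<^esub> g) x)))"
        using equiD[OF f(2) g] f(3) lin_closed[OF eta(1)] by simp
    qed (use x N.act_closed lin_closed[OF \<alpha>(1)] lin_closed[OF \<beta>(1)] in auto)
    finally show "of_nat (card Q) \<odot>\<^bsub>N\<^esub> f (s x) = of_nat (card Q) \<odot>\<^bsub>N\<^esub> x" using t[OF x] by simp
  qed
  then show ?thesis using iso_summandI[OF N P s f(1,2)] by blast
qed

text \<open>When \<open>M\<close> is the restriction of \<open>N\<close> itself, the two factors
  merge into one endomorphism: \<open>\<beta> \<alpha>\<close> in one direction, \<open>a\<close>
  followed by the identity in the other.\<close>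

corollary relatively_projective_iff:
  fixes N :: "('r::idom, 'g, 'n) gmod"
  assumes N: "gmodule G N" and fin: "finite (carrier G)" and free: "free_of_finite_rank N"
    and inj: "inj (of_nat :: nat \<Rightarrow> 'r)"
  shows "relatively_projective G N Q \<longleftrightarrow> subgroup Q G \<and>
    (\<exists>a. lin N N a \<and> equi Q N N a \<and> (\<forall>x\<in>carrier N. transfer_map G N a x = of_nat (card Q) \<odot>\<^bsub>N\<^esub> x))"
proof -
  have nz: "(of_nat (card Q) :: 'r) \<noteq> 0" if "subgroup Q G"
  proof -
    have "card Q \<noteq> 0"
      using finite_subset[OF subgroup.subset[OF that] fin] subgroup.one_closed[OF that] by auto
    then show ?thesis using inj by (metis injD of_nat_0)
  qed
  show ?thesis
  proof
    assume rp: "relatively_projective G N Q"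
    then have Q: "subgroup Q G" by (simp add: relatively_projective_def)
    from rp obtain \<alpha> \<beta> where "lin N N \<alpha>" "equi Q N N \<alpha>" "lin N N \<beta>" "equi Q N N \<beta>"
      "\<And>x. x \<in> carrier N \<Longrightarrow> transfer_map G N (\<lambda>x. \<beta> (\<alpha> x)) x = of_nat (card Q) \<odot>\<^bsub>N\<^esub> x"
      using higman_necessary[OF N fin Q gmodule_restrict[OF N Q]] unfolding relatively_projective_def by metis
    then show "subgroup Q G \<and> (\<exists>a. lin N N a \<and> equi Q N N a \<and> (\<forall>x\<in>carrier N. transfer_map G N a x = of_nat (card Q) \<odot>\<^bsub>N\<^esub> x))"
      using Q lin_comp[of N N \<alpha> N \<beta>] equi_comp[of N N \<alpha> Q N \<beta>] by blast
  next
    assume "subgroup Q G \<and> (\<exists>a. lin N N a \<and> equi Q N N a \<and> (\<forall>x\<in>carrier N. transfer_map G N a x = of_nat (card Q) \<odot>\<^bsub>N\<^esub> x))"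
    then obtain a where a: "lin N N a" "equi Q N N a" "\<And>x. x \<in> carrier N \<Longrightarrow> transfer_map G N a x = of_nat (card Q) \<odot>\<^bsub>N\<^esub> x"
      and Q: "subgroup Q G" by blast
    have "equi Q N N (\<lambda>x. x)" by (simp add: equi_def)
    then show "relatively_projective G N Q"
      unfolding relatively_projective_def
      using higman_sufficient[OF N fin Q free nz[OF Q] gmodule_restrict[OF N Q] a(1,2) lin_id _ a(3)] Q by blast
  qed
qed

subsection \<open>Endomorphisms and characters\<close>

text \<open>Joint injectivity of the coordinates replaces the expansion property: an element and its
  expansion have the same coordinates.\<close>

lemma coordsI:
  assumes "rmod M" "finite I" "\<And>i. i \<in> I \<Longrightarrow> b i \<in> carrier M" "\<And>i. i \<in> I \<Longrightarrow> lin M scal (c i)"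
    and "\<And>i j. i \<in> I \<Longrightarrow> j \<in> I \<Longrightarrow> c i (b j) = (if i = j then 1 else 0)"
    and "\<And>x y. x \<in> carrier M \<Longrightarrow> y \<in> carrier M \<Longrightarrow> (\<And>i. i \<in> I \<Longrightarrow> c i x = c i y) \<Longrightarrow> x = y"
  shows "coords M I b c"
proof -
  interpret M: rmod M by fact
  have "x = (\<Oplus>\<^bsub>M\<^esub>i\<in>I. c i x \<odot>\<^bsub>M\<^esub> b i)" if x: "x \<in> carrier M" for x
  proof (rule assms(6)[OF x])
    show "(\<Oplus>\<^bsub>M\<^esub>i\<in>I. c i x \<odot>\<^bsub>M\<^esub> b i) \<in> carrier M" using assms(3) by (auto intro!: M.M.finsum_closed)
    fix i assume i: "i \<in> I"
    have "c i (\<Oplus>\<^bsub>M\<^esub>j\<in>I. c j x \<odot>\<^bsub>M\<^esub> b j) = (\<Sum>j\<in>I. c i (c j x \<odot>\<^bsub>M\<^esub> b j))"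
      using assms i by (intro fun_sum) auto
    also have "\<dots> = (\<Sum>j\<in>I. if i = j then c j x else 0)"
      using assms i by (intro sum.cong) (auto simp: fun_smult[OF assms(4)])
    finally show "c i x = c i (\<Oplus>\<^bsub>M\<^esub>j\<in>I. c j x \<odot>\<^bsub>M\<^esub> b j)" using i assms(2) by simp
  qed
  then show ?thesis unfolding coords_def using assms by blast
qed

text \<open>All O-endomorphisms as a module. The maps are extensional, since otherwise an element
  would not be determined by its values on the carrier.\<close>

definition linmod :: "('r::comm_ring_1, 'm, 'x) module_scheme \<Rightarrow> ('r, 'm \<Rightarrow> 'm) module" where
  "linmod M = \<lparr>carrier = {f \<in> extensional (carrier M). lin M M f}, monoid.mult = (\<lambda>_ _. undefined),
     one = undefined, ring.zero = (\<lambda>x\<in>carrier M. \<zero>\<^bsub>M\<^esub>), add = (\<lambda>f h. \<lambda>x\<in>carrier M. f x \<oplus>\<^bsub>M\<^esub> h x),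
     module.smult = (\<lambda>a f. \<lambda>x\<in>carrier M. a \<odot>\<^bsub>M\<^esub> f x)\<rparr>"

lemma linmod_simps [simp]:
  "carrier (linmod M) = {f \<in> extensional (carrier M). lin M M f}"
  "\<zero>\<^bsub>linmod M\<^esub> = (\<lambda>x\<in>carrier M. \<zero>\<^bsub>M\<^esub>)" "f \<oplus>\<^bsub>linmod M\<^esub> h = (\<lambda>x\<in>carrier M. f x \<oplus>\<^bsub>M\<^esub> h x)"
  "a \<odot>\<^bsub>linmod M\<^esub> f = (\<lambda>x\<in>carrier M. a \<odot>\<^bsub>M\<^esub> f x)"
  by (simp_all add: linmod_def)

lemma lin_restrict: "rmod M \<Longrightarrow> lin M N (restrict f (carrier M)) = lin M N f"
  by (rule lin_cong) auto

lemma rmod_linmod: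
  assumes "rmod M" shows "rmod (linmod M)"
proof -
  interpret M: rmod M by fact
  have z: "lin M M (\<lambda>x. \<zero>\<^bsub>M\<^esub>)" by (simp add: lin_def)
  show ?thesis
    using lin_plus[OF assms, of M] lin_scale[OF assms, of M] z
    by (intro rmodI)
      (auto simp: lin_restrict[OF assms] lin_closed M.M.a_ac M.rmod_ldistr M.rmod_rdistr M.rmod_assoc
        intro!: extensionalityI[of _ "carrier M"])
qed

lemma linmod_functional:
  assumes "rmod M" "lin M scal c" "x \<in> carrier M"
  shows "lin (linmod M) scal (\<lambda>f. c (f x))"
  using assms by (auto simp: lin_def)

text \<open>The basis consists of the elementary matrices, and the dual functionals read off matrix
  entries.\<close>

lemma coords_linmod:
  fixes M :: "('r::comm_ring_1, 'm, 'x) module_scheme"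
  assumes B: "coords M B (\<lambda>b. b) c"
  shows "coords (linmod M) (B \<times> B) (\<lambda>(i, j). \<lambda>x\<in>carrier M. c j x \<odot>\<^bsub>M\<^esub> i) (\<lambda>(i, j) f. c i (f j))"
proof (rule coordsI)
  note C = coordsD[OF B]
  interpret M: rmod M by (rule C)
  show "rmod (linmod M)" using rmod_linmod C by blast
  show "finite (B \<times> B)" using C by blast
  show "(case k of (i, j) \<Rightarrow> \<lambda>x\<in>carrier M. c j x \<odot>\<^bsub>M\<^esub> i) \<in> carrier (linmod M)" if kB: "k \<in> B \<times> B" for k
  proof -
    obtain i j where k: "k = (i, j)" "i \<in> B" "j \<in> B" using kB by blast
    have "lin M M (\<lambda>x. c j x \<odot>\<^bsub>M\<^esub> i)"
      using C(3)[OF k(2)] C(4)[OF k(3)] by (simp add: lin_def M.rmod_ldistr M.rmod_assoc)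
    then show ?thesis by (simp add: k(1) lin_restrict[OF C(1)])
  qed
  show "lin (linmod M) scal ((\<lambda>(i, j) f. c i (f j)) k)" if "k \<in> B \<times> B" for k
    using that C linmod_functional[OF C(1)] by auto
  show "(\<lambda>(i, j) f. c i (f j)) k (case l of (i, j) \<Rightarrow> \<lambda>x\<in>carrier M. c j x \<odot>\<^bsub>M\<^esub> i) = (if k = l then 1 else 0)"
    if "k \<in> B \<times> B" "l \<in> B \<times> B" for k l
    using that C(3,5) by (auto simp: fun_smult[OF C(4)] split: if_splits)
  show "f = h" if "f \<in> carrier (linmod M)" "h \<in> carrier (linmod M)"
    "\<And>k. k \<in> B \<times> B \<Longrightarrow> (\<lambda>(i, j) f. c i (f j)) k f = (\<lambda>(i, j) f. c i (f j)) k h" for f h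
  proof (rule extensionalityI[of _ "carrier M"])
    show "f \<in> extensional (carrier M)" "h \<in> extensional (carrier M)" using that by auto
    have fh: "lin M M f" "lin M M h" using that by auto
    fix x assume x: "x \<in> carrier M"
    show "f x = h x"
    proof (rule coords_lin_eqI[OF B C(1) fh _ x])
      fix b assume b: "b \<in> B"
      show "f b = h b"
      proof (rule coords_eqI[OF B])
        show "c i (f b) = c i (h b)" if "i \<in> B" for i
          using \<open>\<And>k. k \<in> B \<times> B \<Longrightarrow> (\<lambda>(i, j) f. c i (f j)) k f = (\<lambda>(i, j) f. c i (f j)) k h\<close>[of "(i, b)"] that b by simp
      qed (use fh b C(3) lin_closed in metis)+
    qed
  qed
qed

text \<open>The carrier of \<open>gmod_End\<close>, seen as a submodule of \<open>linmod\<close>, so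
  that the freeness of submodules applies to it.\<close>

definition commutant :: "('g, 'z) monoid_scheme \<Rightarrow> ('r::comm_ring_1, 'g, 'm) gmod \<Rightarrow> ('m \<Rightarrow> 'm) set" where
  "commutant G M = {f \<in> carrier (linmod M). equi (carrier G) M M f}"

lemma equi_plus:
  assumes "gmodule G N" "Q \<subseteq> carrier G" "lin M N f" "lin M N h" "equi Q M N f" "equi Q M N h"
  shows "equi Q M N (\<lambda>x. f x \<oplus>\<^bsub>N\<^esub> h x)"
  unfolding equi_def
proof (intro ballI)
  fix g x assume g: "g \<in> Q" and x: "x \<in> carrier M"
  then have "g \<in> carrier G" using assms(2) by blast
  from lin_add[OF act_lin[OF assms(1) this], of "f x" "h x"]
  show "f (act M g x) \<oplus>\<^bsub>N\<^esub> h (act M g x) = act N g (f x \<oplus>\<^bsub>N\<^esub> h x)"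
    using g x lin_closed[OF assms(3) x] lin_closed[OF assms(4) x] equiD[OF assms(5) g x] equiD[OF assms(6) g x]
    by simp
qed

lemma equi_scale:
  assumes "gmodule G N" "Q \<subseteq> carrier G" "lin M N f" "equi Q M N f"
  shows "equi Q M N (\<lambda>x. a \<odot>\<^bsub>N\<^esub> f x)"
  unfolding equi_def
proof (intro ballI)
  fix g x assume g: "g \<in> Q" and x: "x \<in> carrier M"
  then have "g \<in> carrier G" using assms(2) by blast
  from lin_smult[OF act_lin[OF assms(1) this], of "f x"]
  show "a \<odot>\<^bsub>N\<^esub> f (act M g x) = act N g (a \<odot>\<^bsub>N\<^esub> f x)"
    using g x lin_closed[OF assms(3) x] equiD[OF assms(4) g x] by simp
qed

lemma equi_restrict:
  assumes "gmodule G M" "Q \<subseteq> carrier G"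
  shows "equi Q M N (restrict f (carrier M)) = equi Q M N f"
  using assms gmodule.act_closed[OF assms(1)] by (auto simp: equi_def subset_iff)

lemma submodule_commutant:
  assumes M: "gmodule G M" shows "submodule (commutant G M) rta (linmod M)"
proof -
  interpret M: gmodule G M by fact
  interpret M: rmod M using M by (rule gmodule_rmod)
  interpret L: rmod "linmod M" by (rule rmod_linmod[OF M.rmod_axioms])
  note r = equi_restrict[OF M subset_refl]
  have z: "equi (carrier G) M M (\<lambda>x. \<zero>\<^bsub>M\<^esub>)"
    using lin_zero[OF M.rmod_axioms M.rmod_axioms act_lin[OF M]] by (simp add: equi_def)
  show ?thesis
  proof (rule L.rmod_submoduleI)
    show "commutant G M \<subseteq> carrier (linmod M)" by (auto simp: commutant_def)
    show "\<zero>\<^bsub>linmod M\<^esub> \<in> commutant G M"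
      using L.M.zero_closed z by (simp add: commutant_def r)
    show "f \<oplus>\<^bsub>linmod M\<^esub> h \<in> commutant G M" if "f \<in> commutant G M" "h \<in> commutant G M" for f h
      using that L.M.a_closed[of f h] equi_plus[OF M subset_refl, of M f h] by (simp add: commutant_def r)
    show "a \<odot>\<^bsub>linmod M\<^esub> f \<in> commutant G M" if "f \<in> commutant G M" for a f
      using that L.rmod_smult[of f a] equi_scale[OF M subset_refl, of M f] by (simp add: commutant_def r)
  qed
qed

text \<open>Both sides are the trace of the averaging operator on the endomorphism ring, computed once with
  elementary matrices and once on its image.\<close>

theorem sum_character_squared:
  fixes M :: "('r::comm_ring_1, 'g, 'm) gmod"
  assumes M: "gmodule G M" and fin: "finite (carrier G)" and free: "free_of_finite_rank M"
    and C: "coords (linmod M\<lparr>carrier := commutant G M\<rparr>) J d e"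
  shows "(\<Sum>g\<in>carrier G. mod_trace M (act M g) * mod_trace M (act M (inv\<^bsub>G\<^esub> g))) =
    of_nat (card (carrier G)) * of_nat (card J)"
proof -
  interpret M: gmodule G M by fact
  interpret M: rmod M using M by (rule gmodule_rmod)
  interpret L: rmod "linmod M" by (rule rmod_linmod[OF M.rmod_axioms])
  obtain B c where B: "coords M B (\<lambda>b. b) c" using free_coords[OF M.rmod_axioms free] by blast
  note BD = coordsD[OF B] and CD = coordsD[OF C]
  let ?C = "linmod M\<lparr>carrier := commutant G M\<rparr>"
  have sub: "commutant G M \<subseteq> carrier (linmod M)" by (auto simp: commutant_def)
  define \<sigma> where "\<sigma> f = restrict (transfer_map G M f) (carrier M)" for f
  have sC: "\<sigma> f \<in> commutant G M" if "lin M M f" for f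
    using transfer_lin[OF M fin that] transfer_equi[OF M fin that]
    by (simp add: \<sigma>_def commutant_def lin_restrict[OF M.rmod_axioms] equi_restrict[OF M subset_refl])
  have conj: "act M g (f (act M (inv\<^bsub>G\<^esub> g) x)) \<in> carrier M" if "lin M M f" "g \<in> carrier G" "x \<in> carrier M" for f g x
    using lin_closed[OF conj_lin[OF M that(2,1)] that(3)] .
  have "lin (linmod M) ?C \<sigma>"
    unfolding lin_def
  proof (intro conjI ballI allI)
    show "\<sigma> f \<in> carrier ?C" if "f \<in> carrier (linmod M)" for f using that sC by simp
    fix f assume f: "f \<in> carrier (linmod M)"
    then have lf: "lin M M f" by simp
    have fx: "f x \<in> carrier M" if "x \<in> carrier M" for x using lin_closed[OF lf that] .
    show "\<sigma> (f \<oplus>\<^bsub>linmod M\<^esub> h) = \<sigma> f \<oplus>\<^bsub>?C\<^esub> \<sigma> h" if h: "h \<in> carrier (linmod M)" for h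
    proof -
      have lh: "lin M M h" using h by simp
      have "transfer_map G M (\<lambda>x\<in>carrier M. f x \<oplus>\<^bsub>M\<^esub> h x) x = transfer_map G M f x \<oplus>\<^bsub>M\<^esub> transfer_map G M h x" if x: "x \<in> carrier M" for x
      proof -
        have "transfer_map G M (\<lambda>x\<in>carrier M. f x \<oplus>\<^bsub>M\<^esub> h x) x =
            (\<Oplus>\<^bsub>M\<^esub>g\<in>carrier G. act M g (f (act M (inv\<^bsub>G\<^esub> g) x)) \<oplus>\<^bsub>M\<^esub> act M g (h (act M (inv\<^bsub>G\<^esub> g) x)))"
          unfolding transfer_map_def using x conj[OF lf _ x] conj[OF lh _ x] fx lin_closed[OF lh] M.act_closed
          by (intro M.M.finsum_cong') (auto simp: M.act_add)
        then show ?thesis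
          unfolding transfer_map_def using conj[OF lf _ x] conj[OF lh _ x] by (simp add: M.M.finsum_addf Pi_def)
      qed
      then show ?thesis by (auto simp: \<sigma>_def)
    qed
    show "\<sigma> (a \<odot>\<^bsub>linmod M\<^esub> f) = a \<odot>\<^bsub>?C\<^esub> \<sigma> f" for a
    proof -
      have "transfer_map G M (\<lambda>x\<in>carrier M. a \<odot>\<^bsub>M\<^esub> f x) x = a \<odot>\<^bsub>M\<^esub> transfer_map G M f x" if x: "x \<in> carrier M" for x
        unfolding transfer_map_def using x conj[OF lf _ x] fx M.act_closed fin
        by (subst M.rmod_finsum_smult) (auto intro!: M.M.finsum_cong' simp: M.act_smult)
      then show ?thesis by (auto simp: \<sigma>_def)
    qed
  qed
  from trace_commute[OF coords_linmod[OF B] C this lin_incl[OF sub]]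
  have "(\<Sum>k\<in>B \<times> B. (\<lambda>(i, j) f. c i (f j)) k (\<sigma> (case k of (i, j) \<Rightarrow> \<lambda>x\<in>carrier M. c j x \<odot>\<^bsub>M\<^esub> i))) =
      (\<Sum>j\<in>J. e j (\<sigma> (d j)))" .
  also have "\<dots> = (\<Sum>j\<in>J. of_nat (card (carrier G)))"
  proof (intro sum.cong refl)
    fix j assume j: "j \<in> J"
    have dj: "d j \<in> carrier ?C" using CD(3)[OF j] .
    then have dl: "lin M M (d j)" "equi (carrier G) M M (d j)" "d j \<in> extensional (carrier M)"
      by (auto simp: commutant_def)
    \<comment> \<open>An equivariant map equals each of its |G| conjugates, so every diagonal entry
      on this side is |G|.\<close>
    have "\<sigma> (d j) = of_nat (card (carrier G)) \<odot>\<^bsub>?C\<^esub> d j"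
    proof (rule extensionalityI[of _ "carrier M"])
      fix x assume x: "x \<in> carrier M"
      have "act M g (d j (act M (inv\<^bsub>G\<^esub> g) x)) = d j x" if g: "g \<in> carrier G" for g
        using equiD[OF dl(2) g, of "act M (inv\<^bsub>G\<^esub> g) x"] act_inv(1)[OF M g x] x g M.act_closed by simp
      then have "transfer_map G M (d j) x = (\<Oplus>\<^bsub>M\<^esub>g\<in>carrier G. d j x)"
        unfolding transfer_map_def using lin_closed[OF dl(1) x] by (intro M.M.finsum_cong') auto
      then show "\<sigma> (d j) x = (of_nat (card (carrier G)) \<odot>\<^bsub>?C\<^esub> d j) x"
        using x M.rmod_finsum_const[OF fin lin_closed[OF dl(1) x]] by (simp add: \<sigma>_def)
    qed (auto simp: \<sigma>_def)
    then show "e j (\<sigma> (d j)) = of_nat (card (carrier G))"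
      using fun_smult[OF CD(4)[OF j] dj, of "of_nat (card (carrier G))"] CD(5)[OF j j] by simp
  qed
  finally have rhs: "(\<Sum>k\<in>B \<times> B. (\<lambda>(i, j) f. c i (f j)) k (\<sigma> (case k of (i, j) \<Rightarrow> \<lambda>x\<in>carrier M. c j x \<odot>\<^bsub>M\<^esub> i))) =
      of_nat (card (carrier G)) * of_nat (card J)" by simp
  \<comment> \<open>The diagonal entry at an elementary matrix: conjugation by \<open>g\<close>
    contributes a diagonal entry of \<open>g\<close> times one of its inverse, and the double sum
    splits into a product of traces.\<close>
  have "c i (\<sigma> (\<lambda>x\<in>carrier M. c j x \<odot>\<^bsub>M\<^esub> i) j) = (\<Sum>g\<in>carrier G. c i (act M g i) * c j (act M (inv\<^bsub>G\<^esub> g) j))"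
    if i: "i \<in> B" and j: "j \<in> B" for i j
  proof -
    have ij: "i \<in> carrier M" "j \<in> carrier M" using BD(3) that by auto
    have "\<sigma> (\<lambda>x\<in>carrier M. c j x \<odot>\<^bsub>M\<^esub> i) j = (\<Oplus>\<^bsub>M\<^esub>g\<in>carrier G. c j (act M (inv\<^bsub>G\<^esub> g) j) \<odot>\<^bsub>M\<^esub> act M g i)"
      using ij M.act_closed by (auto simp: \<sigma>_def transfer_map_def M.act_smult intro!: M.M.finsum_cong')
    then have "c i (\<sigma> (\<lambda>x\<in>carrier M. c j x \<odot>\<^bsub>M\<^esub> i) j) = (\<Sum>g\<in>carrier G. c i (c j (act M (inv\<^bsub>G\<^esub> g) j) \<odot>\<^bsub>M\<^esub> act M g i))"
      using ij M.act_closed fin by (simp, intro fun_sum[OF M.rmod_axioms BD(4)[OF i]]) auto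
    then show ?thesis using ij M.act_closed by (simp add: fun_smult[OF BD(4)[OF i]] mult.commute)
  qed
  then have "(\<Sum>k\<in>B \<times> B. (\<lambda>(i, j) f. c i (f j)) k (\<sigma> (case k of (i, j) \<Rightarrow> \<lambda>x\<in>carrier M. c j x \<odot>\<^bsub>M\<^esub> i))) =
      (\<Sum>(i, j)\<in>B \<times> B. \<Sum>g\<in>carrier G. c i (act M g i) * c j (act M (inv\<^bsub>G\<^esub> g) j))"
    by (intro sum.cong) auto
  also have "\<dots> = (\<Sum>g\<in>carrier G. (\<Sum>(i, j)\<in>B \<times> B. c i (act M g i) * c j (act M (inv\<^bsub>G\<^esub> g) j)))"
    by (simp add: case_prod_unfold sum.swap[of _ "B \<times> B"])
  also have "\<dots> = (\<Sum>g\<in>carrier G. mod_trace M (act M g) * mod_trace M (act M (inv\<^bsub>G\<^esub> g)))"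
    by (intro sum.cong refl)
      (simp add: mod_trace_coords[OF B act_lin[OF M]] sum_product sum.cartesian_product)
  finally show ?thesis using rhs by simp
qed

section \<open>Eigenvalues, Schur's lemma and absolute irreducibility\<close>

text \<open>There are \<open>card I + 1\<close> coefficients and \<open>card I\<close> conditions.
  If zero were the only solution, the conditions would be jointly injective functionals on a free
  module of rank \<open>card I + 1\<close>, against the bound of
  \<open>free_of_functionals\<close>.\<close>

lemma exists_relation:
  fixes M :: "('r::idom, 'm, 'x) module_scheme" and w :: "nat \<Rightarrow> 'm"
  assumes pid: "principal_domain (rta :: 'r ring)" and inj: "inj (of_nat :: nat \<Rightarrow> 'r)" and M: "rmod M"
    and I: "finite I" "\<And>i. i \<in> I \<Longrightarrow> lin M scal (c i)" and w: "\<And>k. w k \<in> carrier M"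
  obtains a where "\<exists>k\<le>card I. a k \<noteq> 0" "\<And>i. i \<in> I \<Longrightarrow> (\<Sum>k\<le>card I. a k * c i (w k)) = 0"
proof (rule ccontr)
  note found = that
  assume neg: "\<not> thesis"
  let ?n = "card I"
  define FN :: "('r, nat \<Rightarrow> 'r) module" where
    "FN = \<lparr>carrier = {a. \<forall>k>?n. a k = 0}, monoid.mult = (\<lambda>_ _. undefined), one = undefined, ring.zero = (\<lambda>_. 0),
       add = (\<lambda>a b k. a k + b k), module.smult = (\<lambda>t a k. t * a k)\<rparr>"
  have FN [simp]: "carrier FN = {a. \<forall>k>?n. a k = 0}" "\<zero>\<^bsub>FN\<^esub> = (\<lambda>_. 0)" "a \<oplus>\<^bsub>FN\<^esub> b = (\<lambda>k. a k + b k)"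
    "t \<odot>\<^bsub>FN\<^esub> a = (\<lambda>k. t * a k)" for a b t by (auto simp: FN_def)
  have rm: "rmod FN" by (rule rmodI) (auto simp: algebra_simps)
  have co: "coords FN {..?n} (\<lambda>k l. if l = k then 1 else 0) (\<lambda>k a. a k)"
  proof (rule coordsI[OF rm])
    show "a = b" if ab: "a \<in> carrier FN" "b \<in> carrier FN" "\<And>k. k \<in> {..?n} \<Longrightarrow> a k = b k" for a b
    proof
      fix k show "a k = b k" using ab by (cases "k \<le> ?n") auto
    qed
  qed (auto simp: lin_def)
  have "\<exists>(b :: nat \<Rightarrow> nat \<Rightarrow> 'r) e r. r \<le> card I \<and> coords FN {..<r} b e"
  proof (rule free_of_functionals[OF pid I(1) rm])
    show "lin FN scal (\<lambda>a. \<Sum>k\<le>?n. a k * c i (w k))" if "i \<in> I" for i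
      by (simp add: lin_def sum.distrib distrib_right sum_distrib_left mult.assoc)
    show "a = \<zero>\<^bsub>FN\<^esub>" if "a \<in> carrier FN" "\<And>i. i \<in> I \<Longrightarrow> (\<Sum>k\<le>?n. a k * c i (w k)) = 0" for a
    proof -
      have "\<not> (\<exists>k\<le>?n. a k \<noteq> 0)" using neg that(2) found by blast
      then show ?thesis using that(1) by (auto simp: not_le[symmetric])
    qed
  qed
  then obtain r b e where "r \<le> card I" "coords FN {..<r::nat} b e" by blast
  then show False using mod_rank_coords[OF inj co] mod_rank_coords[OF inj] by fastforce
qed

text \<open>A nonzero polynomial of least degree that annihilates \<open>v\<close> under
  \<open>f\<close> has a root \<open>l\<close>. Dividing it by \<open>X - l\<close> leaves a
  polynomial \<open>q\<close> that does not annihilate \<open>v\<close>, and \<open>q(f) v\<close>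
  is an eigenvector. Annihilation is expressed in coordinates through the numbers
  \<open>z i k\<close>.\<close>

lemma eigenvalue_exists:
  fixes M :: "('k::alg_closed_field, 'm, 'x) module_scheme"
  assumes inj: "inj (of_nat :: nat \<Rightarrow> 'k)" and M: "rmod M" and free: "free_of_finite_rank M"
    and nz: "carrier M \<noteq> {\<zero>\<^bsub>M\<^esub>}" and f: "lin M M f"
  obtains x l where "x \<in> carrier M" "x \<noteq> \<zero>\<^bsub>M\<^esub>" "f x = l \<odot>\<^bsub>M\<^esub> x"
proof -
  interpret M: rmod M by fact
  obtain B c where B: "coords M B (\<lambda>b. b) c" using free_coords[OF M free] by blast
  note C = coordsD[OF B]
  have "field (rta :: 'k ring)" by (rule field_from_type_algebra)
  then interpret K: field "rta :: 'k ring" .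
  have pid: "principal_domain (rta :: 'k ring)" by (rule K.principal_domain_axioms)
  obtain v where v: "v \<in> carrier M" "v \<noteq> \<zero>\<^bsub>M\<^esub>" using nz M.M.zero_closed by blast
  define w where "w k = (f ^^ k) v" for k
  have w: "w k \<in> carrier M" for k using v lin_closed[OF f] by (induction k) (auto simp: w_def)
  have fw: "f (w k) = w (Suc k)" for k by (simp add: w_def)
  define z where "z i k = c i (w k)" for i k
  define n where "n = card B"
  obtain a where a: "\<exists>k\<le>n. a k \<noteq> 0" "\<And>i. i \<in> B \<Longrightarrow> (\<Sum>k\<le>n. a k * z i k) = 0"
    unfolding z_def n_def by (rule exists_relation[where w = w, OF pid inj M C(2) C(4) w]) blast+
  \<comment> \<open>The bound on the degree lets every sum run over the same range
    \<open>{..n}\<close>.\<close>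
  define Ann where "Ann p \<longleftrightarrow> p \<noteq> 0 \<and> degree p \<le> n \<and> (\<forall>i\<in>B. (\<Sum>k\<le>n. coeff p k * z i k) = 0)" for p
  define p0 where "p0 = Poly (map a [0..<Suc n])"
  have co0: "coeff p0 k = (if k \<le> n then a k else 0)" for k
    by (simp add: p0_def coeff_Poly_eq nth_default_def less_Suc_eq_le del: upt_Suc)
  have "Ann p0"
    using a co0 by (auto simp: Ann_def intro!: degree_le) (metis coeff_0)
  define p where "p = arg_min degree Ann"
  have p: "Ann p" and pmin: "\<And>q. Ann q \<Longrightarrow> degree p \<le> degree q"
    using arg_min_nat_lemma[of Ann p0 degree] \<open>Ann p0\<close> by (auto simp: p_def)
  have deg: "degree p \<noteq> 0"
  proof
    assume "degree p = 0"
    then obtain t where t: "p = [:t:]" by (metis degree_eq_zeroE)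
    have "t * z i 0 = 0" if "i \<in> B" for i
    proof -
      have "(\<Sum>k\<le>n. coeff p k * z i k) = (\<Sum>k\<le>n. if k = 0 then t * z i 0 else 0)"
        by (intro sum.cong) (auto simp: t coeff_pCons split: nat.split)
      then show ?thesis using p that by (simp add: Ann_def)
    qed
    moreover have "t \<noteq> 0" using p t by (auto simp: Ann_def)
    ultimately have "c i v = c i \<zero>\<^bsub>M\<^esub>" if "i \<in> B" for i
      using that lin_zero[OF M rmod_scal C(4)[OF that]] by (auto simp: z_def w_def)
    then have "v = \<zero>\<^bsub>M\<^esub>" using coords_eqI[OF B v(1)] by blast
    then show False using v by simp
  qed
  then obtain l where "poly p l = 0" using alg_closed_imp_poly_has_root[of p] by blast
  then obtain q where q: "p = [:- l, 1:] * q" by (metis poly_eq_0_iff_dvd dvdE)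
  have q0: "q \<noteq> 0" using p q by (auto simp: Ann_def)
  have degq: "degree p = Suc (degree q)" unfolding q using q0 by (subst degree_mult_eq) auto
  define x where "x = (\<Oplus>\<^bsub>M\<^esub>k\<in>{..<n}. coeff q k \<odot>\<^bsub>M\<^esub> w k)"
  have x: "x \<in> carrier M" unfolding x_def using w by (intro M.M.finsum_closed) auto
  have cq: "coeff q k = 0" if "k \<ge> n" for k
    using degq p that by (intro coeff_eq_0) (auto simp: Ann_def)
  have cx: "c i x = (\<Sum>k<n. coeff q k * z i k)" if "i \<in> B" for i
    unfolding x_def using w fun_sum[OF M C(4)[OF that], of "{..<n}"] fun_smult[OF C(4)[OF that]] by (simp add: z_def)
  have "f x = (\<Oplus>\<^bsub>M\<^esub>k\<in>{..<n}. coeff q k \<odot>\<^bsub>M\<^esub> w (Suc k))"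
    unfolding x_def using w lin_smult[OF f] fw
    by (subst lin_finsum[OF M M f]) (auto intro!: M.M.finsum_cong')
  then have cfx: "c i (f x) = (\<Sum>k<n. coeff q k * z i (Suc k))" if "i \<in> B" for i
    using w fun_sum[OF M C(4)[OF that], of "{..<n}"] fun_smult[OF C(4)[OF that]] by (simp add: z_def)
  have "x \<noteq> \<zero>\<^bsub>M\<^esub>"
  proof
    assume "x = \<zero>\<^bsub>M\<^esub>"
    then have "(\<Sum>k<n. coeff q k * z i k) = 0" if "i \<in> B" for i
      using cx[OF that] lin_zero[OF M rmod_scal C(4)[OF that]] by simp
    then have "(\<Sum>k\<le>n. coeff q k * z i k) = 0" if "i \<in> B" for i
      using that cq[of n] by (simp flip: lessThan_Suc_atMost)
    then have "Ann q" using q0 degq p by (auto simp: Ann_def)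
    then show False using pmin[of q] degq by simp
  qed
  moreover have "f x = l \<odot>\<^bsub>M\<^esub> x"
  proof (rule coords_eqI[OF B lin_closed[OF f x]])
    show "l \<odot>\<^bsub>M\<^esub> x \<in> carrier M" using x by simp
    fix i assume i: "i \<in> B"
    \<comment> \<open>The polynomial \<open>p\<close> applied to \<open>f\<close> and
      \<open>v\<close> is \<open>f x\<close> minus \<open>l\<close> times \<open>x\<close>; in
      coordinates this vanishes by \<open>Ann p\<close>.\<close>
    have "p = pCons 0 q - Polynomial.smult l q" unfolding q by (simp add: mult_pCons_left)
    then have "(\<Sum>k\<le>n. coeff p k * z i k) = (\<Sum>k\<le>n. coeff (pCons 0 q) k * z i k) - l * (\<Sum>k\<le>n. coeff q k * z i k)"
      by (simp add: left_diff_distrib sum_subtractf sum_distrib_left mult.assoc)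
    moreover have "(\<Sum>k\<le>n. coeff (pCons 0 q) k * z i k) = c i (f x)"
      by (simp add: sum.atMost_shift cfx[OF i])
    moreover have "(\<Sum>k\<le>n. coeff q k * z i k) = c i x"
      using cx[OF i] cq[of n] by (simp flip: lessThan_Suc_atMost)
    ultimately have "c i (f x) = l * c i x" using p i by (simp add: Ann_def)
    then show "c i (f x) = c i (l \<odot>\<^bsub>M\<^esub> x)" using fun_smult[OF C(4)[OF i] x] by simp
  qed
  ultimately show ?thesis using that x by blast
qed

text \<open>The eigenspace for an eigenvalue is a nonzero submodule, hence everything.\<close>

theorem schur:
  fixes M :: "('k::alg_closed_field, 'g, 'm) gmod"
  assumes inj: "inj (of_nat :: nat \<Rightarrow> 'k)" and M: "gmodule G M" and free: "free_of_finite_rank M"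
    and simple: "simple_gmod G M" and f: "lin M M f" "equi (carrier G) M M f"
  shows "\<exists>l. \<forall>x\<in>carrier M. f x = l \<odot>\<^bsub>M\<^esub> x"
proof -
  interpret M: gmodule G M by fact
  interpret M: rmod M using M by (rule gmodule_rmod)
  obtain x l where x: "x \<in> carrier M" "x \<noteq> \<zero>\<^bsub>M\<^esub>" "f x = l \<odot>\<^bsub>M\<^esub> x"
    by (rule eigenvalue_exists[OF inj M.rmod_axioms free _ f(1)]) (use simple in \<open>auto simp: simple_gmod_def\<close>)
  let ?A = "{y \<in> carrier M. f y = l \<odot>\<^bsub>M\<^esub> y}"
  have "submodule ?A rta M"
    using lin_zero[OF M.rmod_axioms M.rmod_axioms f(1)] lin_add[OF f(1)] lin_smult[OF f(1)]
    by (intro M.rmod_submoduleI) (auto simp: M.rmod_rdistr intro: M.rmod_swap)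
  then have "gsubmodule G ?A M"
    using equiD[OF f(2)] M.act_closed M.act_smult by (auto simp: gsubmodule_def)
  then have "?A = carrier M" using simple x unfolding simple_gmod_def by blast
  then show ?thesis by blast
qed

corollary sum_character_squared_simple:
  fixes M :: "('k::alg_closed_field, 'g, 'm) gmod"
  assumes inj: "inj (of_nat :: nat \<Rightarrow> 'k)" and M: "gmodule G M" and fin: "finite (carrier G)"
    and free: "free_of_finite_rank M" and simple: "simple_gmod G M"
  shows "(\<Sum>g\<in>carrier G. mod_trace M (act M g) * mod_trace M (act M (inv\<^bsub>G\<^esub> g))) = of_nat (card (carrier G))"
proof -
  interpret M: gmodule G M by fact
  interpret M: rmod M using M by (rule gmodule_rmod)
  obtain B c where B: "coords M B (\<lambda>b. b) c" using free_coords[OF M.rmod_axioms free] by blast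
  note C = coordsD[OF B]
  obtain b where b: "b \<in> B"
  proof (rule ccontr)
    assume "\<not> thesis"
    then have "B = {}" using that by blast
    then have "carrier M \<subseteq> {\<zero>\<^bsub>M\<^esub>}" using coords_eqI[OF B] by blast
    then show False using simple M.M.zero_closed by (auto simp: simple_gmod_def)
  qed
  let ?C = "linmod M\<lparr>carrier := commutant G M\<rparr>"
  let ?id = "\<lambda>x\<in>carrier M. x"
  note bM = C(3)[OF b]
  have sub: "commutant G M \<subseteq> carrier (linmod M)" by (auto simp: commutant_def)
  \<comment> \<open>By Schur's lemma the commutant is the line of the identity, and one fixed
    diagonal coordinate reads off the scalar.\<close>
  have "coords ?C {0::nat} (\<lambda>_. ?id) (\<lambda>_ f. c b (f b))"
  proof (rule coordsI)
    show "rmod ?C" using rmod_sub[OF rmod_linmod[OF M.rmod_axioms] submodule_commutant[OF M]] .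
    show "?id \<in> carrier ?C"
      using lin_id by (simp add: commutant_def lin_restrict[OF M.rmod_axioms] equi_restrict[OF M subset_refl])
        (simp add: equi_def)
    show "lin ?C scal (\<lambda>f. c b (f b))"
      using lin_from_sub[OF sub linmod_functional[OF M.rmod_axioms C(4)[OF b] bM]] .
    show "c b (?id b) = (if i = j then 1 else 0)" if "i \<in> {0::nat}" "j \<in> {0}" for i j
      using that bM C(5)[OF b b] by simp
    show "f = h" if f: "f \<in> carrier ?C" and h: "h \<in> carrier ?C" and eq: "\<And>i. i \<in> {0::nat} \<Longrightarrow> c b (f b) = c b (h b)" for f h
    proof -
      have "\<exists>l. \<forall>x\<in>carrier M. f x = l \<odot>\<^bsub>M\<^esub> x" "\<exists>l. \<forall>x\<in>carrier M. h x = l \<odot>\<^bsub>M\<^esub> x"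
        using f h by (auto intro!: schur[OF inj M free simple] simp: commutant_def)
      then obtain k l where kl: "\<And>x. x \<in> carrier M \<Longrightarrow> f x = k \<odot>\<^bsub>M\<^esub> x" "\<And>x. x \<in> carrier M \<Longrightarrow> h x = l \<odot>\<^bsub>M\<^esub> x" by blast
      have "k = l"
        using eq[of 0] kl(1)[OF bM] kl(2)[OF bM] fun_smult[OF C(4)[OF b] bM] C(5)[OF b b] by simp
      then show ?thesis using f h kl by (intro extensionalityI[of _ "carrier M"]) (auto simp: commutant_def)
    qed
  qed auto
  from sum_character_squared[OF M fin free this] show ?thesis by simp
qed

text \<open>The mean of \<open>\<chi>(g) \<chi>(g\<^sup>-\<^sup>1)\<close> is 1 by passing to the algebraic closure, and it is the rank of the
  endomorphism ring, so that the endomorphism ring consists of scalars.\<close>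

theorem absolutely_irreducible_scalar:
  fixes M :: "('o::idom, 'g, 'm) gmod"
  assumes pid: "principal_domain (rta :: 'o ring)" and inj: "inj (of_nat :: nat \<Rightarrow> 'o)"
    and M: "gmodule G M" and fin: "finite (carrier G)" and free: "free_of_finite_rank M"
    and irr: "absolutely_irreducible_character G (lattice_character M)"
  shows "\<And>f. lin M M f \<Longrightarrow> equi (carrier G) M M f \<Longrightarrow> \<exists>l. \<forall>x\<in>carrier M. f x = l \<odot>\<^bsub>M\<^esub> x"
    and "carrier M \<noteq> {\<zero>\<^bsub>M\<^esub>}"
proof -
  interpret M: gmodule G M by fact
  interpret M: rmod M using M by (rule gmodule_rmod)
  \<comment> \<open>Characteristic zero passes from the ring to its fraction field and on to the
    algebraic closure.\<close>
  have inj': "inj (of_nat :: nat \<Rightarrow> 'o fract alg_closure)"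
  proof (rule injI)
    fix m n assume "(of_nat m :: 'o fract alg_closure) = of_nat n"
    then have "to_ac (of_nat m :: 'o fract) = to_ac (of_nat n)" by simp
    then have "(of_nat m :: 'o fract) = of_nat n" by (simp only: to_ac_eq_iff)
    moreover have "of_nat k = to_fract (of_nat k :: 'o)" for k by (induction k) auto
    ultimately have "(of_nat m :: 'o) = of_nat n" by simp
    then show "m = n" using inj by (simp add: inj_eq)
  qed
  from irr obtain N :: "('o fract alg_closure, 'g, nat \<Rightarrow> 'o fract alg_closure) gmod"
    where N: "gmodule G N" "free_of_finite_rank N" "simple_gmod G N"
      and ch: "\<And>g. g \<in> carrier G \<Longrightarrow> to_ac (lattice_character M g) = gmod_character N g"
    unfolding absolutely_irreducible_character_def irreducible_character_def by blast
  have tr: "mod_trace N (act N g) = to_ac (to_fract (mod_trace M (act M g)))" if "g \<in> carrier G" for g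
    using ch[OF that] lattice_character_eq[OF M free that] by (simp add: gmod_character_def)
  have "to_ac (to_fract (\<Sum>g\<in>carrier G. mod_trace M (act M g) * mod_trace M (act M (inv\<^bsub>G\<^esub> g)))) =
      (\<Sum>g\<in>carrier G. mod_trace N (act N g) * mod_trace N (act N (inv\<^bsub>G\<^esub> g)))"
    by (simp add: to_ac_sum tr)
  also have "\<dots> = of_nat (card (carrier G))"
    using sum_character_squared_simple[OF inj' N(1) fin N(2,3)] .
  also have "\<dots> = to_ac (to_fract (of_nat (card (carrier G)) :: 'o))"
  proof -
    have "of_nat k = to_fract (of_nat k :: 'o)" for k by (induction k) auto
    then show ?thesis by (metis to_ac_of_nat)
  qed
  finally have sum: "(\<Sum>g\<in>carrier G. mod_trace M (act M g) * mod_trace M (act M (inv\<^bsub>G\<^esub> g))) = of_nat (card (carrier G))"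
    by (simp only: to_ac_eq_iff to_fract_eq_iff)
  obtain B c where B: "coords M B (\<lambda>b. b) c" using free_coords[OF M.rmod_axioms free] by blast
  note C = coordsD[OF B]
  let ?C = "linmod M\<lparr>carrier := commutant G M\<rparr>"
  have "free_of_finite_rank (linmod M)" using coords_linmod[OF B] by (rule coords_free)
  from free_sub[OF pid rmod_linmod[OF M.rmod_axioms] this submodule_commutant[OF M]]
  obtain J e where J: "coords ?C J (\<lambda>d. d) e"
    using free_coords[OF rmod_sub[OF rmod_linmod[OF M.rmod_axioms] submodule_commutant[OF M]]] by blast
  have "carrier G \<noteq> {}" using M.G.one_closed by blast
  then have "card (carrier G) \<noteq> 0" using fin by simp
  moreover from this have "(of_nat (card (carrier G)) :: 'o) \<noteq> 0" using inj by (metis injD of_nat_0)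
  \<comment> \<open>The same sum is |G| by comparison with the simple module and |G| times the rank
    of the commutant; cancelling |G| leaves rank 1.\<close>
  ultimately have "(of_nat (card J) :: 'o) = of_nat 1"
    using sum_character_squared[OF M fin free J] sum by simp
  then have "card J = 1" using inj by (metis injD)
  then obtain d where d: "J = {d}" by (auto simp: card_1_singleton_iff)
  have dC: "d \<in> carrier ?C" using coordsD(3)[OF J] d by blast
  have rep: "f x = e d f \<odot>\<^bsub>M\<^esub> d x" if "f \<in> commutant G M" "x \<in> carrier M" for f x
  proof -
    interpret C: rmod ?C by (rule coordsD(1)[OF J])
    have "f = (\<Oplus>\<^bsub>?C\<^esub>i\<in>J. e i f \<odot>\<^bsub>?C\<^esub> i)" using coords_repr[OF J] that by simp
    also have "\<dots> = e d f \<odot>\<^bsub>?C\<^esub> d"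
      using C.M.finsum_insert[of "{}" d "\<lambda>i. e i f \<odot>\<^bsub>?C\<^esub> i"] C.rmod_smult[OF dC, of "e d f"]
        C.M.r_zero[OF C.rmod_smult[OF dC, of "e d f"]] C.M.finsum_empty
      unfolding d by (simp del: linmod_simps)
    finally have "f x = (e d f \<odot>\<^bsub>?C\<^esub> d) x" by (rule arg_cong)
    then show ?thesis using that(2) by simp
  qed
  have idC: "(\<lambda>x\<in>carrier M. x) \<in> commutant G M"
    using lin_id by (simp add: commutant_def lin_restrict[OF M.rmod_axioms] equi_restrict[OF M subset_refl])
      (simp add: equi_def)
  show ne: "carrier M \<noteq> {\<zero>\<^bsub>M\<^esub>}"
  proof
    assume z: "carrier M = {\<zero>\<^bsub>M\<^esub>}"
    have "d = \<zero>\<^bsub>?C\<^esub>"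
      using dC z by (intro extensionalityI[of _ "carrier M"]) (auto simp: commutant_def lin_def)
    then have "e d d = 0"
      using lin_zero[OF coordsD(1)[OF J] rmod_scal coordsD(4)[OF J]] d by auto
    then show False using coordsD(5)[OF J, of d d] d by simp
  qed
  obtain b where b: "b \<in> B"
  proof (rule ccontr)
    assume "\<not> thesis"
    then have "B = {}" using that by blast
    then have "carrier M \<subseteq> {\<zero>\<^bsub>M\<^esub>}" using coords_eqI[OF B] by blast
    then show False using ne M.M.zero_closed by blast
  qed
  have dM: "d x \<in> carrier M" if "x \<in> carrier M" for x
    using dC that by (auto simp: commutant_def lin_closed)
  let ?x = "e d (\<lambda>x\<in>carrier M. x)"
  \<comment> \<open>Rank 1 alone does not make the identity a generator. Its coordinate
    \<open>?x\<close> with respect to \<open>d\<close> divides 1, so it is a unit, and the generator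
    \<open>d\<close> is a scalar map as well.\<close>
  have "1 = ?x * c b (d b)"
    using rep[OF idC C(3)[OF b]] C(3)[OF b] C(5)[OF b b] fun_smult[OF C(4)[OF b] dM[OF C(3)[OF b]], of ?x] by simp
  then obtain u where u: "u * ?x = 1" by (metis mult.commute)
  show "\<exists>l. \<forall>x\<in>carrier M. f x = l \<odot>\<^bsub>M\<^esub> x" if f: "lin M M f" "equi (carrier G) M M f" for f
  proof (intro exI ballI)
    fix x assume x: "x \<in> carrier M"
    let ?f = "restrict f (carrier M)"
    have fC: "?f \<in> commutant G M"
      using f by (simp add: commutant_def lin_restrict[OF M.rmod_axioms] equi_restrict[OF M subset_refl])
    have "f x = e d ?f \<odot>\<^bsub>M\<^esub> d x" using rep[OF fC x] x by simp
    also have "\<dots> = (e d ?f * u) \<odot>\<^bsub>M\<^esub> (?x \<odot>\<^bsub>M\<^esub> d x)"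
      using u dM[OF x] by (simp add: mult.assoc flip: M.rmod_assoc)
    also have "?x \<odot>\<^bsub>M\<^esub> d x = x" using rep[OF idC x] x by simp
    finally show "f x = (e d ?f * u) \<odot>\<^bsub>M\<^esub> x" .
  qed
qed

subsection \<open>Double cosets\<close>

definition dcoset :: "('g, 'z) monoid_scheme \<Rightarrow> 'g set \<Rightarrow> 'g \<Rightarrow> 'g set \<Rightarrow> 'g set" where
  "dcoset G T h S = (\<lambda>(t, s). t \<otimes>\<^bsub>G\<^esub> h \<otimes>\<^bsub>G\<^esub> s) ` (T \<times> S)"

text \<open>The intersection of \<open>T\<close> with \<open>h S h^-1\<close>, which is the
  stabiliser in \<open>T\<close> of the coset \<open>hS\<close>.\<close>

definition conj_stab :: "('g, 'z) monoid_scheme \<Rightarrow> 'g set \<Rightarrow> 'g \<Rightarrow> 'g set \<Rightarrow> 'g set" where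
  "conj_stab G T h S = {t \<in> T. inv\<^bsub>G\<^esub> h \<otimes>\<^bsub>G\<^esub> t \<otimes>\<^bsub>G\<^esub> h \<in> S}"

context group
begin

lemma inv_left_cancel:
  "g \<in> carrier G \<Longrightarrow> x \<in> carrier G \<Longrightarrow> inv g \<otimes> (g \<otimes> x) = x"
  "g \<in> carrier G \<Longrightarrow> x \<in> carrier G \<Longrightarrow> g \<otimes> (inv g \<otimes> x) = x"
  by (simp_all add: m_assoc[symmetric])

lemma dcosetI: "t \<in> T \<Longrightarrow> s \<in> S \<Longrightarrow> t \<otimes> h \<otimes> s \<in> dcoset G T h S"
  unfolding dcoset_def by (intro image_eqI[of _ _ "(t, s)"]) auto

lemma dcosetE:
  assumes "y \<in> dcoset G T h S"
  obtains t s where "t \<in> T" "s \<in> S" "y = t \<otimes> h \<otimes> s"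
  using assms by (auto simp: dcoset_def)

lemma conj_mult:
  assumes "g \<in> carrier G" "x \<in> carrier G" "y \<in> carrier G"
  shows "(inv g \<otimes> x \<otimes> g) \<otimes> (inv g \<otimes> y \<otimes> g) = inv g \<otimes> (x \<otimes> y) \<otimes> g"
proof -
  have "g \<otimes> (inv g \<otimes> (y \<otimes> g)) = y \<otimes> g" using assms by (simp add: m_assoc[symmetric])
  then show ?thesis using assms by (simp add: m_assoc)
qed

lemma conj_inverse:
  "g \<in> carrier G \<Longrightarrow> x \<in> carrier G \<Longrightarrow> inv (inv g \<otimes> x \<otimes> g) = inv g \<otimes> inv x \<otimes> g"
  by (simp add: inv_mult_group m_assoc)

lemma subgroup_conj_stab:
  assumes S: "subgroup S G" and T: "subgroup T G" and h: "h \<in> carrier G"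
  shows "subgroup (conj_stab G T h S) (G\<lparr>carrier := T\<rparr>)"
proof -
  have TG: "\<And>t. t \<in> T \<Longrightarrow> t \<in> carrier G" using subgroup.subset[OF T] by blast
  show ?thesis
  proof (rule group.subgroupI[OF subgroup_imp_group[OF T]])
    show "conj_stab G T h S \<noteq> {}"
      using subgroup.one_closed[OF S] subgroup.one_closed[OF T] h by (auto simp: conj_stab_def)
    show "inv\<^bsub>G\<lparr>carrier := T\<rparr>\<^esub> a \<in> conj_stab G T h S" if "a \<in> conj_stab G T h S" for a
      using that m_inv_consistent[OF T] subgroup.m_inv_closed[OF T] subgroup.m_inv_closed[OF S] conj_inverse[OF h] TG
      by (auto simp: conj_stab_def) metis
    show "a \<otimes>\<^bsub>G\<lparr>carrier := T\<rparr>\<^esub> b \<in> conj_stab G T h S" if "a \<in> conj_stab G T h S" "b \<in> conj_stab G T h S" for a b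
      using that subgroup.m_closed[OF T] subgroup.m_closed[OF S] conj_mult[OF h] TG
      by (auto simp: conj_stab_def) metis
  qed (auto simp: conj_stab_def)
qed

text \<open>The fibre of \<open>(t, s) \<mapsto> t h s\<close> over \<open>t0 h s0\<close> is
  parametrised by the stabiliser: \<open>k\<close> gives the pair
  \<open>(t0 k, (h^-1 k h)^-1 s0)\<close>.\<close>

lemma card_dcoset:
  assumes S: "subgroup S G" and T: "subgroup T G" and h: "h \<in> carrier G" and fin: "finite (carrier G)"
  shows "card (dcoset G T h S) * card (conj_stab G T h S) = card T * card S"
proof -
  have TG: "\<And>t. t \<in> T \<Longrightarrow> t \<in> carrier G" and SG: "\<And>s. s \<in> S \<Longrightarrow> s \<in> carrier G"
    using subgroup.subset[OF T] subgroup.subset[OF S] by blast+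
  have fT: "finite T" and fS: "finite S" using TG SG fin by (auto intro: finite_subset[OF _ fin])
  let ?f = "\<lambda>(t, s). t \<otimes> h \<otimes> s"
  have fibre: "card {x \<in> T \<times> S. ?f x = y} = card (conj_stab G T h S)" if y: "y \<in> dcoset G T h S" for y
  proof -
    obtain t0 s0 where y': "t0 \<in> T" "s0 \<in> S" "y = t0 \<otimes> h \<otimes> s0" using y by (auto simp: dcoset_def)
    note c = TG[OF y'(1)] SG[OF y'(2)]
    have "bij_betw (\<lambda>k. (t0 \<otimes> k, inv (inv h \<otimes> k \<otimes> h) \<otimes> s0)) (conj_stab G T h S) {x \<in> T \<times> S. ?f x = y}"
    proof (rule bij_betw_byWitness[where f' = "\<lambda>(t, s). inv t0 \<otimes> t"])
      show "\<forall>a\<in>conj_stab G T h S. (\<lambda>(t, s). inv t0 \<otimes> t) (t0 \<otimes> a, inv (inv h \<otimes> a \<otimes> h) \<otimes> s0) = a"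
        using c TG by (auto simp: conj_stab_def m_assoc[symmetric])
      have key: "s = inv (inv h \<otimes> (inv t0 \<otimes> t) \<otimes> h) \<otimes> s0 \<and> inv h \<otimes> (inv t0 \<otimes> t) \<otimes> h = s0 \<otimes> inv s"
        if "t \<in> T" "s \<in> S" "t \<otimes> h \<otimes> s = y" for t s
      proof -
        note d = TG[OF that(1)] SG[OF that(2)]
        have "inv h \<otimes> inv t0 \<otimes> (t \<otimes> h \<otimes> s) = inv h \<otimes> inv t0 \<otimes> (t0 \<otimes> h \<otimes> s0)" using that y' by simp
        also have "\<dots> = s0" using c h by (simp add: m_assoc inv_left_cancel)
        finally have e: "(inv h \<otimes> (inv t0 \<otimes> t) \<otimes> h) \<otimes> s = s0" using c d h by (simp add: m_assoc)
        let ?k = "inv h \<otimes> (inv t0 \<otimes> t) \<otimes> h"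
        have k: "?k \<in> carrier G" using c d h by simp
        have "?k = s0 \<otimes> inv s" using e k d c by (metis inv_solve_right)
        moreover have "s = inv ?k \<otimes> s0" using e k d c by (metis inv_solve_left)
        ultimately show ?thesis by blast
      qed
      show "\<forall>a'\<in>{x \<in> T \<times> S. ?f x = y}.
          (\<lambda>k. (t0 \<otimes> k, inv (inv h \<otimes> k \<otimes> h) \<otimes> s0)) ((\<lambda>(t, s). inv t0 \<otimes> t) a') = a'"
        using key c TG by (auto simp: m_assoc[symmetric])
      show "(\<lambda>k. (t0 \<otimes> k, inv (inv h \<otimes> k \<otimes> h) \<otimes> s0)) ` conj_stab G T h S \<subseteq> {x \<in> T \<times> S. ?f x = y}"
      proof
        fix z assume "z \<in> (\<lambda>k. (t0 \<otimes> k, inv (inv h \<otimes> k \<otimes> h) \<otimes> s0)) ` conj_stab G T h S"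
        then obtain k where k: "k \<in> T" "inv h \<otimes> k \<otimes> h \<in> S" "z = (t0 \<otimes> k, inv (inv h \<otimes> k \<otimes> h) \<otimes> s0)"
          by (auto simp: conj_stab_def)
        have kG: "k \<in> carrier G" using TG k by blast
        have "t0 \<otimes> k \<otimes> h \<otimes> (inv (inv h \<otimes> k \<otimes> h) \<otimes> s0) = y"
          using c kG h y' by (simp add: inv_mult_group m_assoc inv_left_cancel)
        then show "z \<in> {x \<in> T \<times> S. ?f x = y}"
          using k y' subgroup.m_closed[OF T] subgroup.m_closed[OF S] subgroup.m_inv_closed[OF S] by auto
      qed
      show "(\<lambda>(t, s). inv t0 \<otimes> t) ` {x \<in> T \<times> S. ?f x = y} \<subseteq> conj_stab G T h S"
      proof
        fix k assume "k \<in> (\<lambda>(t, s). inv t0 \<otimes> t) ` {x \<in> T \<times> S. ?f x = y}"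
        then have "\<exists>z\<in>{x \<in> T \<times> S. ?f x = y}. k = (\<lambda>(t, s). inv t0 \<otimes> t) z" by (simp only: image_iff)
        then obtain z where z: "z \<in> T \<times> S" "?f z = y" "k = (\<lambda>(t, s). inv t0 \<otimes> t) z" by blast
        obtain t s where "z = (t, s)" by (cases z)
        with z have ts: "t \<in> T" "s \<in> S" "t \<otimes> h \<otimes> s = y" "k = inv t0 \<otimes> t" by simp_all
        have "inv h \<otimes> k \<otimes> h = s0 \<otimes> inv s" unfolding ts(4) by (rule conjunct2[OF key[OF ts(1-3)]])
        moreover have "s0 \<otimes> inv s \<in> S" using y' ts subgroup.m_closed[OF S] subgroup.m_inv_closed[OF S] by blast
        moreover have "k \<in> T" using y' ts subgroup.m_closed[OF T] subgroup.m_inv_closed[OF T] by blast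
        ultimately show "k \<in> conj_stab G T h S" by (simp add: conj_stab_def)
      qed
    qed
    then show ?thesis by (rule bij_betw_same_card[symmetric])
  qed
  have "card (T \<times> S) = (\<Sum>y\<in>?f ` (T \<times> S). card {x \<in> T \<times> S. ?f x = y})"
    using sum.image_gen[of "T \<times> S" "\<lambda>_. 1::nat" ?f] fT fS by (simp only: card_eq_sum finite_cartesian_product)
  also have "\<dots> = (\<Sum>y\<in>dcoset G T h S. card (conj_stab G T h S))"
    unfolding dcoset_def[symmetric] using fibre by (intro sum.cong) auto
  finally show ?thesis by (simp add: card_cartesian_product)
qed

text \<open>The product set is the double coset of 1, and its stabiliser is the
  intersection.\<close>

lemma card_set_mult:
  assumes S: "subgroup S G" and T: "subgroup T G" and fin: "finite (carrier G)"
  shows "card (T <#> S) * card (T \<inter> S) = card T * card S"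
proof -
  have TG: "\<And>t. t \<in> T \<Longrightarrow> t \<in> carrier G" using subgroup.subset[OF T] by blast
  have "dcoset G T \<one> S = T <#> S" using TG by (force simp: dcoset_def set_mult_def)
  moreover have "conj_stab G T \<one> S = T \<inter> S" using TG by (auto simp: conj_stab_def)
  ultimately show ?thesis using card_dcoset[OF S T one_closed fin] by simp
qed

lemma dcoset_eq:
  assumes S: "subgroup S G" and T: "subgroup T G" and h: "h \<in> carrier G" and x: "x \<in> carrier G"
  shows "dcoset G T x S = dcoset G T h S \<longleftrightarrow> x \<in> dcoset G T h S"
proof
  have TG: "\<And>t. t \<in> T \<Longrightarrow> t \<in> carrier G" and SG: "\<And>s. s \<in> S \<Longrightarrow> s \<in> carrier G"
    using subgroup.subset[OF T] subgroup.subset[OF S] by blast+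
  have self: "y \<in> dcoset G T y S" if "y \<in> carrier G" for y
    using that subgroup.one_closed[OF S] subgroup.one_closed[OF T] unfolding dcoset_def
    by (intro image_eqI[of _ _ "(\<one>, \<one>)"]) auto
  then show "x \<in> dcoset G T h S" if "dcoset G T x S = dcoset G T h S" using that x by blast
  have sub: "dcoset G T y S \<subseteq> dcoset G T z S" if yz: "y \<in> dcoset G T z S" and z: "z \<in> carrier G" for y z
  proof
    fix w assume "w \<in> dcoset G T y S"
    then obtain t' s' where 1: "t' \<in> T" "s' \<in> S" "w = t' \<otimes> y \<otimes> s'" by (rule dcosetE)
    obtain t s where 2: "t \<in> T" "s \<in> S" "y = t \<otimes> z \<otimes> s" using yz by (rule dcosetE)
    then have "w = (t' \<otimes> t) \<otimes> z \<otimes> (s \<otimes> s')" using 1 2 TG SG z by (simp add: m_assoc)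
    then show "w \<in> dcoset G T z S"
      using 1 2 subgroup.m_closed[OF T] subgroup.m_closed[OF S] dcosetI by simp
  qed
  assume xh: "x \<in> dcoset G T h S"
  then obtain t s where *: "t \<in> T" "s \<in> S" "x = t \<otimes> h \<otimes> s" by (rule dcosetE)
  then have "inv t \<otimes> x \<otimes> inv s = h" using TG SG h by (simp add: m_assoc inv_left_cancel)
  then have "h \<in> dcoset G T x S"
    using dcosetI[of "inv t" T "inv s" S x] * subgroup.m_inv_closed[OF T] subgroup.m_inv_closed[OF S] by simp
  then show "dcoset G T x S = dcoset G T h S" using sub[OF xh h] sub[of h x] x by blast
qed

text \<open>If \<open>T\<close> is a \<open>p\<close>-group acting on \<open>G/S\<close>, a sum over \<open>G/S\<close> of a \<open>T\<close>-invariant function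
  agrees with the sum over the fixed points modulo \<open>p\<close>.\<close>

theorem p_group_fixed_coset:
  fixes F :: "'a \<Rightarrow> 'o::idom" and I :: "'o set"
  assumes inj: "inj (of_nat :: nat \<Rightarrow> 'o)" and fin: "finite (carrier G)" and p: "Factorial_Ring.prime p"
    and S: "subgroup S G" and T: "subgroup T G" and cT: "card T = p ^ n"
    and F: "\<And>t h s. t \<in> T \<Longrightarrow> h \<in> carrier G \<Longrightarrow> s \<in> S \<Longrightarrow> F (t \<otimes> h \<otimes> s) = F h"
    and I: "0 \<in> I" "\<And>x y. x \<in> I \<Longrightarrow> y \<in> I \<Longrightarrow> x + y \<in> I" "\<And>a x. x \<in> I \<Longrightarrow> a * x \<in> I" "of_nat p \<in> I"
    and u: "(\<Sum>h\<in>carrier G. F h) = of_nat (card S) * u" "u \<notin> I"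
  obtains h where "h \<in> carrier G" "F h \<notin> I" "\<And>t. t \<in> T \<Longrightarrow> inv h \<otimes> t \<otimes> h \<in> S"
proof (rule ccontr)
  assume neg: "\<not> thesis"
  note found = that
  have TG: "\<And>t. t \<in> T \<Longrightarrow> t \<in> carrier G" and SG: "\<And>s. s \<in> S \<Longrightarrow> s \<in> carrier G"
    using subgroup.subset[OF T] subgroup.subset[OF S] by blast+
  let ?d = "\<lambda>h. dcoset G T h S"
  \<comment> \<open>Assuming the claim fails, each double coset contributes |S| times an element of
    \<open>I\<close>: it consists of |S| times the index of the stabiliser many points, on which
    \<open>F\<close> is constant.\<close>
  have "\<exists>v\<in>I. (\<Sum>x\<in>{x \<in> carrier G. ?d x = D}. F x) = of_nat (card S) * v" if D: "D \<in> ?d ` carrier G" for D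
  proof -
    obtain h where h: "h \<in> carrier G" "D = ?d h" using D by blast
    have "D \<subseteq> carrier G" using h(1) TG SG unfolding h(2) by (auto simp: dcoset_def)
    then have fib: "{x \<in> carrier G. ?d x = D} = D" using h dcoset_eq[OF S T h(1)] by auto
    have FD: "F x = F h" if "x \<in> D" for x using that h F by (auto simp: dcoset_def)
    then have sum: "(\<Sum>x\<in>D. F x) = of_nat (card D) * F h" by simp
    let ?K = "conj_stab G T h S"
    have K: "subgroup ?K (G\<lparr>carrier := T\<rparr>)" by (rule subgroup_conj_stab[OF S T h(1)])
    have "card ?K dvd card T"
      using group.lagrange[OF subgroup_imp_group[OF T] K] by (simp add: Coset.order_def) (metis dvd_triv_right)
    then obtain j where j: "j \<le> n" "card ?K = p ^ j" using cT p divides_primepow_nat by metis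
    have "p ^ j > 0" using p prime_gt_0_nat by simp
    moreover have "card D * p ^ j = (p ^ (n - j) * card S) * p ^ j"
      using card_dcoset[OF S T h(1) fin] h(2) cT j by (simp add: power_add[symmetric])
    ultimately have cD: "card D = p ^ (n - j) * card S" by (metis mult_right_cancel less_numeral_extra(3))
    \<comment> \<open>Either all of \<open>T\<close> fixes the coset \<open>hS\<close>, and the
      assumed failure puts \<open>F h\<close> into \<open>I\<close>, or the index is divisible by
      \<open>p\<close>.\<close>
    have "of_nat (p ^ (n - j)) * F h \<in> I"
    proof (cases "j = n")
      case True
      have "?K = T"
        using j cT True finite_subset[OF _ fin, of T] TG by (intro card_subset_eq) (auto simp: conj_stab_def)
      then have "F h \<in> I" using neg found[OF h(1)] by (auto simp: conj_stab_def)
      then show ?thesis using I(3) by blast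
    next
      case False
      then have "p ^ (n - j) = p ^ (n - j - 1) * p" using j by (metis Suc_diff_1 diff_is_0_eq le_antisym not_gr_zero power_Suc2)
      then have "of_nat (p ^ (n - j)) * F h = (of_nat (p ^ (n - j - 1)) * F h) * of_nat p"
        by (simp add: mult_ac)
      then show ?thesis using I(3)[OF I(4)] by metis
    qed
    moreover have "(\<Sum>x\<in>{x \<in> carrier G. ?d x = D}. F x) = of_nat (card S) * (of_nat (p ^ (n - j)) * F h)"
      unfolding fib sum cD by (simp add: mult_ac)
    ultimately show ?thesis by blast
  qed
  then have "\<forall>D\<in>?d ` carrier G. \<exists>v. v \<in> I \<and> (\<Sum>x\<in>{x \<in> carrier G. ?d x = D}. F x) = of_nat (card S) * v"
    by blast
  from bchoice[OF this] obtain v where v: "\<And>D. D \<in> ?d ` carrier G \<Longrightarrow> v D \<in> I"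
    "\<And>D. D \<in> ?d ` carrier G \<Longrightarrow> (\<Sum>x\<in>{x \<in> carrier G. ?d x = D}. F x) = of_nat (card S) * v D" by blast
  have "(\<Sum>h\<in>carrier G. F h) = (\<Sum>D\<in>?d ` carrier G. \<Sum>x\<in>{x \<in> carrier G. ?d x = D}. F x)"
    by (rule sum.image_gen[OF fin])
  also have "\<dots> = of_nat (card S) * (\<Sum>D\<in>?d ` carrier G. v D)" using v(2) by (simp add: sum_distrib_left)
  finally have "of_nat (card S) * u = of_nat (card S) * (\<Sum>D\<in>?d ` carrier G. v D)" using u(1) by simp
  moreover have "(of_nat (card S) :: 'o) \<noteq> 0"
  proof -
    have "finite S" using SG finite_subset[OF _ fin] by blast
    then have "card S \<noteq> 0" using subgroup.one_closed[OF S] by auto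
    then show ?thesis using inj by (metis injD of_nat_0)
  qed
  ultimately have "u = (\<Sum>D\<in>?d ` carrier G. v D)" by simp
  moreover have "(\<Sum>D\<in>A. v D) \<in> I" if "finite A" "A \<subseteq> ?d ` carrier G" for A
    using that by (induction A rule: finite_induct) (auto intro: I v(1))
  ultimately show False using u(2) fin by auto
qed

section \<open>Conjugate subgroups and Sylow subgroups\<close>

definition conj_set :: "'a \<Rightarrow> 'a set \<Rightarrow> 'a set" where
  "conj_set g S = (\<lambda>s. g \<otimes> s \<otimes> inv g) ` S"

lemma conj_set_mem:
  assumes "S \<subseteq> carrier G" "g \<in> carrier G" "x \<in> carrier G"
  shows "x \<in> conj_set g S \<longleftrightarrow> inv g \<otimes> x \<otimes> g \<in> S"
proof
  assume "x \<in> conj_set g S"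
  then obtain s where s: "s \<in> S" "x = g \<otimes> s \<otimes> inv g" by (auto simp: conj_set_def)
  then have "s \<in> carrier G" using assms by blast
  then have "inv g \<otimes> x \<otimes> g = s" using assms s by (simp add: m_assoc) (simp add: m_assoc[symmetric])
  then show "inv g \<otimes> x \<otimes> g \<in> S" using s by simp
next
  assume "inv g \<otimes> x \<otimes> g \<in> S"
  moreover have "x = g \<otimes> (inv g \<otimes> x \<otimes> g) \<otimes> inv g"
    using assms by (simp add: m_assoc) (simp add: m_assoc[symmetric])
  ultimately show "x \<in> conj_set g S" unfolding conj_set_def by (rule image_eqI[rotated])
qed

lemma subgroup_conj_set:
  assumes S: "subgroup S G" and g: "g \<in> carrier G"
  shows "subgroup (conj_set g S) G"
proof -
  have SG: "S \<subseteq> carrier G" using subgroup.subset[OF S] .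
  have sub: "conj_set g S \<subseteq> carrier G" using SG g by (auto simp: conj_set_def)
  note mem = conj_set_mem[OF SG g]
  show ?thesis
  proof (rule subgroupI[OF sub])
    show "conj_set g S \<noteq> {}" using subgroup.one_closed[OF S] by (auto simp: conj_set_def)
    show "inv a \<in> conj_set g S" if "a \<in> conj_set g S" for a
      using that sub mem[of a] mem[of "inv a"] conj_inverse[OF g, of a] subgroup.m_inv_closed[OF S]
      by (metis inv_closed subsetD)
    show "a \<otimes> b \<in> conj_set g S" if "a \<in> conj_set g S" "b \<in> conj_set g S" for a b
      using that sub mem[of a] mem[of b] mem[of "a \<otimes> b"] conj_mult[OF g, of a b] subgroup.m_closed[OF S]
      by (metis m_closed subsetD)
  qed
qed

lemma card_conj_set:
  assumes "S \<subseteq> carrier G" "g \<in> carrier G" shows "card (conj_set g S) = card S"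
  unfolding conj_set_def
proof (rule card_image, rule inj_onI)
  fix x y assume "x \<in> S" "y \<in> S" "g \<otimes> x \<otimes> inv g = g \<otimes> y \<otimes> inv g"
  moreover from this have "x \<in> carrier G" "y \<in> carrier G" using assms by auto
  ultimately show "x = y" using assms(2) by simp
qed

lemma conj_set_inv:
  assumes "S \<subseteq> carrier G" "g \<in> carrier G" shows "conj_set g (conj_set (inv g) S) = S" "conj_set (inv g) (conj_set g S) = S"
proof -
  have "g \<otimes> (inv g \<otimes> s \<otimes> g) \<otimes> inv g = s" "inv g \<otimes> (g \<otimes> s \<otimes> inv g) \<otimes> g = s" if "s \<in> S" for s
    using that assms by (simp_all add: m_assoc subset_iff) (simp_all add: m_assoc[symmetric])
  then show "conj_set g (conj_set (inv g) S) = S" "conj_set (inv g) (conj_set g S) = S"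
    using assms(2) unfolding conj_set_def image_image by simp_all
qed

text \<open>The fixed-point theorem for the constant function 1 on the integers with the ideal of
  multiples of \<open>p\<close>: the index of \<open>P\<close> is prime to \<open>p\<close>, so
  \<open>T\<close> fixes some coset \<open>hP\<close>.\<close>

lemma p_subgroup_in_sylow:
  assumes fin: "finite (carrier G)" and p: "Factorial_Ring.prime p" and T: "subgroup T G" and cT: "card T = p ^ n"
    and P: "subgroup P G" and cP: "card P = p ^ multiplicity p (Coset.order G)"
  obtains h where "h \<in> carrier G" "conj_set (inv h) T \<subseteq> P"
proof -
  have TG: "T \<subseteq> carrier G" and PG: "P \<subseteq> carrier G" using subgroup.subset[OF T] subgroup.subset[OF P] by auto
  have o: "Coset.order G \<noteq> 0" using fin one_closed by (auto simp: Coset.order_def)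
  have np: "\<not> is_unit p" using p by (metis not_prime_unit)
  obtain m where m: "Coset.order G = p ^ multiplicity p (Coset.order G) * m" "\<not> p dvd m"
    using multiplicity_decompose'[OF o np] by metis
  obtain h where h: "h \<in> carrier G" "\<And>t. t \<in> T \<Longrightarrow> inv h \<otimes> t \<otimes> h \<in> P"
  proof (rule p_group_fixed_coset[where F = "\<lambda>_. 1 :: int" and I = "{x :: int. int p dvd x}" and u = "int m",
        OF _ fin p P T cT])
    show "inj (of_nat :: nat \<Rightarrow> int)" by simp
    show "(\<Sum>h\<in>carrier G. 1) = int (card P) * int m"
      using arg_cong[OF m(1), of int] cP by (simp add: Coset.order_def)
    show "int m \<notin> {x. int p dvd x}" using m(2) by simp
  qed auto
  have "conj_set (inv h) T \<subseteq> P"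
    using h TG by (auto simp: conj_set_def)
  then show ?thesis using that h by blast
qed

end

subsection \<open>Local rings and the Jacobson radical\<close>

text \<open>Zorn's lemma on the left ideals that contain \<open>L\<close> and miss the unit. The
  statement is about a bare record with a right unit law, so that it applies to
  \<open>gmod_End\<close> as well as to \<open>rta\<close>.\<close>

lemma exists_maximal_left_ideal:
  assumes L: "left_ideal L E" and one: "\<one>\<^bsub>E\<^esub> \<in> carrier E" "\<one>\<^bsub>E\<^esub> \<notin> L"
    and unit: "\<And>x. x \<in> carrier E \<Longrightarrow> x \<otimes>\<^bsub>E\<^esub> \<one>\<^bsub>E\<^esub> = x"
  obtains I where "maximal_left_ideal I E" "L \<subseteq> I"
proof -
  let ?A = "{I. left_ideal I E \<and> L \<subseteq> I \<and> \<one>\<^bsub>E\<^esub> \<notin> I}"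
  have "\<exists>M\<in>?A. \<forall>I\<in>?A. M \<subseteq> I \<longrightarrow> I = M"
  proof (rule subset_Zorn_nonempty)
    show "?A \<noteq> {}" using L one by blast
    fix C assume ne: "C \<noteq> {}" and ch: "subset.chain ?A C"
    have CA: "I \<in> ?A" if "I \<in> C" for I using ch that by (auto simp: subset_chain_def)
    have sg: "subgroup I (add_monoid E)" if "I \<in> C" for I
      using CA[OF that] by (auto simp: left_ideal_def additive_subgroup_def)
    have "subgroup (\<Union>C) (add_monoid E)"
    proof
      show "\<Union>C \<subseteq> carrier (add_monoid E)" using subgroup.subset[OF sg] by blast
      show "\<one>\<^bsub>add_monoid E\<^esub> \<in> \<Union>C" using ne subgroup.one_closed[OF sg] by blast
      show "inv\<^bsub>add_monoid E\<^esub> x \<in> \<Union>C" if "x \<in> \<Union>C" for x using that subgroup.m_inv_closed[OF sg] by blast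
      show "x \<otimes>\<^bsub>add_monoid E\<^esub> y \<in> \<Union>C" if "x \<in> \<Union>C" "y \<in> \<Union>C" for x y
      proof -
        obtain I J where IJ: "I \<in> C" "J \<in> C" "x \<in> I" "y \<in> J" using \<open>x \<in> \<Union>C\<close> \<open>y \<in> \<Union>C\<close> by blast
        then have "I \<subseteq> J \<or> J \<subseteq> I" using ch by (auto simp: subset_chain_def)
        then show ?thesis using IJ subgroup.m_closed[OF sg] by blast
      qed
    qed
    moreover have "x \<otimes>\<^bsub>E\<^esub> a \<in> \<Union>C" if "a \<in> \<Union>C" "x \<in> carrier E" for a x
      using that CA by (auto simp: left_ideal_def) blast
    ultimately have "left_ideal (\<Union>C) E" by (simp add: left_ideal_def additive_subgroup_def)
    moreover have "L \<subseteq> \<Union>C" using ne CA by blast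
    moreover have "\<one>\<^bsub>E\<^esub> \<notin> \<Union>C" using CA by blast
    ultimately show "\<Union>C \<in> ?A" by blast
  qed
  then obtain M where M: "M \<in> ?A" "\<forall>I\<in>?A. M \<subseteq> I \<longrightarrow> I = M" by (rule bexE)
  have "J = M \<or> J = carrier E" if J: "left_ideal J E" "M \<subseteq> J" for J
  proof (cases "\<one>\<^bsub>E\<^esub> \<in> J")
    case True
    have "carrier E \<subseteq> J"
    proof
      fix x assume x: "x \<in> carrier E"
      then have "x \<otimes>\<^bsub>E\<^esub> \<one>\<^bsub>E\<^esub> \<in> J" using True J(1) by (auto simp: left_ideal_def)
      then show "x \<in> J" using unit[OF x] by simp
    qed
    moreover have "J \<subseteq> carrier E"
      using J(1) additive_subgroup.a_subset by (auto simp: left_ideal_def)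
    ultimately show ?thesis by blast
  next
    case False
    then have "J \<in> ?A" using M(1) J by blast
    then show ?thesis using M(2)[rule_format, OF _ J(2)] by blast
  qed
  then have "maximal_left_ideal M E" using M(1) one by (auto simp: maximal_left_ideal_def)
  then show ?thesis using that M(1) by blast
qed

text \<open>Locality in terms of units: a sum of two nonunits is a nonunit. In this form it applies
  directly to sums of traces, with no passage to the residue field.\<close>

definition local_type :: "'o::comm_ring_1 itself \<Rightarrow> bool" where
  "local_type _ \<longleftrightarrow> (\<forall>x y :: 'o. x + y dvd 1 \<longrightarrow> x dvd 1 \<or> y dvd 1)"

text \<open>A nonunit generates a proper ideal, which lies in a maximal one and hence in the only
  one. So \<open>max_ideal\<close> is the set of nonunits, and the nonunits are closed under
  addition.\<close>

lemma complete_local_pid_facts: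
  assumes "complete_local_pid (rta :: 'o::idom ring)"
  shows "principal_domain (rta :: 'o ring)" "local_type TYPE('o)" "x \<in> max_ideal (rta :: 'o ring) \<Longrightarrow> \<not> x dvd 1"
    "additive_subgroup (max_ideal (rta :: 'o ring)) rta"
proof -
  have cr: "cring (rta :: 'o ring)" by (rule cring_from_type_algebra)
  have rg: "ring (rta :: 'o ring)" by (rule ring_from_type_algebra)
  show "principal_domain (rta :: 'o ring)" using assms by (simp add: complete_local_pid_def)
  let ?m = "max_ideal (rta :: 'o ring)"
  have ex1: "\<exists>!m. maximalideal m (rta :: 'o ring)" using assms by (simp add: complete_local_pid_def)
  then have m: "maximalideal ?m (rta :: 'o ring)" unfolding max_ideal_def by (rule theI')
  then interpret m: maximalideal ?m "rta :: 'o ring" .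
  show "additive_subgroup ?m rta" by (rule m.additive_subgroup_axioms)
  have nu: "\<not> x dvd 1" if "x \<in> ?m" for x
  proof
    assume "x dvd 1"
    then obtain y where "1 = x * y" by (auto simp: dvd_def)
    then have "1 \<in> ?m" using m.I_r_closed[OF that, of y] by simp
    then have "?m = carrier rta" using m.one_imp_carrier by simp
    then show False using m.I_notcarr by simp
  qed
  then show "x \<in> ?m \<Longrightarrow> \<not> x dvd 1" .
  have mem: "x \<in> ?m" if x: "\<not> x dvd 1" for x
  proof -
    have "ideal (PIdl\<^bsub>rta\<^esub> x) rta" using cring.cgenideal_ideal[OF cr, of x] by simp
    then have li_x: "left_ideal (PIdl\<^bsub>rta\<^esub> x) rta"
      using ideal.I_l_closed by (fastforce simp: left_ideal_def ideal_def)
    have one_x: "\<one>\<^bsub>rta\<^esub> \<notin> PIdl\<^bsub>rta\<^esub> x" using x by (auto simp: cgenideal_def dvd_def mult.commute)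
    obtain I where I: "maximal_left_ideal I (rta :: 'o ring)" "PIdl\<^bsub>rta\<^esub> x \<subseteq> I"
      by (rule exists_maximal_left_ideal[OF li_x _ one_x]) auto
    have li: "left_ideal J (rta :: 'o ring)" if "ideal J (rta :: 'o ring)" for J
      using that ideal.I_l_closed by (fastforce simp: left_ideal_def ideal_def)
    have "maximalideal I (rta :: 'o ring)"
    proof (rule maximalidealI)
      show "ideal I (rta :: 'o ring)"
        using I(1) rg by (intro idealI) (auto simp: maximal_left_ideal_def left_ideal_def additive_subgroup_def mult.commute)
      show "carrier rta \<noteq> I" using I(1) by (auto simp: maximal_left_ideal_def)
      show "J = I \<or> J = carrier rta" if "ideal J (rta :: 'o ring)" "I \<subseteq> J" for J
        using I(1) li that unfolding maximal_left_ideal_def by blast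
    qed
    then have "I = ?m" using ex1 m by blast
    moreover have "x \<in> PIdl\<^bsub>rta\<^esub> x" using ring.cgenideal_self[OF rg, of x] by simp
    ultimately show ?thesis using I(2) by blast
  qed
  have "x dvd 1 \<or> y dvd 1" if "x + y dvd 1" for x y :: 'o
  proof (rule ccontr)
    assume "\<not> (x dvd 1 \<or> y dvd 1)"
    then have "x \<in> ?m" "y \<in> ?m" using mem by blast+
    then have "x + y \<in> ?m"
      using additive_subgroup.a_closed[OF m.additive_subgroup_axioms, of x y] by simp
    then show False using nu that by blast
  qed
  then show "local_type TYPE('o)" by (simp add: local_type_def)
qed

section \<open>Elements and maps that vanish modulo the maximal ideal\<close>

lemma local_sum:
  assumes "local_type TYPE('o::comm_ring_1)" "\<And>i. i \<in> A \<Longrightarrow> \<not> (f i :: 'o) dvd 1"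
  shows "\<not> (\<Sum>i\<in>A. f i) dvd 1"
  using assms(2)
  by (induction A rule: infinite_finite_induct) (use assms(1) in \<open>auto simp: local_type_def\<close>)

lemma nonunit_mult: "\<not> (x :: 'o::comm_ring_1) dvd 1 \<Longrightarrow> \<not> a * x dvd 1"
  using dvd_mult_right by blast

text \<open>For a free module over a local ring with maximal ideal \<open>\<m>\<close> this is membership in \<open>\<m>M\<close>.\<close>

definition small :: "('r::comm_ring_1, 'm, 'x) module_scheme \<Rightarrow> 'm \<Rightarrow> bool" where
  "small M x \<longleftrightarrow> x \<in> carrier M \<and> (\<forall>h. lin M scal h \<longrightarrow> \<not> h x dvd 1)"

lemma small_lin: "lin M N f \<Longrightarrow> small M x \<Longrightarrow> small N (f x)"
  using lin_comp[of M N f scal] by (auto simp: small_def lin_closed)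

lemma small_add:
  fixes M :: "('r::comm_ring_1, 'm, 'x) module_scheme"
  assumes "rmod M" "local_type TYPE('r)" "small M x" "small M y"
  shows "small M (x \<oplus>\<^bsub>M\<^esub> y)"
proof -
  interpret M: rmod M by fact
  show ?thesis using assms unfolding small_def local_type_def
    by (metis (no_types, lifting) M.M.a_closed fun_add)
qed

lemma small_smult:
  assumes "rmod M" "small M x" shows "small M (a \<odot>\<^bsub>M\<^esub> x)"
proof -
  interpret M: rmod M by fact
  show ?thesis using assms(2) nonunit_mult by (auto simp: small_def fun_smult)
qed

lemma small_coords:
  fixes M :: "('r::comm_ring_1, 'm, 'x) module_scheme"
  assumes "coords M I b c" "local_type TYPE('r)" "x \<in> carrier M" "\<And>i. i \<in> I \<Longrightarrow> \<not> c i x dvd 1"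
  shows "small M x"
  unfolding small_def
proof (intro conjI allI impI)
  fix h assume "lin M scal h"
  from coords_expand_fun[OF assms(1) this assms(3)]
  have "h x = (\<Sum>i\<in>I. h (b i) * c i x)" by (simp add: mult.commute)
  moreover have "\<not> (\<Sum>i\<in>I. h (b i) * c i x) dvd 1"
    using nonunit_mult[OF assms(4)] by (rule local_sum[OF assms(2)])
  ultimately show "\<not> h x dvd 1" by simp
qed (rule assms(3))

lemma mod_trace_rank_one:
  assumes "rmod M" "free_of_finite_rank M" "lin M scal h" "y \<in> carrier M"
  shows "mod_trace M (\<lambda>x. h x \<odot>\<^bsub>M\<^esub> y) = h y"
proof -
  interpret M: rmod M by fact
  obtain B c where B: "coords M B (\<lambda>b. b) c" using free_coords[OF assms(1,2)] by blast
  have "lin M M (\<lambda>x. h x \<odot>\<^bsub>M\<^esub> y)" using assms(3,4) by (simp add: lin_def M.rmod_ldistr M.rmod_assoc)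
  from mod_trace_coords[OF B this] show ?thesis
    using coords_expand_fun[OF B assms(3,4)] fun_smult[OF coordsD(4)[OF B] assms(4)] by (simp add: mult.commute)
qed

lemma lin_fun_smult:
  assumes "rmod N" "lin M scal h" "y \<in> carrier N" shows "lin M N (\<lambda>x. h x \<odot>\<^bsub>N\<^esub> y)"
proof -
  interpret N: rmod N by fact
  show ?thesis using assms(2,3) by (simp add: lin_def N.rmod_ldistr N.rmod_assoc)
qed

lemma small_zero:
  assumes "rmod M" shows "small M \<zero>\<^bsub>M\<^esub>"
proof -
  interpret M: rmod M by fact
  have "h \<zero>\<^bsub>M\<^esub> = 0" if "lin M scal h" for h
    using lin_zero[OF assms rmod_scal that] by simp
  then show ?thesis unfolding small_def by (metis M.M.zero_closed dvd_0_left zero_neq_one)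
qed

text \<open>A nilpotent matrix over the residue field has trace zero; here the argument is carried
  out over O. By induction on the rank, a vector \<open>y\<close> with \<open>h y = 1\<close> and
  \<open>f y\<close> small is split off. The trace is \<open>h (f y)\<close> plus the trace of the
  compression of \<open>f\<close> to the kernel of \<open>h\<close>, and the compression is again
  nilpotent up to small elements.\<close>

theorem trace_nilpotent_mod:
  fixes M :: "('o::idom, 'm, 'x) module_scheme"
  assumes pid: "principal_domain (rta :: 'o ring)" and inj: "inj (of_nat :: nat \<Rightarrow> 'o)" and loc: "local_type TYPE('o)"
    and "rmod M" "free_of_finite_rank M" "lin M M f" "\<And>x. x \<in> carrier M \<Longrightarrow> small M ((f ^^ s) x)"
  shows "\<not> mod_trace M f dvd 1"
  using assms(4-)
proof (induction "mod_rank M" arbitrary: M f s rule: less_induct)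
  case less
  interpret M: rmod M by fact
  note free = less.prems(2) and f = less.prems(3)
  obtain B c where B: "coords M B (\<lambda>b. b) c" using free_coords[OF M.rmod_axioms free] by blast
  note C = coordsD[OF B]
  have pw: "(f ^^ k) x \<in> carrier M" if "x \<in> carrier M" for k x
    using that lin_closed[OF f] by (induction k) auto
  show ?case
  proof (cases "B = {}")
    case True
    then show ?thesis using mod_trace_coords[OF B f] by simp
  next
    case False
    then obtain b where b: "b \<in> B" by blast
    have "c b b dvd 1" using C(5)[OF b b] by simp
    then have "\<not> small M b" using C(4)[OF b] unfolding small_def by blast
    \<comment> \<open>With \<open>t\<close> the least exponent for which \<open>f^t\<close> is small
      everywhere, some \<open>f^(t-1) x\<close> is not small while its image under \<open>f\<close>
      is. This element becomes \<open>y\<close>.\<close>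
    define t where "t = (LEAST t. \<forall>x\<in>carrier M. small M ((f ^^ t) x))"
    have t: "\<And>x. x \<in> carrier M \<Longrightarrow> small M ((f ^^ t) x)"
      using LeastI[of "\<lambda>t. \<forall>x\<in>carrier M. small M ((f ^^ t) x)" s] less.prems(4) unfolding t_def by blast
    have "t \<noteq> 0" using t[OF C(3)[OF b]] \<open>\<not> small M b\<close> by (auto intro: ccontr)
    then obtain t' where t': "t = Suc t'" using not0_implies_Suc by blast
    have "\<not> (\<forall>x\<in>carrier M. small M ((f ^^ t') x))"
      using not_less_Least[of t' "\<lambda>t. \<forall>x\<in>carrier M. small M ((f ^^ t) x)"] t' unfolding t_def by simp
    then obtain x where x: "x \<in> carrier M" "\<not> small M ((f ^^ t') x)" by blast
    define y where "y = (f ^^ t') x"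
    have y: "y \<in> carrier M" "small M (f y)" "\<not> small M y"
      using pw[OF x(1)] t[OF x(1)] t' x(2) by (auto simp: y_def)
    then obtain h0 where h0: "lin M scal h0" "h0 y dvd 1" by (auto simp: small_def)
    then obtain v where v: "v * h0 y = 1" by (auto simp: dvd_def mult.commute)
    define h where "h x = v * h0 x" for x
    have h: "lin M scal h" "h y = 1" using lin_scale[OF rmod_scal h0(1), of v] v by (simp_all add: h_def[abs_def])
    let ?H = "{x \<in> carrier M. h x = 0}"
    let ?K = "M\<lparr>carrier := ?H\<rparr>"
    have H: "submodule ?H rta M"
      using lin_zero[OF M.rmod_axioms rmod_scal h(1)]
      by (intro M.rmod_submoduleI) (auto simp: fun_add[OF h(1)] fun_smult[OF h(1)])
    interpret K: rmod ?K using rmod_sub[OF M.rmod_axioms H] .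
    have freeK: "free_of_finite_rank ?K" using free_sub[OF pid M.rmod_axioms free H] .
    have HM: "?H \<subseteq> carrier M" by blast
    define p where "p x = x \<oplus>\<^bsub>M\<^esub> (- h x) \<odot>\<^bsub>M\<^esub> y" for x
    have hy: "lin M M (\<lambda>x. (- h x) \<odot>\<^bsub>M\<^esub> y)"
      using lin_scale[OF rmod_scal h(1), of "-1"] by (intro lin_fun_smult[OF M.rmod_axioms _ y(1)]) simp
    have pM: "lin M M p" unfolding p_def by (rule lin_plus[OF M.rmod_axioms lin_id hy])
    have pK: "lin M ?K p"
    proof (rule lin_to_sub[OF pM])
      fix x assume x: "x \<in> carrier M"
      have "h (p x) = 0"
        using x y(1) h(2) by (simp add: p_def fun_add[OF h(1)] fun_smult[OF h(1)])
      then show "p x \<in> ?H" using lin_closed[OF pM x] by simp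
    qed
    have p_id: "p x = x" if "x \<in> ?H" for x using that y(1) by (simp add: p_def)
    have split: "x = p x \<oplus>\<^bsub>M\<^esub> h x \<odot>\<^bsub>M\<^esub> y" if "x \<in> carrier M" for x
      using that y(1) by (simp add: p_def M.M.a_assoc flip: M.rmod_ldistr)
    have incl: "lin ?K M (\<lambda>x. x)" by (rule lin_incl[OF HM])
    \<comment> \<open>The trace along the splitting of \<open>M\<close> into the kernel of
      \<open>h\<close> and the line of \<open>y\<close>. Applied to the identity it shows that the
      rank drops by one, applied to \<open>f\<close> it gives the induction step.\<close>
    have tr: "mod_trace M g = mod_trace ?K (\<lambda>x. p (g x)) + h (g y)" if g: "lin M M g" for g
    proof -
      have "mod_trace M g = mod_trace M (\<lambda>x. g (p x) \<oplus>\<^bsub>M\<^esub> h x \<odot>\<^bsub>M\<^esub> g y)"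
      proof (rule mod_trace_cong[OF M.rmod_axioms free g])
        fix x assume x: "x \<in> carrier M"
        have "g x = g (p x \<oplus>\<^bsub>M\<^esub> h x \<odot>\<^bsub>M\<^esub> y)" using split[OF x] by simp
        then show "g x = g (p x) \<oplus>\<^bsub>M\<^esub> h x \<odot>\<^bsub>M\<^esub> g y"
          using x y(1) lin_closed[OF pM x] by (simp add: lin_add[OF g] lin_smult[OF g])
      qed
      also have "\<dots> = mod_trace M (\<lambda>x. g (p x)) + mod_trace M (\<lambda>x. h x \<odot>\<^bsub>M\<^esub> g y)"
      proof (rule mod_trace_add[OF M.rmod_axioms free lin_comp[OF pM g]])
        show "lin M M (\<lambda>x. h x \<odot>\<^bsub>M\<^esub> g y)"
          using lin_closed[OF g y(1)] h(1) by (simp add: lin_def M.rmod_ldistr M.rmod_assoc)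
      qed
      also have "mod_trace M (\<lambda>x. h x \<odot>\<^bsub>M\<^esub> g y) = h (g y)"
        by (rule mod_trace_rank_one[OF M.rmod_axioms free h(1) lin_closed[OF g y(1)]])
      also have "mod_trace M (\<lambda>x. g (p x)) = mod_trace ?K (\<lambda>x. p (g x))"
        using mod_trace_commute[OF M.rmod_axioms K.rmod_axioms free freeK pK lin_comp[OF incl g]] by simp
      finally show ?thesis .
    qed
    have "mod_trace ?K (\<lambda>x. p x) = mod_trace ?K (\<lambda>x. x)"
      by (rule mod_trace_cong[OF K.rmod_axioms freeK lin_comp[OF incl pK]]) (use p_id in simp)
    then have "of_nat (mod_rank M) = (of_nat (Suc (mod_rank ?K)) :: 'o)"
      using tr[OF lin_id] h(2) mod_trace_id[OF inj M.rmod_axioms free] mod_trace_id[OF inj K.rmod_axioms freeK] by simp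
    then have "mod_rank M = Suc (mod_rank ?K)" by (rule injD[OF inj])
    then have rk: "mod_rank ?K < mod_rank M" by simp
    define f' where "f' x = p (f x)" for x
    have f'K: "lin ?K ?K f'" unfolding f'_def using lin_comp[OF lin_comp[OF incl f] pK] by simp
    have pw': "(f' ^^ k) x \<in> ?H" if "x \<in> ?H" for k x
      using that lin_closed[OF f'K] by (induction k) auto
    \<comment> \<open>Replacing \<open>f\<close> by its compression costs a multiple of
      \<open>p (f y)\<close> at each step, which is small, and an error that is small stays so under
      \<open>f\<close> and \<open>p\<close>.\<close>
    have approx: "\<exists>z. small M z \<and> (f' ^^ k) x = p ((f ^^ k) x) \<oplus>\<^bsub>M\<^esub> z" if x: "x \<in> ?H" for k x
    proof (induction k)
      case 0
      show ?case using small_zero[OF M.rmod_axioms] x p_id[OF x] by (intro exI[of _ "\<zero>\<^bsub>M\<^esub>"]) simp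
    next
      case (Suc k)
      then obtain z where z: "small M z" "(f' ^^ k) x = p ((f ^^ k) x) \<oplus>\<^bsub>M\<^esub> z" by blast
      let ?w = "(f ^^ k) x"
      have w: "?w \<in> carrier M" using pw x by blast
      have zM: "z \<in> carrier M" using z(1) by (simp add: small_def)
      have cl: "f ?w \<in> carrier M" "p (f ?w) \<in> carrier M" "f y \<in> carrier M" "p (f y) \<in> carrier M" "f z \<in> carrier M" "p (f z) \<in> carrier M"
        using w y zM lin_closed[OF f] lin_closed[OF pM] by auto
      have "f (p ?w \<oplus>\<^bsub>M\<^esub> z) = (f ?w \<oplus>\<^bsub>M\<^esub> (- h ?w) \<odot>\<^bsub>M\<^esub> f y) \<oplus>\<^bsub>M\<^esub> f z"
        using w y(1) zM by (simp add: p_def lin_add[OF f] lin_smult[OF f])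
      then have "p (f (p ?w \<oplus>\<^bsub>M\<^esub> z)) = p (f ?w) \<oplus>\<^bsub>M\<^esub> ((- h ?w) \<odot>\<^bsub>M\<^esub> p (f y) \<oplus>\<^bsub>M\<^esub> p (f z))"
        using cl by (simp add: lin_add[OF pM] lin_smult[OF pM] M.M.a_assoc)
      moreover have "small M ((- h ?w) \<odot>\<^bsub>M\<^esub> p (f y) \<oplus>\<^bsub>M\<^esub> p (f z))"
        using small_add[OF M.rmod_axioms loc small_smult[OF M.rmod_axioms small_lin[OF pM y(2)]] small_lin[OF pM small_lin[OF f z(1)]]] .
      moreover have "(f' ^^ Suc k) x = p (f ((f' ^^ k) x))" by (simp add: f'_def[of "(f' ^^ k) x"])
      ultimately show ?case using z(2) by auto
    qed
    have "small ?K ((f' ^^ t) x)" if x: "x \<in> carrier ?K" for x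
    proof -
      obtain z where z: "small M z" "(f' ^^ t) x = p ((f ^^ t) x) \<oplus>\<^bsub>M\<^esub> z" using approx[of x t] x by auto
      have "small M ((f' ^^ t) x)"
        unfolding z(2) using x by (intro small_add[OF M.rmod_axioms loc small_lin[OF pM t] z(1)]) simp
      then have "small ?K (p ((f' ^^ t) x))" by (rule small_lin[OF pK])
      then show ?thesis using p_id[OF pw'[of x t]] x by simp
    qed
    then have "\<not> mod_trace ?K f' dvd 1"
      by (rule less.hyps[OF rk K.rmod_axioms freeK f'K])
    moreover have "\<not> h (f y) dvd 1" using y(2) h(1) by (auto simp: small_def)
    moreover have "mod_trace M f = mod_trace ?K f' + h (f y)" using tr[OF f] by (simp add: f'_def[abs_def])
    ultimately show ?thesis using loc by (auto simp: local_type_def)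
  qed
qed

section \<open>The radical of the endomorphism ring\<close>

lemma carrier_gmod_End: "carrier (gmod_End G M) = commutant G M"
  by (auto simp: gmod_End_def gmod_hom_def commutant_def lin_def equi_def PiE_def)

text \<open>The ring record \<open>gmod_End\<close> and the module on the commutant share their
  additive group, so that a submodule yields an additive subgroup of the ring.\<close>

lemma additive_subgroup_End:
  "additive_subgroup I (gmod_End G M) \<longleftrightarrow> additive_subgroup I (linmod M\<lparr>carrier := commutant G M\<rparr>)"
proof -
  have "carrier (add_monoid (gmod_End G M)) = carrier (add_monoid (linmod M\<lparr>carrier := commutant G M\<rparr>))"
    "monoid.mult (add_monoid (gmod_End G M)) = monoid.mult (add_monoid (linmod M\<lparr>carrier := commutant G M\<rparr>))"
    "one (add_monoid (gmod_End G M)) = one (add_monoid (linmod M\<lparr>carrier := commutant G M\<rparr>))"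
    using carrier_gmod_End[of G M] by (simp_all add: gmod_End_def linmod_def)
  then show ?thesis by (simp only: additive_subgroup_def subgroup_def m_inv_def)
qed

lemma commutant_comp:
  assumes M: "gmodule G M" and f: "f \<in> commutant G M" and h: "h \<in> commutant G M"
  shows "compose (carrier M) f h \<in> commutant G M"
proof -
  note rm = gmodule_rmod[OF M]
  have "lin M M (\<lambda>x. f (h x))" "equi (carrier G) M M (\<lambda>x. f (h x))"
    using f h lin_comp[of M M h M f] equi_comp[of M M h "carrier G" M f] by (auto simp: commutant_def)
  then show ?thesis
    by (simp add: commutant_def compose_def lin_restrict[OF rm] equi_restrict[OF M subset_refl])
qed

lemma commutant_restrict:
  assumes "gmodule G M"
  shows "restrict f (carrier M) \<in> commutant G M \<longleftrightarrow> lin M M f \<and> equi (carrier G) M M f"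
  by (simp add: commutant_def lin_restrict[OF gmodule_rmod[OF assms]] equi_restrict[OF assms subset_refl])

text \<open>Otherwise the proper left ideal generated by \<open>u\<close> lies in a maximal one.
  That ideal also contains \<open>j\<close>, hence \<open>u - w j\<close>, which is multiplication
  by the unit \<open>c\<close>.\<close>

lemma radical_left_inverse:
  fixes M :: "('r::comm_ring_1, 'g, 'm) gmod"
  assumes M: "gmodule G M" and j: "j \<in> jacobson_radical (gmod_End G M)" and w: "w \<in> commutant G M"
    and c: "c dvd 1" and u: "u \<in> commutant G M" "\<And>x. x \<in> carrier M \<Longrightarrow> u x = c \<odot>\<^bsub>M\<^esub> x \<oplus>\<^bsub>M\<^esub> w (j x)"
  obtains v where "lin M M v" "\<And>x. x \<in> carrier M \<Longrightarrow> v (u x) = x"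
proof -
  interpret M: rmod M using M by (rule gmodule_rmod)
  let ?E = "gmod_End G M"
  let ?C = "linmod M\<lparr>carrier := commutant G M\<rparr>"
  interpret C: rmod ?C using rmod_sub[OF rmod_linmod[OF M.rmod_axioms] submodule_commutant[OF M]] .
  have mult: "f \<otimes>\<^bsub>?E\<^esub> h = compose (carrier M) f h" and one: "\<one>\<^bsub>?E\<^esub> = (\<lambda>x\<in>carrier M. x)" for f h
    by (simp_all add: gmod_End_def)
  have l: "lin M M f" if "f \<in> commutant G M" for f using that by (simp add: commutant_def)
  have ext: "f \<in> extensional (carrier M)" if "f \<in> commutant G M" for f using that by (simp add: commutant_def)
  have jC: "j \<in> commutant G M" using j by (simp add: jacobson_radical_def carrier_gmod_End)
  let ?L = "(\<lambda>v. compose (carrier M) v u) ` commutant G M"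
  have sub: "?L \<subseteq> commutant G M" using commutant_comp[OF M _ u(1)] by blast
  have "submodule ?L rta ?C"
  proof (rule C.rmod_submoduleI)
    show "?L \<subseteq> carrier ?C" using sub by simp
    have "\<zero>\<^bsub>?C\<^esub> = compose (carrier M) \<zero>\<^bsub>?C\<^esub> u"
      using lin_closed[OF l[OF u(1)]] by (auto simp: compose_def)
    then show "\<zero>\<^bsub>?C\<^esub> \<in> ?L" using C.M.zero_closed by (auto intro: image_eqI)
    show "x \<oplus>\<^bsub>?C\<^esub> y \<in> ?L" if xy: "x \<in> ?L" "y \<in> ?L" for x y
    proof -
      obtain a b where ab: "a \<in> commutant G M" "b \<in> commutant G M" "x = compose (carrier M) a u" "y = compose (carrier M) b u"
        using xy by blast
      have "x \<oplus>\<^bsub>?C\<^esub> y = compose (carrier M) (a \<oplus>\<^bsub>?C\<^esub> b) u"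
        using lin_closed[OF l[OF u(1)]] unfolding ab by (auto simp: compose_def)
      moreover have "a \<oplus>\<^bsub>?C\<^esub> b \<in> commutant G M" using C.M.a_closed[of a b] ab by simp
      ultimately show ?thesis by blast
    qed
    show "t \<odot>\<^bsub>?C\<^esub> x \<in> ?L" if x: "x \<in> ?L" for t x
    proof -
      obtain a where a: "a \<in> commutant G M" "x = compose (carrier M) a u" using x by blast
      have "t \<odot>\<^bsub>?C\<^esub> x = compose (carrier M) (t \<odot>\<^bsub>?C\<^esub> a) u"
        using lin_closed[OF l[OF u(1)]] unfolding a by (auto simp: compose_def)
      moreover have "t \<odot>\<^bsub>?C\<^esub> a \<in> commutant G M" using C.rmod_smult[of a t] a by simp
      ultimately show ?thesis by blast
    qed
  qed
  then have "additive_subgroup ?L ?E"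
    unfolding additive_subgroup_End by (simp add: submodule_def additive_subgroup_def)
  moreover have "x \<otimes>\<^bsub>?E\<^esub> a \<in> ?L" if a: "a \<in> ?L" and x: "x \<in> carrier ?E" for a x
  proof -
    obtain b where b: "b \<in> commutant G M" "a = compose (carrier M) b u" using a by blast
    have "x \<otimes>\<^bsub>?E\<^esub> a = compose (carrier M) (compose (carrier M) x b) u"
      using lin_closed[OF l[OF u(1)]] lin_closed[OF l[OF b(1)]] unfolding mult b by (auto simp: compose_def)
    then show ?thesis using commutant_comp[OF M _ b(1)] x by (auto simp: carrier_gmod_End)
  qed
  ultimately have L: "left_ideal ?L ?E" by (simp add: left_ideal_def)
  have idC: "(\<lambda>x\<in>carrier M. x) \<in> commutant G M"
    unfolding commutant_restrict[OF M] by (simp add: lin_id equi_def)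
  have unit: "x \<otimes>\<^bsub>?E\<^esub> \<one>\<^bsub>?E\<^esub> = x" if "x \<in> carrier ?E" for x
    using ext[of x] that unfolding mult one carrier_gmod_End
    by (intro extensionalityI[of _ "carrier M"]) (auto simp: compose_def)
  have "\<one>\<^bsub>?E\<^esub> \<in> ?L"
  proof (rule ccontr)
    assume nL: "\<one>\<^bsub>?E\<^esub> \<notin> ?L"
    obtain I where I: "maximal_left_ideal I ?E" "?L \<subseteq> I"
      by (rule exists_maximal_left_ideal[OF L _ nL unit]) (use idC in \<open>auto simp: carrier_gmod_End one\<close>)
    then have jI: "j \<in> I" using j by (auto simp: jacobson_radical_def)
    have Il: "a \<in> I \<Longrightarrow> x \<in> commutant G M \<Longrightarrow> compose (carrier M) x a \<in> I" for a x
      using I(1) by (auto simp: maximal_left_ideal_def left_ideal_def mult carrier_gmod_End)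
    have Is: "subgroup I (add_monoid ?C)"
      using I(1) additive_subgroup_End[of I G M] by (simp add: maximal_left_ideal_def left_ideal_def additive_subgroup_def)
    have "compose (carrier M) (\<lambda>x\<in>carrier M. x) u \<in> ?L" using idC by blast
    moreover have "compose (carrier M) (\<lambda>x\<in>carrier M. x) u = u"
      using ext[OF u(1)] lin_closed[OF l[OF u(1)]]
      by (intro extensionalityI[of _ "carrier M"]) (auto simp: compose_def)
    ultimately have uI: "u \<in> I" using I(2) by auto
    let ?m = "\<lambda>x\<in>carrier M. (- 1) \<odot>\<^bsub>M\<^esub> w x"
    have "?m \<in> commutant G M" using C.rmod_smult[of w "- 1"] w by simp
    then have "compose (carrier M) ?m j \<in> I" by (rule Il[OF jI])
    then have "u \<oplus>\<^bsub>?C\<^esub> compose (carrier M) ?m j \<in> I" using subgroup.m_closed[OF Is uI] by simp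
    moreover have "u \<oplus>\<^bsub>?C\<^esub> compose (carrier M) ?m j = (\<lambda>x\<in>carrier M. c \<odot>\<^bsub>M\<^esub> x)"
    proof (rule extensionalityI[of _ "carrier M"])
      fix x assume x: "x \<in> carrier M"
      have wj: "w (j x) \<in> carrier M" using x lin_closed[OF l[OF jC]] lin_closed[OF l[OF w]] by simp
      have "c \<odot>\<^bsub>M\<^esub> x \<oplus>\<^bsub>M\<^esub> (w (j x) \<oplus>\<^bsub>M\<^esub> (- 1) \<odot>\<^bsub>M\<^esub> w (j x)) = c \<odot>\<^bsub>M\<^esub> x"
        using rmod_eq_iff[OF M.rmod_axioms wj wj] x by simp
      then show "(u \<oplus>\<^bsub>?C\<^esub> compose (carrier M) ?m j) x = (\<lambda>x\<in>carrier M. c \<odot>\<^bsub>M\<^esub> x) x"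
        using x u(2)[OF x] wj lin_closed[OF l[OF jC] x] by (simp add: compose_def M.M.a_assoc)
    qed auto
    ultimately have cI: "(\<lambda>x\<in>carrier M. c \<odot>\<^bsub>M\<^esub> x) \<in> I" by simp
    obtain d where d: "1 = c * d" using c by (auto simp: dvd_def)
    have dC: "(\<lambda>x\<in>carrier M. d \<odot>\<^bsub>M\<^esub> x) \<in> commutant G M"
      using C.rmod_smult[of "\<lambda>x\<in>carrier M. x" d] idC by (simp cong: restrict_cong)
    have "compose (carrier M) (\<lambda>x\<in>carrier M. d \<odot>\<^bsub>M\<^esub> x) (\<lambda>x\<in>carrier M. c \<odot>\<^bsub>M\<^esub> x) = \<one>\<^bsub>?E\<^esub>"
      unfolding one by (auto simp: compose_def d[symmetric] mult.commute[of d] simp flip: M.rmod_assoc)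
    then have "\<one>\<^bsub>?E\<^esub> \<in> I" using Il[OF cI dC] by simp
    then have "carrier ?E \<subseteq> I" using I(1) unit by (auto simp: maximal_left_ideal_def left_ideal_def)
    then show False using I(1) subgroup.subset[OF Is] by (auto simp: maximal_left_ideal_def carrier_gmod_End)
  qed
  then obtain v where v: "v \<in> commutant G M" "(\<lambda>x\<in>carrier M. x) = compose (carrier M) v u" unfolding one by blast
  have "v (u x) = x" if x: "x \<in> carrier M" for x
    using fun_cong[OF v(2), of x] x by (simp add: compose_def)
  then show ?thesis using that[OF l[OF v(1)]] by blast
qed

text \<open>Divide a linear relation between powers of \<open>j\<close> by the greatest common divisor of its coefficients,
  so that some coefficient is a unit.  If the first unit occurs at \<open>j\<^sup>s\<close>, then \<open>j\<^sup>s u \<equiv> 0\<close> modulo the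
  maximal ideal with \<open>u\<close> invertible, because \<open>j\<close> is in the radical.  So \<open>j\<close> is nilpotent
  modulo the maximal ideal.\<close>

theorem radical_trace:
  fixes M :: "('o::idom, 'g, 'm) gmod"
  assumes pid: "principal_domain (rta :: 'o ring)" and inj: "inj (of_nat :: nat \<Rightarrow> 'o)" and loc: "local_type TYPE('o)"
    and M: "gmodule G M" and free: "free_of_finite_rank M" and j: "j \<in> jacobson_radical (gmod_End G M)"
  shows "\<not> mod_trace M j dvd 1"
proof -
  interpret M: gmodule G M by fact
  interpret M: rmod M using M by (rule gmodule_rmod)
  interpret C: rmod "linmod M\<lparr>carrier := commutant G M\<rparr>"
    using rmod_sub[OF rmod_linmod[OF M.rmod_axioms] submodule_commutant[OF M]] .
  obtain B c where B: "coords M B (\<lambda>b. b) c" using free_coords[OF M.rmod_axioms free] by blast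
  note BD = coordsD[OF B]
  have jC: "j \<in> commutant G M" using j by (simp add: jacobson_radical_def carrier_gmod_End)
  then have jl: "lin M M j" "equi (carrier G) M M j" by (auto simp: commutant_def)
  have pl: "lin M M (j ^^ k)" "equi (carrier G) M M (j ^^ k)" for k
  proof (induction k)
    case 0
    show "lin M M (j ^^ 0)" by (simp add: lin_def)
    show "equi (carrier G) M M (j ^^ 0)" by (simp add: equi_def)
  next
    case (Suc k)
    show "lin M M (j ^^ Suc k)" using lin_comp[OF Suc(1) jl(1)] by (simp add: comp_def)
    show "equi (carrier G) M M (j ^^ Suc k)" using equi_comp[OF Suc jl(2)] by (simp add: comp_def)
  qed
  note pc = lin_closed[OF pl(1)]
  \<comment> \<open>The rank of the module of all endomorphisms, so that the \<open>n + 1\<close>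
    powers of \<open>j\<close> up to \<open>j^n\<close> are dependent.\<close>
  define n where "n = card (B \<times> B)"
  have fin: "finite (B \<times> B)" using BD by blast
  have fl: "lin (linmod M) scal ((\<lambda>(i, b) f. c i (f b)) k)" if "k \<in> B \<times> B" for k
    using that BD linmod_functional[OF M.rmod_axioms] by auto
  have wl: "restrict (j ^^ k) (carrier M) \<in> carrier (linmod M)" for k
    using pl by (simp add: lin_restrict[OF M.rmod_axioms])
  obtain a where a: "\<exists>k\<le>n. a k \<noteq> 0"
    "\<And>i. i \<in> B \<times> B \<Longrightarrow> (\<Sum>k\<le>n. a k * (\<lambda>(i, b) f. c i (f b)) i (restrict (j ^^ k) (carrier M))) = 0"
    unfolding n_def
    by (rule exists_relation[where w = "\<lambda>k. restrict (j ^^ k) (carrier M)", OF pid inj rmod_linmod[OF M.rmod_axioms] fin fl wl]) blast+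
  have rel0: "(\<Sum>k\<le>n. a k * c i ((j ^^ k) b)) = 0" if "i \<in> B" "b \<in> B" for i b
    using a(2)[of "(i, b)"] that BD(3) by simp
  let ?D = "{\<Sum>k\<le>n. r k * a k | r. True}"
  obtain d where d: "d \<in> ?D" "\<And>x. x \<in> ?D \<Longrightarrow> d dvd x"
  proof (rule principal_generator[OF pid])
    show "0 \<in> ?D" by (intro CollectI exI[of _ "\<lambda>_. 0"]) simp
    show "x + y \<in> ?D" if "x \<in> ?D" "y \<in> ?D" for x y
    proof -
      obtain r s where "x = (\<Sum>k\<le>n. r k * a k)" "y = (\<Sum>k\<le>n. s k * a k)" using \<open>x \<in> ?D\<close> \<open>y \<in> ?D\<close> by blast
      then have "x + y = (\<Sum>k\<le>n. (r k + s k) * a k)" by (simp add: distrib_right sum.distrib)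
      then show ?thesis by (intro CollectI exI[of _ "\<lambda>k. r k + s k"] conjI TrueI)
    qed
    show "t * x \<in> ?D" if "x \<in> ?D" for t x
    proof -
      obtain r where "x = (\<Sum>k\<le>n. r k * a k)" using \<open>x \<in> ?D\<close> by blast
      then have "t * x = (\<Sum>k\<le>n. (t * r k) * a k)" by (simp add: sum_distrib_left mult.assoc)
      then show ?thesis by (intro CollectI exI[of _ "\<lambda>k. t * r k"] conjI TrueI)
    qed
  qed blast
  have dv: "d dvd a k" if "k \<le> n" for k
  proof (rule d(2), intro CollectI exI conjI)
    show "a k = (\<Sum>l\<le>n. (if l = k then 1 else 0) * a l)" using that by (simp add: if_distrib[of "\<lambda>x. x * _"] cong: if_cong)
  qed simp
  define a' where "a' k = (SOME t. a k = d * t)" for k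
  have a': "a k = d * a' k" if "k \<le> n" for k
    unfolding a'_def by (rule someI_ex) (use dv[OF that] in \<open>auto simp: dvd_def\<close>)
  have d0: "d \<noteq> 0" using a(1) a' by auto
  \<comment> \<open>The generator \<open>d\<close> is a combination of the coefficients, so 1 is a
    combination of the reduced ones; these cannot all be nonunits.\<close>
  have "\<exists>k\<le>n. a' k dvd 1"
  proof (rule ccontr)
    assume neg: "\<not> ?thesis"
    obtain r where "d = (\<Sum>k\<le>n. r k * a k)" using d(1) by blast
    also have "\<dots> = d * (\<Sum>k\<le>n. r k * a' k)" using a' by (simp add: sum_distrib_left mult.left_commute)
    finally have "(\<Sum>k\<le>n. r k * a' k) = 1" using d0 by simp
    moreover have "\<not> (\<Sum>k\<le>n. r k * a' k) dvd 1"
      using neg nonunit_mult by (intro local_sum[OF loc]) auto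
    ultimately show False by simp
  qed
  define s where "s = (LEAST k. k \<le> n \<and> a' k dvd 1)"
  have s: "s \<le> n" "a' s dvd 1" using LeastI_ex[OF \<open>\<exists>k\<le>n. a' k dvd 1\<close>] by (auto simp: s_def)
  have below: "\<not> a' k dvd 1" if "k < s" for k
    using not_less_Least[of k "\<lambda>k. k \<le> n \<and> a' k dvd 1"] that s(1) by (auto simp: s_def)
  have rel: "(\<Sum>k\<le>n. a' k * c i ((j ^^ k) b)) = 0" if "i \<in> B" "b \<in> B" for i b
  proof -
    have "d * (\<Sum>k\<le>n. a' k * c i ((j ^^ k) b)) = (\<Sum>k\<le>n. a k * c i ((j ^^ k) b))"
      using a' by (simp add: sum_distrib_left mult.assoc)
    then show ?thesis using rel0[OF that] d0 by simp
  qed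
  have relx: "(\<Oplus>\<^bsub>M\<^esub>k\<in>{..n}. a' k \<odot>\<^bsub>M\<^esub> (j ^^ k) x) = \<zero>\<^bsub>M\<^esub>" if x: "x \<in> carrier M" for x
  proof (rule coords_lin_eqI[OF B M.rmod_axioms _ _ _ x])
    show "lin M M (\<lambda>x. \<Oplus>\<^bsub>M\<^esub>k\<in>{..n}. a' k \<odot>\<^bsub>M\<^esub> (j ^^ k) x)"
      using pl by (intro lin_sum[OF M.rmod_axioms M.rmod_axioms] lin_scale[OF M.rmod_axioms]) auto
    show "lin M M (\<lambda>_. \<zero>\<^bsub>M\<^esub>)" by (simp add: lin_def)
    fix b assume b: "b \<in> B"
    have cl: "(\<lambda>k. a' k \<odot>\<^bsub>M\<^esub> (j ^^ k) b) \<in> {..n} \<rightarrow> carrier M" using pc BD(3)[OF b] by simp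
    show "(\<Oplus>\<^bsub>M\<^esub>k\<in>{..n}. a' k \<odot>\<^bsub>M\<^esub> (j ^^ k) b) = \<zero>\<^bsub>M\<^esub>"
    proof (rule coords_eqI[OF B M.M.finsum_closed[OF cl] M.M.zero_closed])
      fix i assume i: "i \<in> B"
      have "c i (\<Oplus>\<^bsub>M\<^esub>k\<in>{..n}. a' k \<odot>\<^bsub>M\<^esub> (j ^^ k) b) = (\<Sum>k\<le>n. a' k * c i ((j ^^ k) b))"
        using fun_sum[OF M.rmod_axioms BD(4)[OF i] _ cl] pc BD(3)[OF b] by (simp add: fun_smult[OF BD(4)[OF i]])
      then show "c i (\<Oplus>\<^bsub>M\<^esub>k\<in>{..n}. a' k \<odot>\<^bsub>M\<^esub> (j ^^ k) b) = c i \<zero>\<^bsub>M\<^esub>"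
        using rel[OF i b] lin_zero[OF M.rmod_axioms rmod_scal BD(4)[OF i]] by simp
    qed
  qed
  \<comment> \<open>The part of the relation beyond \<open>s\<close>, with the factor
    \<open>j^(s+1)\<close> removed. With \<open>u = a' s + w j\<close> the relation says that the
    terms below \<open>s\<close> and \<open>u (j^s x)\<close> add up to zero.\<close>
  define w where "w = (\<lambda>x\<in>carrier M. \<Oplus>\<^bsub>M\<^esub>k\<in>{s<..n}. a' k \<odot>\<^bsub>M\<^esub> (j ^^ (k - s - 1)) x)"
  have equi_sum: "equi (carrier G) M M (\<lambda>x. \<Oplus>\<^bsub>M\<^esub>k\<in>A. f k x)"
    if "finite A" "\<And>k. k \<in> A \<Longrightarrow> lin M M (f k)" "\<And>k. k \<in> A \<Longrightarrow> equi (carrier G) M M (f k)" for A :: "nat set" and f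
    unfolding equi_def
  proof (intro ballI)
    fix g x assume g: "g \<in> carrier G" and x: "x \<in> carrier M"
    have "act M g (\<Oplus>\<^bsub>M\<^esub>k\<in>A. f k x) = (\<Oplus>\<^bsub>M\<^esub>k\<in>A. act M g (f k x))"
      using lin_closed[OF that(2) x] that(1) by (intro lin_finsum[OF M.rmod_axioms M.rmod_axioms act_lin[OF M g]]) auto
    also have "\<dots> = (\<Oplus>\<^bsub>M\<^esub>k\<in>A. f k (act M g x))"
      using equiD[OF that(3) g x] lin_closed[OF that(2)] M.act_closed[OF g x] by (intro M.M.finsum_cong') auto
    finally show "(\<Oplus>\<^bsub>M\<^esub>k\<in>A. f k (act M g x)) = act M g (\<Oplus>\<^bsub>M\<^esub>k\<in>A. f k x)" by simp
  qed
  have wC: "w \<in> commutant G M"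
    unfolding w_def commutant_restrict[OF M]
    by (intro conjI lin_sum[OF M.rmod_axioms M.rmod_axioms] equi_sum lin_scale[OF M.rmod_axioms]
        equi_scale[OF M subset_refl] pl) auto
  define u where "u = (\<lambda>x\<in>carrier M. a' s \<odot>\<^bsub>M\<^esub> x \<oplus>\<^bsub>M\<^esub> w (j x))"
  have wl': "lin M M w" "equi (carrier G) M M w" using wC by (auto simp: commutant_def)
  have eid: "equi (carrier G) M M (\<lambda>x. x)" by (simp add: equi_def)
  have uC: "u \<in> commutant G M"
    unfolding u_def commutant_restrict[OF M]
    using lin_plus[OF M.rmod_axioms lin_scale[OF M.rmod_axioms lin_id] lin_comp[OF jl(1) wl'(1)]]
      equi_plus[OF M subset_refl lin_scale[OF M.rmod_axioms lin_id] lin_comp[OF jl(1) wl'(1)]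
        equi_scale[OF M subset_refl lin_id eid] equi_comp[OF jl wl'(2)]] by blast
  obtain v where v: "lin M M v" "\<And>x. x \<in> carrier M \<Longrightarrow> v (u x) = x"
    by (rule radical_left_inverse[OF M j wC s(2) uC]) (simp_all add: u_def)
  have "small M ((j ^^ s) x)" if x: "x \<in> carrier M" for x
  proof -
    let ?y = "(j ^^ s) x"
    have y: "?y \<in> carrier M" using pc x by blast
    have cl: "(\<lambda>k. a' k \<odot>\<^bsub>M\<^esub> (j ^^ k) x) \<in> A \<rightarrow> carrier M" for A using pc x by simp
    have "w (j ?y) = (\<Oplus>\<^bsub>M\<^esub>k\<in>{s<..n}. a' k \<odot>\<^bsub>M\<^esub> (j ^^ k) x)"
    proof -
      have "(j ^^ (k - s - 1)) (j ?y) = (j ^^ k) x" if "k \<in> {s<..n}" for k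
      proof -
        have "k = (k - s - 1) + Suc s" using that by auto
        then have "(j ^^ k) x = (j ^^ ((k - s - 1) + Suc s)) x" by simp
        then show ?thesis by (simp add: funpow_add funpow_swap1)
      qed
      then show ?thesis unfolding w_def using lin_closed[OF jl(1) y] cl pc x
        by (simp, intro M.M.finsum_cong') auto
    qed
    then have uy: "u ?y = (\<Oplus>\<^bsub>M\<^esub>k\<in>{s..n}. a' k \<odot>\<^bsub>M\<^esub> (j ^^ k) x)"
    proof -
      have "{s..n} = insert s {s<..n}" using s(1) by auto
      then show ?thesis
        using \<open>w (j ?y) = _\<close> y cl[of "{s<..n}"] unfolding u_def by (simp add: M.M.finsum_insert)
    qed
    let ?z = "\<Oplus>\<^bsub>M\<^esub>k\<in>{..<s}. (- a' k) \<odot>\<^bsub>M\<^esub> (j ^^ k) x"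
    let ?z' = "\<Oplus>\<^bsub>M\<^esub>k\<in>{..<s}. a' k \<odot>\<^bsub>M\<^esub> (j ^^ k) x"
    have zc: "?z \<in> carrier M" "?z' \<in> carrier M" "u ?y \<in> carrier M"
      unfolding uy using pc x by (auto intro!: M.M.finsum_closed)
    have "{..n} = {..<s} \<union> {s..n}" using s(1) by auto
    moreover have "(\<Oplus>\<^bsub>M\<^esub>k\<in>{..<s} \<union> {s..n}. a' k \<odot>\<^bsub>M\<^esub> (j ^^ k) x) = ?z' \<oplus>\<^bsub>M\<^esub> u ?y"
      unfolding uy by (intro M.M.finsum_Un_disjoint cl) auto
    ultimately have "?z' \<oplus>\<^bsub>M\<^esub> u ?y = \<zero>\<^bsub>M\<^esub>" using relx[OF x] by simp
    moreover have "?z \<oplus>\<^bsub>M\<^esub> ?z' = \<zero>\<^bsub>M\<^esub>"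
    proof -
      have "?z \<oplus>\<^bsub>M\<^esub> ?z' = (\<Oplus>\<^bsub>M\<^esub>k\<in>{..<s}. (- a' k) \<odot>\<^bsub>M\<^esub> (j ^^ k) x \<oplus>\<^bsub>M\<^esub> a' k \<odot>\<^bsub>M\<^esub> (j ^^ k) x)"
        using pc x by (intro M.M.finsum_addf[symmetric]) auto
      also have "\<dots> = (\<Oplus>\<^bsub>M\<^esub>k\<in>{..<s}. \<zero>\<^bsub>M\<^esub>)"
        using pc x by (intro M.M.finsum_cong') (auto simp flip: M.rmod_ldistr)
      finally show ?thesis by simp
    qed
    ultimately have "u ?y = ?z"
      using zc M.M.a_assoc[of ?z ?z' "u ?y"] by simp
    \<comment> \<open>So \<open>j^s x\<close> is the image under \<open>v\<close> of a combination
      whose coefficients are all nonunits, and linear maps keep small elements small.\<close>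
    then have "?y = v ?z" using v(2)[OF y] by simp
    moreover have "small M ?z"
    proof (rule small_coords[OF B loc zc(1)])
      fix i assume i: "i \<in> B"
      have "c i ?z = (\<Sum>k<s. - c i ((j ^^ k) x) * a' k)"
        using fun_sum[OF M.rmod_axioms BD(4)[OF i], of "{..<s}"] pc x
        by (simp add: fun_smult[OF BD(4)[OF i]] mult.commute)
      moreover have "\<not> (\<Sum>k<s. - c i ((j ^^ k) x) * a' k) dvd 1"
        using nonunit_mult[OF below] by (intro local_sum[OF loc]) auto
      ultimately show "\<not> c i ?z dvd 1" by simp
    qed
    ultimately show ?thesis using small_lin[OF v(1)] by simp
  qed
  then show ?thesis by (rule trace_nilpotent_mod[OF pid inj loc M.rmod_axioms free jl(1)])
qed

text \<open>The class of \<open>f\<close> corresponds to that of some \<open>l\<close> in the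
  residue field, and compatibility of the isomorphism with scalars makes \<open>f - l\<close>
  radical. Then \<open>radical_trace\<close> applies to the difference.\<close>

theorem absolutely_indecomposable_trace:
  fixes M :: "('o::idom, 'g, 'm) gmod"
  assumes O: "complete_local_pid (rta :: 'o ring)" and inj: "inj (of_nat :: nat \<Rightarrow> 'o)"
    and M: "gmodule G M" and free: "free_of_finite_rank M" and ai: "absolutely_indecomposable G M"
    and f: "lin M M f" "equi (carrier G) M M f"
  shows "\<exists>l. \<not> (mod_trace M f - l * of_nat (mod_rank M)) dvd 1"
proof -
  interpret M: gmodule G M by fact
  interpret M: rmod M using M by (rule gmodule_rmod)
  let ?E = "gmod_End G M"
  let ?J = "jacobson_radical ?E"
  let ?C = "linmod M\<lparr>carrier := commutant G M\<rparr>"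
  let ?m = "max_ideal (rta :: 'o ring)"
  interpret C: rmod ?C using rmod_sub[OF rmod_linmod[OF M.rmod_axioms] submodule_commutant[OF M]] .
  obtain \<phi> where \<phi>: "\<phi> \<in> ring_iso (?E Quot ?J) (residue_field (rta :: 'o ring))"
    "\<And>a. \<phi> (?J +>\<^bsub>?E\<^esub> (\<lambda>x\<in>carrier M. a \<odot>\<^bsub>M\<^esub> x)) = ?m +>\<^bsub>rta\<^esub> a"
    using ai unfolding absolutely_indecomposable_def Let_def by blast
  have bij: "bij_betw \<phi> (a_rcosets\<^bsub>?E\<^esub> ?J) (a_rcosets\<^bsub>rta\<^esub> ?m)"
    using \<phi>(1) by (auto simp: ring_iso_def residue_field_def FactRing_def)
  let ?f = "restrict f (carrier M)"
  have fC: "?f \<in> commutant G M" using f by (simp add: commutant_restrict[OF M])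
  have eid: "equi (carrier G) M M (\<lambda>x. x)" by (simp add: equi_def)
  have lC: "(\<lambda>x\<in>carrier M. l \<odot>\<^bsub>M\<^esub> x) \<in> commutant G M" for l
    unfolding commutant_restrict[OF M]
    by (intro conjI lin_scale[OF M.rmod_axioms lin_id] equi_scale[OF M subset_refl lin_id eid])
  have cos: "?J +>\<^bsub>?E\<^esub> h \<in> a_rcosets\<^bsub>?E\<^esub> ?J" if "h \<in> commutant G M" for h
    using that by (auto simp: A_RCOSETS_def' carrier_gmod_End)
  have "\<phi> (?J +>\<^bsub>?E\<^esub> ?f) \<in> a_rcosets\<^bsub>rta\<^esub> ?m" using bij cos[OF fC] by (auto simp: bij_betw_def)
  then obtain l where "\<phi> (?J +>\<^bsub>?E\<^esub> ?f) = ?m +>\<^bsub>rta\<^esub> l" by (auto simp: A_RCOSETS_def')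
  then have "\<phi> (?J +>\<^bsub>?E\<^esub> ?f) = \<phi> (?J +>\<^bsub>?E\<^esub> (\<lambda>x\<in>carrier M. l \<odot>\<^bsub>M\<^esub> x))" using \<phi>(2) by simp
  then have eq: "?J +>\<^bsub>?E\<^esub> ?f = ?J +>\<^bsub>?E\<^esub> (\<lambda>x\<in>carrier M. l \<odot>\<^bsub>M\<^esub> x)"
    using bij cos[OF fC] cos[OF lC] by (auto simp: bij_betw_def inj_on_def)
  have add: "h \<oplus>\<^bsub>?E\<^esub> k = (\<lambda>x\<in>carrier M. h x \<oplus>\<^bsub>M\<^esub> k x)" for h k by (simp add: gmod_End_def)
  have zero: "\<zero>\<^bsub>?E\<^esub> = (\<lambda>x\<in>carrier M. \<zero>\<^bsub>M\<^esub>)" by (simp add: gmod_End_def)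
  \<comment> \<open>Zero lies in the radical, so \<open>f\<close> belongs to its own coset; reading
    it as an element of the coset of \<open>l\<close> produces the radical element
    \<open>j\<close>.\<close>
  have zJ: "\<zero>\<^bsub>?E\<^esub> \<in> ?J"
  proof -
    have "\<zero>\<^bsub>?E\<^esub> \<in> carrier ?E" using C.M.zero_closed by (simp add: carrier_gmod_End zero)
    then show ?thesis
      using additive_subgroup.zero_closed by (auto simp: jacobson_radical_def maximal_left_ideal_def left_ideal_def)
  qed
  moreover have "\<zero>\<^bsub>?E\<^esub> \<oplus>\<^bsub>?E\<^esub> ?f = ?f"
    using lin_closed[OF f(1)] by (auto simp: add zero)
  ultimately have "?f \<in> ?J +>\<^bsub>?E\<^esub> ?f" unfolding a_r_coset_def' by (intro UN_I[OF zJ]) simp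
  then have "?f \<in> ?J +>\<^bsub>?E\<^esub> (\<lambda>x\<in>carrier M. l \<odot>\<^bsub>M\<^esub> x)" by (simp only: eq)
  then obtain j where j: "j \<in> ?J" "?f = j \<oplus>\<^bsub>?E\<^esub> (\<lambda>x\<in>carrier M. l \<odot>\<^bsub>M\<^esub> x)"
    unfolding a_r_coset_def' by (elim UN_E singletonE)
  have jl: "lin M M j" using j(1) by (auto simp: jacobson_radical_def carrier_gmod_End commutant_def)
  have "f x = j x \<oplus>\<^bsub>M\<^esub> l \<odot>\<^bsub>M\<^esub> x" if "x \<in> carrier M" for x
    using fun_cong[OF j(2), of x] that by (simp add: add)
  then have "mod_trace M f = mod_trace M (\<lambda>x. j x \<oplus>\<^bsub>M\<^esub> l \<odot>\<^bsub>M\<^esub> x)"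
    by (rule mod_trace_cong[OF M.rmod_axioms free f(1)])
  also have "\<dots> = mod_trace M j + l * of_nat (mod_rank M)"
    using mod_trace_add[OF M.rmod_axioms free jl lin_scale[OF M.rmod_axioms lin_id]]
      mod_trace_scale[OF M.rmod_axioms free lin_id] mod_trace_id[OF inj M.rmod_axioms free] by simp
  finally have "mod_trace M f - l * of_nat (mod_rank M) = mod_trace M j" by simp
  then show ?thesis
    using radical_trace[OF complete_local_pid_facts(1)[OF O] inj complete_local_pid_facts(2)[OF O] M free j(1)] by metis
qed

subsection \<open>Vertices and sources\<close>

lemma transfer_scale:
  assumes "gmodule G M" "finite (carrier G)" "lin M M a" "x \<in> carrier M"
  shows "transfer_map G M (\<lambda>x. l \<odot>\<^bsub>M\<^esub> a x) x = l \<odot>\<^bsub>M\<^esub> transfer_map G M a x"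
proof -
  interpret M: gmodule G M by fact
  interpret M: rmod M using assms(1) by (rule gmodule_rmod)
  have c: "a (act M (inv\<^bsub>G\<^esub> g) x) \<in> carrier M" if "g \<in> carrier G" for g
    using that assms(4) lin_closed[OF assms(3)] M.act_closed by simp
  show ?thesis
    unfolding transfer_map_def using c M.act_closed assms(2)
    by (subst M.rmod_finsum_smult) (auto intro!: M.M.finsum_cong' simp: M.act_smult)
qed

lemma transfer_plus:
  assumes "gmodule G M" "finite (carrier G)" "lin M M a" "lin M M b" "x \<in> carrier M"
  shows "transfer_map G M (\<lambda>x. a x \<oplus>\<^bsub>M\<^esub> b x) x = transfer_map G M a x \<oplus>\<^bsub>M\<^esub> transfer_map G M b x"
proof -
  interpret M: gmodule G M by fact
  interpret M: rmod M using assms(1) by (rule gmodule_rmod)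
  have c: "a (act M (inv\<^bsub>G\<^esub> g) x) \<in> carrier M" "b (act M (inv\<^bsub>G\<^esub> g) x) \<in> carrier M" if "g \<in> carrier G" for g
    using that assms(5) lin_closed[OF assms(3)] lin_closed[OF assms(4)] M.act_closed by simp_all
  have "transfer_map G M (\<lambda>x. a x \<oplus>\<^bsub>M\<^esub> b x) x =
      (\<Oplus>\<^bsub>M\<^esub>g\<in>carrier G. act M g (a (act M (inv\<^bsub>G\<^esub> g) x)) \<oplus>\<^bsub>M\<^esub> act M g (b (act M (inv\<^bsub>G\<^esub> g) x)))"
    unfolding transfer_map_def using c M.act_closed by (intro M.M.finsum_cong') (auto simp: M.act_add)
  then show ?thesis unfolding transfer_map_def using c M.act_closed by (simp add: M.M.finsum_addf Pi_def)
qed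

lemma transfer_cong:
  assumes "gmodule G M" "lin M M b" "\<And>x. x \<in> carrier M \<Longrightarrow> a x = b x" "x \<in> carrier M"
  shows "transfer_map G M a x = transfer_map G M b x"
proof -
  interpret M: gmodule G M by fact
  interpret M: rmod M using assms(1) by (rule gmodule_rmod)
  show ?thesis unfolding transfer_map_def
    using assms(3,4) M.act_closed lin_closed[OF assms(2)] by (intro M.M.finsum_cong') auto
qed

text \<open>Reindex the sum by \<open>g \<mapsto> g k\<close>. Thus the conjugate by
  \<open>k\<close> of a witness for \<open>S\<close> is a witness for
  \<open>k S k^-1\<close>.\<close>

lemma transfer_conj:
  assumes M: "gmodule G M" and fin: "finite (carrier G)" and a: "lin M M a" and k: "k \<in> carrier G" and x: "x \<in> carrier M"
  shows "transfer_map G M (\<lambda>x. act M k (a (act M (inv\<^bsub>G\<^esub> k) x))) x = transfer_map G M a x"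
proof -
  interpret M: gmodule G M by fact
  interpret M: rmod M using M by (rule gmodule_rmod)
  have bij: "inj_on (\<lambda>g. g \<otimes>\<^bsub>G\<^esub> k) (carrier G)" "(\<lambda>g. g \<otimes>\<^bsub>G\<^esub> k) ` carrier G = carrier G"
  proof -
    show "inj_on (\<lambda>g. g \<otimes>\<^bsub>G\<^esub> k) (carrier G)" using M.G.inj_on_multc[OF k] .
    have "x \<in> (\<lambda>g. g \<otimes>\<^bsub>G\<^esub> k) ` carrier G" if "x \<in> carrier G" for x
      using that k by (intro image_eqI[of _ _ "x \<otimes>\<^bsub>G\<^esub> inv\<^bsub>G\<^esub> k"]) (simp_all add: M.G.m_assoc)
    then show "(\<lambda>g. g \<otimes>\<^bsub>G\<^esub> k) ` carrier G = carrier G" using k by auto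
  qed
  have cl: "act M g (a (act M (inv\<^bsub>G\<^esub> g) x)) \<in> carrier M" if "g \<in> carrier G" for g
    using lin_closed[OF conj_lin[OF M that a] x] .
  have "transfer_map G M a x = (\<Oplus>\<^bsub>M\<^esub>g\<in>(\<lambda>g. g \<otimes>\<^bsub>G\<^esub> k) ` carrier G. act M g (a (act M (inv\<^bsub>G\<^esub> g) x)))"
    by (simp only: transfer_map_def bij(2))
  also have "\<dots> = (\<Oplus>\<^bsub>M\<^esub>g\<in>carrier G. act M (g \<otimes>\<^bsub>G\<^esub> k) (a (act M (inv\<^bsub>G\<^esub> (g \<otimes>\<^bsub>G\<^esub> k)) x)))"
    using bij cl by (intro M.M.finsum_reindex) auto
  also have "\<dots> = transfer_map G M (\<lambda>x. act M k (a (act M (inv\<^bsub>G\<^esub> k) x))) x"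
    unfolding transfer_map_def
  proof (intro M.M.finsum_cong' refl)
    fix g assume g: "g \<in> carrier G"
    have "act M (inv\<^bsub>G\<^esub> (g \<otimes>\<^bsub>G\<^esub> k)) x = act M (inv\<^bsub>G\<^esub> k) (act M (inv\<^bsub>G\<^esub> g) x)"
      using g k x M.act_mult by (simp add: M.G.inv_mult_group)
    moreover from this have "a (act M (inv\<^bsub>G\<^esub> (g \<otimes>\<^bsub>G\<^esub> k)) x) \<in> carrier M"
      using g k x M.act_closed lin_closed[OF a] by simp
    ultimately show "act M (g \<otimes>\<^bsub>G\<^esub> k) (a (act M (inv\<^bsub>G\<^esub> (g \<otimes>\<^bsub>G\<^esub> k)) x)) =
        act M g (act M k (a (act M (inv\<^bsub>G\<^esub> k) (act M (inv\<^bsub>G\<^esub> g) x))))"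
      using g k by (simp add: M.act_mult)
  next
    show "(\<lambda>g. act M g (act M k (a (act M (inv\<^bsub>G\<^esub> k) (act M (inv\<^bsub>G\<^esub> g) x))))) \<in> carrier G \<rightarrow> carrier M"
      using k x M.act_closed lin_closed[OF a] by simp
  qed
  finally show ?thesis by simp
qed

lemma equi_conj:
  assumes M: "gmodule G M" and S: "subgroup S G" and a: "lin M M a" "equi S M M a" and k: "k \<in> carrier G"
  shows "equi (group.conj_set G k S) M M (\<lambda>x. act M k (a (act M (inv\<^bsub>G\<^esub> k) x)))"
  unfolding equi_def
proof (intro ballI)
  interpret M: gmodule G M by fact
  fix g x assume "g \<in> M.G.conj_set k S" and x: "x \<in> carrier M"
  then obtain s where s: "s \<in> S" "g = k \<otimes>\<^bsub>G\<^esub> s \<otimes>\<^bsub>G\<^esub> inv\<^bsub>G\<^esub> k" by (auto simp: M.G.conj_set_def)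
  have sG: "s \<in> carrier G" using s(1) subgroup.subset[OF S] by blast
  let ?y = "act M (inv\<^bsub>G\<^esub> k) x"
  have y: "?y \<in> carrier M" using k x M.act_closed by simp
  have "act M g x = act M k (act M s ?y)" using s k sG x y M.act_closed by (simp add: M.act_mult)
  then have "act M (inv\<^bsub>G\<^esub> k) (act M g x) = act M s ?y"
    using act_inv(2)[OF M k, of "act M s ?y"] sG y M.act_closed by simp
  then have "act M k (a (act M (inv\<^bsub>G\<^esub> k) (act M g x))) = act M k (act M s (a ?y))"
    using equiD[OF a(2) s(1) y] by simp
  also have "\<dots> = act M g (act M k (a ?y))"
    using s k sG y lin_closed[OF a(1) y] act_inv(2)[OF M k lin_closed[OF a(1) y]] M.act_closed by (simp add: M.act_mult)
  finally show "act M k (a (act M (inv\<^bsub>G\<^esub> k) (act M g x))) = act M g (act M k (a ?y))" .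
qed

section \<open>Conjugation, existence and order of vertices\<close>

lemma relatively_projective_conj:
  fixes M :: "('r::idom, 'g, 'n) gmod"
  assumes M: "gmodule G M" and fin: "finite (carrier G)" and free: "free_of_finite_rank M"
    and inj: "inj (of_nat :: nat \<Rightarrow> 'r)" and S: "relatively_projective G M S" and k: "k \<in> carrier G"
  shows "relatively_projective G M (group.conj_set G k S)"
proof -
  interpret M: gmodule G M by fact
  from S obtain a where Sg: "subgroup S G" and a: "lin M M a" "equi S M M a"
    "\<And>x. x \<in> carrier M \<Longrightarrow> transfer_map G M a x = of_nat (card S) \<odot>\<^bsub>M\<^esub> x"
    unfolding relatively_projective_iff[OF M fin free inj] by blast
  show ?thesis
    unfolding relatively_projective_iff[OF M fin free inj]
    using M.G.subgroup_conj_set[OF Sg k] conj_lin[OF M k a(1)] equi_conj[OF M Sg a(1,2) k]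
      transfer_conj[OF M fin a(1) k] a(3) M.G.card_conj_set[OF subgroup.subset[OF Sg] k] by metis
qed

lemma is_vertex_conj:
  fixes M :: "('r::idom, 'g, 'n) gmod"
  assumes M: "gmodule G M" and fin: "finite (carrier G)" and free: "free_of_finite_rank M"
    and inj: "inj (of_nat :: nat \<Rightarrow> 'r)" and S: "is_vertex G M S" and k: "k \<in> carrier G"
  shows "is_vertex G M (group.conj_set G k S)"
  unfolding is_vertex_def
proof (intro conjI allI impI)
  interpret M: gmodule G M by fact
  note rc = relatively_projective_conj[OF M fin free inj]
  show "relatively_projective G M (M.G.conj_set k S)" using S k rc by (auto simp: is_vertex_def)
  fix P assume P: "relatively_projective G M P \<and> P \<subseteq> M.G.conj_set k S"
  have PG: "P \<subseteq> carrier G" and SG: "S \<subseteq> carrier G"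
    using P S subgroup.subset by (auto simp: is_vertex_def relatively_projective_def)
  have "M.G.conj_set (inv\<^bsub>G\<^esub> k) P \<subseteq> M.G.conj_set (inv\<^bsub>G\<^esub> k) (M.G.conj_set k S)"
    using P by (auto simp: M.G.conj_set_def)
  then have "M.G.conj_set (inv\<^bsub>G\<^esub> k) P \<subseteq> S" using M.G.conj_set_inv[OF SG k] by simp
  then have "M.G.conj_set (inv\<^bsub>G\<^esub> k) P = S"
    using S P rc[of P "inv\<^bsub>G\<^esub> k"] k by (auto simp: is_vertex_def)
  then show "P = M.G.conj_set k S" using M.G.conj_set_inv(1)[OF PG k] by simp
qed

text \<open>The identity witnesses relative projectivity for \<open>G\<close> itself, and a subgroup
  of least order among those that occur is minimal under inclusion.\<close>

lemma exists_vertex: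
  fixes M :: "('r::idom, 'g, 'n) gmod"
  assumes M: "gmodule G M" and fin: "finite (carrier G)" and free: "free_of_finite_rank M"
    and inj: "inj (of_nat :: nat \<Rightarrow> 'r)"
  obtains Q where "is_vertex G M Q"
proof -
  interpret M: gmodule G M by fact
  interpret M: rmod M using M by (rule gmodule_rmod)
  have "transfer_map G M (\<lambda>x. x) x = of_nat (card (carrier G)) \<odot>\<^bsub>M\<^esub> x" if x: "x \<in> carrier M" for x
  proof -
    have "transfer_map G M (\<lambda>x. x) x = (\<Oplus>\<^bsub>M\<^esub>g\<in>carrier G. x)"
      unfolding transfer_map_def using x act_inv(1)[OF M] by (intro M.M.finsum_cong') auto
    then show ?thesis using M.rmod_finsum_const[OF fin x] by simp
  qed
  moreover have "equi (carrier G) M M (\<lambda>x. x)" by (simp add: equi_def)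
  ultimately have rG: "relatively_projective G M (carrier G)"
    unfolding relatively_projective_iff[OF M fin free inj] using M.G.subgroup_self lin_id by blast
  define Q where "Q = arg_min card (relatively_projective G M)"
  have Q: "relatively_projective G M Q" "\<And>P. relatively_projective G M P \<Longrightarrow> card Q \<le> card P"
    using arg_min_nat_lemma[of "relatively_projective G M" "carrier G" card] rG by (auto simp: Q_def)
  have "subgroup Q G" using Q(1) by (simp add: relatively_projective_def)
  then have "finite Q" using finite_subset[OF subgroup.subset fin] by blast
  then have "is_vertex G M Q"
    unfolding is_vertex_def using Q card_seteq by blast
  then show ?thesis by (rule that)
qed

text \<open>By Bezout 1 is a multiple of \<open>n\<close> plus a multiple of \<open>p\<close>, and
  the latter is a nonunit.\<close>

lemma coprime_unit:
  assumes loc: "local_type TYPE('o::comm_ring_1)" and p: "\<not> (of_nat p :: 'o) dvd 1" and n: "coprime n p"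
  shows "(of_nat n :: 'o) dvd 1"
proof -
  obtain a b where "a * int n + b * int p = 1"
    using bezout_int[of "int n" "int p"] n by (auto simp: coprime_iff_gcd_eq_1)
  then have "of_int (a * int n + b * int p) = (1 :: 'o)" by simp
  then have e: "of_int a * of_nat n + of_int b * of_nat p = (1 :: 'o)" by simp
  then have "of_int a * of_nat n + of_int b * of_nat p dvd (1 :: 'o)" by simp
  then have "of_int a * of_nat n dvd (1 :: 'o) \<or> of_int b * of_nat p dvd (1 :: 'o)"
    using loc unfolding local_type_def by blast
  then show ?thesis using p dvd_mult_right by blast
qed

text \<open>The index \<open>m\<close> of a Sylow \<open>p\<close>-subgroup \<open>P\<close> of
  \<open>S\<close> is a unit of the ring, so a witness for \<open>S\<close> divided by
  \<open>m\<close> is one for \<open>P\<close>; minimality gives \<open>P = S\<close>.\<close>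

lemma vertex_p_group:
  fixes M :: "('o::idom, 'g, 'n) gmod"
  assumes loc: "local_type TYPE('o)" and p: "Factorial_Ring.prime p" "\<not> (of_nat p :: 'o) dvd 1"
    and M: "gmodule G M" and fin: "finite (carrier G)" and free: "free_of_finite_rank M"
    and inj: "inj (of_nat :: nat \<Rightarrow> 'o)" and S: "is_vertex G M S"
  obtains n where "card S = p ^ n"
proof -
  interpret M: gmodule G M by fact
  interpret M: rmod M using M by (rule gmodule_rmod)
  from S obtain a where Sg: "subgroup S G" and a: "lin M M a" "equi S M M a"
    "\<And>x. x \<in> carrier M \<Longrightarrow> transfer_map G M a x = of_nat (card S) \<odot>\<^bsub>M\<^esub> x"
    unfolding is_vertex_def relatively_projective_iff[OF M fin free inj] by blast
  have "finite S" using subgroup.subset[OF Sg] finite_subset[OF _ fin] by blast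
  then have "card S \<noteq> 0" using subgroup.one_closed[OF Sg] by auto
  moreover have "\<not> is_unit p" using p(1) not_prime_unit by blast
  ultimately obtain m where m: "card S = p ^ multiplicity p (card S) * m" "\<not> p dvd m"
    using multiplicity_decompose' by metis
  obtain P where P: "subgroup P (G\<lparr>carrier := S\<rparr>)" "card P = p ^ multiplicity p (card S)"
    using sylow_thm[OF p(1) M.G.subgroup_imp_group[OF Sg], of "multiplicity p (card S)" m] m(1) \<open>finite S\<close>
    by (auto simp: Coset.order_def)
  have PG: "subgroup P G" using M.G.incl_subgroup[OF Sg P(1)] .
  have PS: "P \<subseteq> S" using subgroup.subset[OF P(1)] by simp
  have "coprime m p" using m(2) p(1) by (metis coprime_commute prime_imp_coprime)
  from coprime_unit[OF loc p(2) this] obtain v where v: "1 = of_nat m * (v :: 'o)" by (auto simp: dvd_def)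
  have "transfer_map G M (\<lambda>x. v \<odot>\<^bsub>M\<^esub> a x) x = of_nat (card P) \<odot>\<^bsub>M\<^esub> x" if x: "x \<in> carrier M" for x
  proof -
    have "transfer_map G M (\<lambda>x. v \<odot>\<^bsub>M\<^esub> a x) x = (v * of_nat (card S)) \<odot>\<^bsub>M\<^esub> x"
      using transfer_scale[OF M fin a(1) x] a(3)[OF x] x by (simp add: M.rmod_assoc)
    also have "(of_nat (card S) :: 'o) = of_nat (card P) * of_nat m" using m(1) P(2) by (metis of_nat_mult)
    also have "v * (of_nat (card P) * of_nat m) = of_nat (card P) * (of_nat m * v)" by (simp add: mult_ac)
    finally show ?thesis using v by simp
  qed
  moreover have "equi P M M (\<lambda>x. v \<odot>\<^bsub>M\<^esub> a x)"
    using equi_scale[OF M subgroup.subset[OF PG] a(1) equi_mono[OF a(2) PS]] .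
  ultimately have "relatively_projective G M P"
    unfolding relatively_projective_iff[OF M fin free inj] using PG lin_scale[OF M.rmod_axioms a(1)] by blast
  then have "P = S" using S PS by (auto simp: is_vertex_def)
  then show ?thesis using that P(2) by blast
qed

section \<open>Ranks, scalar endomorphisms and the existence of sources\<close>

text \<open>Cyclicity moves the trace to \<open>C\<close>, where the projection is the identity.
  This is how the rank of a source enters as a trace.\<close>

lemma mod_trace_projection:
  fixes N :: "('o::idom, 'n, 'x) module_scheme"
  assumes pid: "principal_domain (rta :: 'o ring)" and inj: "inj (of_nat :: nat \<Rightarrow> 'o)"
    and N: "rmod N" and free: "free_of_finite_rank N" and C: "submodule C rta N"
    and f: "lin N N f" "\<And>x. x \<in> carrier N \<Longrightarrow> f x \<in> C" "\<And>x. x \<in> C \<Longrightarrow> f x = x"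
  shows "mod_trace N f = of_nat (mod_rank (N\<lparr>carrier := C\<rparr>))"
proof -
  note rmC = rmod_sub[OF N C] and frC = free_sub[OF pid N free C]
  have l: "lin N (N\<lparr>carrier := C\<rparr>) f" using lin_to_sub[OF f(1,2)] .
  have i: "lin (N\<lparr>carrier := C\<rparr>) N (\<lambda>x. x)" using lin_incl[OF submodule_subset[OF C]] .
  have "mod_trace N f = mod_trace (N\<lparr>carrier := C\<rparr>) f"
    using mod_trace_commute[OF N rmC free frC l i] by simp
  also have "\<dots> = mod_trace (N\<lparr>carrier := C\<rparr>) (\<lambda>x. x)"
    using f(3) by (intro mod_trace_cong[OF rmC frC lin_comp[OF i l]]) simp
  finally show ?thesis using mod_trace_id[OF inj rmC frC] by simp
qed

lemma rank_decomposition: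
  fixes N :: "('o::idom, 'g, 'n) gmod"
  assumes pid: "principal_domain (rta :: 'o ring)" and inj: "inj (of_nat :: nat \<Rightarrow> 'o)"
    and N: "gmodule G N" and free: "free_of_finite_rank N" and d: "direct_decomposition G N A B"
  shows "mod_rank N = mod_rank (N\<lparr>carrier := A\<rparr>) + mod_rank (N\<lparr>carrier := B\<rparr>)"
proof -
  note rm = gmodule_rmod[OF N]
  obtain e e' where e: "lin N N e" "lin N N e'" "\<And>x. x \<in> carrier N \<Longrightarrow> e x \<in> A" "\<And>x. x \<in> carrier N \<Longrightarrow> e' x \<in> B"
    "\<And>x. x \<in> carrier N \<Longrightarrow> e x \<oplus>\<^bsub>N\<^esub> e' x = x" "\<And>x. x \<in> A \<Longrightarrow> e x = x" "\<And>x. x \<in> B \<Longrightarrow> e' x = x"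
    by (rule decomposition_projections[OF N d]) (rule that)
  have A: "submodule A rta N" and B: "submodule B rta N" using d by (auto simp: direct_decomposition_def gsubmodule_def)
  have "(of_nat (mod_rank N) :: 'o) = mod_trace N (\<lambda>x. x)" using mod_trace_id[OF inj rm free] by simp
  also have "\<dots> = mod_trace N (\<lambda>x. e x \<oplus>\<^bsub>N\<^esub> e' x)"
    using e(5) by (intro mod_trace_cong[OF rm free lin_id]) simp
  also have "\<dots> = of_nat (mod_rank (N\<lparr>carrier := A\<rparr>) + mod_rank (N\<lparr>carrier := B\<rparr>))"
    using mod_trace_add[OF rm free e(1,2)] mod_trace_projection[OF pid inj rm free A e(1,3,6)]
      mod_trace_projection[OF pid inj rm free B e(2,4,7)] by simp
  finally show ?thesis by (rule injD[OF inj])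
qed

lemma rank_zero:
  assumes "inj (of_nat :: nat \<Rightarrow> 'r)" "rmod (M :: ('r::comm_ring_1, 'm, 'x) module_scheme)" "free_of_finite_rank M" "mod_rank M = 0"
  shows "carrier M = {\<zero>\<^bsub>M\<^esub>}"
proof -
  interpret M: rmod M by fact
  obtain B c where B: "coords M B (\<lambda>b. b) c" using free_coords[OF assms(2,3)] by blast
  then have "B = {}" using mod_rank_coords[OF assms(1) B] assms(4) coordsD(2)[OF B] by simp
  then have "carrier M \<subseteq> {\<zero>\<^bsub>M\<^esub>}" using coords_eqI[OF B] M.M.zero_closed by blast
  then show ?thesis using M.M.zero_closed by blast
qed

text \<open>The form in which absolute irreducibility of the character is applied. The nonzero
  carrier makes the scalar of a map on a free module unique.\<close>

definition scalar_endomorphisms :: "('g, 'z) monoid_scheme \<Rightarrow> ('r::comm_ring_1, 'g, 'm) gmod \<Rightarrow> bool" where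
  "scalar_endomorphisms G M \<longleftrightarrow> carrier M \<noteq> {\<zero>\<^bsub>M\<^esub>} \<and>
     (\<forall>f. lin M M f \<longrightarrow> equi (carrier G) M M f \<longrightarrow> (\<exists>l. \<forall>x\<in>carrier M. f x = l \<odot>\<^bsub>M\<^esub> x))"

lemma transfer_scalar:
  assumes sc: "scalar_endomorphisms G M" and M: "gmodule G M" and fin: "finite (carrier G)" and Q: "subgroup Q G"
    and a: "lin M M a" "equi Q M M a"
  obtains l where "\<And>x. x \<in> carrier M \<Longrightarrow> transfer_map G M a x = (of_nat (card Q) * l) \<odot>\<^bsub>M\<^esub> x"
proof -
  interpret M: rmod M using M by (rule gmodule_rmod)
  obtain s where s: "lin M M s" "equi (carrier G) M M s"
    "\<And>x. x \<in> carrier M \<Longrightarrow> transfer_map G M a x = of_nat (card Q) \<odot>\<^bsub>M\<^esub> s x"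
    using transfer_eq_index_smult[OF M fin Q a] by blast
  obtain l where "\<And>x. x \<in> carrier M \<Longrightarrow> s x = l \<odot>\<^bsub>M\<^esub> x"
    using sc s(1,2) unfolding scalar_endomorphisms_def by blast
  then show ?thesis using s(3) by (intro that[of l]) (simp add: M.rmod_assoc)
qed

lemma scalar_trace:
  assumes "rmod M" "free_of_finite_rank M" "lin M M f" "\<And>x. x \<in> carrier M \<Longrightarrow> f x = l \<odot>\<^bsub>M\<^esub> x"
  shows "mod_trace M f = l * mod_trace M (\<lambda>x. x)"
  using mod_trace_cong[OF assms] mod_trace_scale[OF assms(1,2) lin_id] by simp

lemma scalar_unique:
  fixes M :: "('r::idom, 'm, 'x) module_scheme"
  assumes "rmod M" "free_of_finite_rank M" "carrier M \<noteq> {\<zero>\<^bsub>M\<^esub>}" "\<And>x. x \<in> carrier M \<Longrightarrow> k \<odot>\<^bsub>M\<^esub> x = l \<odot>\<^bsub>M\<^esub> x"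
  shows "k = l"
proof -
  interpret M: rmod M by fact
  obtain x where x: "x \<in> carrier M" "x \<noteq> \<zero>\<^bsub>M\<^esub>" using assms(3) M.M.zero_closed by blast
  have "(k - l) \<odot>\<^bsub>M\<^esub> x = (k - l) \<odot>\<^bsub>M\<^esub> \<zero>\<^bsub>M\<^esub>"
    using x(1) assms(4)[OF x(1)] by (simp add: M.rmod_lminus M.M.minus_eq M.M.r_neg)
  then show ?thesis using free_cancel[OF assms(1,2), of "k - l" x "\<zero>\<^bsub>M\<^esub>"] x by auto
qed

text \<open>A source is a direct summand \<open>S\<close> of least rank through which a map witnessing relative
  \<open>Q\<close>-projectivity factors.  If \<open>S\<close> decomposes, the witness is a sum of two maps with transfers
  \<open>|Q| k\<close> and \<open>|Q| k'\<close>, and \<open>k\<close> or \<open>k'\<close> is a unit.\<close>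

theorem exists_source:
  fixes M :: "('o::idom, 'g, 'n) gmod"
  assumes pid: "principal_domain (rta :: 'o ring)" and loc: "local_type TYPE('o)" and inj: "inj (of_nat :: nat \<Rightarrow> 'o)"
    and M: "gmodule G M" and fin: "finite (carrier G)" and free: "free_of_finite_rank M"
    and sc: "scalar_endomorphisms G M" and Q: "is_vertex G M Q"
  obtains S where "is_source G M Q S"
proof -
  interpret M: gmodule G M by fact
  interpret M: rmod M using M by (rule gmodule_rmod)
  let ?Q = "G\<lparr>carrier := Q\<rparr>"
  have Qg: "subgroup Q G" using Q by (simp add: is_vertex_def relatively_projective_def)
  have QG: "Q \<subseteq> carrier G" using subgroup.subset[OF Qg] .
  have MQ: "gmodule ?Q M" using gmodule_restrict[OF M Qg] .
  have nQ: "(of_nat (card Q) :: 'o) \<noteq> 0"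
  proof -
    have "card Q \<noteq> 0" using finite_subset[OF QG fin] subgroup.one_closed[OF Qg] by auto
    then show ?thesis using inj by (metis injD of_nat_0)
  qed
  \<comment> \<open>The scalar of the transfer is fixed only up to a unit \<open>l\<close>, because
    passing to a summand changes it; the normalisation to |Q| is postponed to the end.\<close>
  define good where "good A \<longleftrightarrow> direct_summand ?Q A M \<and> (\<exists>\<alpha> \<beta> l. lin M (M\<lparr>carrier := A\<rparr>) \<alpha> \<and> equi Q M (M\<lparr>carrier := A\<rparr>) \<alpha> \<and>
      lin (M\<lparr>carrier := A\<rparr>) M \<beta> \<and> equi Q (M\<lparr>carrier := A\<rparr>) M \<beta> \<and> l dvd 1 \<and>
      (\<forall>x\<in>carrier M. transfer_map G M (\<lambda>x. \<beta> (\<alpha> x)) x = (of_nat (card Q) * l) \<odot>\<^bsub>M\<^esub> x))" for A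
  have "good (carrier M)"
  proof -
    have z: "submodule {\<zero>\<^bsub>M\<^esub>} rta M" by (rule M.rmod_submoduleI) auto
    have c: "submodule (carrier M) rta M" by (rule M.rmod_submoduleI) auto
    have z0: "act M g \<zero>\<^bsub>M\<^esub> = \<zero>\<^bsub>M\<^esub>" if "g \<in> carrier G" for g
      using lin_zero[OF M.rmod_axioms M.rmod_axioms act_lin[OF M that]] .
    have "direct_decomposition ?Q M (carrier M) {\<zero>\<^bsub>M\<^esub>}"
      using z c z0 QG M.act_closed M.M.zero_closed
      by (auto simp: direct_decomposition_def gsubmodule_def set_add_def' subset_iff intro!: bexI)
    moreover obtain a where "lin M M a" "equi Q M M a" "\<forall>x\<in>carrier M. transfer_map G M a x = of_nat (card Q) \<odot>\<^bsub>M\<^esub> x"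
      using Q unfolding is_vertex_def relatively_projective_iff[OF M fin free inj] by blast
    moreover have "equi Q M M (\<lambda>x. x)" by (simp add: equi_def)
    ultimately show ?thesis
      unfolding good_def direct_summand_def using lin_id[of M]
      by (intro conjI exI[of _ a] exI[of _ "\<lambda>x. x"] exI[of _ "1::'o"]) auto
  qed
  define S where "S = arg_min (\<lambda>A. mod_rank (M\<lparr>carrier := A\<rparr>)) good"
  have S: "good S" "\<And>A. good A \<Longrightarrow> mod_rank (M\<lparr>carrier := S\<rparr>) \<le> mod_rank (M\<lparr>carrier := A\<rparr>)"
    using arg_min_nat_lemma[of good "carrier M" "\<lambda>A. mod_rank (M\<lparr>carrier := A\<rparr>)"] \<open>good (carrier M)\<close> by (auto simp: S_def)
  let ?S = "M\<lparr>carrier := S\<rparr>"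
  obtain B where dS: "direct_decomposition ?Q M S B" using S(1) by (auto simp: good_def direct_summand_def)
  obtain \<alpha> \<beta> l where \<alpha>: "lin M ?S \<alpha>" "equi Q M ?S \<alpha>" and \<beta>: "lin ?S M \<beta>" "equi Q ?S M \<beta>" and l: "l dvd 1"
    and t: "\<And>x. x \<in> carrier M \<Longrightarrow> transfer_map G M (\<lambda>x. \<beta> (\<alpha> x)) x = (of_nat (card Q) * l) \<odot>\<^bsub>M\<^esub> x"
    using S(1) unfolding good_def by blast
  have gS: "gsubmodule ?Q S M" using dS by (simp add: direct_decomposition_def)
  then have sS: "submodule S rta M" by (simp add: gsubmodule_def)
  have SQ: "gmodule ?Q ?S" using gmodule_sub[OF MQ gS] .
  interpret S: rmod ?S using rmod_sub[OF M.rmod_axioms sS] .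
  have freeS: "free_of_finite_rank ?S" using free_sub[OF pid M.rmod_axioms free sS] .
  have SM: "S \<subseteq> carrier M" using submodule_subset[OF sS] .
  obtain v where v: "1 = l * v" using l by (auto simp: dvd_def)
  have ne: "carrier M \<noteq> {\<zero>\<^bsub>M\<^esub>}" using sc by (simp add: scalar_endomorphisms_def)
  obtain e e' where e0: "lin M M e" "lin M M e'" "equi (carrier ?Q) M M e" "equi (carrier ?Q) M M e'"
    "\<And>x. x \<in> carrier M \<Longrightarrow> e x \<in> S" "\<And>x. x \<in> carrier M \<Longrightarrow> e' x \<in> B"
    "\<And>x. x \<in> carrier M \<Longrightarrow> e x \<oplus>\<^bsub>M\<^esub> e' x = x" "\<And>x. x \<in> S \<Longrightarrow> e x = x" "\<And>x. x \<in> B \<Longrightarrow> e' x = x"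
    by (rule decomposition_projections[OF MQ dS]) (rule that)
  have e: "lin M M e" "equi Q M M e" "\<And>x. x \<in> carrier M \<Longrightarrow> e x \<in> S" "\<And>x. x \<in> S \<Longrightarrow> e x = x"
    using e0(1,3,5,8) by simp_all
  have eS: "lin M ?S e" "equi Q M ?S e" using lin_to_sub[OF e(1,3)] e(2) by (auto simp: equi_def)
  \<comment> \<open>If the part of the witness through \<open>A1\<close> still has a unit scalar,
    then \<open>A1\<close> is good again. It is a summand of \<open>M\<close> by the projection onto
    \<open>S\<close> followed by that onto \<open>A1\<close>.\<close>
  have good_part: "good A1" if d: "direct_decomposition ?Q ?S A1 A2" and f: "lin ?S ?S f" "equi Q ?S ?S f" "\<And>x. x \<in> S \<Longrightarrow> f x \<in> A1"
      "\<And>x. x \<in> A1 \<Longrightarrow> f x = x" and k: "k dvd 1"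
      "\<And>x. x \<in> carrier M \<Longrightarrow> transfer_map G M (\<lambda>x. \<beta> (f (\<alpha> x))) x = (of_nat (card Q) * k) \<odot>\<^bsub>M\<^esub> x" for A1 A2 f k
  proof -
    have g1: "gsubmodule ?Q A1 ?S" using d by (simp add: direct_decomposition_def)
    have A1S: "A1 \<subseteq> S" using g1 submodule_subset by (fastforce simp: gsubmodule_def)
    have s1: "submodule A1 rta ?S" using g1 by (simp add: gsubmodule_def)
    interpret A1: rmod "?S\<lparr>carrier := A1\<rparr>" using rmod_sub[OF S.rmod_axioms s1] .
    have s1M: "submodule A1 rta M"
      using A1S SM A1.M.zero_closed A1.M.a_closed A1.rmod_smult by (intro M.rmod_submoduleI) auto
    have g1M: "gsubmodule ?Q A1 M" using g1 s1M by (simp add: gsubmodule_def)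
    let ?A = "M\<lparr>carrier := A1\<rparr>"
    have AQ: "gmodule ?Q ?A" using gmodule_sub[OF MQ g1M] .
    have fA: "lin ?S ?A f" "equi Q ?S ?A f" using f by (auto simp: lin_def equi_def)
    have iAS: "lin ?A ?S (\<lambda>x. x)" "equi Q ?A ?S (\<lambda>x. x)" using A1S by (auto simp: lin_def equi_def)
    have iAM: "lin ?A M (\<lambda>x. x)" "equi Q ?A M (\<lambda>x. x)" using A1S SM by (auto simp: lin_def equi_def)
    have "direct_decomposition ?Q M ((\<lambda>x. x) ` carrier ?A) {z \<in> carrier M. f (e z) = \<zero>\<^bsub>?A\<^esub>}"
      using iAM lin_comp[OF eS(1) fA(1)] equi_comp[OF eS fA(2)] e(4) f(4) A1S
      by (intro split_decomposition[OF AQ MQ]) auto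
    then have "direct_summand ?Q A1 M" unfolding direct_summand_def by auto
    moreover have "lin M ?A (\<lambda>x. f (\<alpha> x))" "equi Q M ?A (\<lambda>x. f (\<alpha> x))"
      using lin_comp[OF \<alpha>(1) fA(1)] equi_comp[OF \<alpha> fA(2)] by auto
    moreover have "lin ?A M \<beta>" "equi Q ?A M \<beta>"
      using lin_comp[OF iAS(1) \<beta>(1)] equi_comp[OF iAS \<beta>(2)] by auto
    ultimately show ?thesis using k unfolding good_def by blast
  qed
  have indec: "indecomposable ?Q ?S"
    unfolding indecomposable_def
  proof (intro conjI allI impI)
    show "carrier ?S \<noteq> {\<zero>\<^bsub>?S\<^esub>}"
    proof
      assume z: "carrier ?S = {\<zero>\<^bsub>?S\<^esub>}"
      have b0: "\<beta> y = \<zero>\<^bsub>M\<^esub>" if "y \<in> S" for y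
        using that z lin_zero[OF S.rmod_axioms M.rmod_axioms \<beta>(1)] by simp
      have "(of_nat (card Q) * l) \<odot>\<^bsub>M\<^esub> x = 0 \<odot>\<^bsub>M\<^esub> x" if x: "x \<in> carrier M" for x
      proof -
        have "transfer_map G M (\<lambda>x. \<beta> (\<alpha> x)) x = transfer_map G M (\<lambda>x. 0 \<odot>\<^bsub>M\<^esub> x) x"
          using b0 lin_closed[OF \<alpha>(1)] by (intro transfer_cong[OF M lin_scale[OF M.rmod_axioms lin_id] _ x]) simp
        also have "\<dots> = 0 \<odot>\<^bsub>M\<^esub> x"
          using transfer_scale[OF M fin lin_id x, of 0] lin_closed[OF transfer_lin[OF M fin lin_id] x] x by simp
        finally show ?thesis using t[OF x] by simp
      qed
      then have "of_nat (card Q) * l = 0" by (rule scalar_unique[OF M.rmod_axioms free ne])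
      then show False using nQ v by auto
    qed
    fix A1 A2 assume d: "direct_decomposition ?Q ?S A1 A2"
    obtain f f' where f0: "lin ?S ?S f" "lin ?S ?S f'" "equi (carrier ?Q) ?S ?S f" "equi (carrier ?Q) ?S ?S f'"
      "\<And>x. x \<in> carrier ?S \<Longrightarrow> f x \<in> A1" "\<And>x. x \<in> carrier ?S \<Longrightarrow> f' x \<in> A2"
      "\<And>x. x \<in> carrier ?S \<Longrightarrow> f x \<oplus>\<^bsub>?S\<^esub> f' x = x" "\<And>x. x \<in> A1 \<Longrightarrow> f x = x" "\<And>x. x \<in> A2 \<Longrightarrow> f' x = x"
      by (rule decomposition_projections[OF SQ d]) (rule that)
    have f: "lin ?S ?S f" "lin ?S ?S f'" "equi Q ?S ?S f" "equi Q ?S ?S f'"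
      "\<And>x. x \<in> S \<Longrightarrow> f x \<in> A1" "\<And>x. x \<in> S \<Longrightarrow> f' x \<in> A2"
      "\<And>x. x \<in> S \<Longrightarrow> f x \<oplus>\<^bsub>M\<^esub> f' x = x" "\<And>x. x \<in> A1 \<Longrightarrow> f x = x" "\<And>x. x \<in> A2 \<Longrightarrow> f' x = x"
      using f0 by simp_all
    have part: "lin M M (\<lambda>x. \<beta> (h (\<alpha> x)))" "equi Q M M (\<lambda>x. \<beta> (h (\<alpha> x)))" if "lin ?S ?S h" "equi Q ?S ?S h" for h
      using lin_comp[OF lin_comp[OF \<alpha>(1) that(1)] \<beta>(1)]
        equi_comp[OF lin_comp[OF \<alpha>(1) that(1)] equi_comp[OF \<alpha> that(2)] \<beta>(2)] by auto
    obtain k where k: "\<And>x. x \<in> carrier M \<Longrightarrow> transfer_map G M (\<lambda>x. \<beta> (f (\<alpha> x))) x = (of_nat (card Q) * k) \<odot>\<^bsub>M\<^esub> x"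
      using transfer_scalar[OF sc M fin Qg part[OF f(1,3)]] by blast
    obtain k' where k': "\<And>x. x \<in> carrier M \<Longrightarrow> transfer_map G M (\<lambda>x. \<beta> (f' (\<alpha> x))) x = (of_nat (card Q) * k') \<odot>\<^bsub>M\<^esub> x"
      using transfer_scalar[OF sc M fin Qg part[OF f(2,4)]] by blast
    have "(of_nat (card Q) * l) \<odot>\<^bsub>M\<^esub> x = (of_nat (card Q) * (k + k')) \<odot>\<^bsub>M\<^esub> x" if x: "x \<in> carrier M" for x
    proof -
      have "transfer_map G M (\<lambda>x. \<beta> (\<alpha> x)) x = transfer_map G M (\<lambda>x. \<beta> (f (\<alpha> x)) \<oplus>\<^bsub>M\<^esub> \<beta> (f' (\<alpha> x))) x"
      proof (rule transfer_cong[OF M lin_plus[OF M.rmod_axioms part(1)[OF f(1,3)] part(1)[OF f(2,4)]] _ x])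
        fix x assume "x \<in> carrier M"
        then have a: "\<alpha> x \<in> S" using lin_closed[OF \<alpha>(1)] by simp
        have "\<beta> (\<alpha> x) = \<beta> (f (\<alpha> x) \<oplus>\<^bsub>M\<^esub> f' (\<alpha> x))" using f(7)[OF a] by simp
        then show "\<beta> (\<alpha> x) = \<beta> (f (\<alpha> x)) \<oplus>\<^bsub>M\<^esub> \<beta> (f' (\<alpha> x))"
          using lin_add[OF \<beta>(1), of "f (\<alpha> x)" "f' (\<alpha> x)"] lin_closed[OF f(1)] lin_closed[OF f(2)] a by simp
      qed
      then show ?thesis
        using transfer_plus[OF M fin part(1)[OF f(1,3)] part(1)[OF f(2,4)] x] k[OF x] k'[OF x] t[OF x] x
        by (simp add: distrib_left M.rmod_ldistr)
    qed
    then have "of_nat (card Q) * l = of_nat (card Q) * (k + k')" by (rule scalar_unique[OF M.rmod_axioms free ne])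
    then have "k + k' dvd 1" using nQ l by simp
    then have kk: "k dvd 1 \<or> k' dvd 1" using loc by (auto simp: local_type_def)
    have d': "direct_decomposition ?Q ?S A2 A1"
    proof -
      have "A2 <+>\<^bsub>?S\<^esub> A1 = A1 <+>\<^bsub>?S\<^esub> A2"
      proof -
        have "submodule A1 rta ?S" "submodule A2 rta ?S"
          using d by (simp_all add: direct_decomposition_def gsubmodule_def)
        then have s: "A1 \<subseteq> carrier ?S" "A2 \<subseteq> carrier ?S" using submodule_subset by blast+
        have c: "x \<oplus>\<^bsub>?S\<^esub> y = y \<oplus>\<^bsub>?S\<^esub> x" if "x \<in> A1" "y \<in> A2" for x y
          using S.M.a_comm[OF subsetD[OF s(1) that(1)] subsetD[OF s(2) that(2)]] .
        have "(\<Union>x\<in>A1. \<Union>y\<in>A2. {x \<oplus>\<^bsub>?S\<^esub> y}) = (\<Union>x\<in>A1. \<Union>y\<in>A2. {y \<oplus>\<^bsub>?S\<^esub> x})"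
          by (intro SUP_cong refl arg_cong[of _ _ "\<lambda>z. {z}"] c)
        also have "\<dots> = (\<Union>y\<in>A2. \<Union>x\<in>A1. {y \<oplus>\<^bsub>?S\<^esub> x})" by (rule SUP_commute)
        finally show ?thesis unfolding set_add_def' by (rule sym)
      qed
      then show ?thesis using d by (auto simp: direct_decomposition_def Int_commute)
    qed
    note rk = rank_decomposition[OF pid inj SQ freeS]
    have zero: "A = {\<zero>\<^bsub>?S\<^esub>}" if "mod_rank (M\<lparr>carrier := A\<rparr>) = 0" "direct_decomposition ?Q ?S A A'" for A A'
    proof -
      have sA: "submodule A rta ?S" using that(2) by (simp add: direct_decomposition_def gsubmodule_def)
      show ?thesis
        using rank_zero[OF inj rmod_sub[OF S.rmod_axioms sA] free_sub[OF pid S.rmod_axioms freeS sA]] that(1) by simp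
    qed
    \<comment> \<open>The good part has rank at least that of \<open>S\<close>, so the complementary
      part has rank zero.\<close>
    show "A1 = {\<zero>\<^bsub>?S\<^esub>} \<or> A2 = {\<zero>\<^bsub>?S\<^esub>}"
      using kk
    proof
      assume "k dvd 1"
      from S(2)[OF good_part[OF d f(1,3,5,8) this k]] rk[OF d] have "mod_rank (M\<lparr>carrier := A2\<rparr>) = 0" by simp
      from zero[OF this d'] show ?thesis by simp
    next
      assume "k' dvd 1"
      from S(2)[OF good_part[OF d' f(2,4,6,9) this k']] rk[OF d'] have "mod_rank (M\<lparr>carrier := A1\<rparr>) = 0" by simp
      from zero[OF this d] show ?thesis by simp
    qed
  qed
  \<comment> \<open>Absorbing the inverse \<open>v\<close> of \<open>l\<close> into \<alpha> makes
    the transfer exactly |Q|.\<close>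
  have av: "lin M ?S (\<lambda>x. \<alpha> (v \<odot>\<^bsub>M\<^esub> x))" "equi Q M ?S (\<lambda>x. \<alpha> (v \<odot>\<^bsub>M\<^esub> x))"
    using lin_comp[OF lin_scale[OF M.rmod_axioms lin_id] \<alpha>(1)]
      equi_comp[OF lin_scale[OF M.rmod_axioms lin_id] equi_scale[OF M QG lin_id] \<alpha>(2)] by (auto simp: equi_def)
  have "iso_to_direct_summand G M (gmod_ind G Q ?S)"
  proof (rule higman_sufficient[OF M fin Qg free nQ SQ av \<beta>])
    fix x assume x: "x \<in> carrier M"
    have ba: "lin M M (\<lambda>x. \<beta> (\<alpha> x))" using lin_comp[OF \<alpha>(1) \<beta>(1)] .
    have "transfer_map G M (\<lambda>x. \<beta> (\<alpha> (v \<odot>\<^bsub>M\<^esub> x))) x = transfer_map G M (\<lambda>x. v \<odot>\<^bsub>M\<^esub> \<beta> (\<alpha> x)) x"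
      using lin_smult[OF \<alpha>(1)] lin_smult[OF \<beta>(1)] lin_closed[OF \<alpha>(1)]
      by (intro transfer_cong[OF M lin_scale[OF M.rmod_axioms ba] _ x]) simp
    also have "\<dots> = (v * (of_nat (card Q) * l)) \<odot>\<^bsub>M\<^esub> x"
      using transfer_scale[OF M fin ba x] t[OF x] x by (simp add: M.rmod_assoc)
    also have "v * (of_nat (card Q) * l) = of_nat (card Q)" using v by (metis mult.assoc mult.commute mult_1)
    finally show "transfer_map G M (\<lambda>x. \<beta> (\<alpha> (v \<odot>\<^bsub>M\<^esub> x))) x = of_nat (card Q) \<odot>\<^bsub>M\<^esub> x" .
  qed
  then have "is_source G M Q S"
    unfolding is_source_def direct_summand_def using Q dS indec by blast
  then show ?thesis by (rule that)
qed

subsection \<open>Vertices of the tensor product\<close>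

text \<open>The \<open>n\<close>-fold sum of the residue class of 1 is the coset of
  \<open>n\<close>; for \<open>n = p\<close> its vanishing puts \<open>p\<close> into the maximal
  ideal.\<close>

lemma residue_characteristic_nonunit:
  fixes p :: nat
  assumes O: "complete_local_pid (rta :: 'o::idom ring)"
    and p: "add_pow (residue_field (rta :: 'o ring)) p \<one>\<^bsub>residue_field (rta :: 'o ring)\<^esub> = \<zero>\<^bsub>residue_field (rta :: 'o ring)\<^esub>"
  shows "\<not> (of_nat p :: 'o) dvd 1"
proof -
  let ?I = "max_ideal (rta :: 'o ring)"
  have rg: "ring (rta :: 'o ring)" by (rule ring_from_type_algebra)
  have "abelian_subgroup ?I rta"
    using ring.is_abelian_group[OF rg] by (intro abelian_subgroupI3[OF complete_local_pid_facts(4)[OF O]])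
  then interpret I: abelian_subgroup ?I "rta :: 'o ring" .
  have "add_pow (residue_field (rta :: 'o ring)) n \<one>\<^bsub>residue_field (rta :: 'o ring)\<^esub> = ?I +>\<^bsub>rta\<^esub> of_nat n" for n :: nat
  proof (induction n)
    case 0
    have "?I = ?I +>\<^bsub>rta\<^esub> 0" using I.a_coset_add_zero[OF I.a_subset] by simp
    then show ?case by (simp add: residue_field_def FactRing_def add_pow_def)
  next
    case (Suc n)
    have "add_pow (residue_field (rta :: 'o ring)) (Suc n) \<one>\<^bsub>residue_field (rta :: 'o ring)\<^esub> =
        add_pow (residue_field (rta :: 'o ring)) n \<one>\<^bsub>residue_field (rta :: 'o ring)\<^esub> <+>\<^bsub>rta\<^esub> (?I +>\<^bsub>rta\<^esub> 1)"
      by (simp add: residue_field_def FactRing_def add_pow_def)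
    then show ?case using Suc I.a_rcos_sum[of "of_nat n" 1] by (simp add: add.commute)
  qed
  then have "?I +>\<^bsub>rta\<^esub> of_nat p = ?I" using p by (simp add: residue_field_def FactRing_def)
  moreover have "of_nat p \<in> ?I +>\<^bsub>rta\<^esub> of_nat p" by (rule I.a_rcos_self) simp
  ultimately have "of_nat p \<in> ?I" by simp
  then show ?thesis by (rule complete_local_pid_facts(3)[OF O])
qed

section \<open>Unit traces, vertices and sources\<close>

text \<open>A witness \<open>a\<close> through the source gives |Q| rk M = |G| tr a, and the
  projection \<open>e\<close> onto the source, with transfer |Q| l, gives |G| tr e = |Q| l rk M.
  Hence tr e = l tr a. Since tr e is the rank of the source, it is a unit, and so is tr a, which
  serves as \<mu>.\<close>

lemma vertex_trace:
  fixes M :: "('o::idom, 'g, 'n) gmod"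
  assumes pid: "principal_domain (rta :: 'o ring)" and loc: "local_type TYPE('o)" and inj: "inj (of_nat :: nat \<Rightarrow> 'o)"
    and p: "\<not> (of_nat p :: 'o) dvd 1" and M: "gmodule G M" and fin: "finite (carrier G)" and free: "free_of_finite_rank M"
    and sc: "scalar_endomorphisms G M" and src: "sources_rank_prime_to p G M" and Q: "is_vertex G M Q"
  obtains e \<mu> where "lin M M e" "equi Q M M e" "mod_trace M e dvd 1" "\<mu> dvd 1"
    "of_nat (card Q) * mod_trace M (\<lambda>x. x) = of_nat (card (carrier G)) * \<mu>"
proof -
  interpret M: gmodule G M by fact
  interpret M: rmod M using M by (rule gmodule_rmod)
  obtain S where S: "is_source G M Q S" using exists_source[OF pid loc inj M fin free sc Q] .
  let ?Q = "G\<lparr>carrier := Q\<rparr>" and ?S = "M\<lparr>carrier := S\<rparr>"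
  have Qg: "subgroup Q G" using Q by (simp add: is_vertex_def relatively_projective_def)
  have MQ: "gmodule ?Q M" using gmodule_restrict[OF M Qg] .
  have iso: "iso_to_direct_summand G M (gmod_ind G Q ?S)" using S by (simp add: is_source_def)
  obtain B where dS: "direct_decomposition ?Q M S B" using S by (auto simp: is_source_def direct_summand_def)
  have gS: "gsubmodule ?Q S M" using dS by (simp add: direct_decomposition_def)
  then have sS: "submodule S rta M" by (simp add: gsubmodule_def)
  have SQ: "gmodule ?Q ?S" using gmodule_sub[OF MQ gS] .
  obtain e e' where e: "lin M M e" "lin M M e'" "equi (carrier ?Q) M M e" "equi (carrier ?Q) M M e'"
    "\<And>x. x \<in> carrier M \<Longrightarrow> e x \<in> S" "\<And>x. x \<in> carrier M \<Longrightarrow> e' x \<in> B"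
    "\<And>x. x \<in> carrier M \<Longrightarrow> e x \<oplus>\<^bsub>M\<^esub> e' x = x" "\<And>x. x \<in> S \<Longrightarrow> e x = x" "\<And>x. x \<in> B \<Longrightarrow> e' x = x"
    by (rule decomposition_projections[OF MQ dS]) (rule that)
  have eQ: "equi Q M M e" using e(3) by simp
  have u: "mod_trace M e dvd 1"
    using coprime_unit[OF loc p] src S mod_trace_projection[OF pid inj M.rmod_axioms free sS e(1,5,8)]
    by (auto simp: sources_rank_prime_to_def)
  obtain \<alpha> \<beta> where ab: "lin M ?S \<alpha>" "equi Q M ?S \<alpha>" "lin ?S M \<beta>" "equi Q ?S M \<beta>"
    and t: "\<And>x. x \<in> carrier M \<Longrightarrow> transfer_map G M (\<lambda>x. \<beta> (\<alpha> x)) x = of_nat (card Q) \<odot>\<^bsub>M\<^esub> x"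
    by (rule higman_necessary[OF M fin Qg SQ iso]) (rule that)
  let ?r = "mod_trace M (\<lambda>x. x)" and ?g = "of_nat (card (carrier G)) :: 'o" and ?m = "mod_trace M (\<lambda>x. \<beta> (\<alpha> x))"
  have ba: "lin M M (\<lambda>x. \<beta> (\<alpha> x))" using lin_comp[OF ab(1,3)] .
  have 1: "of_nat (card Q) * ?r = ?g * ?m"
    using scalar_trace[OF M.rmod_axioms free transfer_lin[OF M fin ba] t] mod_trace_transfer[OF M fin free ba] by simp
  obtain l where l: "\<And>x. x \<in> carrier M \<Longrightarrow> transfer_map G M e x = (of_nat (card Q) * l) \<odot>\<^bsub>M\<^esub> x"
    by (rule transfer_scalar[OF sc M fin Qg e(1) eQ]) (rule that)
  have "?g * mod_trace M e = of_nat (card Q) * l * ?r"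
    using scalar_trace[OF M.rmod_axioms free transfer_lin[OF M fin e(1)] l] mod_trace_transfer[OF M fin free e(1)] by simp
  also have "\<dots> = ?g * (l * ?m)" using 1 by (metis mult.assoc mult.commute)
  finally have "mod_trace M e = l * ?m"
    using fin M.G.one_closed inj by (metis card_eq_0_iff empty_iff injD mult_left_cancel of_nat_0)
  then have "?m dvd 1" using u dvd_mult_right by metis
  from that[OF e(1) eQ u this 1] show ?thesis .
qed

text \<open>The trace of \<open>F\<close> composed with the conjugate of \<open>a\<close> by
  \<open>h\<close> depends only on \<open>ThS\<close>, since \<open>F\<close> commutes with
  \<open>T\<close> and \<open>a\<close> with \<open>S\<close>. Summed over \<open>G\<close> it is
  the trace of \<open>F\<close> composed with the transfer of \<open>a\<close>, that is |S| tr F,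
  and the fixed-point theorem applies with the ideal of nonunits.\<close>

lemma double_coset_trace:
  fixes M :: "('o::idom, 'g, 'n) gmod"
  assumes loc: "local_type TYPE('o)" and inj: "inj (of_nat :: nat \<Rightarrow> 'o)"
    and p: "Factorial_Ring.prime p" "\<not> (of_nat p :: 'o) dvd 1"
    and M: "gmodule G M" and fin: "finite (carrier G)" and free: "free_of_finite_rank M"
    and S: "subgroup S G" and a: "lin M M a" "equi S M M a"
      "\<And>x. x \<in> carrier M \<Longrightarrow> transfer_map G M a x = of_nat (card S) \<odot>\<^bsub>M\<^esub> x"
    and T: "subgroup T G" "card T = p ^ n" and F: "lin M M F" "equi T M M F" "mod_trace M F dvd 1"
  obtains h where "h \<in> carrier G" "group.conj_set G (inv\<^bsub>G\<^esub> h) T \<subseteq> S"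
    "mod_trace M (\<lambda>x. F (act M h (a (act M (inv\<^bsub>G\<^esub> h) x)))) dvd 1"
proof -
  interpret M: gmodule G M by fact
  interpret M: rmod M using M by (rule gmodule_rmod)
  define A where "A = (\<lambda>h x. act M h (a (act M (inv\<^bsub>G\<^esub> h) x)))"
  define \<phi> where "\<phi> = (\<lambda>h. mod_trace M (\<lambda>x. F (A h x)))"
  have A: "lin M M (A h)" if "h \<in> carrier G" for h unfolding A_def using conj_lin[OF M that a(1)] .
  have FA: "lin M M (\<lambda>x. F (A h x))" if "h \<in> carrier G" for h using lin_comp[OF A[OF that] F(1)] .
  have inv: "\<phi> (t \<otimes>\<^bsub>G\<^esub> h \<otimes>\<^bsub>G\<^esub> s) = \<phi> h" if t: "t \<in> T" and h: "h \<in> carrier G" and s: "s \<in> S" for t h s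
  proof -
    have tG: "t \<in> carrier G" and sG: "s \<in> carrier G" using t s subgroup.subset[OF T(1)] subgroup.subset[OF S] by auto
    have "A (t \<otimes>\<^bsub>G\<^esub> h \<otimes>\<^bsub>G\<^esub> s) x = act M t (A h (act M (inv\<^bsub>G\<^esub> t) x))" if x: "x \<in> carrier M" for x
    proof -
      let ?y = "act M (inv\<^bsub>G\<^esub> h) (act M (inv\<^bsub>G\<^esub> t) x)"
      have y: "?y \<in> carrier M" using x tG h M.act_closed by simp
      have "act M (inv\<^bsub>G\<^esub> (t \<otimes>\<^bsub>G\<^esub> h \<otimes>\<^bsub>G\<^esub> s)) x = act M (inv\<^bsub>G\<^esub> s) ?y"
        using x tG sG h M.act_closed by (simp add: M.G.inv_mult_group M.act_mult)
      moreover have "act M s (a (act M (inv\<^bsub>G\<^esub> s) ?y)) = a ?y"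
        using equiD[OF a(2) s, of "act M (inv\<^bsub>G\<^esub> s) ?y"] act_inv(1)[OF M sG y] y sG M.act_closed by simp
      moreover have "a (act M (inv\<^bsub>G\<^esub> s) ?y) \<in> carrier M" using lin_closed[OF a(1)] y sG M.act_closed by simp
      ultimately show ?thesis unfolding A_def using tG sG h lin_closed[OF a(1) y] M.act_closed by (simp add: M.act_mult)
    qed
    then have "\<phi> (t \<otimes>\<^bsub>G\<^esub> h \<otimes>\<^bsub>G\<^esub> s) = mod_trace M (\<lambda>x. act M t (F (A h (act M (inv\<^bsub>G\<^esub> t) x))))"
      unfolding \<phi>_def
      using equiD[OF F(2) t] lin_closed[OF A[OF h]] M.act_closed tG
      by (intro mod_trace_cong[OF M.rmod_axioms free FA]) (use h sG in auto)
    also have "\<dots> = \<phi> h" unfolding \<phi>_def using mod_trace_conj[OF M free tG FA[OF h]] .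
    finally show ?thesis .
  qed
  have "(\<Sum>h\<in>carrier G. \<phi> h) = mod_trace M (\<lambda>x. \<Oplus>\<^bsub>M\<^esub>h\<in>carrier G. F (A h x))"
    unfolding \<phi>_def using mod_trace_sum[OF M.rmod_axioms free fin FA] by simp
  also have "\<dots> = mod_trace M (\<lambda>x. F (transfer_map G M a x))"
    using lin_finsum[OF M.rmod_axioms M.rmod_axioms F(1) fin] lin_closed[OF A]
    by (intro mod_trace_cong[OF M.rmod_axioms free lin_sum[OF M.rmod_axioms M.rmod_axioms fin FA]]) (simp_all add: transfer_map_def A_def)
  also have "\<dots> = mod_trace M (\<lambda>x. of_nat (card S) \<odot>\<^bsub>M\<^esub> F x)"
    using a(3) lin_smult[OF F(1)]
    by (intro mod_trace_cong[OF M.rmod_axioms free lin_comp[OF transfer_lin[OF M fin a(1)] F(1)]]) simp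
  also have "\<dots> = of_nat (card S) * mod_trace M F" by (rule mod_trace_scale[OF M.rmod_axioms free F(1)])
  finally have sum: "(\<Sum>h\<in>carrier G. \<phi> h) = of_nat (card S) * mod_trace M F" .
  have I: "0 \<in> {x. \<not> x dvd (1 :: 'o)}" "of_nat p \<in> {x. \<not> x dvd (1 :: 'o)}"
    "x \<in> {x. \<not> x dvd (1 :: 'o)} \<Longrightarrow> y \<in> {x. \<not> x dvd (1 :: 'o)} \<Longrightarrow> x + y \<in> {x. \<not> x dvd (1 :: 'o)}"
    "x \<in> {x. \<not> x dvd (1 :: 'o)} \<Longrightarrow> z * x \<in> {x. \<not> x dvd (1 :: 'o)}" for x y z
    using p(2) loc nonunit_mult[of x z] by (auto simp: local_type_def)
  have u: "mod_trace M F \<notin> {x. \<not> x dvd 1}" using F(3) by simp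
  obtain h where h: "h \<in> carrier G" "\<phi> h \<notin> {x. \<not> x dvd 1}" "\<And>t. t \<in> T \<Longrightarrow> inv\<^bsub>G\<^esub> h \<otimes>\<^bsub>G\<^esub> t \<otimes>\<^bsub>G\<^esub> h \<in> S"
    by (rule M.G.p_group_fixed_coset[OF inj fin p(1) S T(1) T(2) inv I(1,3,4,2) sum u]) (assumption | rule that)+
  have "M.G.conj_set (inv\<^bsub>G\<^esub> h) T \<subseteq> S" using h(1,3) by (auto simp: M.G.conj_set_def)
  with h(1,2) show ?thesis using that unfolding \<phi>_def A_def by simp
qed

text \<open>A witness for a subgroup \<open>P\<close> of \<open>T\<close> forces a conjugate of
  \<open>T\<close> into \<open>P\<close>, and comparison of orders gives equality.\<close>

lemma vertex_if_trace_unit: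
  fixes M :: "('o::idom, 'g, 'n) gmod"
  assumes loc: "local_type TYPE('o)" and inj: "inj (of_nat :: nat \<Rightarrow> 'o)"
    and p: "Factorial_Ring.prime p" "\<not> (of_nat p :: 'o) dvd 1"
    and M: "gmodule G M" and fin: "finite (carrier G)" and free: "free_of_finite_rank M"
    and T: "relatively_projective G M T" "card T = p ^ n" and F: "lin M M F" "equi T M M F" "mod_trace M F dvd 1"
  shows "is_vertex G M T"
  unfolding is_vertex_def
proof (intro conjI allI impI)
  interpret M: gmodule G M by fact
  have Tg: "subgroup T G" using T(1) by (simp add: relatively_projective_def)
  fix P assume P: "relatively_projective G M P \<and> P \<subseteq> T"
  then obtain a where Pg: "subgroup P G" and a: "lin M M a" "equi P M M a"
    "\<And>x. x \<in> carrier M \<Longrightarrow> transfer_map G M a x = of_nat (card P) \<odot>\<^bsub>M\<^esub> x"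
    unfolding relatively_projective_iff[OF M fin free inj] by blast
  obtain h where h: "h \<in> carrier G" "M.G.conj_set (inv\<^bsub>G\<^esub> h) T \<subseteq> P"
    using double_coset_trace[OF loc inj p M fin free Pg a Tg T(2) F] by blast
  have "finite T" "finite P" using subgroup.subset[OF Tg] subgroup.subset[OF Pg] finite_subset[OF _ fin] by auto
  then have "card T \<le> card P"
    using card_mono[OF _ h(2)] M.G.card_conj_set[OF subgroup.subset[OF Tg], of "inv\<^bsub>G\<^esub> h"] h(1) by simp
  then show "P = T" using P \<open>finite T\<close> card_seteq by blast
qed (rule T(1))

text \<open>The witness factors through the source \<open>Z\<close>, so cyclicity moves the unit
  trace onto \<open>Z\<close>. There it is congruent to a multiple of the rank, which would be a
  nonunit if \<open>p\<close> divided the rank.\<close>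

lemma source_rank_prime_to_if_trace_unit:
  fixes M :: "('o::idom, 'g, 'n) gmod"
  assumes O: "complete_local_pid (rta :: 'o ring)" and inj: "inj (of_nat :: nat \<Rightarrow> 'o)"
    and p: "Factorial_Ring.prime p" "\<not> (of_nat p :: 'o) dvd 1"
    and M: "gmodule G M" and fin: "finite (carrier G)" and free: "free_of_finite_rank M"
    and T: "relatively_projective G M T" "card T = p ^ n" and F: "lin M M F" "equi T M M F" "mod_trace M F dvd 1"
    and ai: "sources_absolutely_indecomposable G M"
  shows "sources_rank_prime_to p G M"
  unfolding sources_rank_prime_to_def
proof (intro allI impI)
  note pid = complete_local_pid_facts(1)[OF O] and loc = complete_local_pid_facts(2)[OF O]
  interpret M: gmodule G M by fact
  interpret M: rmod M using M by (rule gmodule_rmod)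
  have Tg: "subgroup T G" using T(1) by (simp add: relatively_projective_def)
  fix S Z assume Z: "is_source G M S Z"
  let ?S = "G\<lparr>carrier := S\<rparr>" and ?Z = "M\<lparr>carrier := Z\<rparr>"
  have vS: "is_vertex G M S" and iso: "iso_to_direct_summand G M (gmod_ind G S ?Z)" using Z by (simp_all add: is_source_def)
  then have Sg: "subgroup S G" by (simp add: is_vertex_def relatively_projective_def)
  have gZ: "gsubmodule ?S Z M" using Z by (auto simp: is_source_def direct_summand_def direct_decomposition_def)
  then have sZ: "submodule Z rta M" by (simp add: gsubmodule_def)
  have ZS: "gmodule ?S ?Z" using gmodule_sub[OF gmodule_restrict[OF M Sg] gZ] .
  have freeZ: "free_of_finite_rank ?Z" using free_sub[OF pid M.rmod_axioms free sZ] .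
  interpret Z: rmod ?Z using rmod_sub[OF M.rmod_axioms sZ] .
  obtain \<alpha> \<beta> where ab: "lin M ?Z \<alpha>" "equi S M ?Z \<alpha>" "lin ?Z M \<beta>" "equi S ?Z M \<beta>"
    and t: "\<And>x. x \<in> carrier M \<Longrightarrow> transfer_map G M (\<lambda>x. \<beta> (\<alpha> x)) x = of_nat (card S) \<odot>\<^bsub>M\<^esub> x"
    by (rule higman_necessary[OF M fin Sg ZS iso]) (rule that)
  have ba: "lin M M (\<lambda>x. \<beta> (\<alpha> x))" using lin_comp[OF ab(1,3)] .
  have bae: "equi S M M (\<lambda>x. \<beta> (\<alpha> x))" using equi_comp[OF ab(1,2,4)] .
  obtain h where h: "h \<in> carrier G" "M.G.conj_set (inv\<^bsub>G\<^esub> h) T \<subseteq> S"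
    and u: "mod_trace M (\<lambda>x. F (act M h (\<beta> (\<alpha> (act M (inv\<^bsub>G\<^esub> h) x))))) dvd 1"
    by (rule double_coset_trace[OF loc inj p M fin free Sg ba bae t Tg T(2) F]) (assumption | rule that)+
  have ih: "inv\<^bsub>G\<^esub> h \<in> carrier G" using h(1) by simp
  have "relatively_projective G M (M.G.conj_set (inv\<^bsub>G\<^esub> h) T)"
    using relatively_projective_conj[OF M fin free inj T(1) ih] .
  \<comment> \<open>Minimality of the vertex \<open>S\<close> upgrades the inclusion to equality, so
    that a conjugate of \<open>F\<close> commutes with all of \<open>S\<close>.\<close>
  then have S: "M.G.conj_set (inv\<^bsub>G\<^esub> h) T = S" using vS h(2) by (simp add: is_vertex_def)
  define F' where "F' = (\<lambda>x. act M (inv\<^bsub>G\<^esub> h) (F (act M (inv\<^bsub>G\<^esub> (inv\<^bsub>G\<^esub> h)) x)))"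
  have F': "lin M M F'" "equi S M M F'"
    unfolding F'_def using conj_lin[OF M ih F(1)] equi_conj[OF M Tg F(1,2) ih] S by simp_all
  have l: "lin M M (\<lambda>x. F (act M h (\<beta> (\<alpha> (act M (inv\<^bsub>G\<^esub> h) x)))))"
    using lin_comp[OF conj_lin[OF M h(1) ba] F(1)] .
  have "mod_trace M (\<lambda>x. F (act M h (\<beta> (\<alpha> (act M (inv\<^bsub>G\<^esub> h) x))))) = mod_trace M (\<lambda>x. act M (inv\<^bsub>G\<^esub> h)
      (F (act M h (\<beta> (\<alpha> (act M (inv\<^bsub>G\<^esub> h) (act M (inv\<^bsub>G\<^esub> (inv\<^bsub>G\<^esub> h)) x)))))))"
    using mod_trace_conj[OF M free ih l] by simp
  also have "\<dots> = mod_trace M (\<lambda>x. F' (\<beta> (\<alpha> x)))"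
    using act_inv(1)[OF M ih] h(1)
    by (intro mod_trace_cong[OF M.rmod_axioms free conj_lin[OF M ih l]]) (simp add: F'_def)
  also have "\<dots> = mod_trace ?Z (\<lambda>z. \<alpha> (F' (\<beta> z)))"
    using mod_trace_commute[OF M.rmod_axioms Z.rmod_axioms free freeZ ab(1) lin_comp[OF ab(3) F'(1)]] .
  finally have u': "mod_trace ?Z (\<lambda>z. \<alpha> (F' (\<beta> z))) dvd 1" using u by simp
  have "absolutely_indecomposable ?S ?Z" using ai Z by (simp add: sources_absolutely_indecomposable_def)
  moreover have "lin ?Z ?Z (\<lambda>z. \<alpha> (F' (\<beta> z)))" using lin_comp[OF lin_comp[OF ab(3) F'(1)] ab(1)] .
  moreover have "equi (carrier ?S) ?Z ?Z (\<lambda>z. \<alpha> (F' (\<beta> z)))"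
    using equi_comp[OF lin_comp[OF ab(3) F'(1)] equi_comp[OF ab(3,4) F'(2)] ab(2)] by simp
  ultimately obtain k where k: "\<not> (mod_trace ?Z (\<lambda>z. \<alpha> (F' (\<beta> z))) - k * of_nat (mod_rank ?Z)) dvd 1"
    using absolutely_indecomposable_trace[OF O inj ZS freeZ] by blast
  have "\<not> p dvd mod_rank ?Z"
  proof
    assume "p dvd mod_rank ?Z"
    then obtain d where "mod_rank ?Z = d * p" by (auto simp: dvd_def mult.commute)
    then have "\<not> k * of_nat (mod_rank ?Z) dvd 1" using p(2) nonunit_mult[of "of_nat p :: 'o" "k * of_nat d"] by (simp add: mult.assoc)
    then show False using k loc u' unfolding local_type_def by (metis diff_add_cancel)
  qed
  then show "coprime (mod_rank ?Z) p" using p(1) by (metis coprime_commute prime_imp_coprime)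
qed

lemma (in group) card_subgroup_dvd:
  assumes "subgroup H G" "subgroup P G" "H \<subseteq> P"
  shows "card H dvd card P"
proof -
  have "card (rcosets\<^bsub>G\<lparr>carrier := P\<rparr>\<^esub> H) * card H = card P"
    using group.lagrange[OF subgroup_imp_group[OF assms(2)] subgroup_incl[OF assms]] by (simp add: Coset.order_def)
  then show ?thesis by (metis dvd_triv_right)
qed

text \<open>With |Q| |R| = |QR| |Q \<inter> R| the rank relations turn the trace of the transfer of
  \<open>F\<close> into |G| \<mu> \<nu> l = |QR| tr F. Write |QR| = p^b and |G| = p^s m with p^s the
  order of \<open>P\<close>, so b \<le> s. Cancelling p^b leaves p^(s-b) m \<mu> \<nu> l equal to
  the unit tr F, whence s = b and \<open>l\<close> is a unit.\<close>

theorem tensor_vertices: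
  fixes U :: "('o::idom, 'g, 'u) gmod" and V :: "('o, 'g, 'v) gmod"
  assumes loc: "local_type TYPE('o)" and inj: "inj (of_nat :: nat \<Rightarrow> 'o)"
    and p: "Factorial_Ring.prime p" "\<not> (of_nat p :: 'o) dvd 1" and fin: "finite (carrier G)"
    and U: "gmodule G U" "free_of_finite_rank U" and V: "gmodule G V" "free_of_finite_rank V"
    and sc: "scalar_endomorphisms G (gmod_tensor U V)"
    and P: "subgroup P G" "card P = p ^ multiplicity p (Coset.order G)"
    and Q: "subgroup Q G" "Q \<subseteq> P" and R: "subgroup R G" "R \<subseteq> P"
    and e: "lin U U e" "equi Q U U e" "mod_trace U e dvd 1"
    and f: "lin V V f" "equi R V V f" "mod_trace V f dvd 1"
    and mu: "\<mu> dvd 1" "of_nat (card Q) * mod_trace U (\<lambda>x. x) = of_nat (card (carrier G)) * \<mu>"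
    and nu: "\<nu> dvd 1" "of_nat (card R) * mod_trace V (\<lambda>x. x) = of_nat (card (carrier G)) * \<nu>"
  obtains F where "Q <#>\<^bsub>G\<^esub> R = P" "relatively_projective G (gmod_tensor U V) (Q \<inter> R)"
    "lin (gmod_tensor U V) (gmod_tensor U V) F" "equi (Q \<inter> R) (gmod_tensor U V) (gmod_tensor U V) F"
    "mod_trace (gmod_tensor U V) F dvd 1"
proof -
  interpret U: gmodule G U by fact
  let ?W = "gmod_tensor U V" and ?T = "Q \<inter> R"
  have W: "gmodule G ?W" "free_of_finite_rank ?W"
    and r: "mod_trace ?W (\<lambda>x. x) = mod_trace U (\<lambda>x. x) * mod_trace V (\<lambda>x. x)"
    using tensor_facts(1-3)[OF U V] by auto
  interpret W: rmod ?W using W(1) by (rule gmodule_rmod)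
  have Tg: "subgroup ?T G" using U.G.subgroups_Inter_pair[OF Q(1) R(1)] .
  have TG: "?T \<subseteq> carrier G" using subgroup.subset[OF Tg] .
  obtain F where F: "lin ?W ?W F" and tr: "mod_trace ?W F = mod_trace U e * mod_trace V f"
    and c: "\<forall>g\<in>carrier G. (\<forall>x\<in>carrier U. e (act U g x) = act U g (e x)) \<longrightarrow>
         (\<forall>x\<in>carrier V. f (act V g x) = act V g (f x)) \<longrightarrow>
         (\<forall>x\<in>carrier ?W. F (act ?W g x) = act ?W g (F x))"
    using tensor_facts(4)[OF U V e(1) f(1)] by blast
  have FT: "equi ?T ?W ?W F" using c e(2) f(2) TG unfolding equi_def by blast
  have u: "mod_trace ?W F dvd 1" unfolding tr using e(3) f(3) by (metis mult_dvd_mono mult_1)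
  obtain l where l: "\<And>x. x \<in> carrier ?W \<Longrightarrow> transfer_map G ?W F x = (of_nat (card ?T) * l) \<odot>\<^bsub>?W\<^esub> x"
    by (rule transfer_scalar[OF sc W(1) fin Tg F FT]) (rule that)
  let ?g = "of_nat (card (carrier G)) :: 'o" and ?m = "mod_trace ?W F"
  have g0: "?g \<noteq> 0" using fin U.G.one_closed inj by (metis card_eq_0_iff empty_iff injD of_nat_0)
  have 1: "of_nat (card ?T) * l * (mod_trace U (\<lambda>x. x) * mod_trace V (\<lambda>x. x)) = ?g * ?m"
    using scalar_trace[OF W.rmod_axioms W(2) transfer_lin[OF W(1) fin F] l] mod_trace_transfer[OF W(1) fin W(2) F] r by simp
  have qr: "card (Q <#>\<^bsub>G\<^esub> R) * card ?T = card Q * card R" using U.G.card_set_mult[OF R(1) Q(1) fin] .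
  then have 2: "(of_nat (card (Q <#>\<^bsub>G\<^esub> R)) * of_nat (card ?T) :: 'o) = of_nat (card Q) * of_nat (card R)"
    by (metis of_nat_mult)
  \<comment> \<open>The second factor |G| is there so that the rank relations of both lattices can
    be inserted; it is cancelled right afterwards.\<close>
  have "?g * (?g * (\<mu> * \<nu> * l)) = (?g * \<mu>) * (?g * \<nu>) * l" by (simp add: mult_ac)
  also have "\<dots> = of_nat (card Q) * of_nat (card R) * (l * (mod_trace U (\<lambda>x. x) * mod_trace V (\<lambda>x. x)))"
    unfolding mu(2)[symmetric] nu(2)[symmetric] by (simp add: mult_ac)
  also have "\<dots> = of_nat (card (Q <#>\<^bsub>G\<^esub> R)) * (of_nat (card ?T) * l * (mod_trace U (\<lambda>x. x) * mod_trace V (\<lambda>x. x)))"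
    unfolding 2[symmetric] by (simp add: mult_ac)
  also have "\<dots> = ?g * (of_nat (card (Q <#>\<^bsub>G\<^esub> R)) * ?m)" unfolding 1 by (simp add: mult_ac)
  finally have "?g * (?g * (\<mu> * \<nu> * l)) = ?g * (of_nat (card (Q <#>\<^bsub>G\<^esub> R)) * ?m)" .
  then have key: "?g * (\<mu> * \<nu> * l) = of_nat (card (Q <#>\<^bsub>G\<^esub> R)) * ?m" using g0 by simp
  have finP: "finite P" using finite_subset[OF subgroup.subset[OF P(1)] fin] .
  have QRP: "Q <#>\<^bsub>G\<^esub> R \<subseteq> P" using Q(2) R(2) subgroup.m_closed[OF P(1)] by (auto simp: set_mult_def)
  define s where "s = multiplicity p (Coset.order G)"
  have p_power: "\<exists>i. card H = p ^ i" if "subgroup H G" "H \<subseteq> P" for H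
    using U.G.card_subgroup_dvd[OF that(1) P(1) that(2)] P(2) divides_primepow_nat[OF p(1)] by auto
  obtain i j where "card Q = p ^ i" "card R = p ^ j" using p_power[OF Q] p_power[OF R] by blast
  \<comment> \<open>At this point \<open>QR\<close> is only a set; its cardinality is a power of
    \<open>p\<close> because it divides |Q| |R|.\<close>
  then have "card (Q <#>\<^bsub>G\<^esub> R) dvd p ^ (i + j)" using qr by (metis dvd_triv_left power_add)
  then obtain b where b: "card (Q <#>\<^bsub>G\<^esub> R) = p ^ b" using divides_primepow_nat[OF p(1)] by blast
  have "p ^ b \<le> p ^ s" using card_mono[OF finP QRP] b P(2) by (simp add: s_def)
  then have bs: "b \<le> s" using p(1) prime_gt_1_nat power_increasing_iff by metis
  have "p ^ s dvd Coset.order G" unfolding s_def by (rule multiplicity_dvd)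
  then obtain m where "card (carrier G) = p ^ s * m" by (auto simp: dvd_def Coset.order_def)
  then have g: "?g = of_nat p ^ b * (of_nat p ^ (s - b) * of_nat m)"
    using bs by (simp add: mult.assoc flip: power_add)
  have pb: "(of_nat p ^ b :: 'o) \<noteq> 0" using p(1) inj by (metis injD not_prime_0 of_nat_0 power_not_zero)
  have "of_nat p ^ b * (of_nat p ^ (s - b) * of_nat m * (\<mu> * \<nu> * l)) = of_nat p ^ b * ?m"
    using key unfolding g b by (simp only: of_nat_power mult.assoc)
  then have "of_nat p ^ (s - b) * of_nat m * (\<mu> * \<nu> * l) = ?m" using mult_left_cancel[OF pb] by blast
  then have unit: "of_nat p ^ (s - b) * of_nat m * (\<mu> * \<nu> * l) dvd 1" using u by simp
  then have "(of_nat p ^ (s - b) :: 'o) dvd 1" by (metis dvd_mult_left)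
  then have "s - b = 0" using p(2) by (cases "s - b") (auto dest: dvd_mult_left)
  then have "card (Q <#>\<^bsub>G\<^esub> R) = card P" using b bs P(2) by (simp add: s_def)
  then have QR: "Q <#>\<^bsub>G\<^esub> R = P" using card_subset_eq[OF finP QRP] by simp
  obtain v where v: "1 = l * v" using unit by (metis dvd_def dvd_mult_right)
  have "transfer_map G ?W (\<lambda>x. v \<odot>\<^bsub>?W\<^esub> F x) x = of_nat (card ?T) \<odot>\<^bsub>?W\<^esub> x" if x: "x \<in> carrier ?W" for x
  proof -
    have "transfer_map G ?W (\<lambda>x. v \<odot>\<^bsub>?W\<^esub> F x) x = (v * (of_nat (card ?T) * l)) \<odot>\<^bsub>?W\<^esub> x"
      using transfer_scale[OF W(1) fin F x] l[OF x] x by (simp add: W.rmod_assoc)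
    also have "v * (of_nat (card ?T) * l) = of_nat (card ?T)" using v by (metis mult.assoc mult.commute mult_1)
    finally show ?thesis .
  qed
  then have "relatively_projective G ?W ?T"
    unfolding relatively_projective_iff[OF W(1) fin W(2) inj]
    using Tg lin_scale[OF W.rmod_axioms F] equi_scale[OF W(1) TG F FT] by blast
  from that[OF QR this F FT u] show ?thesis .
qed

theorem corollary3:
  fixes p :: nat
    and G :: "('g, 'z) monoid_scheme"
    and U :: "('o::idom, 'g, 'u) gmod"
    and V :: "('o, 'g, 'v) gmod"
    and W :: "('o, 'g, (('u \<times> 'v) \<Rightarrow>\<^sub>0 'o) set) gmod"
  assumes "Factorial_Ring.prime p"
    and "complete_local_pid (ring_of_type_algebra :: 'o ring)"
    and "[p] \<cdot>\<^bsub>residue_field (ring_of_type_algebra :: 'o ring)\<^esub>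
           \<one>\<^bsub>residue_field (ring_of_type_algebra :: 'o ring)\<^esub> =
         \<zero>\<^bsub>residue_field (ring_of_type_algebra :: 'o ring)\<^esub>"
    and "CHAR('o fract) = 0"
    and "group G" and "finite (carrier G)"
    and "gmodule G U" and "free_of_finite_rank U"
    and "gmodule G V" and "free_of_finite_rank V"
    and "irreducible_character G (lattice_character U)"
    and "irreducible_character G (lattice_character V)"
    and "sources_rank_prime_to p G U"
    and "sources_rank_prime_to p G V"
    and "W = gmod_tensor U V"
    and "irreducible_character G (lattice_character W)"
    and "absolutely_indecomposable G U" and "sources_absolutely_indecomposable G U"
    and "absolutely_indecomposable G V" and "sources_absolutely_indecomposable G V"
    and "absolutely_indecomposable G W" and "sources_absolutely_indecomposable G W"
    and "absolutely_irreducible_character G (lattice_character U)"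
    and "absolutely_irreducible_character G (lattice_character V)"
    and "absolutely_irreducible_character G (lattice_character W)"
  shows "sources_rank_prime_to p G W \<and>
    (\<exists>Q R. is_vertex G U Q \<and> is_vertex G V R \<and> is_vertex G W (Q \<inter> R) \<and>
      is_sylow_subgroup p (Q <#>\<^bsub>G\<^esub> R) G)"
proof -
  note p = assms(1) and O = assms(2) and grp = assms(5) and fin = assms(6)
    and U = assms(7,8) and V = assms(9,10) and W_def = assms(15)
  interpret G: group G by fact
  have pn: "\<not> (of_nat p :: 'o) dvd 1" using residue_characteristic_nonunit[OF O assms(3)] .
  note pid = complete_local_pid_facts(1)[OF O] and loc = complete_local_pid_facts(2)[OF O]
  have inj: "inj (of_nat :: nat \<Rightarrow> 'o)"
  proof (rule injI)
    have e: "of_nat k = to_fract (of_nat k :: 'o)" for k by (induction k) auto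
    fix m n assume "(of_nat m :: 'o) = of_nat n"
    then have "(of_nat m :: 'o fract) = of_nat n" by (simp add: e)
    then show "m = n"
      using assms(4) of_nat_eq_iff_char_dvd[of m n, where 'a = "'o fract"]
        of_nat_eq_iff_char_dvd[of n m, where 'a = "'o fract"] by (cases m n rule: linorder_cases) auto
  qed
  have W: "gmodule G W" "free_of_finite_rank W" using tensor_facts(1,2)[OF U V] by (simp_all add: W_def)
  have scU: "scalar_endomorphisms G U" and scV: "scalar_endomorphisms G V" and scW: "scalar_endomorphisms G W"
    using absolutely_irreducible_scalar[OF pid inj U(1) fin U(2) assms(23)]
      absolutely_irreducible_scalar[OF pid inj V(1) fin V(2) assms(24)]
      absolutely_irreducible_scalar[OF pid inj W(1) fin W(2) assms(25)]
    by (simp_all add: scalar_endomorphisms_def)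
  have "Coset.order G \<noteq> 0" using fin by (auto simp: Coset.order_def)
  then obtain m where "Coset.order G = p ^ multiplicity p (Coset.order G) * m"
    using multiplicity_dvd by (metis dvd_def)
  from sylow_thm[OF p grp this fin]
  obtain P where P: "subgroup P G" "card P = p ^ multiplicity p (Coset.order G)" by blast
  \<comment> \<open>Stated for a lattice of arbitrary element type, since it is applied to both
    \<open>U\<close> and \<open>V\<close>: some conjugate of a vertex lies in the Sylow subgroup
    chosen above.\<close>
  have vertex: "\<exists>Q. is_vertex G M Q \<and> Q \<subseteq> P" if M: "gmodule G M" "free_of_finite_rank M"
    for M :: "('o, 'g, 'n) gmod"
  proof -
    obtain Q where Q: "is_vertex G M Q" by (rule exists_vertex[OF M(1) fin M(2) inj])
    obtain n where n: "card Q = p ^ n" by (rule vertex_p_group[OF loc p pn M(1) fin M(2) inj Q])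
    have "subgroup Q G" using Q by (simp add: is_vertex_def relatively_projective_def)
    from G.p_subgroup_in_sylow[OF fin p this n P]
    obtain h where h: "h \<in> carrier G" "G.conj_set (inv\<^bsub>G\<^esub> h) Q \<subseteq> P" by blast
    then show ?thesis using is_vertex_conj[OF M(1) fin M(2) inj Q, of "inv\<^bsub>G\<^esub> h"] by auto
  qed
  obtain Q where Q: "is_vertex G U Q" "Q \<subseteq> P" using vertex[OF U] by blast
  obtain R where R: "is_vertex G V R" "R \<subseteq> P" using vertex[OF V] by blast
  have QR: "subgroup Q G" "subgroup R G" using Q(1) R(1) by (simp_all add: is_vertex_def relatively_projective_def)
  obtain e \<mu> where e: "lin U U e" "equi Q U U e" "mod_trace U e dvd 1" "\<mu> dvd 1"
    "of_nat (card Q) * mod_trace U (\<lambda>x. x) = of_nat (card (carrier G)) * \<mu>"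
    by (rule vertex_trace[OF pid loc inj pn U(1) fin U(2) scU assms(13) Q(1)]) (rule that)
  obtain f \<nu> where f: "lin V V f" "equi R V V f" "mod_trace V f dvd 1" "\<nu> dvd 1"
    "of_nat (card R) * mod_trace V (\<lambda>x. x) = of_nat (card (carrier G)) * \<nu>"
    by (rule vertex_trace[OF pid loc inj pn V(1) fin V(2) scV assms(14) R(1)]) (rule that)
  obtain F where F: "Q <#>\<^bsub>G\<^esub> R = P" "relatively_projective G W (Q \<inter> R)" "lin W W F" "equi (Q \<inter> R) W W F" "mod_trace W F dvd 1"
    using tensor_vertices[OF loc inj p pn fin U V scW[unfolded W_def] P QR(1) Q(2) QR(2) R(2) e(1-3) f(1-3) e(4,5) f(4,5)]
    unfolding W_def by blast
  obtain n where n: "card (Q \<inter> R) = p ^ n"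
  proof -
    obtain k where k: "card Q = p ^ k" by (rule vertex_p_group[OF loc p pn U(1) fin U(2) inj Q(1)])
    have "card (Q \<inter> R) dvd card Q" using G.card_subgroup_dvd[OF G.subgroups_Inter_pair[OF QR] QR(1)] by simp
    then show ?thesis using k that divides_primepow_nat[OF p] by auto
  qed
  have "is_vertex G W (Q \<inter> R)" by (rule vertex_if_trace_unit[OF loc inj p pn W(1) fin W(2) F(2) n F(3-5)])
  moreover have "sources_rank_prime_to p G W"
    by (rule source_rank_prime_to_if_trace_unit[OF O inj p pn W(1) fin W(2) F(2) n F(3-5) assms(22)])
  ultimately show ?thesis using Q(1) R(1) F(1) P by (auto simp: is_sylow_subgroup_def)
qed

end
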